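(* Fix $\alpha<2$, $p>0$, and let $\mu=TS^p_\alpha(R,b)$ be a $p$-tempered $\alpha$-stable distribution on $\mathbb R^d$ with Rosi\'nski measure $R$ and shift $b$. If $\sigma\ne0$ is a finite Borel measure on $\mathbb S^{d-1}$ and $\gamma\in(0\vee\alpha,2)$, then $\mu$ is in the domain of attraction of a $\gamma$-stable distribution with spectral measure $\sigma$ if and only if $R\in RV_{-\gamma}(\sigma)$.
   Context: $ID(0,M,b)$ is the infinitely divisible distribution on $\mathbb R^d$ with no Gaussian part, L\'evy measure $M$, and characteristic function $\exp\left\{i\langle b,z\rangle+\int_{\mathbb R^d}\left(e^{i\langle z,x\rangle}-1-i\frac{\langle z,x\rangle}{1+|x|^2}\right)M(dx)\right\}$. For $\alpha<2$, $p>0$, $TS^p_\alpha(R,b)$ denotes the $p$-tempered $\alpha$-stable distribution with Rosi\'nski measure $R$ and shift $b\in\mathbb R^d$, i.e. $ID(0,M,b)$ with $$M(A)=\int_{\mathbb R^d}\int_0^\infty1_A(tx)\,t^{-1-\alpha}e^{-t^p}\,dt\,R(dx),\qquad A\in\mathfrak B(\mathbb R^d),$$ where $R$ is a Borel measure on $\mathbb R^d$ with $R(\{0\})=0$ and $\int(|x|^2\wedge|x|^\alpha)R(dx)<\infty$ if $\alpha\in(0,2)$, $\int(|x|^2\wedge[1+\log^+|x|])R(dx)<\infty$ if $\alpha=0$, $\int(|x|^2\wedge1)R(dx)<\infty$ if $\alpha<0$. (These are exactly the conditions under which $M$ is a L\'evy measure when $R\ne 0$, and $M$ determines $R$.) For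 $\gamma\in(0,2)$, a $\gamma$-stable distribution with spectral measure $\sigma$ is $ID(0,L,b')$, $b'\in\mathbb R^d$, with $L(B)=\int_{\mathbb S^{d-1}}\int_0^\infty1_B(ru)r^{-\gamma-1}\,dr\,\sigma(du)$. A probability measure $\mu$ is in the domain of attraction of a distribution $\nu$ if, for i.i.d. $X_1,X_2,\dots\sim\mu$, there are scalars $a_n>0$ and vectors $b_n\in\mathbb R^d$ such that $a_n\sum_{i=1}^nX_i-b_n$ converges in distribution to $\nu$. The limiting stable distribution is not assumed to be full. Regular variation: let $\varrho\ge0$ and let $\nu$ be a Borel measure on $\mathbb R^d$ such that $\nu(\{|x|>T\})<\infty$ for some $T>0$ and $\nu(\{|x|>s\})>0$ for all $s>0$. For a finite Borel measure $\sigma\ne0$ on the unit sphere $\mathbb S^{d-1}$, we write $\nu\in RV_{-\varrho}(\sigma)$ if for all $t>0$ and all $D\in\mathfrak B(\mathbb S^{d-1})$ with $\sigma(\partial D)=0$ $$\lim_{r\to\infty}\frac{\nu(|x|>rt,\ x/|x|\in D)}{\nu(|x|>r)}=t^{-\varrho}\frac{\sigma(D)}{\sigma(\mathbb S^{d-1})}.$$ *)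

theory Defs
  imports "HOL-Probability.Probability"
begin

section \<open>Infinitely divisible distributions without Gaussian part\<close>

definition char_fun :: "'a::euclidean_space measure \<Rightarrow> 'a \<Rightarrow> complex" where
  "char_fun \<mu> z = (LINT x|\<mu>. iexp (z \<bullet> x))"

definition levy_measure :: "'a::euclidean_space measure \<Rightarrow> bool" where
  "levy_measure M \<longleftrightarrow>
     sets M = sets borel \<and> emeasure M {0} = 0 \<and>
     (\<integral>\<^sup>+x. ennreal (min ((norm x)\<^sup>2) 1) \<partial>M) < \<infinity>"

text \<open>\<open>is_ID M b \<mu>\<close> says that \<open>\<mu>\<close> is the distribution \<open>ID(0, M, b)\<close>. The integrand of the
  exponent is integrable whenever \<open>M\<close> is a Levy measure, so the Bochner integral carries no
  junk value.\<close>

definition is_ID :: "'a::euclidean_space measure \<Rightarrow> 'a \<Rightarrow> 'a measure \<Rightarrow> bool" where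
  "is_ID M b \<mu> \<longleftrightarrow>
     levy_measure M \<and> prob_space \<mu> \<and> sets \<mu> = sets borel \<and>
     (\<forall>z. char_fun \<mu> z =
        exp (\<i> * complex_of_real (b \<bullet> z) +
          (LINT x|M. iexp (z \<bullet> x) - 1 - \<i> * complex_of_real ((z \<bullet> x) / (1 + (norm x)\<^sup>2)))))"


section \<open>Tempered stable distributions\<close>

text \<open>\<open>measure_of\<close> degenerates to the zero measure unless the given set function is countably
  additive; \<open>emeasure_tempered_levy\<close> and \<open>emeasure_stable_levy\<close> show that the measures
  defined here and below do take the stated values.\<close>

definition tempered_levy :: "real \<Rightarrow> real \<Rightarrow> 'a::euclidean_space measure \<Rightarrow> 'a measure" where
  "tempered_levy p \<alpha> R = measure_of UNIV (sets borel)
     (\<lambda>A. \<integral>\<^sup>+x. (\<integral>\<^sup>+t\<in>{0<..}.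
        (indicator A (t *\<^sub>R x) * ennreal (t powr (- 1 - \<alpha>) * exp (- (t powr p)))) \<partial>lborel) \<partial>R)"

definition rosinski_measure :: "real \<Rightarrow> 'a::euclidean_space measure \<Rightarrow> bool" where
  "rosinski_measure \<alpha> R \<longleftrightarrow>
     sets R = sets borel \<and> emeasure R {0} = 0 \<and>
     (0 < \<alpha> \<and> \<alpha> < 2 \<longrightarrow>
        (\<integral>\<^sup>+x. ennreal (min ((norm x)\<^sup>2) (norm x powr \<alpha>)) \<partial>R) < \<infinity>) \<and>
     (\<alpha> = 0 \<longrightarrow>
        (\<integral>\<^sup>+x. ennreal (min ((norm x)\<^sup>2) (1 + max 0 (ln (norm x)))) \<partial>R) < \<infinity>) \<and>
     (\<alpha> < 0 \<longrightarrow>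
        (\<integral>\<^sup>+x. ennreal (min ((norm x)\<^sup>2) 1) \<partial>R) < \<infinity>)"

text \<open>\<open>is_TS p \<alpha> R b \<mu>\<close> says that \<open>\<mu>\<close> is the \<open>p\<close>-tempered \<open>\<alpha>\<close>-stable distribution with
  Rosinski measure \<open>R\<close> and shift \<open>b\<close>.\<close>

definition is_TS ::
    "real \<Rightarrow> real \<Rightarrow> 'a::euclidean_space measure \<Rightarrow> 'a \<Rightarrow> 'a measure \<Rightarrow> bool" where
  "is_TS p \<alpha> R b \<mu> \<longleftrightarrow>
     \<alpha> < 2 \<and> 0 < p \<and> rosinski_measure \<alpha> R \<and> is_ID (tempered_levy p \<alpha> R) b \<mu>"


section \<open>Stable distributions\<close>

text \<open>Measures on the unit sphere live on the Borel sets of the sphere, not on those of the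
  ambient space.\<close>

definition finite_sphere_measure :: "'a::euclidean_space measure \<Rightarrow> bool" where
  "finite_sphere_measure \<sigma> \<longleftrightarrow>
     sets \<sigma> = sets (restrict_space borel (sphere 0 1)) \<and> finite_measure \<sigma>"

definition stable_levy :: "real \<Rightarrow> 'a::euclidean_space measure \<Rightarrow> 'a measure" where
  "stable_levy \<gamma> \<sigma> = measure_of UNIV (sets borel)
     (\<lambda>B. \<integral>\<^sup>+u. (\<integral>\<^sup>+r\<in>{0<..}.
        (indicator B (r *\<^sub>R u) * ennreal (r powr (- \<gamma> - 1))) \<partial>lborel) \<partial>\<sigma>)"

definition is_stable :: "real \<Rightarrow> 'a::euclidean_space measure \<Rightarrow> 'a measure \<Rightarrow> bool" where
  "is_stable \<gamma> \<sigma> \<nu> \<longleftrightarrow>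
     0 < \<gamma> \<and> \<gamma> < 2 \<and> finite_sphere_measure \<sigma> \<and> (\<exists>b'. is_ID (stable_levy \<gamma> \<sigma>) b' \<nu>)"


section \<open>Domains of attraction\<close>

text \<open>The library's \<open>weak_conv_m\<close> is specific to the real line.\<close>

definition conv_in_dist :: "(nat \<Rightarrow> 'a::euclidean_space measure) \<Rightarrow> 'a measure \<Rightarrow> bool" where
  "conv_in_dist \<mu> \<nu> \<longleftrightarrow>
     (\<forall>f :: 'a \<Rightarrow> real. continuous_on UNIV f \<and> bounded (range f) \<longrightarrow>
        (\<lambda>n. LINT x|\<mu> n. f x) \<longlonglongrightarrow> (LINT x|\<nu>. f x))"

text \<open>The law of \<open>a (X\<^sub>0 + \<dots> + X\<^sub>n\<^sub>-\<^sub>1) - b\<close> for i.i.d. variables with distribution \<open>\<mu>\<close>, realised as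
  the coordinates of the infinite product space. By \<open>distr_iid_sum\<close> any other
  realisation of the sequence gives the same law.\<close>

definition normed_sum_law ::
    "'a::euclidean_space measure \<Rightarrow> real \<Rightarrow> 'a \<Rightarrow> nat \<Rightarrow> 'a measure" where
  "normed_sum_law \<mu> a b n =
     distr (PiM (UNIV :: nat set) (\<lambda>_. \<mu>)) borel (\<lambda>X. a *\<^sub>R (\<Sum>i<n. X i) - b)"

definition in_domain_of_attraction ::
    "'a::euclidean_space measure \<Rightarrow> 'a measure \<Rightarrow> bool" where
  "in_domain_of_attraction \<mu> \<nu> \<longleftrightarrow>
     (\<exists>(a :: nat \<Rightarrow> real) (b :: nat \<Rightarrow> 'a). (\<forall>n. 0 < a n) \<and>
        conv_in_dist (\<lambda>n. normed_sum_law \<mu> (a n) (b n) n) \<nu>)"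


section \<open>Regular variation\<close>

text \<open>The boundary of \<open>D\<close> is taken relative to the sphere. The ratio uses the real-valued
  \<open>measure\<close>; since \<open>\<nu>\<close> is finite off some ball, this agrees with \<open>emeasure\<close> for all large \<open>r\<close>.\<close>

definition regularly_varying ::
    "real \<Rightarrow> 'a::euclidean_space measure \<Rightarrow> 'a measure \<Rightarrow> bool" where
  "regularly_varying \<rho> \<sigma> \<nu> \<longleftrightarrow>
     0 \<le> \<rho> \<and> finite_sphere_measure \<sigma> \<and> emeasure \<sigma> (sphere 0 1) \<noteq> 0 \<and>
     sets \<nu> = sets borel \<and>
     (\<exists>T>0. emeasure \<nu> {x. norm x > T} < \<infinity>) \<and>
     (\<forall>s>0. emeasure \<nu> {x. norm x > s} > 0) \<and>
     (\<forall>t>0. \<forall>D. D \<in> sets (restrict_space borel (sphere 0 1)) \<and>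
          emeasure \<sigma> (top_of_set (sphere 0 1) frontier_of D) = 0 \<longrightarrow>
        ((\<lambda>r. measure \<nu> {x. norm x > r * t \<and> x /\<^sub>R norm x \<in> D} / measure \<nu> {x. norm x > r})
           \<longlongrightarrow> t powr (- \<rho>) * (measure \<sigma> D / measure \<sigma> (sphere 0 1))) at_top)"


section \<open>Well-definedness\<close>

lemma emeasure_polar_measure:
  fixes N :: "'a::euclidean_space measure" and g :: "real \<Rightarrow> real"
  defines "F \<equiv> \<lambda>A. \<integral>\<^sup>+x. (\<integral>\<^sup>+t\<in>{0<..}. (indicator A (t *\<^sub>R x) * ennreal (g t)) \<partial>lborel) \<partial>N"
  assumes N: "(\<lambda>x. x) \<in> N \<rightarrow>\<^sub>M borel" and g [measurable]: "g \<in> borel_measurable borel"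
    and A: "A \<in> sets borel"
  shows "emeasure (measure_of UNIV (sets borel) F) A = F A"
proof -
  have sets_F [simp]: "sets (measure_of UNIV (sets (borel :: 'a measure)) F) = sets borel"
    by (metis sets.sets_measure_of_eq space_borel)
  have ca: "countably_additive (sets borel) F"
  proof (rule countably_additiveI)
    fix B :: "nat \<Rightarrow> 'a set"
    assume "range B \<subseteq> sets borel" and disj: "disjoint_family B"
    then have Bm [measurable]: "B i \<in> sets borel" for i
      by auto
    note N [measurable]
    have m: "(\<lambda>(x, t). indicator (B i) (t *\<^sub>R x) * ennreal (g t) * indicator {0<..} t)
        \<in> borel_measurable (N \<Otimes>\<^sub>M lborel)" for i
      by measurable
    have m1: "(\<lambda>t. indicator (B i) (t *\<^sub>R x) * ennreal (g t) * indicator {0<..} t)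
        \<in> borel_measurable lborel" for i x
      by measurable
    have "(\<Sum>i. F (B i)) = (\<integral>\<^sup>+x. (\<Sum>i. \<integral>\<^sup>+t\<in>{0<..}.
        (indicator (B i) (t *\<^sub>R x) * ennreal (g t)) \<partial>lborel) \<partial>N)"
      unfolding F_def
      by (rule nn_integral_suminf[symmetric])
         (use lborel.borel_measurable_nn_integral[OF m] in simp)
    also have "\<dots> = (\<integral>\<^sup>+x. (\<integral>\<^sup>+t. (\<Sum>i. indicator (B i) (t *\<^sub>R x) * ennreal (g t)
        * indicator {0<..} t) \<partial>lborel) \<partial>N)"
      by (subst nn_integral_suminf[OF m1]) (rule refl)
    also have "\<dots> = F (\<Union>i. B i)"
      unfolding F_def ennreal_suminf_multc suminf_indicator[OF disj] ..
    finally show "(\<Sum>i. F (B i)) = F (\<Union>i. B i)" .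
  qed
  have empty: "F {} = 0"
    by (simp add: F_def)
  show ?thesis
    by (rule emeasure_measure_of[OF refl]) (use A ca empty in \<open>auto simp: positive_def\<close>)
qed

lemma emeasure_tempered_levy:
  assumes "sets R = sets borel" and "A \<in> sets borel"
  shows "emeasure (tempered_levy p \<alpha> R) A = (\<integral>\<^sup>+x. (\<integral>\<^sup>+t\<in>{0<..}.
    (indicator A (t *\<^sub>R x) * ennreal (t powr (- 1 - \<alpha>) * exp (- (t powr p)))) \<partial>lborel) \<partial>R)"
  unfolding tempered_levy_def
  by (rule emeasure_polar_measure) (use assms measurable_ident_sets[OF assms(1)] in auto)

lemma emeasure_stable_levy:
  assumes "finite_sphere_measure \<sigma>" and "B \<in> sets borel"
  shows "emeasure (stable_levy \<gamma> \<sigma>) B = (\<integral>\<^sup>+u. (\<integral>\<^sup>+r\<in>{0<..}.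
    (indicator B (r *\<^sub>R u) * ennreal (r powr (- \<gamma> - 1))) \<partial>lborel) \<partial>\<sigma>)"
proof -
  have "(\<lambda>x. x) \<in> \<sigma> \<rightarrow>\<^sub>M borel"
    using measurable_restrict_space1[OF measurable_ident, of borel "sphere 0 1"] assms(1)
      measurable_cong_sets[of \<sigma> "restrict_space borel (sphere 0 1)" borel borel]
    unfolding finite_sphere_measure_def id_def by blast
  then show ?thesis
    unfolding stable_levy_def
    by (rule emeasure_polar_measure) (use assms in auto)
qed

lemma distr_iid_sum:
  fixes X :: "nat \<Rightarrow> 'w \<Rightarrow> 'a::euclidean_space"
  assumes "prob_space \<Omega>" and "prob_space.indep_vars \<Omega> (\<lambda>_. borel) X UNIV"
    and distr: "\<And>i. distr \<Omega> borel (X i) = \<mu>"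
  shows "distr \<Omega> borel (\<lambda>\<omega>. a *\<^sub>R (\<Sum>i<n. X i \<omega>) - b) = normed_sum_law \<mu> a b n"
proof -
  interpret prob_space \<Omega> by fact
  have X [measurable]: "X i \<in> \<Omega> \<rightarrow>\<^sub>M borel" for i
    using assms(2) by (auto simp: indep_vars_def)
  have "distr \<Omega> (PiM UNIV (\<lambda>_. borel)) (\<lambda>\<omega>. \<lambda>i\<in>UNIV. X i \<omega>)
      = PiM UNIV (\<lambda>i. distr \<Omega> borel (X i))"
    using assms(2) by (subst (asm) indep_vars_iff_distr_eq_PiM) auto
  then have "PiM UNIV (\<lambda>_. \<mu>) = distr \<Omega> (PiM UNIV (\<lambda>_. borel)) (\<lambda>\<omega> i. X i \<omega>)"
    by (simp add: distr restrict_def)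
  moreover have "(\<lambda>\<omega> i. X i \<omega>) \<in> \<Omega> \<rightarrow>\<^sub>M PiM UNIV (\<lambda>_. borel)"
    by (rule measurable_PiM_single') auto
  ultimately show ?thesis
    unfolding normed_sum_law_def by (simp add: distr_distr comp_def)
qed

end

theory Submission
  imports Defs "HOL-Real_Asymp.Real_Asymp"
begin

text \<open>
  Write \<open>T R\<close> for \<open>tempered_levy p \<alpha> R\<close>, \<open>L\<close> for \<open>stable_levy \<gamma> \<sigma>\<close>, and \<open>scaled c a N\<close> for
  \<open>c\<close> times the image of the measure \<open>N\<close> under \<open>x \<mapsto> a x\<close>. Three observations turn the
  theorem into a statement about Rosinski measures. The Levy-Khintchine exponent is linear
  in the Levy measure, so a normed sum of \<open>n\<close> copies of \<open>ID(0, M, b)\<close> is again infinitely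
  divisible, with Levy measure \<open>scaled n a M\<close> and with a shift that the centring of the sum
  can adjust to any value (\<open>is_ID_normed_sum_law\<close>). Tempering commutes with scaling:
  \<open>T (scaled n a R) = scaled n a (T R)\<close> (\<open>tempered_levy_scaled\<close>). And \<open>L = T (L / m)\<close>, where
  \<open>m\<close> is the \<open>\<gamma>\<close>-th moment of the density \<open>t\<^sup>-\<^sup>1\<^sup>-\<^sup>\<alpha> exp (- t\<^sup>p)\<close>, finite because \<open>\<alpha> < \<gamma>\<close>
  (\<open>tempered_levy_stable_levy\<close>). With \<open>R\<^sub>n = scaled n (a\<^sub>n) R\<close>, attraction to the stable law
  means that the laws with Levy measures \<open>T R\<^sub>n\<close> converge to the one with Levy measure
  \<open>T (L / m)\<close>, while regular variation means that, for suitable \<open>a\<^sub>n\<close>, \<open>R\<^sub>n\<close> converges to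
  \<open>L / m\<close> on the sets \<open>{x. norm x > r \<and> x / norm x \<in> D}\<close> for all \<open>D\<close> with a \<open>\<sigma>\<close>-null
  boundary. So the point is that convergence of Rosinski measures and of the associated
  tempered Levy measures are equivalent.

  From attraction to regular variation. Convergence in distribution gives convergence of the
  exponents, hence of integrals of continuous bounded functions that vanish near the origin
  against the Levy measures (\<open>ID_convergence_imp_levy_measure_convergence\<close>). To undo the
  tempering, test \<open>T R\<^sub>n\<close> with \<open>\<theta> (norm x) k (x / norm x)\<close>, where \<open>\<theta>\<close> is a bump on \<open>[a, b]\<close>.
  As \<open>exp (- t\<^sup>p)\<close> is decreasing, the result lies, up to one constant factor, between the
  \<open>R\<^sub>n\<close>-integrals of the weight \<open>(norm x)\<^sup>\<alpha> exp (- (s / norm x)\<^sup>p)\<close> at \<open>s = b\<close> and \<open>s = a\<close>.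
  Shrinking the bump to a point shows that these weighted integrals converge
  (\<open>exp_weight_convergence\<close>). The weights with \<open>s\<^sup>p\<close> a positive integer are the weight at
  \<open>s = 1\<close> times the powers of \<open>exp (- (1 / norm x)\<^sup>p)\<close>, a monotone coordinate for \<open>norm x\<close>
  with values in \<open>[0, 1]\<close>, so the Weierstrass approximation theorem extends the convergence
  from \<open>exp_weight\<close> to all continuous functions of \<open>norm x\<close> whose support is compact and
  avoids \<open>0\<close>, still multiplied by \<open>k (x / norm x)\<close> (\<open>compact_radial_convergence\<close>). Large \<open>x\<close>
  are controlled by the tail of \<open>T R\<^sub>n\<close>, and indicator functions are reached by
  approximation, from above for closed direction sets and then for complements
  (\<open>ray_set_convergence\<close>). Convergence along the sequence \<open>1 / a\<^sub>n\<close> gives regular variation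
  by monotonicity of the tail (\<open>regularly_varying_from_sequence\<close>).

  From regular variation to attraction. Choose \<open>a\<^sub>n\<close> as a multiple of the inverse of a
  quantile \<open>s\<^sub>n\<close> with \<open>n R (norm x > s\<^sub>n) \<rightarrow> 1\<close> (\<open>ex_norming_sequence\<close>). For \<open>\<beta>\<close> strictly
  between \<open>max 0 \<alpha>\<close> and \<open>\<gamma>\<close>, the average of a test function dominated by \<open>min (norm x)\<^sup>2 1\<close>
  over the tempering density is dominated by \<open>min (norm x)\<^sup>2 ((norm x)\<^sup>\<beta>)\<close>
  (\<open>tempering_average_le\<close>). Karamata estimates for the truncated second moment and the
  \<open>\<beta>\<close>-th tail moment make the contributions of small and of large \<open>x\<close> uniformly small, and
  on an annulus the convergence on the sets above suffices (\<open>annulus_integral_convergence\<close>).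
  Applied to the integrand of the exponent this yields convergence of characteristic
  functions, and the continuity theorem (\<open>conv_in_dist_char_fun\<close>) gives attraction to a
  stable law, which exists because every Levy measure belongs to an infinitely divisible
  distribution (\<open>ex_is_ID\<close>).
\<close>

section \<open>Continuity theorem for characteristic functions\<close>

text \<open>The algebra of functions whose integrals are determined linearly by the characteristic
  function.\<close>

inductive_set trig_poly :: "('a::euclidean_space \<Rightarrow> complex) set" where
  monom: "(\<lambda>x. c * iexp (z \<bullet> x)) \<in> trig_poly"
| add: "f \<in> trig_poly \<Longrightarrow> g \<in> trig_poly \<Longrightarrow> (\<lambda>x. f x + g x) \<in> trig_poly"

lemma trig_poly_const: "(\<lambda>x. c) \<in> trig_poly"
  using trig_poly.monom[of c 0] by simp

lemma trig_poly_mult: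
  assumes "f \<in> trig_poly" "g \<in> trig_poly"
  shows "(\<lambda>x. f x * g x) \<in> trig_poly"
  using assms(1)
proof induction
  case (monom c z)
  show ?case
    using assms(2)
  proof induction
    case (monom d w)
    have "(\<lambda>x. c * iexp (z \<bullet> x) * (d * iexp (w \<bullet> x))) = (\<lambda>x. (c * d) * iexp ((z + w) \<bullet> x))"
      by (simp add: fun_eq_iff inner_add_left ring_distribs exp_add)
    then show ?case
      by (simp only:) (rule trig_poly.monom)
  next
    case (add f g)
    then show ?case
      using trig_poly.add by (simp add: ring_distribs)
  qed
next
  case (add f g)
  then show ?case
    using trig_poly.add by (simp add: ring_distribs)
qed

lemma trig_poly_sum:
  "finite I \<Longrightarrow> (\<And>i. i \<in> I \<Longrightarrow> f i \<in> trig_poly) \<Longrightarrow> (\<lambda>x. \<Sum>i\<in>I. f i x) \<in> trig_poly"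
  by (induction I rule: finite_induct) (auto intro: trig_poly_const trig_poly.add)

lemma trig_poly_sin: "(\<lambda>x. complex_of_real (sin (z \<bullet> x))) \<in> trig_poly"
proof -
  have "complex_of_real (sin y) = (1 / (2 * \<i>)) * iexp y + (- 1 / (2 * \<i>)) * iexp (- y)" for y
    by (simp add: sin_of_real[symmetric] sin_exp_eq field_simps)
  then have "(\<lambda>x. complex_of_real (sin (z \<bullet> x))) =
      (\<lambda>x. (1 / (2 * \<i>)) * iexp (z \<bullet> x) + (- 1 / (2 * \<i>)) * iexp ((- z) \<bullet> x))"
    by (simp only: inner_minus_left)
  then show ?thesis
    by (simp only:) (intro trig_poly.monom trig_poly.add)
qed

lemma continuous_on_trig_poly: "f \<in> trig_poly \<Longrightarrow> continuous_on S f"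
  by (induction rule: trig_poly.induct) (auto intro!: continuous_intros)

lemma bounded_trig_poly: "f \<in> trig_poly \<Longrightarrow> bounded (range f)"
proof (induction rule: trig_poly.induct)
  case (monom c z)
  then show ?case
    by (auto simp: bounded_iff norm_mult)
next
  case (add f g)
  then obtain a b where "\<And>x. norm (f x) \<le> a" "\<And>x. norm (g x) \<le> b"
    by (auto simp: bounded_iff)
  then have "norm (f x + g x) \<le> a + b" for x
    by (meson add_mono norm_triangle_le)
  then show ?case
    by (auto simp: bounded_iff)
qed

lemma borel_measurable_sets_eq_borel:
  "sets M = sets borel \<Longrightarrow> f \<in> borel_measurable borel \<Longrightarrow> f \<in> borel_measurable M"
  using measurable_cong_sets[of M borel borel borel] by blast

lemma integrable_continuous_bounded:
  fixes f :: "'a::euclidean_space \<Rightarrow> 'b::{second_countable_topology,banach}"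
  assumes "finite_measure M" "sets M = sets borel" "continuous_on UNIV f" "bounded (range f)"
  shows "integrable M f"
proof -
  interpret finite_measure M by fact
  obtain B where "\<And>x. norm (f x) \<le> B"
    using assms(4) by (auto simp: bounded_iff)
  moreover have "f \<in> borel_measurable M"
    using borel_measurable_continuous_onI[OF assms(3)] measurable_cong_sets[OF assms(2) refl] by blast
  ultimately show ?thesis
    by (intro integrable_const_bound[of _ B]) auto
qed

lemma integrable_trig_poly:
  assumes "finite_measure M" "sets M = sets borel" "f \<in> trig_poly"
  shows "integrable M f"
  using assms integrable_continuous_bounded continuous_on_trig_poly bounded_trig_poly by blast

lemma integral_trig_poly_tendsto:
  fixes \<mu> :: "nat \<Rightarrow> 'a::euclidean_space measure"
  assumes \<mu>: "\<And>n. prob_space (\<mu> n)" "\<And>n. sets (\<mu> n) = sets borel"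
    and \<nu>: "prob_space \<nu>" "sets \<nu> = sets borel"
    and char: "\<And>z. (\<lambda>n. char_fun (\<mu> n) z) \<longlonglongrightarrow> char_fun \<nu> z"
    and f: "f \<in> trig_poly"
  shows "(\<lambda>n. LINT x|\<mu> n. f x) \<longlonglongrightarrow> (LINT x|\<nu>. f x)"
  using f
proof induction
  case (monom c z)
  have "(LINT x|M. c * iexp (z \<bullet> x)) = c * char_fun M z" for M :: "'a measure"
    by (simp add: char_fun_def)
  then show ?case
    by (simp only:) (intro tendsto_intros char)
next
  case (add f g)
  have "(LINT x|M. f x + g x) = (LINT x|M. f x) + (LINT x|M. g x)"
    if "prob_space M" "sets M = sets borel" for M
    using that add prob_space.finite_measure integrable_trig_poly
    by (intro Bochner_Integration.integral_add) auto
  then show ?case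
    using \<mu> \<nu> add by (auto intro!: tendsto_add)
qed

text \<open>Approximation that is good on a cube and bounded everywhere. Substituting
  \<open>sin (c (x \<bullet> i))\<close> for the coordinates of a polynomial gives a trigonometric polynomial,
  and its arguments range over a fixed compact cube for all \<open>x\<close>. Hence approximating \<open>f\<close>,
  read in the coordinates \<open>arcsin (y \<bullet> i) / c\<close>, by a polynomial on that cube settles the
  local error and the global bound at once.\<close>

lemma trig_poly_approximation:
  fixes f :: "'a::euclidean_space \<Rightarrow> real"
  assumes f: "continuous_on UNIV f" and B: "\<And>x. \<bar>f x\<bar> \<le> B" and "0 < K" "0 < \<epsilon>"
  obtains q :: "'a \<Rightarrow> real" where "(\<lambda>x. complex_of_real (q x)) \<in> trig_poly"
    and "\<And>x. \<bar>q x\<bar> \<le> B + \<epsilon>"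
    and "\<And>x. (\<And>i. i \<in> Basis \<Longrightarrow> \<bar>x \<bullet> i\<bar> \<le> K) \<Longrightarrow> \<bar>f x - q x\<bar> \<le> \<epsilon>"
proof -
  \<comment> \<open>With this \<open>c\<close>, arcsin inverts the sine of \<open>c (x \<bullet> i)\<close> exactly on the cube of half-width
    \<open>K\<close>.\<close>
  define c where "c = pi / (2 * K)"
  define e :: "'a \<Rightarrow> 'a" where "e x = (\<Sum>i\<in>Basis. sin (c * (x \<bullet> i)) *\<^sub>R i)" for x
  define g where "g y = f (\<Sum>i\<in>Basis. (arcsin (y \<bullet> i) / c) *\<^sub>R i)" for y :: 'a
  define S :: "'a set" where "S = cbox (- One) One"
  have c: "c > 0" "c * K = pi / 2"
    using \<open>0 < K\<close> by (auto simp: c_def)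
  have "continuous_on S (\<lambda>y. \<Sum>i\<in>Basis. (arcsin (y \<bullet> i) / c) *\<^sub>R i)"
    using c(1) by (auto intro!: continuous_intros simp: S_def mem_box)
  then have "continuous_on S g"
    unfolding g_def by (rule continuous_on_compose2[OF f]) simp
  then obtain p where p: "real_polynomial_function p" "\<And>y. y \<in> S \<Longrightarrow> \<bar>g y - p y\<bar> < \<epsilon>"
    using Stone_Weierstrass_real_polynomial_function[of S g \<epsilon>] \<open>0 < \<epsilon>\<close>
    by (auto simp: S_def compact_cbox)
  have e_i: "e x \<bullet> i = sin (c * (x \<bullet> i))" if "i \<in> Basis" for x i
    using that by (simp add: e_def)
  have eS: "e x \<in> S" for x
    by (auto simp: S_def mem_box e_i)
  have ge: "g (e x) = f x" if "\<And>i. i \<in> Basis \<Longrightarrow> \<bar>x \<bullet> i\<bar> \<le> K" for x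
  proof -
    have "arcsin (e x \<bullet> i) / c = x \<bullet> i" if i: "i \<in> Basis" for i
    proof -
      have "\<bar>c * (x \<bullet> i)\<bar> \<le> pi / 2"
        using \<open>\<And>i. i \<in> Basis \<Longrightarrow> \<bar>x \<bullet> i\<bar> \<le> K\<close>[OF i] c by (simp add: abs_mult flip: c(2))
      then have "arcsin (sin (c * (x \<bullet> i))) = c * (x \<bullet> i)"
        by (intro arcsin_sin) auto
      then show ?thesis
        using c i by (simp add: e_i)
    qed
    then show ?thesis
      by (simp add: g_def euclidean_representation)
  qed
  have "(\<lambda>x. complex_of_real (p (e x))) \<in> trig_poly"
    using p(1)
  proof induction
    case (linear h)
    then have "h (e x) = (\<Sum>i\<in>Basis. sin (c * (x \<bullet> i)) * h i)" for x
      by (simp add: e_def linear_sum bounded_linear.linear linear_cmul)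
    then have "(\<lambda>x. complex_of_real (h (e x)))
        = (\<lambda>x. \<Sum>i\<in>Basis. complex_of_real (sin ((c *\<^sub>R i) \<bullet> x)) * complex_of_real (h i))"
      by (simp add: inner_commute)
    then show ?case
      by (simp only:) (intro trig_poly_sum trig_poly_mult trig_poly_sin trig_poly_const finite_Basis)
  qed (auto intro: trig_poly_const trig_poly.add trig_poly_mult)
  moreover have "\<bar>p (e x)\<bar> \<le> B + \<epsilon>" for x
    using p(2)[OF eS[of x]] B[of "\<Sum>i\<in>Basis. (arcsin (e x \<bullet> i) / c) *\<^sub>R i"]
    unfolding g_def by linarith
  moreover have "\<bar>f x - p (e x)\<bar> \<le> \<epsilon>" if "\<And>i. i \<in> Basis \<Longrightarrow> \<bar>x \<bullet> i\<bar> \<le> K" for x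
    using p(2)[OF eS[of x]] ge[of x] that by fastforce
  ultimately show ?thesis
    by (rule that)
qed

lemma char_distr_inner:
  assumes "sets M = sets borel"
  shows "char (distr M borel (\<lambda>x. z \<bullet> x)) t = char_fun M (t *\<^sub>R z)"
proof -
  have [measurable_cong]: "sets M = sets borel" by fact
  have "(\<lambda>x. z \<bullet> x) \<in> borel_measurable M"
    by (rule borel_measurable_sets_eq_borel[OF assms]) measurable
  then show ?thesis
    unfolding char_def char_fun_def by (subst integral_distr) auto
qed

text \<open>A bounded continuous upper estimate of the indicator of \<open>\<bar>y\<bar> \<ge> K + 1\<close>, so that
  tightness can be read off from weak convergence.\<close>

definition overshoot :: "real \<Rightarrow> real \<Rightarrow> real" where
  "overshoot K y = min 1 (max 0 (\<bar>y\<bar> - K))"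

lemma overshoot_bounds: "0 \<le> overshoot K y" "overshoot K y \<le> 1" "K + 1 \<le> \<bar>y\<bar> \<Longrightarrow> overshoot K y = 1"
  by (auto simp: overshoot_def)

lemma overshoot_tendsto_0: "(\<lambda>k::nat. overshoot (real k) y) \<longlonglongrightarrow> 0"
proof -
  obtain N :: nat where "\<bar>y\<bar> \<le> real N"
    using real_arch_simple by blast
  then have "\<forall>\<^sub>F k in sequentially. overshoot (real k) y = 0"
    unfolding eventually_sequentially by (intro exI[of _ N]) (auto simp: overshoot_def)
  then show ?thesis
    by (rule tendsto_eventually)
qed

lemma continuous_on_overshoot [continuous_intros]:
  "continuous_on S f \<Longrightarrow> continuous_on S (\<lambda>x. overshoot K (f x))"
  unfolding overshoot_def by (intro continuous_intros)

text \<open>Integrals of trigonometric polynomials converge by assumption. A bounded continuous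
  \<open>f\<close> is uniformly close to such a polynomial on a large cube, and off the cube both are
  bounded, so it remains to see that little mass escapes. This is tightness of each
  coordinate, which the one-dimensional continuity theorem provides.\<close>

theorem conv_in_dist_char_fun:
  fixes \<mu> :: "nat \<Rightarrow> 'a::euclidean_space measure"
  assumes \<mu>: "\<And>n. prob_space (\<mu> n)" "\<And>n. sets (\<mu> n) = sets borel"
    and \<nu>: "prob_space \<nu>" "sets \<nu> = sets borel"
    and char: "\<And>z. (\<lambda>n. char_fun (\<mu> n) z) \<longlonglongrightarrow> char_fun \<nu> z"
  shows "conv_in_dist \<mu> \<nu>"
  unfolding conv_in_dist_def
proof (intro allI impI, elim conjE)
  fix f :: "'a \<Rightarrow> real"
  assume f: "continuous_on UNIV f" "bounded (range f)"
  have fin: "finite_measure (\<mu> n)" "finite_measure \<nu>" for n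
    using \<mu> \<nu> by (auto intro: prob_space.finite_measure)
  have [measurable_cong]: "sets \<nu> = sets borel" "sets (\<mu> n) = sets borel" for n
    by fact+
  obtain B where B: "\<And>x. \<bar>f x\<bar> \<le> B"
    using f(2) by (auto simp: bounded_iff)
  then have B0: "B \<ge> 0"
    by (meson abs_ge_zero order_trans)
  \<comment> \<open>\<open>G K\<close> dominates the indicator of the complement of the cube of half-width \<open>K + 1\<close>.\<close>
  define G where "G K x = (\<Sum>i\<in>Basis. overshoot K (x \<bullet> i))" for K and x :: 'a
  have G_cont: "continuous_on UNIV (G K)" for K
    unfolding G_def by (intro continuous_intros)
  have G0: "0 \<le> G K x" for K x
    unfolding G_def by (intro sum_nonneg overshoot_bounds)
  have G_le: "G K x \<le> real DIM('a)" for K x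
    unfolding G_def using sum_bounded_above[of Basis "\<lambda>i. overshoot K (x \<bullet> i)" 1] overshoot_bounds
    by simp
  have G_bd: "bounded (range (G K))" for K
    using G0 G_le by (auto simp: bounded_iff intro!: exI[of _ "real DIM('a)"])
  have int_G: "integrable \<nu> (G K)" "integrable (\<mu> n) (G K)" for n K
    using integrable_continuous_bounded[OF _ _ G_cont G_bd] fin \<mu> \<nu> by auto
  have int_o: "integrable M (\<lambda>x. overshoot K (x \<bullet> i))"
    if "finite_measure M" "sets M = sets borel" for M and i :: 'a and K
    using overshoot_bounds
    by (intro integrable_continuous_bounded that continuous_intros)
       (auto simp: bounded_iff intro!: exI[of _ 1])
  have o_conv: "(\<lambda>n. LINT x|\<mu> n. overshoot K (x \<bullet> i)) \<longlonglongrightarrow> (LINT x|\<nu>. overshoot K (x \<bullet> i))"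
    for K and i :: 'a
  proof -
    define D where "D M = distr M borel (\<lambda>x. i \<bullet> x)" for M
    have rd: "real_distribution (D M)" if "prob_space M" "sets M = sets borel" for M
    proof -
      interpret prob_space M by fact
      have "(\<lambda>x. i \<bullet> x) \<in> borel_measurable M"
        by (rule borel_measurable_sets_eq_borel[OF that(2)]) measurable
      then show ?thesis
        unfolding D_def by (intro real_distribution_distr)
    qed
    have "weak_conv_m (\<lambda>n. D (\<mu> n)) (D \<nu>)"
    proof (rule levy_continuity)
      show "real_distribution (D (\<mu> n))" for n
        by (intro rd \<mu>)
      show "real_distribution (D \<nu>)"
        by (intro rd \<nu>)
      show "(\<lambda>n. char (D (\<mu> n)) t) \<longlonglongrightarrow> char (D \<nu>) t" for t
        unfolding D_def using char \<mu> \<nu> by (simp add: char_distr_inner)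
    qed
    then have "(\<lambda>n. LINT y|D (\<mu> n). overshoot K y) \<longlonglongrightarrow> (LINT y|D \<nu>. overshoot K y)"
      using continuous_on_overshoot[OF continuous_on_id, of UNIV K] overshoot_bounds
      by (intro weak_conv_imp_integral_bdd_continuous_conv[where B=1] rd \<mu> \<nu>)
         (auto simp: continuous_on_eq_continuous_at)
    moreover have "(LINT y|D M. overshoot K y) = (LINT x|M. overshoot K (x \<bullet> i))"
      if "sets M = sets borel" for M
    proof -
      have "(\<lambda>x. i \<bullet> x) \<in> borel_measurable M"
        by (rule borel_measurable_sets_eq_borel[OF that]) measurable
      moreover have "overshoot K \<in> borel_measurable borel"
        using continuous_on_overshoot[OF continuous_on_id, of UNIV K]
        by (intro borel_measurable_continuous_onI) simp
      ultimately have "(LINT y|D M. overshoot K y) = (LINT x|M. overshoot K (i \<bullet> x))"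
        unfolding D_def by (rule integral_distr)
      then show ?thesis
        by (simp only: inner_commute)
    qed
    ultimately show ?thesis
      using \<mu> \<nu> by simp
  qed
  have G_conv: "(\<lambda>n. LINT x|\<mu> n. G K x) \<longlonglongrightarrow> (LINT x|\<nu>. G K x)" for K
  proof -
    have "(LINT x|M. G K x) = (\<Sum>i\<in>Basis. LINT x|M. overshoot K (x \<bullet> i))"
      if "finite_measure M" "sets M = sets borel" for M
      unfolding G_def using int_o that by (intro Bochner_Integration.integral_sum) auto
    then show ?thesis
      using fin \<mu> \<nu> o_conv by (auto intro!: tendsto_sum)
  qed
  have G_tight: "(\<lambda>k::nat. LINT x|\<nu>. G (real k) x) \<longlonglongrightarrow> (LINT x|\<nu>. 0)"
  proof (rule integral_dominated_convergence[where w="\<lambda>_. real DIM('a)"])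
    show "integrable \<nu> (\<lambda>_. real DIM('a))"
      using finite_measure.integrable_const[OF fin(2)] .
    show "AE x in \<nu>. (\<lambda>k. G (real k) x) \<longlonglongrightarrow> 0"
      unfolding G_def by (intro AE_I2 tendsto_null_sum overshoot_tendsto_0)
    show "AE x in \<nu>. norm (G (real k) x) \<le> real DIM('a)" for k
      using G0 G_le by auto
    show "G (real k) \<in> borel_measurable \<nu>" for k
      using int_G by auto
  qed simp
  show "(\<lambda>n. LINT x|\<mu> n. f x) \<longlonglongrightarrow> (LINT x|\<nu>. f x)"
  proof (rule LIMSEQ_I)
    fix r :: real assume r: "0 < r"
    define \<epsilon> where "\<epsilon> = min 1 (r / 6)"
    have \<epsilon>: "0 < \<epsilon>" "\<epsilon> \<le> 1" "6 * \<epsilon> \<le> r"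
      using r by (auto simp: \<epsilon>_def)
    define C where "C = 2 * B + 1"
    have "C > 0"
      using B0 by (simp add: C_def)
    obtain k :: nat where k: "(LINT x|\<nu>. G (real k) x) < \<epsilon> / C"
      using order_tendstoD(2)[OF G_tight, of "\<epsilon> / C"] \<epsilon> \<open>C > 0\<close>
      by (auto simp: eventually_sequentially)
    obtain q where q: "(\<lambda>x. complex_of_real (q x)) \<in> trig_poly"
      and qB: "\<And>x. \<bar>q x\<bar> \<le> B + \<epsilon>"
      and qf: "\<And>x. (\<And>i. i \<in> Basis \<Longrightarrow> \<bar>x \<bullet> i\<bar> \<le> real k + 1) \<Longrightarrow> \<bar>f x - q x\<bar> \<le> \<epsilon>"
      using trig_poly_approximation[OF f(1) B, of "real k + 1" \<epsilon>] \<epsilon> by auto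
    have int_q: "integrable M q" if "finite_measure M" "sets M = sets borel" for M
      using integrable_trig_poly[OF that q] by (metis complex_of_real_integrable_eq)
    have approx: "\<bar>(LINT x|M. f x) - (LINT x|M. q x)\<bar> \<le> \<epsilon> + C * (LINT x|M. G (real k) x)"
      if M: "prob_space M" "sets M = sets borel" "integrable M (G (real k))" for M
    proof -
      interpret prob_space M by fact
      have ptw: "\<bar>f x - q x\<bar> \<le> \<epsilon> + C * G (real k) x" for x
      proof (cases "\<forall>i\<in>Basis. \<bar>x \<bullet> i\<bar> \<le> real k + 1")
        case True
        then show ?thesis
          using qf[of x] G0[of k x] \<open>C > 0\<close> by (smt (verit, best) mult_nonneg_nonneg)
      next
        case False
        then obtain i where i: "i \<in> Basis" "real k + 1 \<le> \<bar>x \<bullet> i\<bar>"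
          by force
        have "1 \<le> G (real k) x"
          unfolding G_def
          using member_le_sum[OF i(1), of "\<lambda>i. overshoot (real k) (x \<bullet> i)"] overshoot_bounds i
          by simp
        then have "C \<le> C * G (real k) x"
          using \<open>C > 0\<close> by simp
        moreover have "\<bar>f x - q x\<bar> \<le> \<epsilon> + C"
          using B[of x] qB[of x] unfolding C_def using \<epsilon> by linarith
        ultimately show ?thesis
          by linarith
      qed
      have [simp]: "integrable M f" "integrable M q" "integrable M (G (real k))"
        using int_q[OF finite_measure_axioms M(2)] M(3)
          integrable_continuous_bounded[OF finite_measure_axioms M(2) f] by blast+
      have "\<bar>(LINT x|M. f x) - (LINT x|M. q x)\<bar> = \<bar>LINT x|M. f x - q x\<bar>"
        by simp
      also have "\<dots> \<le> (LINT x|M. \<bar>f x - q x\<bar>)"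
        by (rule integral_abs_bound)
      also have "\<dots> \<le> (LINT x|M. \<epsilon> + C * G (real k) x)"
        using ptw by (intro integral_mono) auto
      also have "\<dots> = \<epsilon> + C * (LINT x|M. G (real k) x)"
        by (simp add: prob_space)
      finally show ?thesis .
    qed
    have "(\<lambda>n. LINT x|\<mu> n. complex_of_real (q x)) \<longlonglongrightarrow> (LINT x|\<nu>. complex_of_real (q x))"
      by (rule integral_trig_poly_tendsto[OF \<mu> \<nu> char q])
    then have "(\<lambda>n. LINT x|\<mu> n. q x) \<longlonglongrightarrow> (LINT x|\<nu>. q x)"
      by (simp add: tendsto_of_real_iff)
    from tendstoD[OF this \<epsilon>(1)]
    have "\<forall>\<^sub>F n in sequentially. \<bar>(LINT x|\<mu> n. q x) - (LINT x|\<nu>. q x)\<bar> < \<epsilon>"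
      unfolding dist_real_def .
    moreover have "\<forall>\<^sub>F n in sequentially. (LINT x|\<mu> n. G (real k) x) < \<epsilon> / C"
      using G_conv k by (rule order_tendstoD)
    ultimately have "\<forall>\<^sub>F n in sequentially. norm ((LINT x|\<mu> n. f x) - (LINT x|\<nu>. f x)) < r"
    proof eventually_elim
      case (elim n)
      have "C * (LINT x|\<mu> n. G (real k) x) < \<epsilon>" "C * (LINT x|\<nu>. G (real k) x) < \<epsilon>"
        using elim(2) k \<open>C > 0\<close> by (simp_all add: field_simps)
      then show ?case
        using approx[OF \<mu>(1,2) int_G(2), of n] approx[OF \<nu> int_G(1)] elim(1) \<epsilon>
        unfolding real_norm_def
        by linarith
    qed
    then show "\<exists>N. \<forall>n\<ge>N. norm ((LINT x|\<mu> n. f x) - (LINT x|\<nu>. f x)) < r"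
      by (simp add: eventually_sequentially)
  qed
qed

section \<open>Normed sums and Levy-Khintchine exponents\<close>

lemma char_fun_sum_PiM:
  fixes \<mu> :: "nat \<Rightarrow> 'a::euclidean_space measure"
  assumes \<mu>: "\<And>k. prob_space (\<mu> k)" "\<And>k. sets (\<mu> k) = sets borel"
  shows "(LINT \<omega>|PiM UNIV \<mu>. iexp (z \<bullet> (\<Sum>k<n. \<omega> k))) = (\<Prod>k<n. char_fun (\<mu> k) z)"
proof -
  let ?P = "PiM UNIV \<mu>"
  interpret P: prob_space ?P
    using \<mu> by (intro prob_space_PiM)
  have comp [measurable]: "(\<lambda>\<omega>. \<omega> k) \<in> ?P \<rightarrow>\<^sub>M borel" for k
    using measurable_component_singleton[of k UNIV \<mu>] measurable_cong_sets[OF refl \<mu>(2)[of k], of ?P]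
    by auto
  have "P.indep_vars \<mu> (\<lambda>k \<omega>. \<omega> k) UNIV"
    using \<mu> by (subst P.indep_vars_iff_distr_eq_PiM)
      (auto simp: distr_PiM_component distr_id restrict_def)
  then have "P.indep_vars \<mu> (\<lambda>k \<omega>. \<omega> k) {..<n}"
    by (rule P.indep_vars_subset) simp
  then have indep: "P.indep_vars (\<lambda>_. borel) (\<lambda>k \<omega>. z \<bullet> \<omega> k) {..<n}"
  proof (rule P.indep_vars_compose2)
    show "(\<lambda>x. z \<bullet> x) \<in> borel_measurable (\<mu> k)" for k
      by (rule borel_measurable_sets_eq_borel[OF \<mu>(2)]) measurable
  qed
  have char: "char (distr ?P borel (\<lambda>\<omega>. z \<bullet> \<omega> k)) 1 = char_fun (\<mu> k) z" for k
  proof -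
    have "char (distr ?P borel (\<lambda>\<omega>. z \<bullet> \<omega> k)) 1 = (LINT \<omega>|?P. iexp (z \<bullet> \<omega> k))"
      unfolding char_def by (subst integral_distr) auto
    also have "\<dots> = (LINT x|distr ?P (\<mu> k) (\<lambda>\<omega>. \<omega> k). iexp (z \<bullet> x))"
    proof (rule integral_distr[symmetric])
      show "(\<lambda>\<omega>. \<omega> k) \<in> ?P \<rightarrow>\<^sub>M \<mu> k"
        by simp
      show "(\<lambda>x. iexp (z \<bullet> x)) \<in> borel_measurable (\<mu> k)"
        by (rule borel_measurable_sets_eq_borel[OF \<mu>(2)]) measurable
    qed
    finally show ?thesis
      using \<mu> by (simp add: distr_PiM_component char_fun_def)
  qed
  have "(LINT \<omega>|?P. iexp (z \<bullet> (\<Sum>k<n. \<omega> k))) = (LINT \<omega>|?P. iexp (1 * (\<Sum>k<n. z \<bullet> \<omega> k)))"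
    by (simp add: inner_sum_right)
  also have "\<dots> = char (distr ?P borel (\<lambda>\<omega>. \<Sum>k<n. z \<bullet> \<omega> k)) 1"
    unfolding char_def by (subst integral_distr) auto
  also have "\<dots> = (\<Prod>k<n. char_fun (\<mu> k) z)"
    using P.char_distr_sum[OF indep, of 1] by (simp add: char)
  finally show ?thesis .
qed

lemma measurable_sum_PiM:
  fixes \<mu> :: "nat \<Rightarrow> 'a::euclidean_space measure"
  assumes "\<And>k. sets (\<mu> k) = sets borel"
  shows "(\<lambda>\<omega>. \<Sum>k<n. \<omega> k) \<in> PiM UNIV \<mu> \<rightarrow>\<^sub>M borel"
proof -
  have "(\<lambda>\<omega>. \<omega> k) \<in> PiM UNIV \<mu> \<rightarrow>\<^sub>M borel" for k
    using measurable_component_singleton[of k UNIV \<mu>]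
      measurable_cong_sets[OF refl assms[of k], of "PiM UNIV \<mu>"] by auto
  then show ?thesis by measurable
qed

lemma normed_sum_law:
  assumes "prob_space \<mu>" "sets \<mu> = sets borel"
  shows prob_space_normed_sum_law: "prob_space (normed_sum_law \<mu> a b n)"
    and sets_normed_sum_law: "sets (normed_sum_law \<mu> a b n) = sets borel"
    and char_fun_normed_sum_law:
      "char_fun (normed_sum_law \<mu> a b n) z = iexp (- (b \<bullet> z)) * char_fun \<mu> (a *\<^sub>R z) ^ n"
proof -
  let ?P = "PiM (UNIV :: nat set) (\<lambda>_. \<mu>)"
  have m [measurable]: "(\<lambda>\<omega>. \<Sum>k<n. \<omega> k) \<in> ?P \<rightarrow>\<^sub>M borel"
    using assms by (intro measurable_sum_PiM)
  show "prob_space (normed_sum_law \<mu> a b n)"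
    unfolding normed_sum_law_def
    by (intro prob_space.prob_space_distr prob_space_PiM assms) measurable
  show "sets (normed_sum_law \<mu> a b n) = sets borel"
    by (simp add: normed_sum_law_def)
  have "char_fun (normed_sum_law \<mu> a b n) z = (LINT \<omega>|?P. iexp (z \<bullet> (a *\<^sub>R (\<Sum>k<n. \<omega> k) - b)))"
    unfolding normed_sum_law_def char_fun_def by (subst integral_distr) auto
  also have "\<dots> = (LINT \<omega>|?P. iexp (- (b \<bullet> z)) * iexp ((a *\<^sub>R z) \<bullet> (\<Sum>k<n. \<omega> k)))"
    by (intro Bochner_Integration.integral_cong refl)
       (simp add: inner_diff_right inner_commute algebra_simps flip: exp_add)
  also have "\<dots> = iexp (- (b \<bullet> z)) * char_fun \<mu> (a *\<^sub>R z) ^ n"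
    using char_fun_sum_PiM[of "\<lambda>_. \<mu>" "a *\<^sub>R z" n] assms by simp
  finally show "char_fun (normed_sum_law \<mu> a b n) z = iexp (- (b \<bullet> z)) * char_fun \<mu> (a *\<^sub>R z) ^ n" .
qed

definition levy_integrand :: "'a::euclidean_space \<Rightarrow> 'a \<Rightarrow> complex" where
  "levy_integrand z x = iexp (z \<bullet> x) - 1 - \<i> * complex_of_real ((z \<bullet> x) / (1 + (norm x)\<^sup>2))"

definition levy_exponent :: "'a::euclidean_space measure \<Rightarrow> 'a \<Rightarrow> 'a \<Rightarrow> complex" where
  "levy_exponent M b z = \<i> * complex_of_real (b \<bullet> z) + (LINT x|M. levy_integrand z x)"

lemma is_ID_iff:
  "is_ID M b \<mu> \<longleftrightarrow> levy_measure M \<and> prob_space \<mu> \<and> sets \<mu> = sets borel \<and>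
     (\<forall>z. char_fun \<mu> z = exp (levy_exponent M b z))"
  unfolding is_ID_def levy_exponent_def levy_integrand_def ..

lemma norm_iexp_minus_1_le: "norm (iexp y - 1) \<le> \<bar>y\<bar>" "norm (iexp y - 1) \<le> 2"
  using iexp_approx1[of y 0] iexp_approx2[of y 0] by simp_all

lemma norm_iexp_minus_linear_le: "norm (iexp y - 1 - \<i> * complex_of_real y) \<le> y\<^sup>2 / 2"
  using iexp_approx1[of y 1] by (simp add: power2_eq_square algebra_simps)

text \<open>For small \<open>x\<close> the integrand is the Taylor remainder of \<open>iexp\<close> plus a cubic correction
  of the centring; for large \<open>x\<close> every part is bounded.\<close>

lemma norm_levy_integrand_le:
  fixes x z :: "'a::euclidean_space"
  shows "norm (levy_integrand z x) \<le> (2 + norm z + (norm z)\<^sup>2) * min ((norm x)\<^sup>2) 1"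
proof -
  let ?r = "norm x" and ?y = "z \<bullet> x"
  have y: "\<bar>?y\<bar> \<le> norm z * ?r"
    by (rule Cauchy_Schwarz_ineq2)
  have r: "?r / (1 + ?r\<^sup>2) \<le> 1"
  proof -
    have "2 * ?r \<le> 1 + ?r\<^sup>2"
      using zero_le_power2[of "?r - 1"] by (simp add: power2_diff)
    then have "?r \<le> 1 + ?r\<^sup>2"
      using norm_ge_zero[of x] by linarith
    then show ?thesis
      by (simp add: divide_le_eq add_pos_nonneg)
  qed
  have 1: "norm (levy_integrand z x) \<le> 2 + norm z"
  proof -
    have "\<bar>?y / (1 + ?r\<^sup>2)\<bar> = \<bar>?y\<bar> / (1 + ?r\<^sup>2)"
      by (simp add: abs_divide abs_of_nonneg)
    also have "\<dots> \<le> norm z * ?r / (1 + ?r\<^sup>2)"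
      using y by (intro divide_right_mono) auto
    also have "\<dots> \<le> norm z"
      using mult_left_mono[OF r norm_ge_zero[of z]] by simp
    finally have "norm (\<i> * complex_of_real (?y / (1 + ?r\<^sup>2))) \<le> norm z"
      by (simp only: norm_mult norm_of_real norm_ii mult_1)
    then show ?thesis
      unfolding levy_integrand_def
      using norm_iexp_minus_1_le(2)[of ?y]
        norm_triangle_ineq4[of "iexp ?y - 1" "\<i> * complex_of_real (?y / (1 + ?r\<^sup>2))"]
      by linarith
  qed
  have 2: "norm (levy_integrand z x) \<le> (norm z + (norm z)\<^sup>2) * ?r\<^sup>2"
  proof -
    have eq: "levy_integrand z x = (iexp ?y - 1 - \<i> * complex_of_real ?y)
        + \<i> * complex_of_real (?y * (?r\<^sup>2 / (1 + ?r\<^sup>2)))"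
    proof -
      have "1 + ?r\<^sup>2 \<noteq> 0"
        by (smt (verit) zero_le_power2)
      then have "?y / (1 + ?r\<^sup>2) = ?y - ?y * (?r\<^sup>2 / (1 + ?r\<^sup>2))"
        by (simp add: field_simps)
      then show ?thesis
        unfolding levy_integrand_def by (simp only: of_real_diff ring_distribs) simp
    qed
    have "\<bar>?y * (?r\<^sup>2 / (1 + ?r\<^sup>2))\<bar> = \<bar>?y\<bar> * (?r\<^sup>2 / (1 + ?r\<^sup>2))"
      by (simp add: abs_mult abs_of_nonneg)
    also have "\<dots> \<le> norm z * ?r * (?r\<^sup>2 / (1 + ?r\<^sup>2))"
      using y by (intro mult_right_mono) auto
    also have "\<dots> = norm z * ?r\<^sup>2 * (?r / (1 + ?r\<^sup>2))"
      by simp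
    also have "\<dots> \<le> norm z * ?r\<^sup>2 * 1"
      using r by (intro mult_left_mono) auto
    finally have a: "norm (\<i> * complex_of_real (?y * (?r\<^sup>2 / (1 + ?r\<^sup>2)))) \<le> norm z * ?r\<^sup>2"
      by (simp only: norm_mult norm_of_real norm_ii mult_1 mult_1_right)
    have "?y\<^sup>2 \<le> (norm z * ?r)\<^sup>2"
      using y by (metis abs_ge_zero power2_abs power_mono)
    then have "norm (iexp ?y - 1 - \<i> * complex_of_real ?y) \<le> (norm z)\<^sup>2 * ?r\<^sup>2"
      using norm_iexp_minus_linear_le[of ?y] zero_le_power2[of ?y]
      unfolding power_mult_distrib by linarith
    then show ?thesis
      unfolding eq ring_distribs
      using a norm_triangle_ineq[of "iexp ?y - 1 - \<i> * complex_of_real ?y"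
        "\<i> * complex_of_real (?y * (?r\<^sup>2 / (1 + ?r\<^sup>2)))"]
      by linarith
  qed
  show ?thesis
  proof (cases "?r\<^sup>2 \<le> 1")
    case True
    then show ?thesis
      using 2 by (simp add: ring_distribs) (smt (verit) zero_le_power2)
  next
    case False
    then show ?thesis
      using 1 by simp (smt (verit) zero_le_power2)
  qed
qed

lemma levy_integrand_measurable [measurable]: "levy_integrand z \<in> borel_measurable borel"
  unfolding levy_integrand_def by measurable

lemma continuous_on_levy_integrand: "continuous_on S (levy_integrand z)"
proof -
  have "1 + (norm x)\<^sup>2 \<noteq> 0" for x :: 'a
    by (smt (verit) zero_le_power2)
  then show ?thesis
    unfolding levy_integrand_def by (intro continuous_intros) auto
qed

lemma integrable_levy_measure:
  fixes f :: "'a::euclidean_space \<Rightarrow> 'b::{second_countable_topology,banach}"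
  assumes M: "levy_measure M" and f: "f \<in> borel_measurable borel"
    and le: "\<And>x. norm (f x) \<le> C * min ((norm x)\<^sup>2) 1"
  shows "integrable M f"
proof (rule Bochner_Integration.integrable_bound)
  have [measurable_cong]: "sets M = sets borel"
    using M by (simp add: levy_measure_def)
  have "integrable M (\<lambda>x. min ((norm x)\<^sup>2) 1)"
    using M by (intro integrableI_nonneg) (auto simp: levy_measure_def)
  then show "integrable M (\<lambda>x. C * min ((norm x)\<^sup>2) 1)"
    by simp
  show "f \<in> borel_measurable M"
    using f borel_measurable_sets_eq_borel[of M] M by (auto simp: levy_measure_def)
  show "AE x in M. norm (f x) \<le> norm (C * min ((norm x)\<^sup>2) 1)"
    using le by (intro AE_I2) (metis abs_ge_self order_trans real_norm_def)
qed

lemma integrable_levy_integrand: "levy_measure M \<Longrightarrow> integrable M (levy_integrand z)"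
  by (rule integrable_levy_measure[OF _ _ norm_levy_integrand_le]) auto

text \<open>Mass multiplied by \<open>c\<close>, space dilated by \<open>a\<close>: for \<open>c = n\<close> this is what happens to the
  Levy measure of an infinitely divisible distribution when \<open>n\<close> independent copies are added
  and the sum is multiplied by \<open>a\<close>.\<close>

definition scaled :: "real \<Rightarrow> real \<Rightarrow> 'a::euclidean_space measure \<Rightarrow> 'a measure" where
  "scaled c a N = density (distr N borel (\<lambda>x. a *\<^sub>R x)) (\<lambda>_. ennreal c)"

lemma sets_scaled [simp, measurable_cong]: "sets (scaled c a N) = sets borel"
  by (simp add: scaled_def)

lemma
  assumes "sets N = sets (borel :: 'a::euclidean_space measure)"
  shows nn_integral_scaled: "f \<in> borel_measurable borel \<Longrightarrow>
      (\<integral>\<^sup>+x. f x \<partial>scaled c a N) = ennreal c * (\<integral>\<^sup>+x. f (a *\<^sub>R x) \<partial>N)"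
    and emeasure_scaled: "A \<in> sets borel \<Longrightarrow>
      emeasure (scaled c a N) A = ennreal c * emeasure N {x. a *\<^sub>R x \<in> A}"
proof -
  have [measurable_cong]: "sets N = sets borel" by fact
  show *: "(\<integral>\<^sup>+x. f x \<partial>scaled c a N) = ennreal c * (\<integral>\<^sup>+x. f (a *\<^sub>R x) \<partial>N)"
    if [measurable]: "f \<in> borel_measurable borel" for f
    unfolding scaled_def
    by (subst nn_integral_density) (auto simp: nn_integral_distr nn_integral_cmult)
  assume [measurable]: "A \<in> sets borel"
  have "{x. a *\<^sub>R x \<in> A} \<in> sets borel"
    by measurable
  then have [measurable]: "{x. a *\<^sub>R x \<in> A} \<in> sets N"
    by (simp add: assms)
  have "emeasure (scaled c a N) A = ennreal c * (\<integral>\<^sup>+x. indicator A (a *\<^sub>R x) \<partial>N)"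
    using *[of "indicator A"] by simp
  also have "(\<integral>\<^sup>+x. indicator A (a *\<^sub>R x) \<partial>N) = (\<integral>\<^sup>+x. indicator {x. a *\<^sub>R x \<in> A} x \<partial>N)"
    by (intro nn_integral_cong) (simp add: indicator_def)
  finally show "emeasure (scaled c a N) A = ennreal c * emeasure N {x. a *\<^sub>R x \<in> A}"
    by simp
qed

lemma integral_scaled:
  fixes f :: "'a::euclidean_space \<Rightarrow> 'b::{second_countable_topology,banach}"
  assumes [measurable_cong]: "sets N = sets borel" and [measurable]: "f \<in> borel_measurable borel"
    and "0 \<le> c"
  shows "(LINT x|scaled c a N. f x) = c *\<^sub>R (LINT x|N. f (a *\<^sub>R x))"
  unfolding scaled_def using assms(3) by (subst integral_density) (auto simp: integral_distr)

text \<open>Scaling changes the integrand \<open>min ((norm x)\<^sup>2) 1\<close> at most by the factor \<open>max 1 (a\<^sup>2)\<close>.\<close>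

lemma levy_measure_scaled:
  fixes M :: "'a::euclidean_space measure"
  assumes M: "levy_measure M" and "a \<noteq> 0"
  shows "levy_measure (scaled c a M)"
proof -
  have sets [measurable_cong]: "sets M = sets borel"
    using M by (simp add: levy_measure_def)
  have "emeasure (scaled c a M) {0} = 0"
    using M \<open>a \<noteq> 0\<close> by (subst emeasure_scaled) (auto simp: sets levy_measure_def)
  moreover have "(\<integral>\<^sup>+x. ennreal (min ((norm x)\<^sup>2) 1) \<partial>scaled c a M) < \<infinity>"
  proof -
    have "(\<integral>\<^sup>+x. ennreal (min ((norm (a *\<^sub>R x))\<^sup>2) 1) \<partial>M)
        \<le> (\<integral>\<^sup>+x. ennreal (max 1 (a\<^sup>2)) * ennreal (min ((norm x)\<^sup>2) 1) \<partial>M)"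
    proof (intro nn_integral_mono, unfold ennreal_mult'[symmetric, OF le_max_iff_disj[THEN iffD2, OF disjI1[OF zero_le_one]]], rule ennreal_leI)
      fix x :: 'a
      have "min (a\<^sup>2 * (norm x)\<^sup>2) 1 \<le> max 1 (a\<^sup>2) * min ((norm x)\<^sup>2) 1"
      proof (cases "(norm x)\<^sup>2 \<le> 1")
        case True
        then show ?thesis
          by (simp add: min.coboundedI1 mult_right_mono)
      next
        case False
        then show ?thesis
          by (simp add: min.coboundedI2)
      qed
      then show "min ((norm (a *\<^sub>R x))\<^sup>2) 1 \<le> max 1 (a\<^sup>2) * min ((norm x)\<^sup>2) 1"
        by (simp add: power_mult_distrib)
    qed
    also have "\<dots> = ennreal (max 1 (a\<^sup>2)) * (\<integral>\<^sup>+x. ennreal (min ((norm x)\<^sup>2) 1) \<partial>M)"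
      by (intro nn_integral_cmult) measurable
    also have "\<dots> < \<infinity>"
      using M by (simp add: levy_measure_def ennreal_mult_less_top)
    finally have "(\<integral>\<^sup>+x. ennreal (min ((norm (a *\<^sub>R x))\<^sup>2) 1) \<partial>M) < \<infinity>" .
    then show ?thesis
      by (subst nn_integral_scaled[OF sets]) (auto simp: ennreal_mult_less_top)
  qed
  ultimately show ?thesis
    by (simp add: levy_measure_def)
qed

text \<open>Substituting \<open>a z\<close> for \<open>z\<close> in the exponent replaces \<open>M\<close> by its image under \<open>x \<mapsto> a x\<close>,
  except that the centring term is evaluated at \<open>x\<close> instead of \<open>a x\<close>. The difference is
  linear in \<open>z\<close>, with an \<open>M\<close>-integrable coefficient, and only changes the shift.\<close>

lemma is_ID_normed_sum_law:
  fixes M :: "'a::euclidean_space measure"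
  assumes ID: "is_ID M b \<mu>" and "0 < a"
  obtains d where "\<And>c. is_ID (scaled (real n) a M) (d - c) (normed_sum_law \<mu> a c n)"
proof -
  have M: "levy_measure M" and \<mu>: "prob_space \<mu>" "sets \<mu> = sets borel"
    and char: "\<And>z. char_fun \<mu> z = exp (levy_exponent M b z)"
    using ID by (auto simp: is_ID_iff)
  have sets [measurable_cong]: "sets M = sets borel"
    using M by (simp add: levy_measure_def)
  \<comment> \<open>The discrepancy between the two centrings.\<close>
  define h where "h x = (1 / (1 + (norm (a *\<^sub>R x))\<^sup>2) - 1 / (1 + (norm x)\<^sup>2)) *\<^sub>R (a *\<^sub>R x)" for x :: 'a
  have h_meas [measurable]: "h \<in> borel_measurable borel"
    unfolding h_def by measurable
  have int_h: "integrable M h"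
  proof (rule integrable_levy_measure[OF M h_meas])
    fix x :: 'a
    let ?r = "norm x"
    let ?C = "a * \<bar>1 - a\<^sup>2\<bar> * (1 + 1 / a\<^sup>2)"
    have pos: "1 + a\<^sup>2 * ?r\<^sup>2 > 0" "1 + ?r\<^sup>2 > 0" "a\<^sup>2 > 0"
      using \<open>0 < a\<close> by (auto intro!: add_pos_nonneg)
    have "1 / (1 + (norm (a *\<^sub>R x))\<^sup>2) - 1 / (1 + ?r\<^sup>2)
        = (1 - a\<^sup>2) * (?r\<^sup>2 / ((1 + a\<^sup>2 * ?r\<^sup>2) * (1 + ?r\<^sup>2)))"
      using pos by (simp add: power_mult_distrib divide_simps) (simp add: algebra_simps)
    then have "norm (h x) = a * \<bar>1 - a\<^sup>2\<bar> * (?r\<^sup>2 * ?r / ((1 + a\<^sup>2 * ?r\<^sup>2) * (1 + ?r\<^sup>2)))"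
      using pos \<open>0 < a\<close> unfolding h_def by (simp add: abs_mult)
    also have "?r\<^sup>2 * ?r / ((1 + a\<^sup>2 * ?r\<^sup>2) * (1 + ?r\<^sup>2)) \<le> (1 + 1 / a\<^sup>2) * min (?r\<^sup>2) 1"
    proof -
      have r1: "?r / (1 + ?r\<^sup>2) \<le> 1"
        using pos zero_le_power2[of "?r - 1"] norm_ge_zero[of x]
        unfolding power2_diff by (subst divide_le_eq_1_pos) auto
      have r2: "0 \<le> ?r\<^sup>2 / (1 + a\<^sup>2 * ?r\<^sup>2)" "?r\<^sup>2 / (1 + a\<^sup>2 * ?r\<^sup>2) \<le> ?r\<^sup>2"
        "?r\<^sup>2 / (1 + a\<^sup>2 * ?r\<^sup>2) \<le> 1 / a\<^sup>2"
        using pos by (auto simp: divide_le_eq field_simps)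
      have "?r\<^sup>2 * ?r / ((1 + a\<^sup>2 * ?r\<^sup>2) * (1 + ?r\<^sup>2))
          = (?r\<^sup>2 / (1 + a\<^sup>2 * ?r\<^sup>2)) * (?r / (1 + ?r\<^sup>2))"
        by simp
      also have "\<dots> \<le> ?r\<^sup>2 / (1 + a\<^sup>2 * ?r\<^sup>2)"
        using mult_left_mono[OF r1 r2(1)] by simp
      also have "\<dots> \<le> (1 + 1 / a\<^sup>2) * min (?r\<^sup>2) 1"
      proof (cases "?r\<^sup>2 \<le> 1")
        case True
        have "?r\<^sup>2 \<le> (1 + 1 / a\<^sup>2) * ?r\<^sup>2"
          using pos by (simp add: ring_distribs)
        then show ?thesis
          using r2(2) True by simp
      qed (use r2(3) in simp)
      finally show ?thesis .
    qed
    finally show "norm (h x) \<le> ?C * min (?r\<^sup>2) 1"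
      using \<open>0 < a\<close> by (simp add: mult_left_mono mult.assoc)
  qed
  define d where "d = (real n * a) *\<^sub>R b + real n *\<^sub>R (LINT x|M. h x)"
  have key: "of_nat n * levy_exponent M b (a *\<^sub>R z) = levy_exponent (scaled (real n) a M) d z" for z
  proof -
    have "levy_integrand (a *\<^sub>R z) x = levy_integrand z (a *\<^sub>R x) + \<i> * complex_of_real (h x \<bullet> z)" for x
      unfolding levy_integrand_def h_def
      by (simp add: inner_commute[of x z] algebra_simps diff_divide_distrib)
    then have "(LINT x|M. levy_integrand (a *\<^sub>R z) x)
        = (LINT x|M. levy_integrand z (a *\<^sub>R x) + \<i> * complex_of_real (h x \<bullet> z))"
      by simp
    also have "\<dots> = (LINT x|M. levy_integrand z (a *\<^sub>R x)) + (LINT x|M. \<i> * complex_of_real (h x \<bullet> z))"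
    proof (rule Bochner_Integration.integral_add)
      have "integrable (scaled 1 a M) (levy_integrand z)"
        using levy_measure_scaled[OF M, of a 1] \<open>0 < a\<close> by (intro integrable_levy_integrand) auto
      then show "integrable M (\<lambda>x. levy_integrand z (a *\<^sub>R x))"
        by (simp add: scaled_def density_1 integrable_distr_eq)
    qed (use int_h in \<open>auto intro!: integrable_mult_right integrable_of_real\<close>)
    also have "(LINT x|M. \<i> * complex_of_real (h x \<bullet> z)) = \<i> * complex_of_real ((LINT x|M. h x) \<bullet> z)"
      using int_h by simp
    finally show ?thesis
      unfolding levy_exponent_def d_def
      by (subst integral_scaled[OF sets])
         (auto simp: inner_add_left ring_distribs scaleR_conv_of_real)
  qed
  have "is_ID (scaled (real n) a M) (d - c) (normed_sum_law \<mu> a c n)" for c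
    unfolding is_ID_iff
  proof (intro conjI allI)
    show "levy_measure (scaled (real n) a M)"
      using M \<open>0 < a\<close> by (intro levy_measure_scaled) auto
    show "char_fun (normed_sum_law \<mu> a c n) z = exp (levy_exponent (scaled (real n) a M) (d - c) z)" for z
    proof -
      have "char_fun (normed_sum_law \<mu> a c n) z
          = iexp (- (c \<bullet> z)) * exp (levy_exponent (scaled (real n) a M) d z)"
        using char_fun_normed_sum_law[OF \<mu>] by (simp add: char exp_of_nat_mult[symmetric] key)
      then show ?thesis
        by (simp add: levy_exponent_def inner_diff_left algebra_simps flip: exp_add)
    qed
  qed (use prob_space_normed_sum_law[OF \<mu>] sets_normed_sum_law[OF \<mu>] in auto)
  then show ?thesis
    by (rule that)
qed

section \<open>Existence of infinitely divisible distributions\<close>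

lemma norm_char_fun_le_1:
  assumes "prob_space \<mu>"
  shows "norm (char_fun \<mu> z) \<le> 1"
proof -
  interpret prob_space \<mu> by fact
  have "norm (char_fun \<mu> z) \<le> (LINT x|\<mu>. norm (iexp (z \<bullet> x)))"
    unfolding char_fun_def by (rule integral_norm_bound)
  then show ?thesis
    by (simp add: prob_space)
qed

lemma char_fun_shift:
  assumes "prob_space \<mu>" "sets \<mu> = sets (borel :: 'a::euclidean_space measure)"
  shows "char_fun (distr \<mu> borel (\<lambda>x. x - m)) z = iexp (- (m \<bullet> z)) * char_fun \<mu> z"
proof -
  have [measurable_cong]: "sets \<mu> = sets borel" by fact
  have "char_fun (distr \<mu> borel (\<lambda>x. x - m)) z = (LINT x|\<mu>. iexp (- (m \<bullet> z)) * iexp (z \<bullet> x))"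
    unfolding char_fun_def
    by (subst integral_distr)
       (auto simp: inner_diff_right inner_commute algebra_simps simp flip: exp_add)
  then show ?thesis
    by (simp add: char_fun_def)
qed

lemma integral_poisson_power:
  fixes c :: complex
  assumes "0 < r" "norm c \<le> 1"
  shows "(LINT n|measure_pmf (poisson_pmf r). c ^ n) = exp (r * (c - 1))"
proof -
  let ?p = "poisson_pmf r"
  have "integrable (measure_pmf ?p) (\<lambda>n. c ^ n)"
    using assms(2) by (intro measure_pmf.integrable_const_bound[of _ 1])
      (auto simp: norm_power power_le_one)
  then have int: "integrable (count_space UNIV) (\<lambda>n. pmf ?p n *\<^sub>R c ^ n)"
    unfolding measure_pmf_eq_density by (subst (asm) integrable_density) auto
  have "(LINT n|measure_pmf ?p. c ^ n) = (LINT n|count_space UNIV. pmf ?p n *\<^sub>R c ^ n)"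
    unfolding measure_pmf_eq_density by (subst integral_density) auto
  moreover have "(\<lambda>n. pmf ?p n *\<^sub>R c ^ n) sums (LINT n|count_space UNIV. pmf ?p n *\<^sub>R c ^ n)"
    by (rule sums_integral_count_space_nat[OF int])
  moreover have "(\<lambda>n. pmf ?p n *\<^sub>R c ^ n) = (\<lambda>n. exp (- complex_of_real r) * ((r * c) ^ n /\<^sub>R fact n))"
    using assms(1)
    by (simp add: fun_eq_iff scaleR_conv_of_real power_mult_distrib field_simps flip: exp_of_real)
  moreover have "(\<lambda>n. exp (- complex_of_real r) * ((r * c) ^ n /\<^sub>R fact n)) sums
      (exp (- complex_of_real r) * exp (r * c))"
    by (intro sums_mult exp_converges)
  ultimately have "(LINT n|measure_pmf ?p. c ^ n) = exp (- complex_of_real r) * exp (r * c)"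
    using sums_unique2 by metis
  then show ?thesis
    by (simp add: ring_distribs flip: exp_add)
qed

text \<open>For \<open>Q\<close> of total mass \<open>r > 0\<close>, the measure is the law of a sum of a Poisson number
  (with mean \<open>r\<close>) of independent jumps distributed as \<open>Q / r\<close>.\<close>

lemma ex_compound_poisson:
  fixes Q :: "'a::euclidean_space measure"
  assumes Q: "finite_measure Q" "sets Q = sets borel"
  obtains \<mu> where "prob_space \<mu>" "sets \<mu> = sets borel"
    "\<And>z. char_fun \<mu> z = exp (LINT x|Q. iexp (z \<bullet> x) - 1)"
proof -
  interpret Q: finite_measure Q by fact
  have [measurable_cong]: "sets Q = sets borel" by fact
  define r where "r = measure Q UNIV"
  have space_Q: "space Q = UNIV"
    using Q(2) by (metis sets_eq_imp_space_eq space_borel)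
  show ?thesis
  proof (cases "r = 0")
    case True
    then have "emeasure Q (space Q) = 0"
      by (simp add: r_def Q.emeasure_eq_measure space_Q)
    then have "(LINT x|Q. iexp (z \<bullet> x) - 1) = (LINT x|Q. 0)" for z
      by (intro integral_cong_AE AE_I[where N=UNIV]) (auto simp: space_Q)
    moreover have "char_fun (return borel 0) z = 1" for z :: 'a
      unfolding char_fun_def by (subst integral_return) auto
    ultimately show ?thesis
      by (intro that[of "return borel 0"]) (auto intro: prob_space_return)
  next
    case False
    then have r: "0 < r"
      unfolding r_def by (simp add: zero_less_measure_iff)
    define Y where "Y = density Q (\<lambda>_. ennreal (1 / r))"
    have sets_Y [measurable_cong]: "sets Y = sets borel"
      by (simp add: Y_def Q(2))
    have Y: "prob_space Y"
    proof
      have "emeasure Y (space Y) = ennreal (1 / r) * emeasure Q UNIV"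
        by (simp add: Y_def emeasure_density space_Q nn_integral_cmult)
      also have "\<dots> = 1"
        using r by (simp add: Q.emeasure_eq_measure r_def flip: ennreal_mult)
      finally show "emeasure Y (space Y) = 1" .
    qed
    have char_Y: "r * (char_fun Y z - 1) = (LINT x|Q. iexp (z \<bullet> x) - 1)" for z
    proof -
      have "integrable Q (\<lambda>x. iexp (z \<bullet> x))"
        by (intro Q.integrable_const_bound[of _ 1]) auto
      then have "(LINT x|Q. iexp (z \<bullet> x) - 1) = (LINT x|Q. iexp (z \<bullet> x)) - r"
        by (simp add: r_def space_Q scaleR_conv_of_real)
      moreover have "char_fun Y z = (1 / r) *\<^sub>R (LINT x|Q. iexp (z \<bullet> x))"
        unfolding char_fun_def Y_def using r by (subst integral_density) auto
      ultimately show ?thesis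
        using r by (simp add: scaleR_conv_of_real field_simps)
    qed
    let ?N = "measure_pmf (poisson_pmf r)" and ?P = "PiM (UNIV :: nat set) (\<lambda>_. Y)"
    interpret N: prob_space ?N by (rule prob_space_measure_pmf)
    interpret P: prob_space ?P using Y by (intro prob_space_PiM)
    interpret NP: pair_prob_space ?N ?P ..
    define S where "S = (\<lambda>(n::nat, \<omega>). \<Sum>k<n. \<omega> k :: 'a)"
    have "S \<in> count_space UNIV \<Otimes>\<^sub>M ?P \<rightarrow>\<^sub>M borel"
    proof (rule measurable_pair_measure_countable1)
      show "(\<lambda>\<omega>. S (n, \<omega>)) \<in> ?P \<rightarrow>\<^sub>M borel" for n
        using measurable_sum_PiM[of "\<lambda>_. Y" n] sets_Y by (simp add: S_def)
    qed auto
    moreover have "sets (?N \<Otimes>\<^sub>M ?P) = sets (count_space UNIV \<Otimes>\<^sub>M ?P)"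
      by (intro sets_pair_measure_cong) auto
    ultimately have S [measurable]: "S \<in> ?N \<Otimes>\<^sub>M ?P \<rightarrow>\<^sub>M borel"
      using measurable_cong_sets by blast
    define \<mu> where "\<mu> = distr (?N \<Otimes>\<^sub>M ?P) borel S"
    have "char_fun \<mu> z = exp (LINT x|Q. iexp (z \<bullet> x) - 1)" for z
    proof -
      have "char_fun \<mu> z = (LINT \<xi>|(?N \<Otimes>\<^sub>M ?P). iexp (z \<bullet> S \<xi>))"
        unfolding char_fun_def \<mu>_def by (subst integral_distr) auto
      also have "\<dots> = (LINT n|?N. LINT \<omega>|?P. iexp (z \<bullet> S (n, \<omega>)))"
        by (rule NP.integral_fst'[symmetric])
           (auto intro!: NP.P.integrable_const_bound[of _ 1])
      also have "\<dots> = (LINT n|?N. char_fun Y z ^ n)"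
        using char_fun_sum_PiM[of "\<lambda>_. Y" z] Y sets_Y by (simp add: S_def)
      also have "\<dots> = exp (r * (char_fun Y z - 1))"
        by (intro integral_poisson_power r norm_char_fun_le_1 Y)
      finally show ?thesis
        by (simp add: char_Y)
    qed
    moreover have "prob_space \<mu>"
      unfolding \<mu>_def by (intro NP.P.prob_space_distr S)
    ultimately show ?thesis
      by (intro that[of \<mu>]) (auto simp: \<mu>_def)
  qed
qed

text \<open>The derivative of \<open>exp\<close> is bounded by \<open>1\<close> on the left half-plane, which is convex.\<close>

lemma norm_exp_minus_1_le:
  fixes w :: complex
  assumes "Re w \<le> 0"
  shows "norm (exp w - 1) \<le> norm w"
proof -
  have "norm (exp w - exp 0) \<le> 1 * norm (w - 0)"
  proof (rule field_differentiable_bound[where S="{w. Re w \<le> 0}" and f'=exp])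
    show "convex {w. Re w \<le> 0}"
      by (simp add: convex_halfspace_Re_le)
  qed (use assms in \<open>auto intro!: derivative_eq_intros\<close>)
  then show ?thesis
    by simp
qed

lemma inner_power2_le: "(y \<bullet> x)\<^sup>2 \<le> (norm y)\<^sup>2 * (norm x)\<^sup>2"
  for x y :: "'a::real_inner"
  using Cauchy_Schwarz_ineq[of y x] by (simp add: power2_norm_eq_inner)

text \<open>The variance of a centred compound Poisson variable, obtained from the characteristic
  function: \<open>2 m\<^sup>2 (1 - cos (y / m))\<close> tends to \<open>y\<^sup>2\<close>, its expectation is read off from the
  real part of the characteristic function, and Fatou's lemma passes to the limit.\<close>

lemma second_moment_le:
  fixes \<mu> Q :: "'a::euclidean_space measure"
  assumes \<mu>: "prob_space \<mu>" "sets \<mu> = sets borel" and Q: "finite_measure Q" "sets Q = sets borel"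
    and sq: "integrable Q (\<lambda>x. (norm x)\<^sup>2)"
    and char: "\<And>z. char_fun \<mu> z = exp (LINT x|Q. iexp (z \<bullet> x) - 1 - \<i> * complex_of_real (z \<bullet> x))"
  shows "(\<integral>\<^sup>+x. ennreal ((e \<bullet> x)\<^sup>2) \<partial>\<mu>) \<le> ennreal (LINT x|Q. (e \<bullet> x)\<^sup>2)"
proof -
  interpret \<mu>: prob_space \<mu> by fact
  interpret Q: finite_measure Q by fact
  have [measurable_cong]: "sets \<mu> = sets borel" "sets Q = sets borel" by fact+
  define g where "g m x = 2 * (real m)\<^sup>2 * (1 - cos ((e \<bullet> x) / real m))" for m and x :: 'a
  have g0: "0 \<le> g m x" for m x
    by (simp add: g_def)
  have lim: "(\<lambda>m. g m x) \<longlonglongrightarrow> (e \<bullet> x)\<^sup>2" for x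
  proof -
    define y where "y = e \<bullet> x"
    have "(\<lambda>m. 2 * (real m)\<^sup>2 * (1 - cos (y / real m))) \<longlonglongrightarrow> y\<^sup>2"
      by (cases "y = 0") (simp, real_asymp simp: power2_eq_square)
    then show ?thesis
      by (simp add: g_def y_def)
  qed
  have bound: "(\<integral>\<^sup>+x. ennreal (g m x) \<partial>\<mu>) \<le> ennreal (LINT x|Q. (e \<bullet> x)\<^sup>2)" if "m > 0" for m
  proof -
    define z where "z = (1 / real m) *\<^sub>R e"
    define J where "J = (LINT x|Q. iexp (z \<bullet> x) - 1 - \<i> * complex_of_real (z \<bullet> x))"
    have zx: "z \<bullet> x = (e \<bullet> x) / real m" for x
      by (simp add: z_def)
    have sq_z: "integrable Q (\<lambda>x. (y \<bullet> x)\<^sup>2)" for y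
    proof (rule Bochner_Integration.integrable_bound)
      show "integrable Q (\<lambda>x. (norm y)\<^sup>2 * (norm x)\<^sup>2)"
        using sq by simp
      show "AE x in Q. norm ((y \<bullet> x)\<^sup>2) \<le> norm ((norm y)\<^sup>2 * (norm x)\<^sup>2)"
        using inner_power2_le[of y] by simp
    qed simp
    have int: "integrable Q (\<lambda>x. iexp (z \<bullet> x) - 1 - \<i> * complex_of_real (z \<bullet> x))"
    proof (rule Bochner_Integration.integrable_bound[OF sq_z[of z]])
      show "AE x in Q. norm (iexp (z \<bullet> x) - 1 - \<i> * complex_of_real (z \<bullet> x)) \<le> norm ((z \<bullet> x)\<^sup>2)"
        using norm_iexp_minus_linear_le[of "z \<bullet> _"]
        by (intro AE_I2) (smt (verit, best) half_gt_zero_iff real_norm_def zero_le_power2 field_sum_of_halves)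
    qed simp
    have "norm J \<le> (LINT x|Q. norm (iexp (z \<bullet> x) - 1 - \<i> * complex_of_real (z \<bullet> x)))"
      unfolding J_def by (rule integral_norm_bound)
    also have "\<dots> \<le> (LINT x|Q. (z \<bullet> x)\<^sup>2 / 2)"
      using int sq_z norm_iexp_minus_linear_le by (intro integral_mono) auto
    also have "\<dots> = (LINT x|Q. (e \<bullet> x)\<^sup>2) / (2 * (real m)\<^sup>2)"
      by (simp add: zx power_divide)
    finally have J: "norm J \<le> (LINT x|Q. (e \<bullet> x)\<^sup>2) / (2 * (real m)\<^sup>2)" .
    have "Re J = (LINT x|Q. Re (iexp (z \<bullet> x) - 1 - \<i> * complex_of_real (z \<bullet> x)))"
      unfolding J_def by (rule integral_Re[OF int, symmetric])
    also have "\<dots> = (LINT x|Q. - (1 - cos (z \<bullet> x)))"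
      by (simp add: Re_exp)
    also have "\<dots> = - (LINT x|Q. 1 - cos (z \<bullet> x))"
      by (rule integral_minus)
    also have "\<dots> \<le> 0"
      by simp
    finally have "Re J \<le> 0" .
    then have 1: "norm (char_fun \<mu> z - 1) \<le> norm J"
      unfolding char J_def[symmetric] by (rule norm_exp_minus_1_le)
    have int_cos: "integrable \<mu> (\<lambda>x. iexp (z \<bullet> x))"
      by (intro \<mu>.integrable_const_bound[of _ 1]) auto
    have "1 - Re (char_fun \<mu> z) = (LINT x|\<mu>. 1 - cos (z \<bullet> x))"
    proof -
      have "Re (char_fun \<mu> z) = (LINT x|\<mu>. cos (z \<bullet> x))"
        unfolding char_fun_def using int_cos by (simp add: Re_exp flip: integral_Re)
      moreover have "integrable \<mu> (\<lambda>x. cos (z \<bullet> x))"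
        by (intro \<mu>.integrable_const_bound[of _ 1]) auto
      ultimately show ?thesis
        by (simp add: \<mu>.prob_space)
    qed
    moreover have "1 - Re (char_fun \<mu> z) \<le> norm (char_fun \<mu> z - 1)"
      by (metis abs_Re_le_cmod abs_le_D1 complex_Re_numeral minus_complex.simps(1) norm_minus_commute one_complex.simps(1))
    ultimately have le: "(LINT x|\<mu>. 1 - cos (z \<bullet> x)) \<le> (LINT x|Q. (e \<bullet> x)\<^sup>2) / (2 * (real m)\<^sup>2)"
      using 1 J by linarith
    have g_le: "norm (g m x) \<le> 2 * (real m)\<^sup>2 * 2" for x
    proof -
      have "1 - cos ((e \<bullet> x) / real m) \<le> 2"
        using cos_ge_minus_one[of "(e \<bullet> x) / real m"] by linarith
      then have "2 * (real m)\<^sup>2 * (1 - cos ((e \<bullet> x) / real m)) \<le> 2 * (real m)\<^sup>2 * 2"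
        by (intro mult_left_mono) auto
      then show ?thesis
        by (simp only: real_norm_def abs_of_nonneg[OF g0]) (simp only: g_def)
    qed
    have "g m \<in> borel_measurable \<mu>"
      unfolding g_def by measurable
    then have "integrable \<mu> (g m)"
      by (intro \<mu>.integrable_const_bound[where B="2 * (real m)\<^sup>2 * 2"] AE_I2 g_le)
    then have "(\<integral>\<^sup>+x. ennreal (g m x) \<partial>\<mu>) = ennreal (LINT x|\<mu>. g m x)"
      using g0 by (intro nn_integral_eq_integral) auto
    also have "(LINT x|\<mu>. g m x) = 2 * (real m)\<^sup>2 * (LINT x|\<mu>. 1 - cos (z \<bullet> x))"
      by (simp add: g_def zx)
    also have "\<dots> \<le> (LINT x|Q. (e \<bullet> x)\<^sup>2)"
      using le \<open>m > 0\<close> by (simp add: field_simps)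
    finally show ?thesis
      by (simp add: ennreal_leI)
  qed
  have "(\<integral>\<^sup>+x. ennreal ((e \<bullet> x)\<^sup>2) \<partial>\<mu>) = (\<integral>\<^sup>+x. liminf (\<lambda>m. ennreal (g m x)) \<partial>\<mu>)"
    by (intro nn_integral_cong lim_imp_Liminf[symmetric] tendsto_ennrealI lim) simp
  also have "\<dots> \<le> liminf (\<lambda>m. \<integral>\<^sup>+x. ennreal (g m x) \<partial>\<mu>)"
    by (rule nn_integral_liminf) (auto simp: g_def)
  also have "\<dots> \<le> liminf (\<lambda>m. ennreal (LINT x|Q. (e \<bullet> x)\<^sup>2))"
    using bound by (intro Liminf_mono eventually_mono[OF eventually_gt_at_top[of 0]])
  finally show ?thesis
    by (simp add: Liminf_const)
qed

lemma ex_small_jump_radius: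
  fixes M :: "'a::euclidean_space measure"
  assumes M: "levy_measure M" and "0 < \<eta>"
  obtains n where "(LINT x|M. (norm x)\<^sup>2 * indicator {x. norm x \<le> 1 / real (Suc n)} x) < \<eta>"
    and "k \<le> n"
proof -
  have [measurable_cong]: "sets M = sets borel"
    using M by (simp add: levy_measure_def)
  define f where "f n x = (norm x)\<^sup>2 * indicator {x. norm x \<le> 1 / real (Suc n)} x" for n and x :: 'a
  have "(\<lambda>n. LINT x|M. f n x) \<longlonglongrightarrow> (LINT x|M. 0)"
  proof (rule integral_dominated_convergence[where w="\<lambda>x. min ((norm x)\<^sup>2) 1"])
    show "integrable M (\<lambda>x. min ((norm x)\<^sup>2) 1)"
      by (rule integrable_levy_measure[OF M, of _ 1]) auto
    show "AE x in M. (\<lambda>n. f n x) \<longlonglongrightarrow> 0"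
    proof (intro AE_I2 tendsto_eventually)
      fix x :: 'a
      show "\<forall>\<^sub>F n in sequentially. f n x = 0"
      proof (cases "x = 0")
        case False
        then obtain N where N: "inverse (real (Suc N)) < norm x"
          using reals_Archimedean[of "norm x"] by auto
        have "f n x = 0" if "N \<le> n" for n
        proof -
          have "1 / real (Suc n) \<le> inverse (real (Suc N))"
            using that by (simp add: field_simps)
          then show ?thesis
            using N by (simp add: f_def indicator_def)
        qed
        then show ?thesis
          by (auto simp: eventually_sequentially)
      qed (simp add: f_def)
    qed
    show "AE x in M. norm (f n x) \<le> min ((norm x)\<^sup>2) 1" for n
    proof (intro AE_I2)
      fix x :: 'a
      have "(norm x)\<^sup>2 \<le> 1" if "norm x \<le> 1 / real (Suc n)"
      proof -
        have "1 / real (Suc n) \<le> 1"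
          by simp
        with that have "norm x \<le> 1"
          by (rule order_trans)
        then show ?thesis
          by (simp add: power_le_one)
      qed
      then show "norm (f n x) \<le> min ((norm x)\<^sup>2) 1"
        by (auto simp: f_def indicator_def)
    qed
  qed (auto simp: f_def)
  then have "\<forall>\<^sub>F n in sequentially. (LINT x|M. f n x) < \<eta>"
    using \<open>0 < \<eta>\<close> by (intro order_tendstoD(2)[of _ 0]) auto
  then have "\<forall>\<^sub>F n in sequentially. (LINT x|M. f n x) < \<eta> \<and> k \<le> n"
    using eventually_ge_at_top[of k] by eventually_elim auto
  then show ?thesis
    using that unfolding f_def eventually_sequentially by blast
qed

text \<open>Cut the complement of the origin into shells. The jumps in each shell form a centred
  compound Poisson variable, and the shells are chosen so thin that the second moments of
  these variables decay like \<open>4\<^sup>-\<^sup>k\<close>. Their independent sum then converges absolutely almost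
  surely, and its characteristic function is the product of theirs. Only the jumps of the
  outermost shell are left uncentred, since they need not have a first moment; replacing
  this centring by the one in \<open>levy_integrand\<close> changes the shift.\<close>

theorem ex_is_ID:
  fixes M :: "'a::euclidean_space measure"
  assumes M: "levy_measure M"
  obtains b \<nu> where "is_ID M b \<nu>"
proof -
  have sets_M [measurable_cong]: "sets M = sets borel"
    using M by (simp add: levy_measure_def)
  have "\<exists>n. (LINT x|M. (norm x)\<^sup>2 * indicator {x. norm x \<le> 1 / real (Suc n)} x) < (1/4) ^ k \<and> k \<le> n" for k
    by (rule ex_small_jump_radius[OF M, of "(1/4) ^ k" k]) auto
  then obtain N where N: "\<And>k. (LINT x|M. (norm x)\<^sup>2 * indicator {x. norm x \<le> 1 / real (Suc (N k))} x) < (1/4) ^ k"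
    and N_ge: "\<And>k. k \<le> N k"
    by metis
  define \<epsilon> where "\<epsilon> k = 1 / real (Suc (N k))" for k
  have \<epsilon>: "0 < \<epsilon> k" "\<epsilon> k \<le> 1" "\<epsilon> k \<le> 1 / real (Suc k)" for k
    using N_ge[of k] by (auto simp: \<epsilon>_def field_simps)
  define E where "E k = {x::'a. norm x > \<epsilon> k}" for k
  define A where "A = disjointed E"
  have E_meas [measurable]: "E k \<in> sets borel" for k
    unfolding E_def by measurable
  have A_meas [measurable]: "A k \<in> sets borel" for k
    unfolding A_def disjointed_def by measurable
  have A0: "A 0 = E 0"
    by (simp add: A_def disjointed_def)
  have A_Suc: "norm x \<le> \<epsilon> k" if "x \<in> A (Suc k)" for x k
    using that unfolding A_def disjointed_def E_def by (auto simp: not_less)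
  have A_pos: "\<epsilon> k < norm x" if "x \<in> A k" for x k
    using that unfolding A_def disjointed_def E_def by auto
  have A_disj: "disjoint_family A"
    unfolding A_def by (rule disjoint_family_disjointed)
  have A_UN: "(\<Union>k. A k) = - {0}"
  proof -
    have "x \<in> (\<Union>k. E k)" if "x \<noteq> 0" for x
    proof -
      obtain k where "inverse (real (Suc k)) < norm x"
        using reals_Archimedean[of "norm x"] \<open>x \<noteq> 0\<close> by auto
      then have "\<epsilon> k < norm x"
        using \<epsilon>(3)[of k] by (simp add: inverse_eq_divide)
      then show ?thesis
        by (auto simp: E_def)
    qed
    moreover have "0 \<notin> (\<Union>k. E k)"
      using \<epsilon> by (auto simp: E_def not_less less_imp_le)
    ultimately show ?thesis
      unfolding A_def UN_disjointed_eq by auto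
  qed
  \<comment> \<open>The centring: none on the outermost shell, full on all others.\<close>
  define cst where "cst x = (if norm x > \<epsilon> 0 then 0 else 1 :: real)" for x :: 'a
  have cst_meas [measurable]: "cst \<in> borel_measurable borel"
    unfolding cst_def by measurable
  define f where "f z x = iexp (z \<bullet> x) - 1 - \<i> * complex_of_real (cst x * (z \<bullet> x))" for z x :: 'a
  have f_meas [measurable]: "f z \<in> borel_measurable borel" for z
    unfolding f_def by measurable
  have f_le: "norm (f z x) \<le> ((norm z)\<^sup>2 + 2 / (\<epsilon> 0)\<^sup>2) * min ((norm x)\<^sup>2) 1" for z x
  proof (cases "norm x > \<epsilon> 0")
    case True
    have "(\<epsilon> 0)\<^sup>2 \<le> min ((norm x)\<^sup>2) 1"
      using \<epsilon>[of 0] True by (simp add: power_mono power_le_one)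
    then have "2 \<le> 2 / (\<epsilon> 0)\<^sup>2 * min ((norm x)\<^sup>2) 1"
      using \<epsilon>(1)[of 0] by (simp add: field_simps)
    moreover have "norm (f z x) \<le> 2"
      using True norm_iexp_minus_1_le(2) by (simp add: f_def cst_def)
    moreover have "0 \<le> (norm z)\<^sup>2 * min ((norm x)\<^sup>2) 1"
      by simp
    ultimately show ?thesis
      unfolding ring_distribs by linarith
  next
    case False
    then have "norm x \<le> 1"
      using \<epsilon>(2)[of 0] by linarith
    then have min: "min ((norm x)\<^sup>2) 1 = (norm x)\<^sup>2"
      using power_mono[of "norm x" 1 2] by simp
    have "norm (f z x) \<le> (z \<bullet> x)\<^sup>2 / 2"
      using False norm_iexp_minus_linear_le[of "z \<bullet> x"] by (simp add: f_def cst_def)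
    also have "\<dots> \<le> (norm z)\<^sup>2 * (norm x)\<^sup>2"
      using inner_power2_le[of z x] zero_le_power2[of "z \<bullet> x"] by linarith
    also have "\<dots> \<le> ((norm z)\<^sup>2 + 2 / (\<epsilon> 0)\<^sup>2) * (norm x)\<^sup>2"
      by (intro mult_right_mono) auto
    finally show ?thesis
      by (simp only: min)
  qed
  have int_f: "integrable M (f z)" for z
    by (rule integrable_levy_measure[OF M f_meas f_le])
  define Q where "Q k = density M (indicator (A k))" for k
  have sets_Q [measurable_cong, simp]: "sets (Q k) = sets borel" for k
    by (simp add: Q_def sets_M)
  have integral_Q: "(LINT x|Q k. g x) = (LINT x|M. indicator (A k) x *\<^sub>R g x)"
    if "g \<in> borel_measurable borel" for g :: "'a \<Rightarrow> complex" and k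
  proof -
    have "density M (indicator (A k)) = density M (\<lambda>x. ennreal (indicator (A k) x))"
      by (intro density_cong) (auto simp: indicator_def)
    then show ?thesis
      unfolding Q_def using borel_measurable_sets_eq_borel[OF sets_M that]
      by (simp add: integral_density)
  qed
  have AE_Q: "AE x in Q k. x \<in> A k" for k
    unfolding Q_def by (subst AE_density) (auto simp: indicator_def)
  have fin_Q: "finite_measure (Q k)" for k
  proof
    have "integrable M (\<lambda>x. indicator (A k) x :: real)"
    proof (rule integrable_levy_measure[OF M])
      fix x :: 'a
      have "(\<epsilon> k)\<^sup>2 \<le> min ((norm x)\<^sup>2) 1" if "x \<in> A k"
        using \<epsilon>[of k] A_pos[OF that] by (simp add: power_mono power_le_one)
      then show "norm (indicator (A k) x :: real) \<le> (1 / (\<epsilon> k)\<^sup>2) * min ((norm x)\<^sup>2) 1"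
        using \<epsilon>(1)[of k] by (auto simp: indicator_def field_simps)
    qed simp
    then have "emeasure M (A k) < \<infinity>"
      by (simp add: integrable_indicator_iff sets_M)
    then show "emeasure (Q k) (space (Q k)) \<noteq> \<infinity>"
      unfolding Q_def by (simp add: emeasure_density)
  qed
  have cst_Suc: "cst x = 1" "norm x \<le> 1" if "x \<in> A (Suc k)" for x k
  proof -
    have "x \<notin> E 0"
      using that unfolding A_def disjointed_def by auto
    then show "cst x = 1"
      by (simp add: E_def cst_def)
    show "norm x \<le> 1"
      using A_Suc[OF that] \<epsilon>(2)[of k] by linarith
  qed
  have cst_0: "cst x = 0" if "x \<in> A 0" for x
    using that by (simp add: A0 E_def cst_def)
  have X_ex: "\<exists>X. prob_space X \<and> sets X = sets borel \<and> (\<forall>z. char_fun X z = exp (LINT x|Q k. f z x))" for k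
  proof -
    interpret Q: finite_measure "Q k" by (rule fin_Q)
    obtain Y where Y: "prob_space Y" "sets Y = sets borel"
      and char_Y: "\<And>z. char_fun Y z = exp (LINT x|Q k. iexp (z \<bullet> x) - 1)"
      using ex_compound_poisson[OF fin_Q sets_Q, of k] by blast
    have [measurable_cong]: "sets Y = sets borel" by fact
    define c where "c x = cst x *\<^sub>R x" for x :: 'a
    have c_meas [measurable]: "c \<in> borel_measurable borel"
      unfolding c_def by measurable
    define m where "m = (LINT x|Q k. c x)"
    have "AE x in Q k. norm (c x) \<le> 1"
      using AE_Q[of k]
    proof eventually_elim
      case (elim x)
      show ?case
        by (cases k) (use elim cst_0 cst_Suc in \<open>auto simp: c_def\<close>)
    qed
    then have int_m: "integrable (Q k) c"
      by (intro Q.integrable_const_bound[of _ 1]) auto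
    have "char_fun (distr Y borel (\<lambda>x. x - m)) z = exp (LINT x|Q k. f z x)" for z
    proof -
      have "integrable (Q k) (\<lambda>x. complex_of_real (c x \<bullet> z))"
        using int_m by (intro integrable_of_real integrable_inner_left) auto
      moreover have "integrable (Q k) (\<lambda>x. iexp (z \<bullet> x) - 1)"
        using norm_iexp_minus_1_le(2) by (intro Q.integrable_const_bound[of _ 2]) auto
      moreover have "f z x = (iexp (z \<bullet> x) - 1) - \<i> * complex_of_real (c x \<bullet> z)" for x
        by (simp add: f_def c_def inner_commute)
      ultimately have "(LINT x|Q k. f z x)
          = (LINT x|Q k. iexp (z \<bullet> x) - 1) - \<i> * complex_of_real (m \<bullet> z)"
        unfolding m_def using int_m by simp
      then show ?thesis
        using char_fun_shift[OF Y] by (simp add: char_Y flip: exp_add)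
    qed
    moreover have "prob_space (distr Y borel (\<lambda>x. x - m))"
      by (intro prob_space.prob_space_distr Y) measurable
    ultimately show ?thesis
      by (intro exI[of _ "distr Y borel (\<lambda>x. x - m)"]) auto
  qed
  obtain X where X: "\<And>k. prob_space (X k)" and sets_X [measurable_cong, simp]: "\<And>k. sets (X k) = sets borel"
    and char_X: "\<And>k z. char_fun (X k) z = exp (LINT x|Q k. f z x)"
    using X_ex by metis
  \<comment> \<open>The elementary bound \<open>2 norm x \<le> q + (norm x)\<^sup>2 / q\<close> with \<open>q = 2\<^sup>-\<^sup>k\<close> turns the second
    moment into a first moment.\<close>
  have moment: "(\<integral>\<^sup>+x. ennreal (norm x) \<partial>X (Suc k)) \<le> ennreal ((1/2) ^ k)" for k
  proof -
    interpret Q: finite_measure "Q (Suc k)" by (rule fin_Q)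
    have sq_le: "AE x in Q (Suc k). (norm x)\<^sup>2 \<le> 1"
      using AE_Q[of "Suc k"]
    proof eventually_elim
      case (elim x)
      then show ?case
        using cst_Suc(2)[OF elim] by (simp add: power_le_one)
    qed
    have sq: "integrable (Q (Suc k)) (\<lambda>x. (norm x)\<^sup>2)"
      using sq_le by (intro Q.integrable_const_bound[of _ 1]) auto
    have char: "char_fun (X (Suc k)) z
        = exp (LINT x|Q (Suc k). iexp (z \<bullet> x) - 1 - \<i> * complex_of_real (z \<bullet> x))" for z
    proof -
      have "AE x in Q (Suc k). f z x = iexp (z \<bullet> x) - 1 - \<i> * complex_of_real (z \<bullet> x)"
        using AE_Q[of "Suc k"] by eventually_elim (simp add: f_def cst_Suc)
      then show ?thesis
        unfolding char_X by (intro arg_cong[where f=exp] integral_cong_AE) auto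
    qed
    have sq_i: "integrable (Q (Suc k)) (\<lambda>x. (i \<bullet> x)\<^sup>2)" for i
    proof (rule Bochner_Integration.integrable_bound)
      show "integrable (Q (Suc k)) (\<lambda>x. (norm i)\<^sup>2 * (norm x)\<^sup>2)"
        using sq by simp
      show "AE x in Q (Suc k). norm ((i \<bullet> x)\<^sup>2) \<le> norm ((norm i)\<^sup>2 * (norm x)\<^sup>2)"
        using inner_power2_le[of i] by simp
    qed simp
    have norm_sq: "(norm x)\<^sup>2 = (\<Sum>i\<in>Basis. (i \<bullet> x)\<^sup>2)" for x :: 'a
      unfolding power2_norm_eq_inner by (subst euclidean_inner) (simp add: power2_eq_square inner_commute)
    have "(\<integral>\<^sup>+x. ennreal ((norm x)\<^sup>2) \<partial>X (Suc k)) = (\<Sum>i\<in>Basis. \<integral>\<^sup>+x. ennreal ((i \<bullet> x)\<^sup>2) \<partial>X (Suc k))"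
      unfolding norm_sq by (subst nn_integral_sum[symmetric]) (auto simp: sum_ennreal)
    also have "\<dots> \<le> (\<Sum>i\<in>Basis. ennreal (LINT x|Q (Suc k). (i \<bullet> x)\<^sup>2))"
      by (intro sum_mono second_moment_le X sets_X fin_Q sets_Q sq char)
    also have "\<dots> = ennreal (LINT x|Q (Suc k). (norm x)\<^sup>2)"
      unfolding norm_sq using sq_i by (subst sum_ennreal) auto
    also have "(LINT x|Q (Suc k). (norm x)\<^sup>2) \<le> (1/4) ^ k"
    proof -
      have "density M (indicator (A (Suc k))) = density M (\<lambda>x. ennreal (indicator (A (Suc k)) x))"
        by (intro density_cong) (auto simp: indicator_def)
      then have "(LINT x|Q (Suc k). (norm x)\<^sup>2) = (LINT x|M. indicator (A (Suc k)) x *\<^sub>R (norm x)\<^sup>2)"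
        unfolding Q_def by (simp add: integral_density)
      also have "\<dots> \<le> (LINT x|M. (norm x)\<^sup>2 * indicator {x. norm x \<le> 1 / real (Suc (N k))} x)"
      proof (rule integral_mono)
        show "integrable M (\<lambda>x. indicator (A (Suc k)) x *\<^sub>R (norm x)\<^sup>2)"
          using cst_Suc(2)
          by (intro integrable_levy_measure[OF M, of _ 1]) (auto simp: indicator_def power_le_one)
        have "norm x \<le> 1" if "norm x \<le> 1 / real (Suc (N k))" for x :: 'a
          using \<epsilon>(2)[of k] that unfolding \<epsilon>_def by linarith
        then show "integrable M (\<lambda>x. (norm x)\<^sup>2 * indicator {x. norm x \<le> 1 / real (Suc (N k))} x)"
          by (intro integrable_levy_measure[OF M, of _ 1])
             (auto simp: indicator_def power_le_one simp del: of_nat_Suc)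
        show "indicator (A (Suc k)) x *\<^sub>R (norm x)\<^sup>2
            \<le> (norm x)\<^sup>2 * indicator {x. norm x \<le> 1 / real (Suc (N k))} x" for x
          using A_Suc[of x k] by (auto simp: indicator_def \<epsilon>_def)
      qed
      finally show ?thesis
        using N[of k] by linarith
    qed
    finally have m2: "(\<integral>\<^sup>+x. ennreal ((norm x)\<^sup>2) \<partial>X (Suc k)) \<le> ennreal ((1/4) ^ k)"
      by (simp add: ennreal_leI)
    have "(\<integral>\<^sup>+x. ennreal (norm x) \<partial>X (Suc k))
        \<le> (\<integral>\<^sup>+x. ennreal ((1/2) ^ k / 2) + ennreal (2 ^ k / 2) * ennreal ((norm x)\<^sup>2) \<partial>X (Suc k))"
    proof (intro nn_integral_mono)
      fix x :: 'a
      let ?q = "(1/2 :: real) ^ k"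
      have q: "?q > 0" "2 ^ k = 1 / ?q"
        by (simp_all add: power_one_over)
      have "0 \<le> (norm x - ?q)\<^sup>2 / (2 * ?q)"
        using q by simp
      also have "\<dots> = ?q / 2 + (1 / ?q) / 2 * (norm x)\<^sup>2 - norm x"
        using q(1) by (simp add: power2_diff field_simps power2_eq_square)
      finally have "norm x \<le> ?q / 2 + 2 ^ k / 2 * (norm x)\<^sup>2"
        using q(2) by simp
      then show "ennreal (norm x) \<le> ennreal (?q / 2) + ennreal (2 ^ k / 2) * ennreal ((norm x)\<^sup>2)"
        by (simp flip: ennreal_mult ennreal_plus del: ennreal_plus add: ennreal_leI)
    qed
    also have "\<dots> = ennreal ((1/2) ^ k / 2) + ennreal (2 ^ k / 2) * (\<integral>\<^sup>+x. ennreal ((norm x)\<^sup>2) \<partial>X (Suc k))"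
      using prob_space.emeasure_space_1[OF X] by (simp add: nn_integral_add nn_integral_cmult)
    also have "\<dots> \<le> ennreal ((1/2) ^ k / 2) + ennreal (2 ^ k / 2) * ennreal ((1/4) ^ k)"
      by (intro add_left_mono mult_left_mono m2) simp
    also have "\<dots> = ennreal ((1/2) ^ k)"
    proof -
      have "(2::real) ^ k / 2 * (1/4) ^ k = (1/2) ^ k / 2"
        by (simp flip: power_mult_distrib)
      then show ?thesis
        by (simp flip: ennreal_mult ennreal_plus del: ennreal_plus)
    qed
    finally show ?thesis .
  qed
  let ?P = "PiM UNIV X"
  interpret P: prob_space ?P
    using X by (intro prob_space_PiM)
  have comp [measurable]: "(\<lambda>\<omega>. \<omega> k) \<in> ?P \<rightarrow>\<^sub>M borel" for k
    using measurable_component_singleton[of k UNIV X] measurable_cong_sets[OF refl sets_X[of k], of ?P]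
    by auto
  have "AE \<omega> in ?P. (\<Sum>k. ennreal (norm (\<omega> (Suc k)))) < \<infinity>"
  proof -
    have "(\<integral>\<^sup>+\<omega>. (\<Sum>k. ennreal (norm (\<omega> (Suc k)))) \<partial>?P) = (\<Sum>k. \<integral>\<^sup>+\<omega>. ennreal (norm (\<omega> (Suc k))) \<partial>?P)"
      by (intro nn_integral_suminf) measurable
    also have "\<dots> = (\<Sum>k. \<integral>\<^sup>+x. ennreal (norm x) \<partial>X (Suc k))"
    proof (intro suminf_cong)
      fix k
      have norm_meas: "(\<lambda>x. ennreal (norm x)) \<in> borel_measurable (X (Suc k))"
        by (rule borel_measurable_sets_eq_borel[OF sets_X]) measurable
      have "(\<integral>\<^sup>+x. ennreal (norm x) \<partial>distr ?P (X (Suc k)) (\<lambda>\<omega>. \<omega> (Suc k)))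
          = (\<integral>\<^sup>+\<omega>. ennreal (norm (\<omega> (Suc k))) \<partial>?P)"
        by (rule nn_integral_distr) (use norm_meas in simp_all)
      then show "(\<integral>\<^sup>+\<omega>. ennreal (norm (\<omega> (Suc k))) \<partial>?P) = (\<integral>\<^sup>+x. ennreal (norm x) \<partial>X (Suc k))"
        using X by (simp add: distr_PiM_component)
    qed
    also have "\<dots> \<le> (\<Sum>k. ennreal ((1/2) ^ k))"
      by (intro suminf_le moment) auto
    also have "\<dots> = ennreal (\<Sum>k. (1/2) ^ k)"
      by (intro suminf_ennreal2) (auto intro: summable_geometric)
    also have "\<dots> < \<infinity>"
      by simp
    finally have "(\<integral>\<^sup>+\<omega>. (\<Sum>k. ennreal (norm (\<omega> (Suc k)))) \<partial>?P) \<noteq> \<infinity>"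
      by simp
    then have "AE \<omega> in ?P. (\<Sum>k. ennreal (norm (\<omega> (Suc k)))) \<noteq> \<infinity>"
      by (intro nn_integral_PInf_AE) auto
    then show ?thesis
      by (simp add: less_top)
  qed
  then have AE_sums: "AE \<omega> in ?P. (\<lambda>n. \<Sum>k<n. \<omega> k) \<longlonglongrightarrow> (\<Sum>k. \<omega> k)"
  proof eventually_elim
    case (elim \<omega>)
    then have "summable (\<lambda>k. norm (\<omega> (Suc k)))"
      by (intro summable_suminf_not_top) (auto simp: less_top)
    then have "summable (\<lambda>k. \<omega> (Suc k))"
      by (rule summable_norm_cancel)
    then have "summable \<omega>"
      by (simp add: summable_Suc_iff)
    then show ?case
      by (rule summable_LIMSEQ)
  qed
  define \<nu> where "\<nu> = distr ?P borel (\<lambda>\<omega>. \<Sum>k. \<omega> k)"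
  have S_meas [measurable]: "(\<lambda>\<omega>. \<Sum>k. \<omega> k) \<in> ?P \<rightarrow>\<^sub>M borel"
    by (rule borel_measurable_suminf) measurable
  have char_\<nu>: "char_fun \<nu> z = exp (LINT x|M. f z x)" for z
  proof -
    have "(\<lambda>n. LINT \<omega>|?P. iexp (z \<bullet> (\<Sum>k<n. \<omega> k))) \<longlonglongrightarrow> (LINT \<omega>|?P. iexp (z \<bullet> (\<Sum>k. \<omega> k)))"
    proof (rule integral_dominated_convergence[where w="\<lambda>_. 1"])
      show "AE \<omega> in ?P. (\<lambda>n. iexp (z \<bullet> (\<Sum>k<n. \<omega> k))) \<longlonglongrightarrow> iexp (z \<bullet> (\<Sum>k. \<omega> k))"
        using AE_sums by eventually_elim (intro tendsto_intros)
    qed auto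
    moreover have "(LINT \<omega>|?P. iexp (z \<bullet> (\<Sum>k. \<omega> k))) = char_fun \<nu> z"
      unfolding \<nu>_def char_fun_def by (subst integral_distr) auto
    moreover have "(LINT \<omega>|?P. iexp (z \<bullet> (\<Sum>k<n. \<omega> k))) = exp (\<Sum>k<n. LINT x|Q k. f z x)" for n
      using char_fun_sum_PiM[OF X sets_X, where z=z and n=n] by (simp add: char_X exp_sum)
    moreover have "(\<lambda>n. exp (\<Sum>k<n. LINT x|Q k. f z x)) \<longlonglongrightarrow> exp (LINT x|M. f z x)"
    proof (intro tendsto_exp)
      have int_Af: "integrable M (\<lambda>x. indicator (A k) x *\<^sub>R f z x)" for k
      proof (rule Bochner_Integration.integrable_bound[OF int_f[of z]])
        show "(\<lambda>x. indicator (A k) x *\<^sub>R f z x) \<in> borel_measurable M"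
          by (intro borel_measurable_scaleR borel_measurable_indicator borel_measurable_integrable int_f)
             (simp add: sets_M)
      qed (auto simp: indicator_def)
      have "(\<Sum>k<n. LINT x|Q k. f z x) = (LINT x|M. (\<Sum>k<n. indicator (A k) x *\<^sub>R f z x))" for n
        by (simp only: integral_Q[OF f_meas]) (rule Bochner_Integration.integral_sum[symmetric, OF int_Af])
      moreover have "(\<lambda>n. LINT x|M. (\<Sum>k<n. indicator (A k) x *\<^sub>R f z x)) \<longlonglongrightarrow> (LINT x|M. f z x)"
      proof (rule integral_dominated_convergence[where w="\<lambda>x. norm (f z x)"])
        have ind: "(\<Sum>k<n. indicator (A k) x *\<^sub>R f z x) = indicator (\<Union>k<n. A k) x *\<^sub>R f z x" for n x
        proof -
          have "(\<Sum>k<n. indicator (A k) x :: real) = indicator (\<Union>k<n. A k) x"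
            using A_disj by (intro indicator_UN_disjoint[symmetric]) (auto intro: disjoint_family_on_mono)
          then show ?thesis
            by (simp flip: scaleR_sum_left)
        qed
        show "AE x in M. norm (\<Sum>k<n. indicator (A k) x *\<^sub>R f z x) \<le> norm (f z x)" for n
          unfolding ind by (auto simp: indicator_def)
        show "AE x in M. (\<lambda>n. \<Sum>k<n. indicator (A k) x *\<^sub>R f z x) \<longlonglongrightarrow> f z x"
        proof (intro AE_I2)
          fix x
          show "(\<lambda>n. \<Sum>k<n. indicator (A k) x *\<^sub>R f z x) \<longlonglongrightarrow> f z x"
          proof (cases "x = 0")
            case False
            then obtain k where k: "x \<in> A k"
              using A_UN by blast
            show ?thesis
              unfolding ind
              by (intro tendsto_eventually eventually_sequentiallyI[of "Suc k"])
                 (use k in \<open>force simp: indicator_def\<close>)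
          qed (simp add: f_def)
        qed
        show "integrable M (\<lambda>x. norm (f z x))"
          using int_f by simp
        show "(\<lambda>x. \<Sum>k<n. indicator (A k) x *\<^sub>R f z x) \<in> borel_measurable M" for n
          by (intro borel_measurable_sum borel_measurable_integrable int_Af)
        show "f z \<in> borel_measurable M"
          by (intro borel_measurable_integrable int_f)
      qed
      ultimately show "(\<lambda>n. \<Sum>k<n. LINT x|Q k. f z x) \<longlonglongrightarrow> (LINT x|M. f z x)"
        by simp
    qed
    ultimately show ?thesis
      using LIMSEQ_unique by simp
  qed
  \<comment> \<open>The discrepancy between the two centrings; its integral is the shift.\<close>
  define h where "h x = (1 / (1 + (norm x)\<^sup>2) - cst x) *\<^sub>R x" for x :: 'a
  have h_meas [measurable]: "h \<in> borel_measurable borel"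
    unfolding h_def by measurable
  have int_h: "integrable M h"
  proof (rule integrable_levy_measure[OF M h_meas])
    fix x :: 'a
    let ?r = "norm x"
    have pos: "1 + ?r\<^sup>2 > 0"
      by (auto intro!: add_pos_nonneg)
    have r1: "?r / (1 + ?r\<^sup>2) \<le> 1"
      using pos zero_le_power2[of "?r - 1"] norm_ge_zero[of x]
      unfolding power2_diff by (subst divide_le_eq_1_pos) auto
    show "norm (h x) \<le> (1 + 1 / (\<epsilon> 0)\<^sup>2) * min (?r\<^sup>2) 1"
    proof (cases "?r > \<epsilon> 0")
      case True
      have "(\<epsilon> 0)\<^sup>2 \<le> min (?r\<^sup>2) 1"
        using \<epsilon>[of 0] True by (simp add: power_mono power_le_one)
      then have "1 \<le> 1 / (\<epsilon> 0)\<^sup>2 * min (?r\<^sup>2) 1"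
        using \<epsilon>(1)[of 0] by (simp add: field_simps)
      moreover have "norm (h x) = ?r / (1 + ?r\<^sup>2)"
        using True pos by (simp add: h_def cst_def)
      moreover have "0 \<le> min (?r\<^sup>2) 1"
        by simp
      ultimately show ?thesis
        using r1 unfolding ring_distribs by linarith
    next
      case False
      then have "?r \<le> 1"
        using \<epsilon>(2)[of 0] by linarith
      then have min: "min (?r\<^sup>2) 1 = ?r\<^sup>2"
        using power_mono[of ?r 1 2] by simp
      have "1 / (1 + ?r\<^sup>2) - 1 = - (?r\<^sup>2 / (1 + ?r\<^sup>2))"
        using pos by (simp add: field_simps)
      then have "norm (h x) = ?r\<^sup>2 * (?r / (1 + ?r\<^sup>2))"
        using False pos by (simp add: h_def cst_def)
      also have "\<dots> \<le> ?r\<^sup>2 * 1"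
        using r1 by (intro mult_left_mono) auto
      also have "\<dots> \<le> (1 + 1 / (\<epsilon> 0)\<^sup>2) * ?r\<^sup>2"
        by (simp add: ring_distribs)
      finally show ?thesis
        by (simp only: min)
    qed
  qed
  have "is_ID M (LINT x|M. h x) \<nu>"
    unfolding is_ID_iff
  proof (intro conjI allI M)
    show "prob_space \<nu>" "sets \<nu> = sets borel"
      unfolding \<nu>_def by (auto intro: P.prob_space_distr)
    show "char_fun \<nu> z = exp (levy_exponent M (LINT x|M. h x) z)" for z
    proof -
      have "f z x = levy_integrand z x + \<i> * complex_of_real (h x \<bullet> z)" for x
        unfolding f_def levy_integrand_def h_def by (simp add: inner_commute[of x z] algebra_simps)
      then have "(LINT x|M. f z x) = (LINT x|M. levy_integrand z x + \<i> * complex_of_real (h x \<bullet> z))"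
        by simp
      also have "\<dots> = (LINT x|M. levy_integrand z x) + (LINT x|M. \<i> * complex_of_real (h x \<bullet> z))"
        using int_h by (intro Bochner_Integration.integral_add integrable_levy_integrand M
            integrable_mult_right integrable_of_real integrable_inner_left) auto
      also have "(LINT x|M. \<i> * complex_of_real (h x \<bullet> z)) = \<i> * complex_of_real ((LINT x|M. h x) \<bullet> z)"
        using int_h by simp
      finally show ?thesis
        by (simp add: char_\<nu> levy_exponent_def add.commute)
    qed
  qed
  then show ?thesis
    by (rule that)
qed

section \<open>Convergence of Levy-Khintchine exponents\<close>

lemma conv_in_dist_imp_char_fun:
  assumes conv: "conv_in_dist \<mu> \<nu>"
    and \<mu>: "\<And>n. prob_space (\<mu> n)" "\<And>n. sets (\<mu> n) = sets (borel :: 'a::euclidean_space measure)"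
    and \<nu>: "prob_space \<nu>" "sets \<nu> = sets borel"
  shows "(\<lambda>n. char_fun (\<mu> n) z) \<longlonglongrightarrow> char_fun \<nu> z"
proof -
  have eq: "char_fun M z = Complex (LINT x|M. cos (z \<bullet> x)) (LINT x|M. sin (z \<bullet> x))"
    if M: "prob_space M" "sets M = sets borel" for M
  proof -
    interpret prob_space M by fact
    have [measurable_cong]: "sets M = sets borel" by fact
    have int: "integrable M (\<lambda>x. iexp (z \<bullet> x))"
      by (intro integrable_const_bound[of _ 1]) auto
    show ?thesis
      unfolding char_fun_def
      using integral_Re[OF int] integral_Im[OF int] by (simp add: complex_eq_iff Re_exp Im_exp)
  qed
  have "(\<lambda>n. LINT x|\<mu> n. cos (z \<bullet> x)) \<longlonglongrightarrow> (LINT x|\<nu>. cos (z \<bullet> x))"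
    by (rule conv[unfolded conv_in_dist_def, rule_format])
       (auto intro!: continuous_intros exI[of _ 1] simp: bounded_iff)
  moreover have "(\<lambda>n. LINT x|\<mu> n. sin (z \<bullet> x)) \<longlonglongrightarrow> (LINT x|\<nu>. sin (z \<bullet> x))"
    by (rule conv[unfolded conv_in_dist_def, rule_format])
       (auto intro!: continuous_intros exI[of _ 1] simp: bounded_iff)
  ultimately show ?thesis
    unfolding eq[OF \<mu>] eq[OF \<nu>] by (rule tendsto_Complex)
qed

lemma norm_char_fun_diff_le:
  assumes M: "prob_space M" "sets M = sets (borel :: 'a::euclidean_space measure)" and "\<bar>t - s\<bar> \<le> \<delta>"
  shows "norm (char_fun M (t *\<^sub>R z) - char_fun M (s *\<^sub>R z)) \<le> (LINT x|M. min 2 (\<delta> * \<bar>z \<bullet> x\<bar>))"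
proof -
  interpret prob_space M by fact
  have [measurable_cong]: "sets M = sets borel" by fact
  have int: "integrable M (\<lambda>x. iexp (y \<bullet> x))" for y
    by (intro integrable_const_bound[of _ 1]) auto
  have "\<delta> \<ge> 0"
    using assms(3) by linarith
  then have int_min: "integrable M (\<lambda>x. min 2 (\<delta> * \<bar>z \<bullet> x\<bar>))"
    by (intro integrable_const_bound[of _ 2]) auto
  have "char_fun M (t *\<^sub>R z) - char_fun M (s *\<^sub>R z)
      = (LINT x|M. iexp ((t *\<^sub>R z) \<bullet> x) - iexp ((s *\<^sub>R z) \<bullet> x))"
    unfolding char_fun_def by (rule Bochner_Integration.integral_diff[symmetric, OF int int])
  also have "norm \<dots> \<le> (LINT x|M. norm (iexp ((t *\<^sub>R z) \<bullet> x) - iexp ((s *\<^sub>R z) \<bullet> x)))"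
    by (rule integral_norm_bound)
  also have "\<dots> \<le> (LINT x|M. min 2 (\<delta> * \<bar>z \<bullet> x\<bar>))"
  proof (rule integral_mono)
    fix x
    have "iexp ((t *\<^sub>R z) \<bullet> x) - iexp ((s *\<^sub>R z) \<bullet> x)
        = iexp ((s *\<^sub>R z) \<bullet> x) * (iexp ((t - s) * (z \<bullet> x)) - 1)"
      by (simp add: algebra_simps flip: exp_add)
    then have "norm (iexp ((t *\<^sub>R z) \<bullet> x) - iexp ((s *\<^sub>R z) \<bullet> x)) = norm (iexp ((t - s) * (z \<bullet> x)) - 1)"
      by (simp only: norm_mult norm_exp_i_times mult_1)
    moreover have "\<bar>(t - s) * (z \<bullet> x)\<bar> \<le> \<delta> * \<bar>z \<bullet> x\<bar>"
      using assms(3) by (simp add: abs_mult mult_right_mono)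
    ultimately show "norm (iexp ((t *\<^sub>R z) \<bullet> x) - iexp ((s *\<^sub>R z) \<bullet> x)) \<le> min 2 (\<delta> * \<bar>z \<bullet> x\<bar>)"
      using norm_iexp_minus_1_le[of "(t - s) * (z \<bullet> x)"] by linarith
    show "integrable M (\<lambda>x. norm (iexp ((t *\<^sub>R z) \<bullet> x) - iexp ((s *\<^sub>R z) \<bullet> x)))"
      by (intro integrable_norm Bochner_Integration.integrable_diff int)
  qed (rule int_min)
  finally show ?thesis .
qed

text \<open>Convergence at finitely many points of the segment, combined with a modulus of
  continuity that is common to all large \<open>n\<close>: the modulus \<open>\<integral> min 2 (\<delta> \<bar>z \<bullet> x\<bar>)\<close> is itself
  the integral of a bounded continuous function.\<close>

lemma char_fun_uniform_on_segment:
  fixes \<mu> :: "nat \<Rightarrow> 'a::euclidean_space measure"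
  assumes conv: "conv_in_dist \<mu> \<nu>"
    and \<mu>: "\<And>n. prob_space (\<mu> n)" "\<And>n. sets (\<mu> n) = sets borel"
    and \<nu>: "prob_space \<nu>" "sets \<nu> = sets borel" and "0 < \<epsilon>"
  shows "\<forall>\<^sub>F n in sequentially. \<forall>t\<in>{0..1}.
    norm (char_fun (\<mu> n) (t *\<^sub>R z) - char_fun \<nu> (t *\<^sub>R z)) < \<epsilon>"
proof -
  interpret \<nu>: prob_space \<nu> by fact
  have [measurable_cong]: "sets \<nu> = sets borel" by fact
  define g where "g k x = min 2 ((1 / real (Suc k)) * \<bar>z \<bullet> x\<bar>)" for k x
  have g_bd: "0 \<le> g k x" "g k x \<le> 2" for k x
    by (auto simp: g_def)
  have g_cont: "continuous_on UNIV (g k)" for k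
    unfolding g_def by (intro continuous_intros)
  have "(\<lambda>k. LINT x|\<nu>. g k x) \<longlonglongrightarrow> (LINT x|\<nu>. 0)"
  proof (rule integral_dominated_convergence[where w="\<lambda>_. 2"])
    show "AE x in \<nu>. (\<lambda>k. g k x) \<longlonglongrightarrow> 0"
    proof (intro AE_I2)
      fix x
      have "(\<lambda>k. min 2 ((1 / real (Suc k)) * \<bar>z \<bullet> x\<bar>)) \<longlonglongrightarrow> min 2 (0 * \<bar>z \<bullet> x\<bar>)"
        by (intro tendsto_intros LIMSEQ_Suc[OF lim_1_over_n])
      then show "(\<lambda>k. g k x) \<longlonglongrightarrow> 0"
        by (simp add: g_def)
    qed
    show "g k \<in> borel_measurable \<nu>" for k
      unfolding g_def by measurable
    show "AE x in \<nu>. norm (g k x) \<le> 2" for k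
      using g_bd[of k] by (simp add: abs_of_nonneg)
  qed auto
  then have "\<forall>\<^sub>F k in sequentially. (LINT x|\<nu>. g k x) < \<epsilon> / 3"
    using \<open>0 < \<epsilon>\<close> by (intro order_tendstoD(2)[of _ 0]) auto
  then obtain k where k: "(LINT x|\<nu>. g k x) < \<epsilon> / 3"
    unfolding eventually_sequentially by blast
  have "bounded (range (g k))"
    using g_bd by (auto simp: bounded_iff intro!: exI[of _ 2])
  then have "(\<lambda>n. LINT x|\<mu> n. g k x) \<longlonglongrightarrow> (LINT x|\<nu>. g k x)"
    using conv g_cont unfolding conv_in_dist_def by blast
  then have ev1: "\<forall>\<^sub>F n in sequentially. (LINT x|\<mu> n. g k x) < \<epsilon> / 3"
    using k by (rule order_tendstoD)
  have ev2: "\<forall>\<^sub>F n in sequentially. \<forall>i\<in>{..Suc k}.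
      norm (char_fun (\<mu> n) ((real i / real (Suc k)) *\<^sub>R z) - char_fun \<nu> ((real i / real (Suc k)) *\<^sub>R z)) < \<epsilon> / 3"
  proof (intro eventually_ball_finite ballI)
    fix i
    show "\<forall>\<^sub>F n in sequentially.
        norm (char_fun (\<mu> n) ((real i / real (Suc k)) *\<^sub>R z) - char_fun \<nu> ((real i / real (Suc k)) *\<^sub>R z)) < \<epsilon> / 3"
      using tendstoD[OF conv_in_dist_imp_char_fun[OF conv \<mu> \<nu>], of "\<epsilon> / 3"] \<open>0 < \<epsilon>\<close>
      by (simp add: dist_norm)
  qed simp
  show ?thesis
    using ev1 ev2
  proof eventually_elim
    case (elim n)
    show ?case
    proof
      fix t :: real assume t: "t \<in> {0..1}"
      define i where "i = nat \<lfloor>t * real (Suc k)\<rfloor>"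
      have i: "real i \<le> t * real (Suc k)" "t * real (Suc k) < real i + 1"
        using t by (auto simp: i_def)
      have "real i \<le> real (Suc k)"
        using i(1) t by (intro order_trans[OF i(1)]) (simp add: mult_left_le_one_le)
      then have i_le: "i \<in> {..Suc k}"
        by simp
      let ?s = "real i / real (Suc k)"
      have "?s \<le> t" "t \<le> ?s + 1 / real (Suc k)"
        using i by (simp_all add: field_simps)
      then have ts: "\<bar>t - ?s\<bar> \<le> 1 / real (Suc k)"
        by linarith
      have "norm (char_fun (\<mu> n) (t *\<^sub>R z) - char_fun (\<mu> n) (?s *\<^sub>R z)) < \<epsilon> / 3"
        using norm_char_fun_diff_le[OF \<mu> ts] elim(1) unfolding g_def by (rule order_le_less_trans)
      moreover have "norm (char_fun \<nu> (t *\<^sub>R z) - char_fun \<nu> (?s *\<^sub>R z)) < \<epsilon> / 3"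
        using norm_char_fun_diff_le[OF \<nu> ts] k unfolding g_def by (rule order_le_less_trans)
      moreover have "norm (char_fun (\<mu> n) (?s *\<^sub>R z) - char_fun \<nu> (?s *\<^sub>R z)) < \<epsilon> / 3"
        using elim(2) i_le by blast
      ultimately show "norm (char_fun (\<mu> n) (t *\<^sub>R z) - char_fun \<nu> (t *\<^sub>R z)) < \<epsilon>"
        using norm_triangle_ineq[of "char_fun (\<mu> n) (t *\<^sub>R z) - char_fun (\<mu> n) (?s *\<^sub>R z)"
            "char_fun (\<mu> n) (?s *\<^sub>R z) - char_fun \<nu> (?s *\<^sub>R z)"]
          norm_triangle_ineq4[of "char_fun (\<mu> n) (t *\<^sub>R z) - char_fun \<nu> (?s *\<^sub>R z)"
            "char_fun \<nu> (t *\<^sub>R z) - char_fun \<nu> (?s *\<^sub>R z)"]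
        by simp
    qed
  qed
qed

lemma continuous_on_levy_exponent_segment:
  fixes M :: "'a::euclidean_space measure"
  assumes M: "levy_measure M"
  shows "continuous_on {0..1} (\<lambda>t. levy_exponent M b (t *\<^sub>R z))"
proof -
  have sets_M: "sets M = sets borel"
    using M by (simp add: levy_measure_def)
  have "continuous_on {0..1} (\<lambda>t. LINT x|M. levy_integrand (t *\<^sub>R z) x)"
    unfolding continuous_on_sequentially
  proof (intro allI ballI impI, elim conjE)
    fix u :: "nat \<Rightarrow> real" and t :: real
    assume t: "t \<in> {0..1}" and u: "\<forall>n. u n \<in> {0..1}" and lim: "u \<longlonglongrightarrow> t"
    show "((\<lambda>t. LINT x|M. levy_integrand (t *\<^sub>R z) x) \<circ> u) \<longlonglongrightarrow> (LINT x|M. levy_integrand (t *\<^sub>R z) x)"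
      unfolding comp_def
    proof (rule integral_dominated_convergence[where w="\<lambda>x. (2 + norm z + (norm z)\<^sup>2) * min ((norm x)\<^sup>2) 1"])
      show "levy_integrand (t *\<^sub>R z) \<in> borel_measurable M" "levy_integrand (u n *\<^sub>R z) \<in> borel_measurable M" for n
        by (intro borel_measurable_sets_eq_borel[OF sets_M] levy_integrand_measurable)+
      show "integrable M (\<lambda>x. (2 + norm z + (norm z)\<^sup>2) * min ((norm x)\<^sup>2) 1)"
        by (rule integrable_levy_measure[OF M, of _ "2 + norm z + (norm z)\<^sup>2"]) (auto simp: abs_mult)
      show "AE x in M. (\<lambda>n. levy_integrand (u n *\<^sub>R z) x) \<longlonglongrightarrow> levy_integrand (t *\<^sub>R z) x"
      proof (intro AE_I2)
        fix x :: 'a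
        have "1 + (norm x)\<^sup>2 \<noteq> 0"
          by (smt (verit) zero_le_power2)
        then show "(\<lambda>n. levy_integrand (u n *\<^sub>R z) x) \<longlonglongrightarrow> levy_integrand (t *\<^sub>R z) x"
          unfolding levy_integrand_def by (intro tendsto_intros lim)
      qed
      show "AE x in M. norm (levy_integrand (u n *\<^sub>R z) x) \<le> (2 + norm z + (norm z)\<^sup>2) * min ((norm x)\<^sup>2) 1" for n
      proof (intro AE_I2)
        fix x :: 'a
        have "u n \<in> {0..1}"
          using u by blast
        then have "norm (u n *\<^sub>R z) \<le> norm z"
          by (simp add: mult_left_le_one_le)
        then have "2 + norm (u n *\<^sub>R z) + (norm (u n *\<^sub>R z))\<^sup>2 \<le> 2 + norm z + (norm z)\<^sup>2"
          by (intro add_mono power_mono) auto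
        then show "norm (levy_integrand (u n *\<^sub>R z) x) \<le> (2 + norm z + (norm z)\<^sup>2) * min ((norm x)\<^sup>2) 1"
          by (intro order_trans[OF norm_levy_integrand_le mult_right_mono]) auto
      qed
    qed
  qed
  then show ?thesis
    unfolding levy_exponent_def by (intro continuous_intros)
qed

text \<open>The path \<open>exp \<circ> \<delta>\<close> stays in the disc of radius \<open>1\<close> around \<open>1\<close>, so \<open>Im \<delta>\<close> cannot cross
  \<open>\<plusminus>\<pi>\<close> and stays on the principal branch on which it starts.\<close>

lemma Ln_exp_along_path:
  assumes cont: "continuous_on {0..1} \<delta>" and "\<delta> 0 = 0"
    and near: "\<And>t. t \<in> {0..1} \<Longrightarrow> norm (exp (\<delta> t) - 1) < 1" and t: "t \<in> {0..1::real}"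
  shows "Ln (exp (\<delta> t)) = \<delta> t"
proof (rule Ln_exp)
  have off_axis: "\<bar>Im (\<delta> s)\<bar> \<noteq> pi" if "s \<in> {0..1}" for s
  proof
    assume "\<bar>Im (\<delta> s)\<bar> = pi"
    then have "cos (Im (\<delta> s)) = - 1"
      by (metis cos_abs_real cos_pi)
    then have "Re (exp (\<delta> s) - 1) = - exp (Re (\<delta> s)) - 1"
      by (simp add: Re_exp)
    then have "1 < \<bar>Re (exp (\<delta> s) - 1)\<bar>"
      using exp_gt_zero[of "Re (\<delta> s)"] by linarith
    then show False
      using near[OF that] abs_Re_le_cmod[of "exp (\<delta> s) - 1"] by linarith
  qed
  have cont_Im: "continuous_on {0..t} (\<lambda>s. \<bar>Im (\<delta> s)\<bar>)"
    using t by (intro continuous_intros continuous_on_subset[OF cont]) auto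
  have "\<bar>Im (\<delta> t)\<bar> < pi"
  proof (rule ccontr)
    assume "\<not> \<bar>Im (\<delta> t)\<bar> < pi"
    then obtain s where "0 \<le> s" "s \<le> t" "\<bar>Im (\<delta> s)\<bar> = pi"
      using IVT'[of "\<lambda>s. \<bar>Im (\<delta> s)\<bar>" 0 pi t, OF _ _ _ cont_Im] t \<open>\<delta> 0 = 0\<close> by auto
    then show False
      using off_axis[of s] t by simp
  qed
  then show "- pi < Im (\<delta> t)" "Im (\<delta> t) \<le> pi"
    by auto
qed

text \<open>The characteristic functions are exponentials of the exponents and converge uniformly
  on the segment from \<open>0\<close> to \<open>z\<close>. The difference of the exponents is continuous along the
  segment and starts at \<open>0\<close>, so the principal logarithm recovers it. The second part, a
  bound for the real parts, serves as a dominating constant in averages over the segment.\<close>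

lemma levy_exponent_convergence:
  fixes \<mu> :: "nat \<Rightarrow> 'a::euclidean_space measure"
  assumes conv: "conv_in_dist \<mu> \<nu>"
    and \<mu>: "\<And>n. is_ID (M n) (b n) (\<mu> n)" and \<nu>: "is_ID L c \<nu>"
  shows "(\<lambda>n. levy_exponent (M n) (b n) z) \<longlonglongrightarrow> levy_exponent L c z"
    and "\<exists>B. \<forall>\<^sub>F n in sequentially. \<forall>t\<in>{0..1}. \<bar>Re (levy_exponent (M n) (b n) (t *\<^sub>R z))\<bar> \<le> B"
proof -
  let ?\<psi> = "\<lambda>n. levy_exponent (M n) (b n)" and ?\<Psi> = "levy_exponent L c"
  have levy: "levy_measure (M n)" "levy_measure L" for n
    using \<mu> \<nu> by (auto simp: is_ID_iff)
  have ch: "char_fun (\<mu> n) z = exp (?\<psi> n z)" "char_fun \<nu> z = exp (?\<Psi> z)" for n z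
    using \<mu> \<nu> by (auto simp: is_ID_iff)
  have prob: "prob_space (\<mu> n)" "sets (\<mu> n) = sets borel" "prob_space \<nu>" "sets \<nu> = sets borel" for n
    using \<mu> \<nu> by (auto simp: is_ID_iff)
  have "bounded ((\<lambda>t. ?\<Psi> (t *\<^sub>R z)) ` {0..1})"
    by (intro compact_imp_bounded compact_continuous_image continuous_on_levy_exponent_segment levy) simp
  then obtain C where C: "norm (?\<Psi> (t *\<^sub>R z)) \<le> C" if "t \<in> {0..1}" for t
    unfolding bounded_iff by blast
  define \<delta> where "\<delta> n t = ?\<psi> n (t *\<^sub>R z) - ?\<Psi> (t *\<^sub>R z)" for n t
  have \<delta>_cont: "continuous_on {0..1} (\<delta> n)" for n
    unfolding \<delta>_def by (intro continuous_intros continuous_on_levy_exponent_segment levy)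
  have \<delta>_0: "\<delta> n 0 = 0" for n
    by (simp add: \<delta>_def levy_exponent_def levy_integrand_def)
  have close: "\<forall>\<^sub>F n in sequentially. \<forall>t\<in>{0..1}. norm (exp (\<delta> n t) - 1) < \<epsilon>" if "\<epsilon> > 0" for \<epsilon>
  proof -
    have "\<epsilon> * exp (- C) > 0"
      using that by simp
    from char_fun_uniform_on_segment[OF conv prob this, of z] show ?thesis
    proof eventually_elim
      case (elim n)
      show ?case
      proof
        fix t :: real assume t: "t \<in> {0..1}"
        have "exp (\<delta> n t) - 1 = (exp (?\<psi> n (t *\<^sub>R z)) - exp (?\<Psi> (t *\<^sub>R z))) / exp (?\<Psi> (t *\<^sub>R z))"
          by (simp add: \<delta>_def exp_diff diff_divide_distrib)
        then have "norm (exp (\<delta> n t) - 1)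
            = norm (exp (?\<psi> n (t *\<^sub>R z)) - exp (?\<Psi> (t *\<^sub>R z))) * exp (- Re (?\<Psi> (t *\<^sub>R z)))"
          by (simp only: norm_mult norm_inverse norm_exp_eq_Re exp_minus divide_inverse)
        also have "\<dots> < (\<epsilon> * exp (- C)) * exp C"
        proof (rule mult_less_le_imp_less)
          show "norm (exp (?\<psi> n (t *\<^sub>R z)) - exp (?\<Psi> (t *\<^sub>R z))) < \<epsilon> * exp (- C)"
            using elim t by (simp add: ch)
          show "exp (- Re (?\<Psi> (t *\<^sub>R z))) \<le> exp C"
            using C[OF t] abs_Re_le_cmod[of "?\<Psi> (t *\<^sub>R z)"] by simp
        qed auto
        also have "(\<epsilon> * exp (- C)) * exp C = \<epsilon>"
          by (simp add: mult.assoc flip: exp_add)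
        finally show "norm (exp (\<delta> n t) - 1) < \<epsilon>" .
      qed
    qed
  qed
  have "(\<lambda>n. Ln (exp (\<delta> n 1))) \<longlonglongrightarrow> Ln 1"
  proof (intro tendsto_Ln)
    show "(\<lambda>n. exp (\<delta> n 1)) \<longlonglongrightarrow> 1"
    proof (rule tendstoI)
      show "\<forall>\<^sub>F n in sequentially. dist (exp (\<delta> n 1)) 1 < \<epsilon>" if "\<epsilon> > 0" for \<epsilon>
        using close[OF that] by eventually_elim (auto simp: dist_norm)
    qed
  qed simp
  moreover have "\<forall>\<^sub>F n in sequentially. Ln (exp (\<delta> n 1)) = \<delta> n 1"
    using close[of 1, OF zero_less_one]
    by eventually_elim (intro Ln_exp_along_path[OF \<delta>_cont \<delta>_0], auto)
  ultimately have "(\<lambda>n. \<delta> n 1) \<longlonglongrightarrow> 0"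
    using Lim_transform_eventually by fastforce
  then have "(\<lambda>n. \<delta> n 1 + ?\<Psi> z) \<longlonglongrightarrow> 0 + ?\<Psi> z"
    by (intro tendsto_intros)
  then show "(\<lambda>n. ?\<psi> n z) \<longlonglongrightarrow> ?\<Psi> z"
    by (simp add: \<delta>_def)
  have "\<forall>\<^sub>F n in sequentially. \<forall>t\<in>{0..1}. \<bar>Re (?\<psi> n (t *\<^sub>R z))\<bar> \<le> ln 2 + C"
    using close[of "1/2", OF half_gt_zero[OF zero_less_one]]
  proof eventually_elim
    case (elim n)
    show ?case
    proof
      fix t :: real assume t: "t \<in> {0..1}"
      have "norm (exp (\<delta> n t) - 1) < 1/2"
        using elim t by blast
      then have "norm (exp (\<delta> n t)) \<le> 2" "1/2 \<le> norm (exp (\<delta> n t))"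
        using norm_triangle_ineq3[of "exp (\<delta> n t)" 1] by auto
      then have "Re (\<delta> n t) \<le> ln 2" "- ln 2 \<le> Re (\<delta> n t)"
        using ln_le_cancel_iff[of "exp (Re (\<delta> n t))" 2] ln_le_cancel_iff[of "1/2" "exp (Re (\<delta> n t))"]
        by (auto simp: ln_div)
      then show "\<bar>Re (?\<psi> n (t *\<^sub>R z))\<bar> \<le> ln 2 + C"
        using C[OF t] abs_Re_le_cmod[of "?\<Psi> (t *\<^sub>R z)"] unfolding \<delta>_def by simp
    qed
  qed
  then show "\<exists>B. \<forall>\<^sub>F n in sequentially. \<forall>t\<in>{0..1}. \<bar>Re (?\<psi> n (t *\<^sub>R z))\<bar> \<le> B"
    by blast
qed

section \<open>Convergence of Levy measures\<close>

lemma emeasure_levy_measure_outside_ball: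
  assumes M: "levy_measure M" and "0 < r"
  shows "emeasure M {x. r < norm x} < \<infinity>"
proof -
  have "integrable M (\<lambda>x. indicator {x. r < norm x} x :: real)"
  proof (rule integrable_levy_measure[OF M])
    fix x :: 'a
    have "min (r\<^sup>2) 1 \<le> min ((norm x)\<^sup>2) 1" if "r < norm x"
      using that \<open>0 < r\<close> by (intro min.mono power_mono) auto
    then show "norm (indicator {x. r < norm x} x :: real) \<le> (1 / min (r\<^sup>2) 1) * min ((norm x)\<^sup>2) 1"
      using \<open>0 < r\<close> by (auto simp: indicator_def field_simps)
  qed measurable
  moreover have "{x. r < norm x} \<in> sets M"
    using M by (simp add: levy_measure_def)
  ultimately show ?thesis
    by (simp add: integrable_indicator_iff)
qed

lemma sigma_finite_levy_measure:
  assumes M: "levy_measure M"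
  shows "sigma_finite_measure M"
proof
  let ?A = "insert {0} (range (\<lambda>n. {x::'a. 1 / real (Suc n) < norm x}))"
  have sets_M: "sets M = sets borel"
    using M by (simp add: levy_measure_def)
  then have "space M = UNIV"
    by (metis sets_eq_imp_space_eq space_borel)
  moreover have mem: "x \<in> \<Union> ?A" for x
  proof (cases "x = 0")
    case False
    then obtain n where "inverse (real (Suc n)) < norm x"
      using reals_Archimedean[of "norm x"] by auto
    then show ?thesis
      by (auto simp: inverse_eq_divide)
  qed simp
  moreover have "emeasure M a \<noteq> \<infinity>" if a: "a \<in> ?A" for a
  proof -
    consider "a = {0}" | n where "a = {x. 1 / real (Suc n) < norm x}"
      using a by blast
    then show ?thesis
    proof cases
      case 1
      then show ?thesis
        using M by (simp add: levy_measure_def)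
    next
      case 2
      then show ?thesis
        using emeasure_levy_measure_outside_ball[OF M, of "1 / real (Suc n)"] by simp
    qed
  qed
  ultimately show "\<exists>A. countable A \<and> A \<subseteq> sets M \<and> \<Union> A = space M \<and> (\<forall>a\<in>A. emeasure M a \<noteq> \<infinity>)"
    using sets_M mem by (intro exI[of _ ?A] conjI) (simp, force, blast, blast)
qed

lemma one_minus_cos_le: "\<bar>1 - cos y\<bar> \<le> y\<^sup>2 / 2" "\<bar>1 - cos y\<bar> \<le> 2" for y :: real
proof -
  show "\<bar>1 - cos y\<bar> \<le> 2"
    using cos_ge_minus_one[of y] cos_le_one[of y] by linarith
  have "\<bar>Re (iexp y - 1 - \<i> * complex_of_real y)\<bar> \<le> y\<^sup>2 / 2"
    using norm_iexp_minus_linear_le[of y] abs_Re_le_cmod order_trans by blast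
  then show "\<bar>1 - cos y\<bar> \<le> y\<^sup>2 / 2"
    by (simp add: Re_exp)
qed

lemma one_minus_cos_inner_le:
  fixes w x :: "'a::euclidean_space"
  shows "\<bar>1 - cos (w \<bullet> x)\<bar> \<le> (2 + (norm w)\<^sup>2) * min ((norm x)\<^sup>2) 1"
proof -
  have "\<bar>1 - cos (w \<bullet> x)\<bar> \<le> (norm w)\<^sup>2 * (norm x)\<^sup>2"
    using one_minus_cos_le(1)[of "w \<bullet> x"] inner_power2_le[of w x] zero_le_power2[of "w \<bullet> x"]
    by linarith
  also have "\<dots> \<le> (2 + (norm w)\<^sup>2) * (norm x)\<^sup>2"
    by (intro mult_right_mono) auto
  finally have "\<bar>1 - cos (w \<bullet> x)\<bar> \<le> (2 + (norm w)\<^sup>2) * (norm x)\<^sup>2" .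
  moreover have "\<bar>1 - cos (w \<bullet> x)\<bar> \<le> (2 + (norm w)\<^sup>2) * 1"
    unfolding mult_1_right
    using one_minus_cos_le(2)[of "w \<bullet> x"] zero_le_power2[of "norm w"] by linarith
  ultimately show ?thesis
    unfolding min_def by presburger
qed

text \<open>Second differences cancel the shift and the centring and turn exponents into Fourier
  transforms of the finite measures \<open>(1 - cos (w \<bullet> x)) M(dx)\<close>.\<close>

lemma levy_exponent_second_difference:
  fixes M :: "'a::euclidean_space measure"
  assumes M: "levy_measure M"
  shows "(LINT x|M. iexp (z \<bullet> x) * complex_of_real (1 - cos (w \<bullet> x)))
    = levy_exponent M b z - (levy_exponent M b (z + w) + levy_exponent M b (z - w)) / 2"
proof -
  have iexp2: "iexp (a + c) + iexp (a - c) = 2 * (iexp a * complex_of_real (cos c))" for a c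
  proof -
    have "2 * complex_of_real (cos c) = iexp c + iexp (- c)"
      by (simp add: complex_eq_iff Re_exp Im_exp)
    moreover have "iexp (a + c) = iexp a * iexp c" "iexp (a - c) = iexp a * iexp (- c)"
      by (simp_all add: ring_distribs flip: exp_add)
    ultimately show ?thesis
      by (simp only: mult.left_commute[of 2]) (simp only: ring_distribs)
  qed
  have linear: "(e1 - 1 - \<i> * a) - ((e2 - 1 - \<i> * (a + c)) + (e3 - 1 - \<i> * (a - c))) / 2 = e1 - (e2 + e3) / 2"
    for e1 e2 e3 a c :: complex
    by (simp add: field_simps)
  have "iexp (z \<bullet> x) * complex_of_real (1 - cos (w \<bullet> x))
      = levy_integrand z x - (levy_integrand (z + w) x + levy_integrand (z - w) x) / 2" for x
  proof -
    have "levy_integrand z x - (levy_integrand (z + w) x + levy_integrand (z - w) x) / 2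
        = iexp (z \<bullet> x) - (iexp (z \<bullet> x + w \<bullet> x) + iexp (z \<bullet> x - w \<bullet> x)) / 2"
      unfolding levy_integrand_def inner_add_left inner_diff_left add_divide_distrib[of "z \<bullet> x" "w \<bullet> x"]
        diff_divide_distrib[of "z \<bullet> x" "w \<bullet> x"] of_real_add of_real_diff
      by (rule linear)
    then show ?thesis
      unfolding iexp2 by (simp add: algebra_simps)
  qed
  then have "(LINT x|M. iexp (z \<bullet> x) * complex_of_real (1 - cos (w \<bullet> x)))
      = (LINT x|M. levy_integrand z x - (levy_integrand (z + w) x + levy_integrand (z - w) x) / 2)"
    by simp
  also have "\<dots> = (LINT x|M. levy_integrand z x)
      - ((LINT x|M. levy_integrand (z + w) x) + (LINT x|M. levy_integrand (z - w) x)) / 2"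
    using integrable_levy_integrand[OF M] by simp
  finally show ?thesis
    by (simp add: levy_exponent_def inner_add_right inner_diff_right algebra_simps add_divide_distrib
        diff_divide_distrib)
qed

text \<open>The average of \<open>\<Sum>i. 1 - cos (s (x \<bullet> i))\<close> over \<open>s\<close> in the unit interval. A single
  weight \<open>1 - cos (w \<bullet> x)\<close> vanishes at arbitrarily large \<open>x\<close>; the average is bounded away
  from \<open>0\<close> outside every ball around the origin.\<close>

definition tail_weight :: "'a::euclidean_space \<Rightarrow> real" where
  "tail_weight x = (\<Sum>i\<in>Basis. 1 - sinc (x \<bullet> i))"

lemma sinc_le_1: "sinc y \<le> 1" and sinc_less_1: "y \<noteq> 0 \<Longrightarrow> sinc y < 1"
proof -
  show less: "sinc y < 1" if "y \<noteq> 0" for y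
  proof -
    have *: "sin y < y" if "y > 0" for y :: real
    proof (cases "y \<le> 1")
      case True
        have half: "0 \<le> y / 2" "y / 2 \<le> 1"
          using True that by auto
        have "cos (y / 2) < 1"
          using cos_monotone_0_pi[of 0 "y / 2"] that True pi_gt3 by simp
        moreover have "sin (y / 2) \<le> y / 2"
          using sin_x_le_x[OF half(1)] .
        moreover have "0 < sin (y / 2)"
          using that True pi_gt3 by (intro sin_gt_zero) auto
        ultimately have "sin (y / 2) * cos (y / 2) < y / 2"
          using mult_strict_left_mono[of "cos (y / 2)" 1 "sin (y / 2)"] by linarith
        then show ?thesis
          using sin_double[of "y / 2"] by simp
    next
      case False
      then show ?thesis
        using sin_le_one[of y] by linarith
    qed
    show ?thesis
      using *[of y] *[of "- y"] that by (cases "y > 0") (auto simp: divide_less_eq)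
  qed
  show "sinc y \<le> 1"
    using less[of y] by (cases "y = 0") auto
qed

lemma continuous_on_tail_weight: "continuous_on S tail_weight"
  unfolding tail_weight_def by (intro continuous_intros)

lemma tail_weight_measurable [measurable]: "tail_weight \<in> borel_measurable borel"
  by (intro borel_measurable_continuous_onI continuous_on_tail_weight)

lemma tail_weight_nonneg: "0 \<le> tail_weight x"
  unfolding tail_weight_def using sinc_le_1 by (intro sum_nonneg) (simp add: diff_ge_0_iff_ge)

text \<open>If \<open>norm x \<ge> r\<close> then some coordinate of \<open>x\<close> has modulus at least \<open>r / DIM('a)\<close>. There
  \<open>1 - sinc\<close> is bounded below: by compactness for moderate arguments, and because
  \<open>sinc y \<le> 1 / y\<close> for large ones.\<close>

lemma tail_weight_lower_bound:
  assumes "0 < r"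
  obtains c where "0 < c" and "\<And>x::'a::euclidean_space. r \<le> norm x \<Longrightarrow> c \<le> tail_weight x"
proof -
  define \<eta> where "\<eta> = r / DIM('a)"
  have \<eta>: "0 < \<eta>"
    using assms by (simp add: \<eta>_def)
  have "continuous_on {\<eta>..max \<eta> 2} (\<lambda>y. 1 - sinc y)"
    by (intro continuous_intros)
  then obtain y0 where y0: "y0 \<in> {\<eta>..max \<eta> 2}" "\<And>y. y \<in> {\<eta>..max \<eta> 2} \<Longrightarrow> 1 - sinc y0 \<le> 1 - sinc y"
    using continuous_attains_inf[of "{\<eta>..max \<eta> 2}" "\<lambda>y. 1 - sinc y"] by auto
  define c where "c = min (1 - sinc y0) (1/2)"
  have "0 < c"
    using y0(1) \<eta> sinc_less_1[of y0] by (auto simp: c_def)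
  have pos: "c \<le> 1 - sinc y" if "\<eta> \<le> y" for y
  proof (cases "y \<le> 2")
    case True
    then have "y \<in> {\<eta>..max \<eta> 2}"
      using that by simp
    then show ?thesis
      using y0(2)[of y] unfolding c_def by linarith
  next
    case False
    then have "sin y * 2 \<le> y"
      using sin_le_one[of y] by linarith
    then have "sinc y \<le> 1 / 2"
      using False by (simp add: field_simps)
    moreover have "c \<le> 1 / 2"
      unfolding c_def by (rule min.cobounded2)
    ultimately show ?thesis
      by linarith
  qed
  have "c \<le> tail_weight x" if "r \<le> norm x" for x :: 'a
  proof -
    have "\<exists>i\<in>Basis. \<eta> \<le> \<bar>x \<bullet> i\<bar>"
    proof (rule ccontr)
      assume "\<not> ?thesis"
      then have "(\<Sum>i\<in>Basis. \<bar>x \<bullet> i\<bar>) < (\<Sum>i\<in>(Basis::'a set). \<eta>)"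
        by (intro sum_strict_mono) (auto simp: not_le)
      then show False
        using norm_le_l1[of x] that by (simp add: \<eta>_def)
    qed
    then obtain i where i: "i \<in> Basis" "\<eta> \<le> \<bar>x \<bullet> i\<bar>"
      by blast
    have "sinc \<bar>x \<bullet> i\<bar> = sinc (x \<bullet> i)"
      by (simp add: abs_if)
    then have "c \<le> 1 - sinc (x \<bullet> i)"
      using pos[OF i(2)] by simp
    also have "\<dots> \<le> tail_weight x"
      unfolding tail_weight_def using i(1) sinc_le_1
      by (intro member_le_sum[where f="\<lambda>i. 1 - sinc (x \<bullet> i)"]) (auto simp: diff_ge_0_iff_ge)
    finally show ?thesis .
  qed
  then show ?thesis
    using that[OF \<open>0 < c\<close>] by blast
qed

definition unit_interval :: "real measure" where
  "unit_interval = density lborel (indicator {0..1})"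

lemma sets_unit_interval [simp, measurable_cong]: "sets unit_interval = sets borel"
  by (simp add: unit_interval_def)

lemma prob_space_unit_interval: "prob_space unit_interval"
  by standard (simp add: unit_interval_def emeasure_density)

lemma AE_unit_interval: "AE s in unit_interval. s \<in> {0..1}"
  unfolding unit_interval_def by (subst AE_density) (auto simp: indicator_def)

lemma integral_unit_interval_cos: "(LINT s|unit_interval. 1 - cos (s * y)) = 1 - sinc y"
proof -
  have "density lborel (indicator {0..1}) = density lborel (\<lambda>s. ennreal (indicator {0..1::real} s))"
    by (intro density_cong) (auto simp: indicator_def)
  then have *: "(LINT s|unit_interval. 1 - cos (s * y)) = (LINT s|lborel. indicator {0..1} s *\<^sub>R (1 - cos (s * y)))"
    unfolding unit_interval_def by (simp add: integral_density)
  show ?thesis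
  proof (cases "y = 0")
    case False
    have "(LINT s|lborel. indicator {0..1} s *\<^sub>R (1 - cos (s * y))) = (1 - sin (1 * y) / y) - (0 - sin (0 * y) / y)"
      using False
      by (intro integral_FTC_atLeastAtMost)
         (auto intro!: derivative_eq_intros continuous_intros simp flip: has_real_derivative_iff_has_vector_derivative)
    then show ?thesis
      unfolding * using False by simp
  qed (simp add: *)
qed

lemma tail_weight_integral:
  fixes M :: "'a::euclidean_space measure"
  assumes M: "levy_measure M"
  shows integrable_tail_weight: "integrable M (\<lambda>x. iexp (z \<bullet> x) * complex_of_real (tail_weight x))"
    and "(LINT x|M. iexp (z \<bullet> x) * complex_of_real (tail_weight x)) = (\<Sum>i\<in>Basis. LINT s|unit_interval.
          LINT x|M. iexp (z \<bullet> x) * complex_of_real (1 - cos ((s *\<^sub>R i) \<bullet> x)))"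
    and "i \<in> Basis \<Longrightarrow> (\<lambda>s. LINT x|M. iexp (z \<bullet> x) * complex_of_real (1 - cos ((s *\<^sub>R i) \<bullet> x)))
      \<in> borel_measurable unit_interval"
proof -
  interpret M: sigma_finite_measure M
    by (rule sigma_finite_levy_measure[OF M])
  interpret U: prob_space unit_interval
    by (rule prob_space_unit_interval)
  interpret P: pair_sigma_finite M unit_interval ..
  have sets_M [measurable_cong]: "sets M = sets borel"
    using M by (simp add: levy_measure_def)
  define g where "g i x s = iexp (z \<bullet> x) * complex_of_real (1 - cos ((s *\<^sub>R i) \<bullet> x))" for i x and s :: real
  have [measurable]: "(\<lambda>(x, s). g i x s) \<in> borel_measurable (M \<Otimes>\<^sub>M unit_interval)" for i
    unfolding g_def by measurable
  have g_le: "norm (g i x s) \<le> (2 + (norm i)\<^sup>2) * min ((norm x)\<^sup>2) 1" if "s \<in> {0..1}" for i x s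
  proof -
    have "norm (g i x s) = \<bar>1 - cos ((s *\<^sub>R i) \<bullet> x)\<bar>"
      unfolding g_def by (simp only: norm_mult norm_exp_i_times norm_of_real mult_1)
    also have "\<dots> \<le> (2 + (norm (s *\<^sub>R i))\<^sup>2) * min ((norm x)\<^sup>2) 1"
      by (rule one_minus_cos_inner_le)
    also have "\<dots> \<le> (2 + (norm i)\<^sup>2) * min ((norm x)\<^sup>2) 1"
    proof (intro mult_right_mono add_left_mono power_mono)
      show "norm (s *\<^sub>R i) \<le> norm i"
        using that by (simp add: mult_left_le_one_le)
    qed auto
    finally show ?thesis .
  qed
  have int_g1: "integrable unit_interval (g i x)" for i x
  proof (rule U.integrable_const_bound)
    show "AE s in unit_interval. norm (g i x s) \<le> (2 + (norm i)\<^sup>2) * min ((norm x)\<^sup>2) 1"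
      using AE_unit_interval by eventually_elim (rule g_le)
    show "g i x \<in> borel_measurable unit_interval"
      unfolding g_def by measurable
  qed
  have int_M: "integrable M (\<lambda>x. LINT s|unit_interval. norm (g i x s))" for i
  proof (rule Bochner_Integration.integrable_bound)
    show "integrable M (\<lambda>x. (2 + (norm i)\<^sup>2) * min ((norm x)\<^sup>2) 1)"
      by (rule integrable_levy_measure[OF M, of _ "2 + (norm i)\<^sup>2"]) (auto simp: abs_mult)
    show "(\<lambda>x. LINT s|unit_interval. norm (g i x s)) \<in> borel_measurable M"
      by measurable
    show "AE x in M. norm (LINT s|unit_interval. norm (g i x s)) \<le> norm ((2 + (norm i)\<^sup>2) * min ((norm x)\<^sup>2) 1)"
    proof (intro AE_I2)
      fix x
      have "(LINT s|unit_interval. norm (g i x s)) \<le> (LINT s|unit_interval. (2 + (norm i)\<^sup>2) * min ((norm x)\<^sup>2) 1)"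
      proof (rule integral_mono_AE)
        show "AE s in unit_interval. norm (g i x s) \<le> (2 + (norm i)\<^sup>2) * min ((norm x)\<^sup>2) 1"
          using AE_unit_interval by eventually_elim (rule g_le)
      qed (use int_g1 in auto)
      moreover have "0 \<le> (LINT s|unit_interval. norm (g i x s))"
        by simp
      ultimately show "norm (LINT s|unit_interval. norm (g i x s)) \<le> norm ((2 + (norm i)\<^sup>2) * min ((norm x)\<^sup>2) 1)"
        by (simp add: U.prob_space)
    qed
  qed
  have int: "integrable (M \<Otimes>\<^sub>M unit_interval) (\<lambda>(x, s). g i x s)" for i
    using int_g1 int_M by (intro P.Fubini_integrable) auto
  have inner: "(LINT s|unit_interval. g i x s) = iexp (z \<bullet> x) * complex_of_real (1 - sinc (x \<bullet> i))" for i x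
  proof -
    have "(LINT s|unit_interval. g i x s)
        = iexp (z \<bullet> x) * complex_of_real (LINT s|unit_interval. 1 - cos (s * (x \<bullet> i)))"
      unfolding g_def by (simp add: inner_commute[of i x] del: of_real_diff)
    then show ?thesis
      by (simp only: integral_unit_interval_cos)
  qed
  have int_i: "integrable M (\<lambda>x. iexp (z \<bullet> x) * complex_of_real (1 - sinc (x \<bullet> i)))" for i
    using P.integrable_fst[OF int[of i]] by (simp only: inner)
  have sum: "iexp (z \<bullet> x) * complex_of_real (tail_weight x)
      = (\<Sum>i\<in>Basis. iexp (z \<bullet> x) * complex_of_real (1 - sinc (x \<bullet> i)))" for x
    unfolding tail_weight_def of_real_sum sum_distrib_left ..
  show "integrable M (\<lambda>x. iexp (z \<bullet> x) * complex_of_real (tail_weight x))"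
    unfolding sum by (intro Bochner_Integration.integrable_sum int_i)
  have "(LINT x|M. iexp (z \<bullet> x) * complex_of_real (tail_weight x))
      = (\<Sum>i\<in>Basis. LINT x|M. iexp (z \<bullet> x) * complex_of_real (1 - sinc (x \<bullet> i)))"
    unfolding sum by (intro Bochner_Integration.integral_sum int_i)
  also have "\<dots> = (\<Sum>i\<in>Basis. LINT s|unit_interval. LINT x|M. g i x s)"
    unfolding inner[symmetric] by (intro sum.cong refl P.Fubini_integral[symmetric] int)
  finally show "(LINT x|M. iexp (z \<bullet> x) * complex_of_real (tail_weight x)) = (\<Sum>i\<in>Basis. LINT s|unit_interval.
          LINT x|M. iexp (z \<bullet> x) * complex_of_real (1 - cos ((s *\<^sub>R i) \<bullet> x)))"
    unfolding g_def .
  have "(\<lambda>s. LINT x|M. g i x s) \<in> borel_measurable unit_interval" for i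
    by measurable
  then show "(\<lambda>s. LINT x|M. iexp (z \<bullet> x) * complex_of_real (1 - cos ((s *\<^sub>R i) \<bullet> x)))
      \<in> borel_measurable unit_interval"
    unfolding g_def .
qed

lemma Re_levy_exponent:
  assumes M: "levy_measure M"
  shows "Re (levy_exponent M b w) = - (LINT x|M. 1 - cos (w \<bullet> x))"
proof -
  have "Re (levy_exponent M b w) = (LINT x|M. Re (levy_integrand w x))"
    unfolding levy_exponent_def using integral_Re[OF integrable_levy_integrand[OF M]] by simp
  also have "\<dots> = (LINT x|M. - (1 - cos (w \<bullet> x)))"
    by (simp add: levy_integrand_def Re_exp)
  finally show ?thesis
    by (simp only: integral_minus)
qed

lemma levy_measure_sets: "levy_measure M \<Longrightarrow> sets M = sets borel"
  by (simp add: levy_measure_def)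

text \<open>By Fubini this is an average over \<open>s\<close> of second differences of exponents, which
  converge pointwise. Taking \<open>z = 0\<close> bounds their modulus by real parts of exponents on a
  segment, so dominated convergence applies.\<close>

lemma tail_weight_integral_convergence:
  fixes \<mu> :: "nat \<Rightarrow> 'a::euclidean_space measure"
  assumes conv: "conv_in_dist \<mu> \<nu>"
    and \<mu>: "\<And>n. is_ID (M n) (b n) (\<mu> n)" and \<nu>: "is_ID L c \<nu>"
  shows "(\<lambda>n. LINT x|M n. iexp (z \<bullet> x) * complex_of_real (tail_weight x))
    \<longlonglongrightarrow> (LINT x|L. iexp (z \<bullet> x) * complex_of_real (tail_weight x))"
proof -
  interpret U: prob_space unit_interval
    by (rule prob_space_unit_interval)
  have M: "levy_measure (M n)" and L: "levy_measure L" for n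
    using \<mu> \<nu> by (auto simp: is_ID_iff)
  define A where "A M i s = (LINT x|M. iexp (z \<bullet> x) * complex_of_real (1 - cos ((s *\<^sub>R i) \<bullet> x)))"
    for M and i :: 'a and s
  have A_conv: "(\<lambda>n. A (M n) i s) \<longlonglongrightarrow> A L i s" for i s
  proof -
    have "A (M n) i s = levy_exponent (M n) (b n) z - (levy_exponent (M n) (b n) (z + s *\<^sub>R i)
        + levy_exponent (M n) (b n) (z - s *\<^sub>R i)) / 2" for n
      unfolding A_def by (rule levy_exponent_second_difference[OF M])
    moreover have "A L i s = levy_exponent L c z - (levy_exponent L c (z + s *\<^sub>R i)
        + levy_exponent L c (z - s *\<^sub>R i)) / 2"
      unfolding A_def by (rule levy_exponent_second_difference[OF L])
    ultimately show ?thesis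
      by (simp only:) (intro tendsto_intros levy_exponent_convergence[OF conv \<mu> \<nu>], simp)
  qed
  have A_meas: "A M i \<in> borel_measurable unit_interval" if "levy_measure M" "i \<in> Basis" for M i
    unfolding A_def by (rule tail_weight_integral(3)[OF that])
  have "(\<lambda>n. LINT s|unit_interval. A (M n) i s) \<longlonglongrightarrow> (LINT s|unit_interval. A L i s)"
    if i: "i \<in> Basis" for i
  proof -
    obtain B where "\<forall>\<^sub>F n in sequentially. \<forall>t\<in>{0..1}. \<bar>Re (levy_exponent (M n) (b n) (t *\<^sub>R i))\<bar> \<le> B"
      using levy_exponent_convergence(2)[OF conv \<mu> \<nu>] by blast
    then obtain N where N: "\<bar>Re (levy_exponent (M n) (b n) (t *\<^sub>R i))\<bar> \<le> B" if "n \<ge> N" "t \<in> {0..1}" for n t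
      unfolding eventually_sequentially by blast
    have A_le: "norm (A (M n) i s) \<le> B" if "n \<ge> N" "s \<in> {0..1}" for n s
    proof -
      have "norm (A (M n) i s) \<le> (LINT x|M n. norm (iexp (z \<bullet> x) * complex_of_real (1 - cos ((s *\<^sub>R i) \<bullet> x))))"
        unfolding A_def by (rule integral_norm_bound)
      also have "\<dots> = (LINT x|M n. 1 - cos ((s *\<^sub>R i) \<bullet> x))"
        by (intro Bochner_Integration.integral_cong refl)
           (simp only: norm_mult norm_exp_i_times norm_of_real mult_1 abs_of_nonneg cos_le_one diff_ge_0_iff_ge)
      also have "\<dots> \<le> B"
        using N[OF that] unfolding Re_levy_exponent[OF M] by linarith
      finally show ?thesis .
    qed
    have "(\<lambda>n. LINT s|unit_interval. A (M (n + N)) i s) \<longlonglongrightarrow> (LINT s|unit_interval. A L i s)"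
    proof (rule integral_dominated_convergence[where w="\<lambda>_. B"])
      show "AE s in unit_interval. norm (A (M (n + N)) i s) \<le> B" for n
        using AE_unit_interval by eventually_elim (intro A_le, auto)
      show "AE s in unit_interval. (\<lambda>n. A (M (n + N)) i s) \<longlonglongrightarrow> A L i s"
        by (intro AE_I2 LIMSEQ_ignore_initial_segment A_conv)
      show "A L i \<in> borel_measurable unit_interval" "A (M (n + N)) i \<in> borel_measurable unit_interval" for n
        by (intro A_meas L M i)+
    qed simp
    then show ?thesis
      by (rule LIMSEQ_offset)
  qed
  then have "(\<lambda>n. \<Sum>i\<in>Basis. LINT s|unit_interval. A (M n) i s) \<longlonglongrightarrow> (\<Sum>i\<in>Basis. LINT s|unit_interval. A L i s)"
    by (intro tendsto_sum)
  then show ?thesis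
    unfolding A_def tail_weight_integral(2)[OF M] tail_weight_integral(2)[OF L] .
qed

text \<open>Weighting the Levy measures with \<open>tail_weight\<close> and normalising gives probability
  measures whose characteristic functions converge, hence weak convergence. A function that
  vanishes near the origin stays bounded and continuous after division by the weight.\<close>

theorem ID_convergence_imp_levy_measure_convergence:
  fixes \<mu> :: "nat \<Rightarrow> 'a::euclidean_space measure" and f :: "'a \<Rightarrow> real"
  assumes conv: "conv_in_dist \<mu> \<nu>"
    and \<mu>: "\<And>n. is_ID (M n) (b n) (\<mu> n)" and \<nu>: "is_ID L c \<nu>"
    and nonzero: "emeasure L UNIV \<noteq> 0"
    and f: "continuous_on UNIV f" "bounded (range f)" and "0 < r" and f0: "\<And>x. norm x < r \<Longrightarrow> f x = 0"
  shows "(\<lambda>n. LINT x|M n. f x) \<longlonglongrightarrow> (LINT x|L. f x)"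
proof -
  have M: "levy_measure (M n)" and L: "levy_measure L" for n
    using \<mu> \<nu> by (auto simp: is_ID_iff)
  define m where "m N = (LINT x|N. tail_weight x)" for N :: "'a measure"
  have int_w: "integrable N tail_weight" if "levy_measure N" for N :: "'a measure"
    using integrable_tail_weight[OF that, of 0] by (simp add: complex_of_real_integrable_eq)
  have m_nonneg: "0 \<le> m N" for N
    unfolding m_def using tail_weight_nonneg by (intro integral_nonneg_AE) auto
  have m_conv: "(\<lambda>n. m (M n)) \<longlonglongrightarrow> m L"
    using tail_weight_integral_convergence[OF conv \<mu> \<nu>, of 0]
    by (simp add: m_def tendsto_of_real_iff)
  have w_pos: "0 < tail_weight x" if "x \<noteq> 0" for x :: 'a
    using tail_weight_lower_bound[of "norm x"] that by (metis less_le_trans order_refl zero_less_norm_iff)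
  have m_pos: "0 < m L"
  proof (rule ccontr)
    assume "\<not> 0 < m L"
    then have "m L = 0"
      using m_nonneg[of L] by linarith
    then have "AE x in L. tail_weight x = 0"
      unfolding m_def using tail_weight_nonneg int_w[OF L]
      by (subst (asm) integral_nonneg_eq_0_iff_AE) auto
    then have "AE x in L. x \<in> {0}"
      by eventually_elim (use w_pos in force)
    moreover have "space L = UNIV"
      using levy_measure_sets[OF L] by (metis sets_eq_imp_space_eq space_borel)
    ultimately have "emeasure L UNIV = emeasure L {0}"
      using levy_measure_sets[OF L] by (intro emeasure_eq_AE) auto
    then show False
      using nonzero L by (simp add: levy_measure_def)
  qed
  \<comment> \<open>For a vanishing Levy measure the normalisation is impossible; this case does not occur
    for large \<open>n\<close>, and any probability measure serves as a placeholder.\<close>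
  define P where "P N = (if 0 < m N then density N (\<lambda>x. ennreal (tail_weight x / m N)) else return borel 0)"
    for N :: "'a measure"
  have sets_P: "sets (P N) = sets borel" if "levy_measure N" for N
    using levy_measure_sets[OF that] by (simp add: P_def)
  have prob_P: "prob_space (P N)" if N: "levy_measure N" for N
  proof (cases "0 < m N")
    case True
    have [measurable_cong]: "sets N = sets borel"
      by (rule levy_measure_sets[OF N])
    have "emeasure (P N) (space (P N)) = (\<integral>\<^sup>+x. ennreal (tail_weight x / m N) \<partial>N)"
      using True by (simp add: P_def emeasure_density cong: nn_integral_cong)
    also have "\<dots> = ennreal (LINT x|N. tail_weight x / m N)"
      using int_w[OF N] True
      by (intro nn_integral_eq_integral AE_I2 divide_nonneg_nonneg tail_weight_nonneg) auto
    also have "\<dots> = 1"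
      using True by (simp add: m_def)
    finally show ?thesis
      by (rule prob_spaceI)
  next
    case False
    then show ?thesis
      by (simp add: P_def prob_space_return)
  qed
  have integral_P: "(LINT x|P N. g x) = (1 / m N) *\<^sub>R (LINT x|N. tail_weight x *\<^sub>R g x)"
    if N: "levy_measure N" "0 < m N" and g: "g \<in> borel_measurable borel"
    for N and g :: "'a \<Rightarrow> 'b::{banach, second_countable_topology}"
  proof -
    have [measurable_cong]: "sets N = sets borel"
      by (rule levy_measure_sets[OF N(1)])
    have [measurable]: "g \<in> borel_measurable N"
      by (rule borel_measurable_sets_eq_borel[OF levy_measure_sets[OF N(1)] g])
    have "(LINT x|P N. g x) = (LINT x|N. (tail_weight x / m N) *\<^sub>R g x)"
      using N(2) unfolding P_def
      by (simp, subst integral_density) (auto intro!: AE_I2 divide_nonneg_nonneg tail_weight_nonneg)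
    also have "\<dots> = (LINT x|N. (1 / m N) *\<^sub>R (tail_weight x *\<^sub>R g x))"
      by simp
    finally show ?thesis
      by (simp only: integral_scaleR_right)
  qed
  have ev_pos: "\<forall>\<^sub>F n in sequentially. 0 < m (M n)"
    using order_tendstoD(1)[OF m_conv m_pos] .
  have "conv_in_dist (\<lambda>n. P (M n)) (P L)"
  proof (rule conv_in_dist_char_fun)
    fix z
    have ch: "char_fun (P N) z = (1 / m N) *\<^sub>R (LINT x|N. iexp (z \<bullet> x) * complex_of_real (tail_weight x))"
      if "levy_measure N" "0 < m N" for N
      unfolding char_fun_def using that
      by (subst integral_P) (auto simp: scaleR_conv_of_real mult.commute)
    have "(\<lambda>n. (1 / m (M n)) *\<^sub>R (LINT x|M n. iexp (z \<bullet> x) * complex_of_real (tail_weight x)))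
        \<longlonglongrightarrow> (1 / m L) *\<^sub>R (LINT x|L. iexp (z \<bullet> x) * complex_of_real (tail_weight x))"
      using m_pos by (intro tendsto_intros m_conv tail_weight_integral_convergence[OF conv \<mu> \<nu>]) auto
    then show "(\<lambda>n. char_fun (P (M n)) z) \<longlonglongrightarrow> char_fun (P L) z"
      unfolding ch[OF L m_pos]
      by (rule Lim_transform_eventually)
         (use ev_pos in eventually_elim, simp add: ch[OF M])
  qed (use prob_P sets_P M L in auto)
  moreover obtain \<kappa> where \<kappa>: "0 < \<kappa>" "\<And>x::'a. r \<le> norm x \<Longrightarrow> \<kappa> \<le> tail_weight x"
    using tail_weight_lower_bound[OF \<open>0 < r\<close>] by blast
  define g where "g x = f x / tail_weight x" for x
  have g_cont: "continuous_on UNIV g"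
  proof -
    have "continuous_on {x. norm x < r} g"
      by (rule continuous_on_eq[OF continuous_on_const[of _ 0]]) (simp add: g_def f0)
    moreover have "continuous_on {x. x \<noteq> 0} g"
      unfolding g_def using w_pos
      by (intro continuous_intros continuous_on_tail_weight continuous_on_subset[OF f(1)]) force+
    moreover have "open {x::'a. norm x < r}" "open {x::'a. x \<noteq> 0}"
      by (intro open_Collect_less open_Collect_neq continuous_intros)+
    ultimately have "continuous_on ({x. norm x < r} \<union> {x. x \<noteq> 0}) g"
      by (intro continuous_on_open_Un)
    moreover have "{x::'a. norm x < r} \<union> {x. x \<noteq> 0} = UNIV"
      using \<open>0 < r\<close> by auto
    ultimately show ?thesis
      by simp
  qed
  obtain B where B: "\<And>x. \<bar>f x\<bar> \<le> B"
    using f(2) by (auto simp: bounded_iff)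
  have "\<bar>g x\<bar> \<le> B / \<kappa>" for x
  proof (cases "norm x < r")
    case True
    have "0 \<le> B"
      using B[of x] by linarith
    then show ?thesis
      using True f0 \<kappa>(1) by (simp add: g_def)
  next
    case False
    then have k: "\<kappa> \<le> tail_weight x"
      using \<kappa>(2) by simp
    then have "\<bar>g x\<bar> = \<bar>f x\<bar> / tail_weight x"
      using \<kappa>(1) by (simp add: g_def)
    also have "\<dots> \<le> B / \<kappa>"
      using B[of x] k \<kappa>(1) by (intro frac_le) auto
    finally show ?thesis .
  qed
  then have "bounded (range g)"
    by (auto simp: bounded_iff)
  ultimately have g_conv: "(\<lambda>n. LINT x|P (M n). g x) \<longlonglongrightarrow> (LINT x|P L. g x)"
    using g_cont unfolding conv_in_dist_def by blast
  have wg: "tail_weight x * g x = f x" for x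
    using f0[of x] \<open>0 < r\<close> w_pos[of x] by (cases "x = 0") (auto simp: g_def)
  have f_eq: "(LINT x|N. f x) = m N * (LINT x|P N. g x)" if "levy_measure N" "0 < m N" for N
    using that integral_P[OF that borel_measurable_continuous_onI[OF g_cont]] by (simp add: wg)
  have "(\<lambda>n. m (M n) * (LINT x|P (M n). g x)) \<longlonglongrightarrow> m L * (LINT x|P L. g x)"
    by (intro tendsto_intros m_conv g_conv)
  then show ?thesis
    unfolding f_eq[OF L m_pos]
    by (rule Lim_transform_eventually) (use ev_pos in eventually_elim, simp add: f_eq[OF M])
qed

section \<open>Polar representation of tempered stable and stable Levy measures\<close>

definition tempering :: "real \<Rightarrow> real \<Rightarrow> real measure" where
  "tempering p \<alpha> = density lborel (\<lambda>t. ennreal (t powr (- 1 - \<alpha>) * exp (- (t powr p))) * indicator {0<..} t)"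

definition power_measure :: "real \<Rightarrow> real measure" where
  "power_measure \<gamma> = density lborel (\<lambda>r. ennreal (r powr (- \<gamma> - 1)) * indicator {0<..} r)"

lemma sets_tempering [simp, measurable_cong]: "sets (tempering p \<alpha>) = sets borel"
  by (simp add: tempering_def)

lemma sets_power_measure [simp, measurable_cong]: "sets (power_measure \<gamma>) = sets borel"
  by (simp add: power_measure_def)

lemma nn_integral_tempering:
  "f \<in> borel_measurable borel \<Longrightarrow> (\<integral>\<^sup>+t. f t \<partial>tempering p \<alpha>)
    = (\<integral>\<^sup>+t\<in>{0<..}. f t * ennreal (t powr (- 1 - \<alpha>) * exp (- (t powr p))) \<partial>lborel)"
  unfolding tempering_def by (subst nn_integral_density) (auto simp: mult_ac)

lemma nn_integral_power_measure:
  "f \<in> borel_measurable borel \<Longrightarrow>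
    (\<integral>\<^sup>+r. f r \<partial>power_measure \<gamma>) = (\<integral>\<^sup>+r\<in>{0<..}. f r * ennreal (r powr (- \<gamma> - 1)) \<partial>lborel)"
  unfolding power_measure_def by (subst nn_integral_density) (auto simp: mult_ac)

lemma AE_tempering_pos: "AE t in tempering p \<alpha>. 0 < t"
  unfolding tempering_def by (subst AE_density) (auto simp: indicator_def)

lemma AE_power_measure_pos: "AE r in power_measure \<gamma>. 0 < r"
  unfolding power_measure_def by (subst AE_density) (auto simp: indicator_def)

lemma sigma_finite_tempering: "sigma_finite_measure (tempering p \<alpha>)"
  unfolding tempering_def
  by (subst sigma_finite_measure.sigma_finite_iff_density_finite[OF sigma_finite_lborel]) (auto simp: indicator_def)

lemma sigma_finite_power_measure: "sigma_finite_measure (power_measure \<gamma>)"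
  unfolding power_measure_def
  by (subst sigma_finite_measure.sigma_finite_iff_density_finite[OF sigma_finite_lborel]) (auto simp: indicator_def)

text \<open>Both families of Levy measures are images of a product measure under \<open>(x, t) \<mapsto> t x\<close>;
  this is their common integration formula.\<close>

lemma nn_integral_polar_measure:
  fixes N M :: "'a::euclidean_space measure"
  assumes N: "(\<lambda>x. x) \<in> N \<rightarrow>\<^sub>M borel" and \<Theta>: "sigma_finite_measure \<Theta>" "sets \<Theta> = sets (borel :: real measure)"
    and M: "sets M = sets borel"
    and em: "\<And>A. A \<in> sets borel \<Longrightarrow> emeasure M A = (\<integral>\<^sup>+x. \<integral>\<^sup>+t. indicator A (t *\<^sub>R x) \<partial>\<Theta> \<partial>N)"
    and f: "f \<in> borel_measurable borel"
  shows "(\<integral>\<^sup>+x. f x \<partial>M) = (\<integral>\<^sup>+x. \<integral>\<^sup>+t. f (t *\<^sub>R x) \<partial>\<Theta> \<partial>N)"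
proof -
  interpret sigma_finite_measure \<Theta> by fact
  have [measurable_cong]: "sets \<Theta> = sets borel" "sets M = sets borel" by fact+
  note N [measurable]
  have "f \<in> borel_measurable M"
    by (rule borel_measurable_sets_eq_borel[OF M f])
  then show ?thesis
  proof (induction rule: borel_measurable_induct)
    case (cong f g)
    have "space M = UNIV"
      using M by (metis sets_eq_imp_space_eq space_borel)
    then have "f = g"
      using cong by auto
    then show ?case
      using cong by simp
  next
    case (set A)
    then show ?case
      using em[of A] M by simp
  next
    case (mult u c)
    have [measurable]: "u \<in> borel_measurable borel"
      using mult measurable_cong_sets[OF M refl] by blast
    have "(\<integral>\<^sup>+x. c * u x \<partial>M) = c * (\<integral>\<^sup>+x. u x \<partial>M)"
      using mult by (intro nn_integral_cmult) auto
    also have "\<dots> = (\<integral>\<^sup>+x. c * (\<integral>\<^sup>+t. u (t *\<^sub>R x) \<partial>\<Theta>) \<partial>N)"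
      unfolding mult by (intro nn_integral_cmult[symmetric]) measurable
    finally show ?case
      by (simp add: nn_integral_cmult)
  next
    case (add u v)
    have [measurable]: "u \<in> borel_measurable borel" "v \<in> borel_measurable borel"
      using add measurable_cong_sets[OF M refl] by blast+
    have "(\<integral>\<^sup>+x. v x + u x \<partial>M) = (\<integral>\<^sup>+x. v x \<partial>M) + (\<integral>\<^sup>+x. u x \<partial>M)"
      using add by (intro nn_integral_add) auto
    also have "\<dots> = (\<integral>\<^sup>+x. (\<integral>\<^sup>+t. v (t *\<^sub>R x) \<partial>\<Theta>) + (\<integral>\<^sup>+t. u (t *\<^sub>R x) \<partial>\<Theta>) \<partial>N)"
      unfolding add by (intro nn_integral_add[symmetric]) measurable
    finally show ?case
      by (simp add: nn_integral_add)
  next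
    case (seq U)
    have U [measurable]: "U i \<in> borel_measurable borel" for i
      using seq(1) measurable_cong_sets[OF M refl] by blast
    have sup: "(SUP i. U i) x = (SUP i. U i x)" for x
      by (rule SUP_apply)
    have inc2: "incseq (\<lambda>i t. U i (t *\<^sub>R x))" for x
      using \<open>incseq U\<close> by (simp add: incseq_def le_fun_def)
    have "(\<integral>\<^sup>+x. (SUP i. U i) x \<partial>M) = (SUP i. \<integral>\<^sup>+x. U i x \<partial>M)"
      unfolding sup using seq by (intro nn_integral_monotone_convergence_SUP) auto
    also have "\<dots> = (SUP i. \<integral>\<^sup>+x. \<integral>\<^sup>+t. U i (t *\<^sub>R x) \<partial>\<Theta> \<partial>N)"
      using seq by simp
    also have "\<dots> = (\<integral>\<^sup>+x. (SUP i. \<integral>\<^sup>+t. U i (t *\<^sub>R x) \<partial>\<Theta>) \<partial>N)"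
      using inc2 by (intro nn_integral_monotone_convergence_SUP[symmetric])
        (auto simp: incseq_def le_fun_def intro!: nn_integral_mono)
    also have "\<dots> = (\<integral>\<^sup>+x. \<integral>\<^sup>+t. (SUP i. U i (t *\<^sub>R x)) \<partial>\<Theta> \<partial>N)"
      using inc2 by (intro nn_integral_cong nn_integral_monotone_convergence_SUP[symmetric]) auto
    finally show ?case
      by (simp only: sup)
  qed
qed

lemma sets_tempered_levy [simp, measurable_cong]: "sets (tempered_levy p \<alpha> R) = sets borel"
  unfolding tempered_levy_def by (rule sets.sets_measure_of_eq[of borel, unfolded space_borel])

lemma sets_stable_levy [simp, measurable_cong]: "sets (stable_levy \<gamma> \<sigma>) = sets borel"
  unfolding stable_levy_def by (rule sets.sets_measure_of_eq[of borel, unfolded space_borel])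

lemma nn_integral_tempered_levy:
  fixes R :: "'a::euclidean_space measure"
  assumes R: "sets R = sets borel" and f: "f \<in> borel_measurable borel"
  shows "(\<integral>\<^sup>+x. f x \<partial>tempered_levy p \<alpha> R) = (\<integral>\<^sup>+x. \<integral>\<^sup>+t. f (t *\<^sub>R x) \<partial>tempering p \<alpha> \<partial>R)"
proof (rule nn_integral_polar_measure[OF _ sigma_finite_tempering sets_tempering sets_tempered_levy _ f])
  show "(\<lambda>x. x) \<in> R \<rightarrow>\<^sub>M borel"
    by (rule measurable_ident_sets[OF R])
  fix A :: "'a set" assume A [measurable]: "A \<in> sets borel"
  have "(\<lambda>t. indicator A (t *\<^sub>R x) :: ennreal) \<in> borel_measurable borel" for x
    by measurable
  then show "emeasure (tempered_levy p \<alpha> R) A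
      = (\<integral>\<^sup>+x. \<integral>\<^sup>+t. indicator A (t *\<^sub>R x) \<partial>tempering p \<alpha> \<partial>R)"
    by (simp only: nn_integral_tempering emeasure_tempered_levy[OF R A])
qed

lemma finite_sphere_measureD:
  assumes "finite_sphere_measure \<sigma>"
  shows finite_sphere_measure_measurable_id: "(\<lambda>x. x) \<in> \<sigma> \<rightarrow>\<^sub>M borel"
    and space_finite_sphere_measure: "space \<sigma> = sphere 0 1"
    and finite_measure_finite_sphere_measure: "finite_measure \<sigma>"
    and sets_finite_sphere_measure: "D \<in> sets \<sigma> \<longleftrightarrow> D \<in> sets borel \<and> D \<subseteq> sphere 0 1"
proof -
  have sets: "sets \<sigma> = sets (restrict_space borel (sphere 0 1))"
    using assms by (simp add: finite_sphere_measure_def)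
  show "(\<lambda>x. x) \<in> \<sigma> \<rightarrow>\<^sub>M borel"
    using measurable_restrict_space1[OF measurable_ident, of borel "sphere 0 1"]
      measurable_cong_sets[OF sets refl, of borel] unfolding id_def by blast
  show "space \<sigma> = sphere 0 1"
    using sets_eq_imp_space_eq[OF sets] by (simp add: space_restrict_space)
  show "finite_measure \<sigma>"
    using assms by (simp add: finite_sphere_measure_def)
  show "D \<in> sets \<sigma> \<longleftrightarrow> D \<in> sets borel \<and> D \<subseteq> sphere 0 1"
    unfolding sets by (subst sets_restrict_space_iff) auto
qed

lemma nn_integral_stable_levy:
  fixes \<sigma> :: "'a::euclidean_space measure"
  assumes \<sigma>: "finite_sphere_measure \<sigma>" and f: "f \<in> borel_measurable borel"
  shows "(\<integral>\<^sup>+x. f x \<partial>stable_levy \<gamma> \<sigma>) = (\<integral>\<^sup>+u. \<integral>\<^sup>+r. f (r *\<^sub>R u) \<partial>power_measure \<gamma> \<partial>\<sigma>)"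
proof (rule nn_integral_polar_measure[OF _ sigma_finite_power_measure sets_power_measure sets_stable_levy _ f])
  show "(\<lambda>x. x) \<in> \<sigma> \<rightarrow>\<^sub>M borel"
    by (rule finite_sphere_measure_measurable_id[OF \<sigma>])
  fix A :: "'a set" assume A [measurable]: "A \<in> sets borel"
  have "(\<lambda>t. indicator A (t *\<^sub>R x) :: ennreal) \<in> borel_measurable borel" for x
    by measurable
  then show "emeasure (stable_levy \<gamma> \<sigma>) A
      = (\<integral>\<^sup>+x. \<integral>\<^sup>+t. indicator A (t *\<^sub>R x) \<partial>power_measure \<gamma> \<partial>\<sigma>)"
    by (simp only: nn_integral_power_measure emeasure_stable_levy[OF \<sigma> A])
qed

lemma borel_measurable_tempering_integral:
  assumes f [measurable]: "f \<in> borel_measurable borel"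
  shows "(\<lambda>x::'a::euclidean_space. \<integral>\<^sup>+t. f (t *\<^sub>R x) \<partial>tempering p \<alpha>) \<in> borel_measurable borel"
proof -
  interpret sigma_finite_measure "tempering p \<alpha>" by (rule sigma_finite_tempering)
  show ?thesis
    by measurable
qed

text \<open>The dilation acts on \<open>x\<close> and tempering on the scalar factor \<open>t\<close> of \<open>t x\<close>.\<close>

lemma tempered_levy_scaled:
  fixes R :: "'a::euclidean_space measure"
  assumes R: "sets R = sets borel"
  shows "tempered_levy p \<alpha> (scaled c a R) = scaled c a (tempered_levy p \<alpha> R)"
proof (rule measure_eqI)
  fix A assume "A \<in> sets (tempered_levy p \<alpha> (scaled c a R))"
  then have A [measurable]: "A \<in> sets borel"
    by simp
  define h where "h = (indicator A :: 'a \<Rightarrow> ennreal)"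
  have h [measurable]: "h \<in> borel_measurable borel"
    by (simp add: h_def)
  have ha: "(\<lambda>x. h (a *\<^sub>R x)) \<in> borel_measurable borel"
    by measurable
  have "emeasure (tempered_levy p \<alpha> (scaled c a R)) A = (\<integral>\<^sup>+x. h x \<partial>tempered_levy p \<alpha> (scaled c a R))"
    by (simp add: h_def)
  also have "\<dots> = (\<integral>\<^sup>+x. \<integral>\<^sup>+t. h (t *\<^sub>R x) \<partial>tempering p \<alpha> \<partial>scaled c a R)"
    by (rule nn_integral_tempered_levy[OF sets_scaled h])
  also have "\<dots> = c * (\<integral>\<^sup>+x. \<integral>\<^sup>+t. h (t *\<^sub>R a *\<^sub>R x) \<partial>tempering p \<alpha> \<partial>R)"
    by (rule nn_integral_scaled[OF R borel_measurable_tempering_integral[OF h]])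
  also have "\<dots> = c * (\<integral>\<^sup>+x. \<integral>\<^sup>+t. h (a *\<^sub>R t *\<^sub>R x) \<partial>tempering p \<alpha> \<partial>R)"
    by (simp add: mult.commute)
  also have "\<dots> = c * (\<integral>\<^sup>+x. h (a *\<^sub>R x) \<partial>tempered_levy p \<alpha> R)"
    by (simp only: nn_integral_tempered_levy[OF R ha])
  also have "\<dots> = (\<integral>\<^sup>+x. h x \<partial>scaled c a (tempered_levy p \<alpha> R))"
    by (simp only: nn_integral_scaled[OF sets_tempered_levy h])
  finally show "emeasure (tempered_levy p \<alpha> (scaled c a R)) A = emeasure (scaled c a (tempered_levy p \<alpha> R)) A"
    by (simp add: h_def)
qed simp

lemma nn_integral_powr_0_1:
  assumes "- 1 < s"
  shows "(\<integral>\<^sup>+t. ennreal (t powr s) * indicator {0<..1} t \<partial>lborel) < \<infinity>"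
proof -
  have "(\<integral>\<^sup>+t. ennreal (t powr s) * indicator {0<..1} t \<partial>lborel)
      \<le> (\<integral>\<^sup>+t. ennreal (indicator {0..1} t * t powr s) \<partial>lborel)"
    by (intro nn_integral_mono) (auto simp: indicator_def)
  also have "\<dots> = ennreal (1 powr (s + 1) / (s + 1))"
    by (rule nn_integral_has_integral_lebesgue[OF _ has_integral_powr_from_0[OF assms]]) auto
  finally show ?thesis
    by (rule le_less_trans) simp
qed

lemma nn_integral_powr_atLeast:
  assumes "s < - 1" "0 < a"
  shows "(\<integral>\<^sup>+t. ennreal (t powr s) * indicator {a<..} t \<partial>lborel) = ennreal (- (a powr (s + 1)) / (s + 1))"
proof -
  have "(\<integral>\<^sup>+t. ennreal (t powr s) * indicator {a<..} t \<partial>lborel)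
      = (\<integral>\<^sup>+t. ennreal (indicator {a..} t * t powr s) \<partial>lborel)"
    by (intro nn_integral_cong_AE eventually_mono[OF AE_lborel_singleton[of a]])
       (auto simp: indicator_def)
  also have "\<dots> = ennreal (- (a powr (s + 1)) / (s + 1))"
    by (rule nn_integral_has_integral_lebesgue[OF _ has_integral_powr_to_inf[OF assms]]) auto
  finally show ?thesis .
qed

lemma powr_exp_bound:
  fixes m p :: real
  assumes "0 < p"
  obtains C where "0 \<le> C" "\<And>t. 1 \<le> t \<Longrightarrow> t powr m * exp (- (t powr p)) \<le> C"
proof -
  obtain j :: nat where j: "m / p \<le> real j"
    using real_arch_simple by blast
  have "t powr m * exp (- (t powr p)) \<le> fact j" if "1 \<le> t" for t
  proof -
    have "m = p * (m / p)"
      using assms by simp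
    then have "t powr m = (t powr p) powr (m / p)"
      by (metis powr_powr)
    also have "\<dots> \<le> (t powr p) powr real j"
      using that assms j by (intro powr_mono ge_one_powr_ge_zero) auto
    also have "\<dots> = (t powr p) ^ j"
      using that by (intro powr_realpow) auto
    also have "\<dots> \<le> fact j * exp (t powr p)"
    proof -
      have "(t powr p) ^ j / fact j \<le> exp (t powr p)"
        using sum_le_suminf[OF sums_summable[OF exp_converges[of "t powr p"]], of "{j}"]
          sums_unique[OF exp_converges[of "t powr p"]]
        by (simp add: divide_inverse mult.commute)
      then show ?thesis
        by (simp add: field_simps)
    qed
    finally show ?thesis
      by (simp add: exp_minus field_simps)
  qed
  then show ?thesis
    by (intro that[of "fact j"]) auto
qed

text \<open>At \<open>0\<close> the integrand behaves like \<open>t powr (q - 1 - \<alpha>)\<close>, integrable as \<open>\<alpha> < q\<close>; at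
  infinity the exponential factor wins.\<close>

lemma tempering_moment_finite:
  assumes "0 < p" "\<alpha> < q"
  shows "(\<integral>\<^sup>+t. ennreal (t powr q) \<partial>tempering p \<alpha>) < \<infinity>"
proof -
  obtain C where C: "0 \<le> C" "\<And>t. 1 \<le> t \<Longrightarrow> t powr (q - \<alpha> + 1) * exp (- (t powr p)) \<le> C"
    using powr_exp_bound[OF \<open>0 < p\<close>] by blast
  have "(\<integral>\<^sup>+t. ennreal (t powr q) \<partial>tempering p \<alpha>)
      = (\<integral>\<^sup>+t\<in>{0<..}. ennreal (t powr q) * ennreal (t powr (- 1 - \<alpha>) * exp (- (t powr p))) \<partial>lborel)"
    by (rule nn_integral_tempering) measurable
  also have "\<dots> \<le> (\<integral>\<^sup>+t. ennreal (t powr (q - 1 - \<alpha>)) * indicator {0<..1} t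
      + ennreal C * (ennreal (t powr (- 2)) * indicator {1<..} t) \<partial>lborel)"
  proof (intro nn_integral_mono)
    fix t :: real
    show "ennreal (t powr q) * ennreal (t powr (- 1 - \<alpha>) * exp (- (t powr p))) * indicator {0<..} t
      \<le> ennreal (t powr (q - 1 - \<alpha>)) * indicator {0<..1} t
        + ennreal C * (ennreal (t powr (- 2)) * indicator {1<..} t)"
    proof (cases "0 < t")
      case True
      have eq: "t powr q * (t powr (- 1 - \<alpha>) * exp (- (t powr p))) = t powr (q - 1 - \<alpha>) * exp (- (t powr p))"
      proof -
        have "t powr q * t powr (- 1 - \<alpha>) = t powr (q - 1 - \<alpha>)"
          unfolding powr_add[symmetric] by (rule arg_cong[where f="\<lambda>s. t powr s"]) simp
        then show ?thesis
          by (simp only: mult.assoc[symmetric])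
      qed
      have "t powr (q - 1 - \<alpha>) * exp (- (t powr p)) \<le> t powr (q - 1 - \<alpha>)" if "t \<le> 1"
        by (rule mult_left_le) auto
      moreover have "t powr (q - 1 - \<alpha>) * exp (- (t powr p)) \<le> C * t powr (- 2)" if "1 < t"
      proof -
        have "t powr (q - 1 - \<alpha>) = t powr (q - \<alpha> + 1) * t powr (- 2)"
          unfolding powr_add[symmetric] by (rule arg_cong[where f="\<lambda>s. t powr s"]) simp
        then have "t powr (q - 1 - \<alpha>) * exp (- (t powr p))
            = (t powr (q - \<alpha> + 1) * exp (- (t powr p))) * t powr (- 2)"
          by simp
        also have "\<dots> \<le> C * t powr (- 2)"
          using C(2)[of t] that by (intro mult_right_mono) auto
        finally show ?thesis .
      qed
      ultimately show ?thesis
        using True \<open>0 \<le> C\<close>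
        by (cases "t \<le> 1") (simp_all add: indicator_def eq ennreal_leI flip: ennreal_mult)
    qed simp
  qed
  also have "\<dots> = (\<integral>\<^sup>+t. ennreal (t powr (q - 1 - \<alpha>)) * indicator {0<..1} t \<partial>lborel)
      + ennreal C * (\<integral>\<^sup>+t. ennreal (t powr (- 2)) * indicator {1<..} t \<partial>lborel)"
    by (subst nn_integral_add) (auto simp: nn_integral_cmult)
  also have "\<dots> < \<infinity>"
    using nn_integral_powr_0_1[of "q - 1 - \<alpha>"] nn_integral_powr_atLeast[of "- 2" 1] \<open>\<alpha> < q\<close>
    by (simp add: ennreal_mult_less_top)
  finally show ?thesis .
qed

lemma tempering_moment_pos:
  "0 < (\<integral>\<^sup>+t. ennreal (t powr q) \<partial>tempering p \<alpha>)"
proof (rule ccontr)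
  assume "\<not> ?thesis"
  then have "AE t in tempering p \<alpha>. ennreal (t powr q) = 0"
    by (subst nn_integral_0_iff_AE[symmetric]) auto
  then have "AE t in tempering p \<alpha>. False"
    using AE_tempering_pos[of p \<alpha>] by eventually_elim simp
  then have "AE t in lborel. 0 < ennreal (t powr (- 1 - \<alpha>) * exp (- (t powr p))) * indicator {0<..} t \<longrightarrow> False"
    unfolding tempering_def by (subst (asm) AE_density) auto
  then have "AE t in lborel. \<not> (t \<in> {0<..1::real})"
    by eventually_elim (auto simp: indicator_def)
  then have "emeasure lborel {t \<in> space lborel. t \<in> {0<..1::real}} = 0"
    by (rule emeasure_eq_0_AE)
  moreover have "{t \<in> space lborel. t \<in> {0<..1::real}} = {0<..1}"
    by auto
  ultimately show False
    by simp
qed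

lemma nn_integral_power_measure_scale:
  assumes f [measurable]: "f \<in> borel_measurable borel" and "0 < t"
  shows "(\<integral>\<^sup>+r. f (t * r) \<partial>power_measure \<gamma>) = ennreal (t powr \<gamma>) * (\<integral>\<^sup>+r. f r \<partial>power_measure \<gamma>)"
proof -
  have "(\<integral>\<^sup>+r. f r \<partial>power_measure \<gamma>) = (\<integral>\<^sup>+r\<in>{0<..}. f r * ennreal (r powr (- \<gamma> - 1)) \<partial>lborel)"
    by (rule nn_integral_power_measure[OF f])
  also have "\<dots> = ennreal \<bar>t\<bar> * (\<integral>\<^sup>+r. f (0 + t * r) * ennreal ((0 + t * r) powr (- \<gamma> - 1)) * indicator {0<..} (0 + t * r) \<partial>lborel)"
    using \<open>0 < t\<close> by (intro nn_integral_real_affine) auto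
  also have "\<dots> = (\<integral>\<^sup>+r. ennreal t * (f (t * r) * ennreal ((t * r) powr (- \<gamma> - 1)) * indicator {0<..} (t * r)) \<partial>lborel)"
    using \<open>0 < t\<close> by (subst nn_integral_cmult) auto
  also have "\<dots> = (\<integral>\<^sup>+r. ennreal (t powr (- \<gamma>)) * (f (t * r) * ennreal (r powr (- \<gamma> - 1)) * indicator {0<..} r) \<partial>lborel)"
  proof (intro nn_integral_cong)
    fix r :: real
    show "ennreal t * (f (t * r) * ennreal ((t * r) powr (- \<gamma> - 1)) * indicator {0<..} (t * r))
      = ennreal (t powr (- \<gamma>)) * (f (t * r) * ennreal (r powr (- \<gamma> - 1)) * indicator {0<..} r)"
    proof (cases "0 < r")
      case True
      have "t * (t * r) powr (- \<gamma> - 1) = t powr (- \<gamma>) * r powr (- \<gamma> - 1)"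
        using \<open>0 < t\<close> True by (simp add: powr_mult powr_diff)
      then have "ennreal t * ennreal ((t * r) powr (- \<gamma> - 1)) = ennreal (t powr (- \<gamma>)) * ennreal (r powr (- \<gamma> - 1))"
        using \<open>0 < t\<close> by (simp flip: ennreal_mult)
      then show ?thesis
        using \<open>0 < t\<close> True by (simp add: mult.left_commute[of _ "f (t * r)"])
    next
      case False
      then show ?thesis
        using \<open>0 < t\<close> by (simp add: zero_less_mult_iff indicator_def)
    qed
  qed
  also have "\<dots> = ennreal (t powr (- \<gamma>)) * (\<integral>\<^sup>+r. f (t * r) \<partial>power_measure \<gamma>)"
  proof -
    have "(\<lambda>r. f (t * r) * ennreal (r powr (- \<gamma> - 1)) * indicator {0<..} r) \<in> borel_measurable lborel"
      "(\<lambda>r. f (t * r)) \<in> borel_measurable borel"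
      by measurable
    then show ?thesis
      by (simp only: nn_integral_cmult nn_integral_power_measure)
  qed
  finally have "ennreal (t powr \<gamma>) * (\<integral>\<^sup>+r. f r \<partial>power_measure \<gamma>)
      = (ennreal (t powr \<gamma>) * ennreal (t powr (- \<gamma>))) * (\<integral>\<^sup>+r. f (t * r) \<partial>power_measure \<gamma>)"
    by (simp add: mult.assoc)
  also have "ennreal (t powr \<gamma>) * ennreal (t powr (- \<gamma>)) = 1"
    using \<open>0 < t\<close> by (simp add: powr_add[symmetric] flip: ennreal_mult)
  finally show ?thesis
    by simp
qed

definition tempering_moment :: "real \<Rightarrow> real \<Rightarrow> real \<Rightarrow> real" where
  "tempering_moment p \<alpha> q = enn2real (\<integral>\<^sup>+t. ennreal (t powr q) \<partial>tempering p \<alpha>)"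

lemma
  assumes "0 < p" "\<alpha> < q"
  shows ennreal_tempering_moment:
      "ennreal (tempering_moment p \<alpha> q) = (\<integral>\<^sup>+t. ennreal (t powr q) \<partial>tempering p \<alpha>)"
    and pos_tempering_moment: "0 < tempering_moment p \<alpha> q"
proof -
  show "ennreal (tempering_moment p \<alpha> q) = (\<integral>\<^sup>+t. ennreal (t powr q) \<partial>tempering p \<alpha>)"
    unfolding tempering_moment_def using tempering_moment_finite[OF assms] by simp
  then show "0 < tempering_moment p \<alpha> q"
    using tempering_moment_pos[where q=q and p=p and \<alpha>=\<alpha>] ennreal_less_zero_iff[of "tempering_moment p \<alpha> q"] by simp
qed

text \<open>Fubini and the homogeneity of \<open>power_measure \<gamma>\<close>: dilating by \<open>t\<close> multiplies it by
  \<open>t powr \<gamma>\<close>, so tempering multiplies a stable Levy measure by the \<open>\<gamma>\<close>-th moment of the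
  tempering density.\<close>

lemma tempered_levy_stable_levy:
  fixes \<sigma> :: "'a::euclidean_space measure"
  assumes \<sigma>: "finite_sphere_measure \<sigma>" and "0 < p" "\<alpha> < \<gamma>"
  shows "tempered_levy p \<alpha> (scaled (1 / tempering_moment p \<alpha> \<gamma>) 1 (stable_levy \<gamma> \<sigma>)) = stable_levy \<gamma> \<sigma>"
proof (rule measure_eqI)
  fix A assume "A \<in> sets (tempered_levy p \<alpha> (scaled (1 / tempering_moment p \<alpha> \<gamma>) 1 (stable_levy \<gamma> \<sigma>)))"
  then have A [measurable]: "A \<in> sets borel"
    by simp
  define h where "h = (indicator A :: 'a \<Rightarrow> ennreal)"
  have h [measurable]: "h \<in> borel_measurable borel"
    by (simp add: h_def)
  interpret sigma_finite_measure "power_measure \<gamma>" by (rule sigma_finite_power_measure)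
  interpret T: sigma_finite_measure "tempering p \<alpha>" by (rule sigma_finite_tempering)
  interpret P: pair_sigma_finite "tempering p \<alpha>" "power_measure \<gamma>" ..
  note id [measurable] = finite_sphere_measure_measurable_id[OF \<sigma>]
  let ?m = "tempering_moment p \<alpha> \<gamma>"
  have m: "0 < ?m" "ennreal ?m = (\<integral>\<^sup>+t. ennreal (t powr \<gamma>) \<partial>tempering p \<alpha>)"
    using pos_tempering_moment ennreal_tempering_moment assms by auto
  have "(\<integral>\<^sup>+x. \<integral>\<^sup>+t. h (t *\<^sub>R x) \<partial>tempering p \<alpha> \<partial>stable_levy \<gamma> \<sigma>)
      = (\<integral>\<^sup>+u. \<integral>\<^sup>+r. \<integral>\<^sup>+t. h (t *\<^sub>R r *\<^sub>R u) \<partial>tempering p \<alpha> \<partial>power_measure \<gamma> \<partial>\<sigma>)"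
    by (rule nn_integral_stable_levy[OF \<sigma> borel_measurable_tempering_integral[OF h]])
  also have "\<dots> = (\<integral>\<^sup>+u. \<integral>\<^sup>+t. \<integral>\<^sup>+r. h (t *\<^sub>R r *\<^sub>R u) \<partial>power_measure \<gamma> \<partial>tempering p \<alpha> \<partial>\<sigma>)"
  proof (intro nn_integral_cong)
    fix u
    have "(\<lambda>(t, r). h (t *\<^sub>R r *\<^sub>R u)) \<in> borel_measurable (tempering p \<alpha> \<Otimes>\<^sub>M power_measure \<gamma>)"
      by measurable
    from P.Fubini'[OF this]
    show "(\<integral>\<^sup>+r. \<integral>\<^sup>+t. h (t *\<^sub>R r *\<^sub>R u) \<partial>tempering p \<alpha> \<partial>power_measure \<gamma>)
        = (\<integral>\<^sup>+t. \<integral>\<^sup>+r. h (t *\<^sub>R r *\<^sub>R u) \<partial>power_measure \<gamma> \<partial>tempering p \<alpha>)"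
      by simp
  qed
  also have "\<dots> = (\<integral>\<^sup>+u. \<integral>\<^sup>+t. ennreal (t powr \<gamma>) * (\<integral>\<^sup>+r. h (r *\<^sub>R u) \<partial>power_measure \<gamma>) \<partial>tempering p \<alpha> \<partial>\<sigma>)"
  proof (rule nn_integral_cong, rule nn_integral_cong_AE)
    fix u
    show "AE t in tempering p \<alpha>. (\<integral>\<^sup>+r. h (t *\<^sub>R r *\<^sub>R u) \<partial>power_measure \<gamma>)
        = ennreal (t powr \<gamma>) * (\<integral>\<^sup>+r. h (r *\<^sub>R u) \<partial>power_measure \<gamma>)"
      using AE_tempering_pos
    proof eventually_elim
      case (elim t)
      show ?case
        using nn_integral_power_measure_scale[of "\<lambda>r. h (r *\<^sub>R u)" t \<gamma>] elim by simp
    qed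
  qed
  also have "\<dots> = (\<integral>\<^sup>+u. ennreal ?m * (\<integral>\<^sup>+r. h (r *\<^sub>R u) \<partial>power_measure \<gamma>) \<partial>\<sigma>)"
    by (simp add: nn_integral_multc m(2))
  also have "\<dots> = ennreal ?m * (\<integral>\<^sup>+u. \<integral>\<^sup>+r. h (r *\<^sub>R u) \<partial>power_measure \<gamma> \<partial>\<sigma>)"
    by (intro nn_integral_cmult) measurable
  also have "\<dots> = ennreal ?m * (\<integral>\<^sup>+x. h x \<partial>stable_levy \<gamma> \<sigma>)"
    by (simp only: nn_integral_stable_levy[OF \<sigma> h])
  finally have eq: "(\<integral>\<^sup>+x. \<integral>\<^sup>+t. h (t *\<^sub>R x) \<partial>tempering p \<alpha> \<partial>stable_levy \<gamma> \<sigma>)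
      = ennreal ?m * (\<integral>\<^sup>+x. h x \<partial>stable_levy \<gamma> \<sigma>)" .
  have "(\<integral>\<^sup>+x. h x \<partial>tempered_levy p \<alpha> (scaled (1 / ?m) 1 (stable_levy \<gamma> \<sigma>)))
      = (\<integral>\<^sup>+x. \<integral>\<^sup>+t. h (t *\<^sub>R x) \<partial>tempering p \<alpha> \<partial>scaled (1 / ?m) 1 (stable_levy \<gamma> \<sigma>))"
    by (rule nn_integral_tempered_levy[OF sets_scaled h])
  also have "\<dots> = ennreal (1 / ?m) * (\<integral>\<^sup>+x. \<integral>\<^sup>+t. h (t *\<^sub>R 1 *\<^sub>R x) \<partial>tempering p \<alpha> \<partial>stable_levy \<gamma> \<sigma>)"
    by (rule nn_integral_scaled[OF sets_stable_levy borel_measurable_tempering_integral[OF h]])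
  also have "\<dots> = (ennreal (1 / ?m) * ennreal ?m) * (\<integral>\<^sup>+x. h x \<partial>stable_levy \<gamma> \<sigma>)"
    by (simp add: eq mult.assoc)
  also have "ennreal (1 / ?m) * ennreal ?m = 1"
    using m(1) by (simp flip: ennreal_mult)
  finally show "emeasure (tempered_levy p \<alpha> (scaled (1 / ?m) 1 (stable_levy \<gamma> \<sigma>))) A = emeasure (stable_levy \<gamma> \<sigma>) A"
    by (simp add: h_def)
qed simp

definition ray_set :: "real \<Rightarrow> 'a::euclidean_space set \<Rightarrow> 'a set" where
  "ray_set r D = {x. r < norm x \<and> x /\<^sub>R norm x \<in> D}"

lemma ray_set_measurable [measurable]: "D \<in> sets borel \<Longrightarrow> ray_set r D \<in> sets borel"
proof -
  assume D: "D \<in> sets borel"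
  have "(\<lambda>x::'a. x /\<^sub>R norm x) \<in> borel_measurable borel"
    by measurable
  from measurable_sets[OF this D] have "(\<lambda>x::'a. x /\<^sub>R norm x) -` D \<in> sets borel"
    by simp
  moreover have "{x::'a. r < norm x} \<in> sets borel"
    by measurable
  moreover have "ray_set r D = {x. r < norm x} \<inter> (\<lambda>x. x /\<^sub>R norm x) -` D"
    by (auto simp: ray_set_def)
  ultimately show ?thesis
    by simp
qed

lemma ray_set_sphere: "0 \<le> r \<Longrightarrow> ray_set r (sphere 0 1) = {x. r < norm x}"
  by (auto simp: ray_set_def intro!: left_inverse)

lemma emeasure_stable_levy_ray_set:
  fixes \<sigma> :: "'a::euclidean_space measure"
  assumes \<sigma>: "finite_sphere_measure \<sigma>" and "0 < r" "0 < \<gamma>" and D: "D \<in> sets \<sigma>"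
  shows "emeasure (stable_levy \<gamma> \<sigma>) (ray_set r D) = ennreal (r powr (- \<gamma>) / \<gamma>) * emeasure \<sigma> D"
proof -
  have D' [measurable]: "D \<in> sets borel"
    using D sets_finite_sphere_measure[OF \<sigma>] by blast
  have "emeasure (stable_levy \<gamma> \<sigma>) (ray_set r D) = (\<integral>\<^sup>+x. indicator (ray_set r D) x \<partial>stable_levy \<gamma> \<sigma>)"
    by simp
  also have "\<dots> = (\<integral>\<^sup>+u. \<integral>\<^sup>+s. indicator (ray_set r D) (s *\<^sub>R u) \<partial>power_measure \<gamma> \<partial>\<sigma>)"
    by (rule nn_integral_stable_levy[OF \<sigma>]) measurable
  also have "\<dots> = (\<integral>\<^sup>+u. ennreal (r powr (- \<gamma>) / \<gamma>) * indicator D u \<partial>\<sigma>)"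
  proof (intro nn_integral_cong)
    fix u assume "u \<in> space \<sigma>"
    then have u: "norm u = 1"
      by (simp add: space_finite_sphere_measure[OF \<sigma>])
    have "(\<integral>\<^sup>+s. indicator (ray_set r D) (s *\<^sub>R u) \<partial>power_measure \<gamma>)
        = (\<integral>\<^sup>+s\<in>{0<..}. indicator (ray_set r D) (s *\<^sub>R u) * ennreal (s powr (- \<gamma> - 1)) \<partial>lborel)"
      by (rule nn_integral_power_measure) measurable
    also have "\<dots> = (\<integral>\<^sup>+s. (ennreal (s powr (- \<gamma> - 1)) * indicator {r<..} s) * indicator D u \<partial>lborel)"
      using u \<open>0 < r\<close> by (intro nn_integral_cong) (auto simp: ray_set_def indicator_def)
    also have "\<dots> = ennreal (- (r powr (- \<gamma> - 1 + 1)) / (- \<gamma> - 1 + 1)) * indicator D u"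
      using assms by (simp add: nn_integral_multc nn_integral_powr_atLeast)
    finally show "(\<integral>\<^sup>+s. indicator (ray_set r D) (s *\<^sub>R u) \<partial>power_measure \<gamma>)
        = ennreal (r powr (- \<gamma>) / \<gamma>) * indicator D u"
      by simp
  qed
  also have "\<dots> = ennreal (r powr (- \<gamma>) / \<gamma>) * emeasure \<sigma> D"
    using D by (simp add: nn_integral_cmult_indicator)
  finally show ?thesis .
qed

lemma levy_measure_stable_levy:
  fixes \<sigma> :: "'a::euclidean_space measure"
  assumes \<sigma>: "finite_sphere_measure \<sigma>" and "0 < \<gamma>" "\<gamma> < 2"
  shows "levy_measure (stable_levy \<gamma> \<sigma>)"
proof -
  interpret \<sigma>: finite_measure \<sigma>
    by (rule finite_measure_finite_sphere_measure[OF \<sigma>])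
  have "emeasure (stable_levy \<gamma> \<sigma>) {0} = (\<integral>\<^sup>+x. indicator {0} x \<partial>stable_levy \<gamma> \<sigma>)"
    by simp
  also have "\<dots> = (\<integral>\<^sup>+u. \<integral>\<^sup>+s. indicator {0} (s *\<^sub>R u) \<partial>power_measure \<gamma> \<partial>\<sigma>)"
    by (rule nn_integral_stable_levy[OF \<sigma>]) measurable
  also have "\<dots> = (\<integral>\<^sup>+u. \<integral>\<^sup>+s. 0 \<partial>power_measure \<gamma> \<partial>\<sigma>)"
  proof (rule nn_integral_cong, rule nn_integral_cong_AE)
    fix u assume "u \<in> space \<sigma>"
    then have u: "u \<noteq> 0"
      by (auto simp: space_finite_sphere_measure[OF \<sigma>])
    show "AE s in power_measure \<gamma>. indicator {0} (s *\<^sub>R u) = (0 :: ennreal)"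
      using AE_power_measure_pos by eventually_elim (use u in \<open>simp add: indicator_def\<close>)
  qed
  finally have "emeasure (stable_levy \<gamma> \<sigma>) {0} = 0"
    by simp
  moreover have "(\<integral>\<^sup>+x. ennreal (min ((norm x)\<^sup>2) 1) \<partial>stable_levy \<gamma> \<sigma>) < \<infinity>"
  proof -
    define I where "I = (\<integral>\<^sup>+s. ennreal (min (s\<^sup>2) 1) \<partial>power_measure \<gamma>)"
    have "I = (\<integral>\<^sup>+s\<in>{0<..}. ennreal (min (s\<^sup>2) 1) * ennreal (s powr (- \<gamma> - 1)) \<partial>lborel)"
      unfolding I_def by (rule nn_integral_power_measure) measurable
    also have "\<dots> \<le> (\<integral>\<^sup>+s. ennreal (s powr (1 - \<gamma>)) * indicator {0<..1} s
        + ennreal (s powr (- \<gamma> - 1)) * indicator {1<..} s \<partial>lborel)"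
    proof (intro nn_integral_mono)
      fix s :: real
      have "s\<^sup>2 * s powr (- \<gamma> - 1) = s powr (1 - \<gamma>)" if "0 < s"
        using that by (simp add: powr_add[symmetric] flip: powr_numeral)
      moreover have "min (s\<^sup>2) 1 * s powr (- \<gamma> - 1) \<le> s\<^sup>2 * s powr (- \<gamma> - 1)"
        "min (s\<^sup>2) 1 * s powr (- \<gamma> - 1) \<le> 1 * s powr (- \<gamma> - 1)"
        by (intro mult_right_mono; simp)+
      ultimately show "ennreal (min (s\<^sup>2) 1) * ennreal (s powr (- \<gamma> - 1)) * indicator {0<..} s
          \<le> ennreal (s powr (1 - \<gamma>)) * indicator {0<..1} s + ennreal (s powr (- \<gamma> - 1)) * indicator {1<..} s"
        by (cases "0 < s"; cases "s \<le> 1") (simp_all add: indicator_def ennreal_leI flip: ennreal_mult)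
    qed
    also have "\<dots> < \<infinity>"
      using nn_integral_powr_0_1[of "1 - \<gamma>"] nn_integral_powr_atLeast[of "- \<gamma> - 1" 1] assms
      by (subst nn_integral_add) auto
    finally have I: "I < \<infinity>" .
    have "(\<integral>\<^sup>+x. ennreal (min ((norm x)\<^sup>2) 1) \<partial>stable_levy \<gamma> \<sigma>)
        = (\<integral>\<^sup>+u. \<integral>\<^sup>+s. ennreal (min ((norm (s *\<^sub>R u))\<^sup>2) 1) \<partial>power_measure \<gamma> \<partial>\<sigma>)"
      by (rule nn_integral_stable_levy[OF \<sigma>]) measurable
    also have "\<dots> = (\<integral>\<^sup>+u. I \<partial>\<sigma>)"
      unfolding I_def
      by (intro nn_integral_cong) (simp add: space_finite_sphere_measure[OF \<sigma>])
    also have "\<dots> = I * emeasure \<sigma> (space \<sigma>)"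
      by simp
    finally show ?thesis
      using I by (auto simp: ennreal_mult_less_top \<sigma>.emeasure_eq_measure)
  qed
  ultimately show ?thesis
    by (simp add: levy_measure_def)
qed

text \<open>In each of the three cases the integrand in the definition of a Rosinski measure
  dominates \<open>min ((norm x)\<^sup>2) 1\<close>.\<close>

lemma levy_measure_rosinski_measure:
  assumes "rosinski_measure \<alpha> R" "\<alpha> < 2"
  shows "levy_measure R"
proof -
  have R: "sets R = sets borel" "emeasure R {0} = 0"
    using assms(1) by (auto simp: rosinski_measure_def)
  consider "0 < \<alpha>" | "\<alpha> = 0" | "\<alpha> < 0"
    by linarith
  then have "(\<integral>\<^sup>+x. ennreal (min ((norm x)\<^sup>2) 1) \<partial>R) < \<infinity>"
  proof cases
    case 1
    have "min ((norm x)\<^sup>2) 1 \<le> min ((norm x)\<^sup>2) (norm x powr \<alpha>)" for x :: 'a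
    proof (cases "norm x \<le> 1")
      case True
      have "norm x powr 2 \<le> norm x powr \<alpha>"
        using True assms(2) by (intro powr_mono') auto
      then have "(norm x)\<^sup>2 \<le> norm x powr \<alpha>"
        by (cases "x = 0") (auto simp: powr_numeral)
      then show ?thesis
        by simp
    next
      case False
      then have "1 \<le> norm x powr \<alpha>"
        using 1 by (intro ge_one_powr_ge_zero) auto
      then show ?thesis
        by simp
    qed
    then have "(\<integral>\<^sup>+x. ennreal (min ((norm x)\<^sup>2) 1) \<partial>R)
        \<le> (\<integral>\<^sup>+x. ennreal (min ((norm x)\<^sup>2) (norm x powr \<alpha>)) \<partial>R)"
      by (intro nn_integral_mono ennreal_leI)
    also have "\<dots> < \<infinity>"
      using assms 1 by (simp add: rosinski_measure_def)
    finally show ?thesis .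
  next
    case 2
    have "(\<integral>\<^sup>+x. ennreal (min ((norm x)\<^sup>2) 1) \<partial>R)
        \<le> (\<integral>\<^sup>+x. ennreal (min ((norm x)\<^sup>2) (1 + max 0 (ln (norm x)))) \<partial>R)"
      by (intro nn_integral_mono ennreal_leI min.mono) auto
    also have "\<dots> < \<infinity>"
      using assms 2 by (simp add: rosinski_measure_def)
    finally show ?thesis .
  next
    case 3
    then show ?thesis
      using assms by (simp add: rosinski_measure_def)
  qed
  then show ?thesis
    using R by (simp add: levy_measure_def)
qed

section \<open>Recovering Rosinski measures from tempered Levy measures\<close>

text \<open>The density of the radial part of \<open>tempered_levy p \<alpha> R\<close> at radius \<open>s\<close> is
  \<open>s powr (- 1 - \<alpha>)\<close> times the \<open>R\<close>-integral of this function.\<close>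

definition exp_weight :: "real \<Rightarrow> real \<Rightarrow> real \<Rightarrow> 'a::euclidean_space \<Rightarrow> real" where
  "exp_weight p \<alpha> s x = norm x powr \<alpha> * exp (- ((s / norm x) powr p))"

lemma exp_weight_nonneg: "0 \<le> exp_weight p \<alpha> s x"
  by (simp add: exp_weight_def)

lemma exp_weight_0 [simp]: "exp_weight p \<alpha> s 0 = 0"
  by (simp add: exp_weight_def)

lemma exp_weight_measurable [measurable]: "exp_weight p \<alpha> s \<in> borel_measurable borel"
  unfolding exp_weight_def by measurable

text \<open>Substitute \<open>s = t \<rho>\<close>; the exponential factor \<open>exp (- (s / \<rho>) powr p)\<close> is decreasing in
  \<open>s\<close> and can be replaced by its values at the ends of the support of \<open>\<theta>\<close>.\<close>

lemma nn_integral_tempering_bump: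
  fixes \<theta> :: "real \<Rightarrow> real" and \<alpha> :: real
  assumes \<theta> [measurable]: "\<theta> \<in> borel_measurable borel" and \<theta>_nonneg: "\<And>s. 0 \<le> \<theta> s"
    and supp: "\<And>s. s \<notin> {a..b} \<Longrightarrow> \<theta> s = 0" and "0 < a" "0 < p" "0 < \<rho>"
  defines "W \<equiv> \<integral>\<^sup>+s. ennreal (\<theta> s * s powr (- 1 - \<alpha>)) \<partial>lborel"
  shows "W * ennreal (\<rho> powr \<alpha> * exp (- ((b / \<rho>) powr p))) \<le> (\<integral>\<^sup>+t. ennreal (\<theta> (t * \<rho>)) \<partial>tempering p \<alpha>)"
    and "(\<integral>\<^sup>+t. ennreal (\<theta> (t * \<rho>)) \<partial>tempering p \<alpha>) \<le> W * ennreal (\<rho> powr \<alpha> * exp (- ((a / \<rho>) powr p)))"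
proof -
  define f where "f t = ennreal (\<theta> (t * \<rho>)) * ennreal (t powr (- 1 - \<alpha>) * exp (- (t powr p))) * indicator {0<..} t" for t
  have "(\<integral>\<^sup>+t. ennreal (\<theta> (t * \<rho>)) \<partial>tempering p \<alpha>) = (\<integral>\<^sup>+t. f t \<partial>lborel)"
    unfolding f_def by (rule nn_integral_tempering) measurable
  also have "\<dots> = ennreal \<bar>1 / \<rho>\<bar> * (\<integral>\<^sup>+s. f (0 + (1 / \<rho>) * s) \<partial>lborel)"
    using \<open>0 < \<rho>\<close> unfolding f_def by (intro nn_integral_real_affine) auto
  also have "\<dots> = (\<integral>\<^sup>+s. ennreal \<bar>1 / \<rho>\<bar> * f (0 + (1 / \<rho>) * s) \<partial>lborel)"
    unfolding f_def by (rule nn_integral_cmult[symmetric]) measurable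
  also have "\<dots> = (\<integral>\<^sup>+s. ennreal (\<theta> s * s powr (- 1 - \<alpha>)) * ennreal (\<rho> powr \<alpha> * exp (- ((s / \<rho>) powr p))) \<partial>lborel)"
  proof (intro nn_integral_cong)
    fix s :: real
    show "ennreal \<bar>1 / \<rho>\<bar> * f (0 + (1 / \<rho>) * s)
        = ennreal (\<theta> s * s powr (- 1 - \<alpha>)) * ennreal (\<rho> powr \<alpha> * exp (- ((s / \<rho>) powr p)))"
    proof (cases "0 < s")
      case True
      have "(1 / \<rho>) * (s / \<rho>) powr (- 1 - \<alpha>) = s powr (- 1 - \<alpha>) * \<rho> powr \<alpha>"
      proof -
        have "(s / \<rho>) powr (- 1 - \<alpha>) = s powr (- 1 - \<alpha>) * \<rho> powr (1 + \<alpha>)"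
        proof -
          have "\<rho> powr (- 1 - \<alpha>) = inverse (\<rho> powr (1 + \<alpha>))"
            using powr_minus[of \<rho> "1 + \<alpha>"] by simp
          moreover have "(s / \<rho>) powr (- 1 - \<alpha>) = s powr (- 1 - \<alpha>) / \<rho> powr (- 1 - \<alpha>)"
            by (intro powr_divide)
          ultimately show ?thesis
            by (simp only: divide_inverse inverse_inverse_eq)
        qed
        also have "\<rho> powr (1 + \<alpha>) = \<rho> * \<rho> powr \<alpha>"
          using \<open>0 < \<rho>\<close> by (simp add: powr_add)
        finally show ?thesis
          using \<open>0 < \<rho>\<close> by simp
      qed
      then have "\<theta> s * ((1 / \<rho>) * (s / \<rho>) powr (- 1 - \<alpha>)) * exp (- ((s / \<rho>) powr p))
          = (\<theta> s * s powr (- 1 - \<alpha>)) * (\<rho> powr \<alpha> * exp (- ((s / \<rho>) powr p)))"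
        by (simp only: mult_ac)
      then have "(1 / \<rho>) * (\<theta> s * ((s / \<rho>) powr (- 1 - \<alpha>) * exp (- ((s / \<rho>) powr p))))
          = (\<theta> s * s powr (- 1 - \<alpha>)) * (\<rho> powr \<alpha> * exp (- ((s / \<rho>) powr p)))"
        by (simp only: mult_ac)
      then show ?thesis
        using True \<open>0 < \<rho>\<close> \<theta>_nonneg[of s] by (simp add: f_def flip: ennreal_mult)
    next
      case False
      then have "\<theta> s = 0"
        using supp[of s] \<open>0 < a\<close> by auto
      then show ?thesis
        using False \<open>0 < \<rho>\<close> by (simp add: f_def)
    qed
  qed
  finally have eq: "(\<integral>\<^sup>+t. ennreal (\<theta> (t * \<rho>)) \<partial>tempering p \<alpha>)
    = (\<integral>\<^sup>+s. ennreal (\<theta> s * s powr (- 1 - \<alpha>)) * ennreal (\<rho> powr \<alpha> * exp (- ((s / \<rho>) powr p))) \<partial>lborel)" .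
  have mono: "exp (- ((b / \<rho>) powr p)) \<le> exp (- ((s / \<rho>) powr p))"
    "exp (- ((s / \<rho>) powr p)) \<le> exp (- ((a / \<rho>) powr p))" if "s \<in> {a..b}" for s
    using that \<open>0 < a\<close> \<open>0 < \<rho>\<close> \<open>0 < p\<close> by (auto intro!: powr_mono2 divide_right_mono)
  have W: "W * ennreal c = (\<integral>\<^sup>+s. ennreal (\<theta> s * s powr (- 1 - \<alpha>)) * ennreal c \<partial>lborel)" for c
    unfolding W_def by (rule nn_integral_multc[symmetric]) measurable
  show "W * ennreal (\<rho> powr \<alpha> * exp (- ((b / \<rho>) powr p))) \<le> (\<integral>\<^sup>+t. ennreal (\<theta> (t * \<rho>)) \<partial>tempering p \<alpha>)"
    unfolding eq W
  proof (intro nn_integral_mono)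
    fix s
    show "ennreal (\<theta> s * s powr (- 1 - \<alpha>)) * ennreal (\<rho> powr \<alpha> * exp (- ((b / \<rho>) powr p)))
      \<le> ennreal (\<theta> s * s powr (- 1 - \<alpha>)) * ennreal (\<rho> powr \<alpha> * exp (- ((s / \<rho>) powr p)))"
      using supp[of s] mono[of s] by (cases "s \<in> {a..b}") (auto intro!: mult_left_mono ennreal_leI)
  qed
  show "(\<integral>\<^sup>+t. ennreal (\<theta> (t * \<rho>)) \<partial>tempering p \<alpha>) \<le> W * ennreal (\<rho> powr \<alpha> * exp (- ((a / \<rho>) powr p)))"
    unfolding eq W
  proof (intro nn_integral_mono)
    fix s
    show "ennreal (\<theta> s * s powr (- 1 - \<alpha>)) * ennreal (\<rho> powr \<alpha> * exp (- ((s / \<rho>) powr p)))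
      \<le> ennreal (\<theta> s * s powr (- 1 - \<alpha>)) * ennreal (\<rho> powr \<alpha> * exp (- ((a / \<rho>) powr p)))"
      using supp[of s] mono[of s] by (cases "s \<in> {a..b}") (auto intro!: mult_left_mono ennreal_leI)
  qed
qed

lemma tempered_levy_bump_sandwich:
  fixes R :: "'a::euclidean_space measure" and \<theta> :: "real \<Rightarrow> real" and k :: "'a \<Rightarrow> real" and \<alpha> :: real
  assumes R: "sets R = sets borel"
    and \<theta> [measurable]: "\<theta> \<in> borel_measurable borel" and \<theta>_nonneg: "\<And>s. 0 \<le> \<theta> s"
    and supp: "\<And>s. s \<notin> {a..b} \<Longrightarrow> \<theta> s = 0" and "0 < a" "0 < p"
    and k [measurable]: "k \<in> borel_measurable borel" and k_nonneg: "\<And>u. 0 \<le> k u"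
  defines "W \<equiv> \<integral>\<^sup>+s. ennreal (\<theta> s * s powr (- 1 - \<alpha>)) \<partial>lborel"
  shows "W * (\<integral>\<^sup>+x. ennreal (k (x /\<^sub>R norm x) * exp_weight p \<alpha> b x) \<partial>R)
      \<le> (\<integral>\<^sup>+x. ennreal (\<theta> (norm x) * k (x /\<^sub>R norm x)) \<partial>tempered_levy p \<alpha> R)"
    and "(\<integral>\<^sup>+x. ennreal (\<theta> (norm x) * k (x /\<^sub>R norm x)) \<partial>tempered_levy p \<alpha> R)
      \<le> W * (\<integral>\<^sup>+x. ennreal (k (x /\<^sub>R norm x) * exp_weight p \<alpha> a x) \<partial>R)"
proof -
  have [measurable_cong]: "sets R = sets borel" by fact
  have f [measurable]: "(\<lambda>x. ennreal (\<theta> (norm x) * k (x /\<^sub>R norm x))) \<in> borel_measurable borel"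
    by measurable
  have "(\<integral>\<^sup>+x. ennreal (\<theta> (norm x) * k (x /\<^sub>R norm x)) \<partial>tempered_levy p \<alpha> R)
      = (\<integral>\<^sup>+x. \<integral>\<^sup>+t. ennreal (\<theta> (norm (t *\<^sub>R x)) * k ((t *\<^sub>R x) /\<^sub>R norm (t *\<^sub>R x))) \<partial>tempering p \<alpha> \<partial>R)"
    by (rule nn_integral_tempered_levy[OF R f])
  also have "\<dots> = (\<integral>\<^sup>+x. ennreal (k (x /\<^sub>R norm x)) * (\<integral>\<^sup>+t. ennreal (\<theta> (t * norm x)) \<partial>tempering p \<alpha>) \<partial>R)"
  proof (rule nn_integral_cong)
    fix x :: 'a
    have "(\<integral>\<^sup>+t. ennreal (\<theta> (norm (t *\<^sub>R x)) * k ((t *\<^sub>R x) /\<^sub>R norm (t *\<^sub>R x))) \<partial>tempering p \<alpha>)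
        = (\<integral>\<^sup>+t. ennreal (k (x /\<^sub>R norm x)) * ennreal (\<theta> (t * norm x)) \<partial>tempering p \<alpha>)"
    proof (rule nn_integral_cong_AE)
      show "AE t in tempering p \<alpha>. ennreal (\<theta> (norm (t *\<^sub>R x)) * k ((t *\<^sub>R x) /\<^sub>R norm (t *\<^sub>R x)))
          = ennreal (k (x /\<^sub>R norm x)) * ennreal (\<theta> (t * norm x))"
        using AE_tempering_pos
      proof eventually_elim
        case (elim t)
        then have "(t *\<^sub>R x) /\<^sub>R norm (t *\<^sub>R x) = x /\<^sub>R norm x" "norm (t *\<^sub>R x) = t * norm x"
          by (simp_all add: mult.assoc[symmetric])
        then show ?case
          using \<theta>_nonneg[of "t * norm x"] k_nonneg[of "x /\<^sub>R norm x"]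
          by (simp only: mult.commute[of "\<theta> _"] ennreal_mult)
      qed
    qed
    also have "\<dots> = ennreal (k (x /\<^sub>R norm x)) * (\<integral>\<^sup>+t. ennreal (\<theta> (t * norm x)) \<partial>tempering p \<alpha>)"
      by (rule nn_integral_cmult) measurable
    finally show "(\<integral>\<^sup>+t. ennreal (\<theta> (norm (t *\<^sub>R x)) * k ((t *\<^sub>R x) /\<^sub>R norm (t *\<^sub>R x))) \<partial>tempering p \<alpha>)
        = ennreal (k (x /\<^sub>R norm x)) * (\<integral>\<^sup>+t. ennreal (\<theta> (t * norm x)) \<partial>tempering p \<alpha>)" .
  qed
  finally have eq: "(\<integral>\<^sup>+x. ennreal (\<theta> (norm x) * k (x /\<^sub>R norm x)) \<partial>tempered_levy p \<alpha> R)
    = (\<integral>\<^sup>+x. ennreal (k (x /\<^sub>R norm x)) * (\<integral>\<^sup>+t. ennreal (\<theta> (t * norm x)) \<partial>tempering p \<alpha>) \<partial>R)" .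
  have W: "W * (\<integral>\<^sup>+x. ennreal (k (x /\<^sub>R norm x) * exp_weight p \<alpha> s x) \<partial>R)
      = (\<integral>\<^sup>+x. ennreal (k (x /\<^sub>R norm x)) * (W * ennreal (exp_weight p \<alpha> s x)) \<partial>R)" for s
  proof -
    have "W * (\<integral>\<^sup>+x. ennreal (k (x /\<^sub>R norm x) * exp_weight p \<alpha> s x) \<partial>R)
        = (\<integral>\<^sup>+x. W * ennreal (k (x /\<^sub>R norm x) * exp_weight p \<alpha> s x) \<partial>R)"
      by (rule nn_integral_cmult[symmetric]) measurable
    also have "\<dots> = (\<integral>\<^sup>+x. ennreal (k (x /\<^sub>R norm x)) * (W * ennreal (exp_weight p \<alpha> s x)) \<partial>R)"
      by (simp only: ennreal_mult[OF k_nonneg exp_weight_nonneg] mult.left_commute[of W])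
    finally show ?thesis .
  qed
  have \<theta>0: "\<theta> 0 = 0"
    using supp[of 0] \<open>0 < a\<close> by simp
  have bounds: "W * ennreal (exp_weight p \<alpha> b x) \<le> (\<integral>\<^sup>+t. ennreal (\<theta> (t * norm x)) \<partial>tempering p \<alpha>) \<and>
      (\<integral>\<^sup>+t. ennreal (\<theta> (t * norm x)) \<partial>tempering p \<alpha>) \<le> W * ennreal (exp_weight p \<alpha> a x)" for x :: 'a
  proof (cases "x = 0")
    case True
    then show ?thesis
      by (simp add: \<theta>0)
  next
    case False
    then have "0 < norm x"
      by simp
    then show ?thesis
      unfolding W_def exp_weight_def
      by (intro conjI nn_integral_tempering_bump[OF \<theta> \<theta>_nonneg supp \<open>0 < a\<close> \<open>0 < p\<close>])
  qed
  show "W * (\<integral>\<^sup>+x. ennreal (k (x /\<^sub>R norm x) * exp_weight p \<alpha> b x) \<partial>R)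
      \<le> (\<integral>\<^sup>+x. ennreal (\<theta> (norm x) * k (x /\<^sub>R norm x)) \<partial>tempered_levy p \<alpha> R)"
    unfolding eq W by (intro nn_integral_mono mult_left_mono conjunct1[OF bounds]) simp
  show "(\<integral>\<^sup>+x. ennreal (\<theta> (norm x) * k (x /\<^sub>R norm x)) \<partial>tempered_levy p \<alpha> R)
      \<le> W * (\<integral>\<^sup>+x. ennreal (k (x /\<^sub>R norm x) * exp_weight p \<alpha> a x) \<partial>R)"
    unfolding eq W by (intro nn_integral_mono mult_left_mono conjunct2[OF bounds]) simp
qed

text \<open>A limit theorem for functions that are observed only through averages: \<open>f\<close> lies
  between \<open>W j n b\<close> and \<open>W j n a\<close>, and likewise in the limit. Comparing two adjacent
  intervals with common end point \<open>s\<close> and using the continuity of \<open>J\<close> at \<open>s\<close> isolates the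
  value at \<open>s\<close>.\<close>

lemma tendsto_from_sandwich:
  fixes j :: "nat \<Rightarrow> real \<Rightarrow> real" and J :: "real \<Rightarrow> real"
  assumes cont: "isCont J s" and "0 < s"
    and sandwich: "\<And>a b. 0 < a \<Longrightarrow> a < b \<Longrightarrow> \<exists>W f F. 0 < W \<and> f \<longlonglongrightarrow> F
      \<and> (\<forall>n. W * j n b \<le> f n \<and> f n \<le> W * j n a) \<and> W * J b \<le> F \<and> F \<le> W * J a"
  shows "(\<lambda>n. j n s) \<longlonglongrightarrow> J s"
proof (rule order_tendstoI)
  fix y assume y: "y < J s"
  have "(J \<longlongrightarrow> J s) (at_right s)"
    using cont by (simp add: isCont_def filterlim_at_split)
  then have "\<forall>\<^sub>F b in at_right s. y < J b"
    using y by (rule order_tendstoD)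
  then obtain b where b: "s < b" "y < J b"
    unfolding eventually_at_right_field by (metis dense)
  obtain W f F where W: "0 < W" and f: "f \<longlonglongrightarrow> F" and s1: "\<And>n. f n \<le> W * j n s" and s2: "W * J b \<le> F"
    using sandwich[OF \<open>0 < s\<close> b(1)] by blast
  have "W * y < F"
    using b(2) W s2 mult_strict_left_mono[of y "J b" W] by linarith
  then have "\<forall>\<^sub>F n in sequentially. W * y < f n"
    by (rule order_tendstoD[OF f])
  then show "\<forall>\<^sub>F n in sequentially. y < j n s"
  proof eventually_elim
    case (elim n)
    then have "W * y < W * j n s"
      using s1[of n] by linarith
    then show ?case
      using W by simp
  qed
next
  fix y assume y: "J s < y"
  have "(J \<longlongrightarrow> J s) (at_left s)"
    using cont by (simp add: isCont_def filterlim_at_split)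
  then have "\<forall>\<^sub>F a in at_left s. J a < y"
    using y by (rule order_tendstoD)
  moreover have "\<forall>\<^sub>F a in at_left s. 0 < a"
    using \<open>0 < s\<close> by (intro order_tendstoD(1)[OF tendsto_ident_at])
  ultimately have "\<forall>\<^sub>F a in at_left s. 0 < a \<and> J a < y"
    by eventually_elim simp
  then obtain a where a: "0 < a" "a < s" "J a < y"
    unfolding eventually_at_left_field by (metis dense)
  obtain W f F where W: "0 < W" and f: "f \<longlonglongrightarrow> F" and s1: "\<And>n. W * j n s \<le> f n" and s2: "F \<le> W * J a"
    using sandwich[OF a(1,2)] by blast
  have "F < W * y"
    using a(3) W s2 mult_strict_left_mono[of "J a" y W] by linarith
  then have "\<forall>\<^sub>F n in sequentially. f n < W * y"
    by (rule order_tendstoD[OF f])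
  then show "\<forall>\<^sub>F n in sequentially. j n s < y"
  proof eventually_elim
    case (elim n)
    then have "W * j n s < W * y"
      using s1[of n] by linarith
    then show ?case
      using W by simp
  qed
qed

text \<open>The direction \<open>x / norm x\<close> is discontinuous only at the origin, where the radial
  factor vanishes.\<close>

lemma continuous_on_polar:
  fixes \<theta> :: "real \<Rightarrow> real" and k :: "'a::euclidean_space \<Rightarrow> real"
  assumes \<theta>: "continuous_on UNIV \<theta>" and k: "continuous_on UNIV k"
    and "0 < a" and \<theta>0: "\<And>s. s < a \<Longrightarrow> \<theta> s = 0"
  shows "continuous_on UNIV (\<lambda>x. \<theta> (norm x) * k (x /\<^sub>R norm x))"
proof -
  let ?f = "\<lambda>x. \<theta> (norm x) * k (x /\<^sub>R norm x)"
  have "continuous_on {x. norm x < a} ?f"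
    by (rule continuous_on_eq[OF continuous_on_const[of _ 0]]) (simp add: \<theta>0)
  moreover have "continuous_on {x. x \<noteq> 0} ?f"
    by (intro continuous_intros continuous_on_compose2[OF \<theta>] continuous_on_compose2[OF k]) auto
  moreover have "open {x::'a. norm x < a}" "open {x::'a. x \<noteq> 0}"
    by (intro open_Collect_less open_Collect_neq continuous_intros)+
  ultimately have "continuous_on ({x. norm x < a} \<union> {x. x \<noteq> 0}) ?f"
    by (intro continuous_on_open_Un)
  moreover have "{x::'a. norm x < a} \<union> {x. x \<noteq> 0} = UNIV"
    using \<open>0 < a\<close> by auto
  ultimately show ?thesis
    by simp
qed

lemma integrable_polar:
  fixes \<theta> :: "real \<Rightarrow> real" and k :: "'a::euclidean_space \<Rightarrow> real"
  assumes M: "levy_measure M" and \<theta>: "\<theta> \<in> borel_measurable borel" "\<And>s. \<bar>\<theta> s\<bar> \<le> A" "\<And>s. s < a \<Longrightarrow> \<theta> s = 0"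
    and k: "k \<in> borel_measurable borel" "\<And>u. \<bar>k u\<bar> \<le> B" and "0 < a"
  shows "integrable M (\<lambda>x. \<theta> (norm x) * k (x /\<^sub>R norm x))"
proof (rule integrable_levy_measure[OF M])
  show "(\<lambda>x. \<theta> (norm x) * k (x /\<^sub>R norm x)) \<in> borel_measurable borel"
    using \<theta>(1) k(1) by measurable
  have AB: "0 \<le> A" "0 \<le> B"
    using \<theta>(2)[of 0] k(2)[of 0] by linarith+
  fix x :: 'a
  have pos: "0 < min (a\<^sup>2) 1"
    using \<open>0 < a\<close> by simp
  show "norm (\<theta> (norm x) * k (x /\<^sub>R norm x)) \<le> (A * B / min (a\<^sup>2) 1) * min ((norm x)\<^sup>2) 1"
  proof (cases "norm x < a")
    case True
    then show ?thesis
      using \<theta>(3) AB pos by (simp add: zero_le_divide_iff zero_le_mult_iff)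
  next
    case False
    then have "min (a\<^sup>2) 1 \<le> min ((norm x)\<^sup>2) 1"
      using \<open>0 < a\<close> by (intro min.mono power_mono) auto
    then have "1 \<le> min ((norm x)\<^sup>2) 1 / min (a\<^sup>2) 1"
      using pos by simp
    then have "A * B * 1 \<le> A * B * (min ((norm x)\<^sup>2) 1 / min (a\<^sup>2) 1)"
      using AB by (intro mult_left_mono) auto
    moreover have "norm (\<theta> (norm x) * k (x /\<^sub>R norm x)) \<le> A * B"
      using \<theta>(2)[of "norm x"] k(2)[of "x /\<^sub>R norm x"] AB by (simp add: abs_mult mult_mono)
    ultimately show ?thesis
      by simp
  qed
qed

lemma nn_integral_stable_levy_scale:
  fixes \<sigma> :: "'a::euclidean_space measure"
  assumes \<sigma>: "finite_sphere_measure \<sigma>" and f [measurable]: "f \<in> borel_measurable borel" and "0 < t"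
  shows "(\<integral>\<^sup>+x. f (t *\<^sub>R x) \<partial>stable_levy \<gamma> \<sigma>) = ennreal (t powr \<gamma>) * (\<integral>\<^sup>+x. f x \<partial>stable_levy \<gamma> \<sigma>)"
proof -
  interpret sigma_finite_measure "power_measure \<gamma>" by (rule sigma_finite_power_measure)
  note id [measurable] = finite_sphere_measure_measurable_id[OF \<sigma>]
  have "(\<integral>\<^sup>+x. f (t *\<^sub>R x) \<partial>stable_levy \<gamma> \<sigma>) = (\<integral>\<^sup>+u. \<integral>\<^sup>+r. f (t *\<^sub>R r *\<^sub>R u) \<partial>power_measure \<gamma> \<partial>\<sigma>)"
    by (rule nn_integral_stable_levy[OF \<sigma>]) measurable
  also have "\<dots> = (\<integral>\<^sup>+u. ennreal (t powr \<gamma>) * (\<integral>\<^sup>+r. f (r *\<^sub>R u) \<partial>power_measure \<gamma>) \<partial>\<sigma>)"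
  proof (rule nn_integral_cong)
    fix u
    show "(\<integral>\<^sup>+r. f (t *\<^sub>R r *\<^sub>R u) \<partial>power_measure \<gamma>) = ennreal (t powr \<gamma>) * (\<integral>\<^sup>+r. f (r *\<^sub>R u) \<partial>power_measure \<gamma>)"
      using nn_integral_power_measure_scale[of "\<lambda>r. f (r *\<^sub>R u)" t \<gamma>] \<open>0 < t\<close> by simp
  qed
  also have "\<dots> = ennreal (t powr \<gamma>) * (\<integral>\<^sup>+u. \<integral>\<^sup>+r. f (r *\<^sub>R u) \<partial>power_measure \<gamma> \<partial>\<sigma>)"
    by (rule nn_integral_cmult) measurable
  finally show ?thesis
    by (simp only: nn_integral_stable_levy[OF \<sigma> f])
qed

definition bump :: "real \<Rightarrow> real \<Rightarrow> real \<Rightarrow> real" where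
  "bump a b s = max 0 (min (s - a) (b - s))"

lemma bump: "0 \<le> bump a b s" "s \<notin> {a..b} \<Longrightarrow> bump a b s = 0" "\<bar>bump a b s\<bar> \<le> \<bar>b - a\<bar>"
  "continuous_on S (bump a b)" "bump a b \<in> borel_measurable borel"
  unfolding bump_def by (auto intro!: continuous_intros borel_measurable_continuous_onI)

text \<open>The normalising constant of a bump is a positive real, so it can be cancelled in the
  sandwich.\<close>

lemma nn_integral_bump:
  assumes "0 < a" "a < b"
  shows "0 < (\<integral>\<^sup>+s. ennreal (bump a b s * s powr c) \<partial>lborel)"
    and "(\<integral>\<^sup>+s. ennreal (bump a b s * s powr c) \<partial>lborel) < \<infinity>"
proof -
  have [measurable]: "bump a b \<in> borel_measurable borel"
    by (rule bump)
  show "0 < (\<integral>\<^sup>+s. ennreal (bump a b s * s powr c) \<partial>lborel)"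
  proof (rule ccontr)
    assume "\<not> ?thesis"
    then have "AE s in lborel. ennreal (bump a b s * s powr c) = 0"
      by (subst nn_integral_0_iff_AE[symmetric]) auto
    then have "AE s in lborel. \<not> (s \<in> {a<..<b})"
      by eventually_elim (use assms in \<open>auto simp: bump_def mult_le_0_iff\<close>)
    then have "emeasure lborel {s \<in> space lborel. s \<in> {a<..<b}} = 0"
      by (rule emeasure_eq_0_AE)
    moreover have "{s \<in> space lborel. s \<in> {a<..<b}} = {a<..<b}"
      by auto
    ultimately show False
      using assms by simp
  qed
  have "continuous_on {a..b} (\<lambda>s. bump a b s * s powr c)"
    using assms by (intro continuous_intros bump) auto
  then have "bounded ((\<lambda>s. bump a b s * s powr c) ` {a..b})"
    by (intro compact_imp_bounded compact_continuous_image) auto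
  then obtain B where "\<forall>s\<in>{a..b}. \<bar>bump a b s * s powr c\<bar> \<le> B"
    unfolding bounded_iff by auto
  then have B: "\<bar>bump a b s * s powr c\<bar> \<le> B" if "s \<in> {a..b}" for s
    using that by blast
  have "(\<integral>\<^sup>+s. ennreal (bump a b s * s powr c) \<partial>lborel) \<le> (\<integral>\<^sup>+s. ennreal B * indicator {a..b} s \<partial>lborel)"
  proof (intro nn_integral_mono)
    fix s
    show "ennreal (bump a b s * s powr c) \<le> ennreal B * indicator {a..b} s"
      using B[of s] bump(2)[of s a b] by (cases "s \<in> {a..b}") (auto intro!: ennreal_leI)
  qed
  also have "\<dots> = ennreal B * ennreal (b - a)"
    using assms by (subst nn_integral_cmult_indicator) auto
  also have "\<dots> < \<infinity>"
    by (simp add: ennreal_mult_less_top)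
  finally show "(\<integral>\<^sup>+s. ennreal (bump a b s * s powr c) \<partial>lborel) < \<infinity>" .
qed

lemma integral_nonneg_le_iff_nn_integral:
  fixes f :: "'a \<Rightarrow> real" and g :: "'b \<Rightarrow> real"
  assumes "integrable M f" "integrable N g" "\<And>x. 0 \<le> f x" "\<And>x. 0 \<le> g x" "0 \<le> c"
  shows "ennreal c * (\<integral>\<^sup>+x. ennreal (f x) \<partial>M) \<le> (\<integral>\<^sup>+x. ennreal (g x) \<partial>N) \<longleftrightarrow> c * (LINT x|M. f x) \<le> (LINT x|N. g x)"
    and "(\<integral>\<^sup>+x. ennreal (g x) \<partial>N) \<le> ennreal c * (\<integral>\<^sup>+x. ennreal (f x) \<partial>M) \<longleftrightarrow> (LINT x|N. g x) \<le> c * (LINT x|M. f x)"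
proof -
  have "(\<integral>\<^sup>+x. ennreal (f x) \<partial>M) = ennreal (LINT x|M. f x)" "(\<integral>\<^sup>+x. ennreal (g x) \<partial>N) = ennreal (LINT x|N. g x)"
    using assms by (auto intro!: nn_integral_eq_integral)
  moreover have "0 \<le> (LINT x|M. f x)" "0 \<le> (LINT x|N. g x)"
    using assms by auto
  ultimately show "ennreal c * (\<integral>\<^sup>+x. ennreal (f x) \<partial>M) \<le> (\<integral>\<^sup>+x. ennreal (g x) \<partial>N) \<longleftrightarrow> c * (LINT x|M. f x) \<le> (LINT x|N. g x)"
    and "(\<integral>\<^sup>+x. ennreal (g x) \<partial>N) \<le> ennreal c * (\<integral>\<^sup>+x. ennreal (f x) \<partial>M) \<longleftrightarrow> (LINT x|N. g x) \<le> c * (LINT x|M. f x)"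
    using \<open>0 \<le> c\<close> by (simp_all flip: ennreal_mult)
qed

lemma bump_sandwich:
  fixes R :: "'a::euclidean_space measure" and k :: "'a \<Rightarrow> real" and \<alpha> :: real
  assumes R: "sets R = sets borel" and "0 < a" "0 < p"
    and k: "k \<in> borel_measurable borel" and k_nonneg: "\<And>u. 0 \<le> k u"
  defines "W \<equiv> \<lambda>b. \<integral>\<^sup>+s. ennreal (bump a b s * s powr (- 1 - \<alpha>)) \<partial>lborel"
  shows "W b * (\<integral>\<^sup>+x. ennreal (k (x /\<^sub>R norm x) * exp_weight p \<alpha> b x) \<partial>R)
      \<le> (\<integral>\<^sup>+x. ennreal (bump a b (norm x) * k (x /\<^sub>R norm x)) \<partial>tempered_levy p \<alpha> R)"
    and "(\<integral>\<^sup>+x. ennreal (bump a b (norm x) * k (x /\<^sub>R norm x)) \<partial>tempered_levy p \<alpha> R)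
      \<le> W b * (\<integral>\<^sup>+x. ennreal (k (x /\<^sub>R norm x) * exp_weight p \<alpha> a x) \<partial>R)"
  unfolding W_def
  by (rule tempered_levy_bump_sandwich(1)[where \<theta>="bump a b" and a=a and b=b, OF R],
      auto intro!: bump assms)
     (rule tempered_levy_bump_sandwich(2)[where \<theta>="bump a b" and a=a and b=b, OF R],
      auto intro!: bump assms)

text \<open>The lower half of the sandwich with a bump on \<open>[s / 2, s]\<close>.\<close>

lemma integrable_exp_weight:
  fixes R :: "'a::euclidean_space measure" and k :: "'a \<Rightarrow> real"
  assumes R: "sets R = sets borel" and T: "levy_measure (tempered_levy p \<alpha> R)" and "0 < p" "0 < s"
    and k [measurable]: "k \<in> borel_measurable borel" and k_nonneg: "\<And>u. 0 \<le> k u" and k_le: "\<And>u. k u \<le> B"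
  shows "integrable R (\<lambda>x. k (x /\<^sub>R norm x) * exp_weight p \<alpha> s x)"
proof (rule integrableI_nonneg)
  have [measurable_cong]: "sets R = sets borel" by fact
  show "(\<lambda>x. k (x /\<^sub>R norm x) * exp_weight p \<alpha> s x) \<in> borel_measurable R"
    by measurable
  show "AE x in R. 0 \<le> k (x /\<^sub>R norm x) * exp_weight p \<alpha> s x"
    by (intro AE_I2 mult_nonneg_nonneg k_nonneg exp_weight_nonneg)
  define W where "W = (\<integral>\<^sup>+t. ennreal (bump (s/2) s t * t powr (- 1 - \<alpha>)) \<partial>lborel)"
  have W: "0 < W"
    unfolding W_def using \<open>0 < s\<close> by (intro nn_integral_bump) auto
  have "W * (\<integral>\<^sup>+x. ennreal (k (x /\<^sub>R norm x) * exp_weight p \<alpha> s x) \<partial>R)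
      \<le> (\<integral>\<^sup>+x. ennreal (bump (s/2) s (norm x) * k (x /\<^sub>R norm x)) \<partial>tempered_levy p \<alpha> R)"
    unfolding W_def using bump_sandwich(1)[OF R _ \<open>0 < p\<close> k k_nonneg, of "s/2"] \<open>0 < s\<close> by simp
  also have "\<dots> < \<infinity>"
  proof -
    have "integrable (tempered_levy p \<alpha> R) (\<lambda>x. bump (s/2) s (norm x) * k (x /\<^sub>R norm x))"
    proof (rule integrable_polar[OF T bump(5) bump(3) _ k _, where a="s/2" and B=B])
      show "bump (s/2) s t = 0" if "t < s/2" for t
        using that by (intro bump) auto
      show "\<bar>k u\<bar> \<le> B" for u
        using k_nonneg[of u] k_le[of u] by simp
    qed (use \<open>0 < s\<close> in auto)
    then show ?thesis
      using bump(1) k_nonneg by (simp add: integrable_iff_bounded abs_mult)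
  qed
  finally show "(\<integral>\<^sup>+x. ennreal (k (x /\<^sub>R norm x) * exp_weight p \<alpha> s x) \<partial>R) < \<infinity>"
    using W by (auto simp: ennreal_mult_less_top ennreal_mult_eq_top_iff less_top[symmetric] top_unique)
qed

text \<open>The setting in which the Rosinski measures have to be recovered: tempered Levy
  measures that converge to a stable one when tested with continuous functions vanishing
  near the origin.\<close>

locale tempered_levy_convergence =
  fixes R :: "nat \<Rightarrow> 'a::euclidean_space measure" and \<sigma> :: "'a measure" and p \<alpha> \<gamma> :: real
  assumes levy_R: "\<And>n. levy_measure (R n)"
    and levy_T: "\<And>n. levy_measure (tempered_levy p \<alpha> (R n))"
    and \<sigma>: "finite_sphere_measure \<sigma>"
    and p: "0 < p" and \<gamma>: "0 < \<gamma>" "\<gamma> < 2" "\<alpha> < \<gamma>"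
    and conv: "\<And>f r. continuous_on UNIV f \<Longrightarrow> bounded (range f) \<Longrightarrow> 0 < r \<Longrightarrow> (\<And>x. norm x < r \<Longrightarrow> f x = 0)
      \<Longrightarrow> (\<lambda>n. LINT x|tempered_levy p \<alpha> (R n). f x) \<longlonglongrightarrow> (LINT x|stable_levy \<gamma> \<sigma>. f x :: real)"
begin

definition "R_lim = scaled (1 / tempering_moment p \<alpha> \<gamma>) 1 (stable_levy \<gamma> \<sigma>)"

lemma moment_pos: "0 < tempering_moment p \<alpha> \<gamma>"
  using pos_tempering_moment[OF p \<gamma>(3)] .

lemma levy_measure_limit: "levy_measure (stable_levy \<gamma> \<sigma>)"
  by (rule levy_measure_stable_levy[OF \<sigma> \<gamma>(1,2)])

lemma levy_measure_R_lim: "levy_measure R_lim"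
  unfolding R_lim_def by (rule levy_measure_scaled[OF levy_measure_limit]) simp

lemma tempered_levy_R_lim: "tempered_levy p \<alpha> R_lim = stable_levy \<gamma> \<sigma>"
  unfolding R_lim_def by (rule tempered_levy_stable_levy[OF \<sigma> p \<gamma>(3)])

text \<open>Homogeneity of the stable Levy measure; in particular the left-hand side is continuous
  in \<open>s\<close>.\<close>

lemma exp_weight_R_lim:
  fixes k :: "'a \<Rightarrow> real"
  assumes k [measurable]: "k \<in> borel_measurable borel" and k_nonneg: "\<And>u. 0 \<le> k u" and "0 < s"
  shows "(LINT x|R_lim. k (x /\<^sub>R norm x) * exp_weight p \<alpha> s x)
    = s powr (\<alpha> - \<gamma>) * (LINT x|R_lim. k (x /\<^sub>R norm x) * exp_weight p \<alpha> 1 x)"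
proof -
  let ?L = "stable_levy \<gamma> \<sigma>" and ?m = "ennreal (1 / tempering_moment p \<alpha> \<gamma>)"
  have nonneg: "0 \<le> k (x /\<^sub>R norm x) * exp_weight p \<alpha> s x" for x s
    by (intro mult_nonneg_nonneg k_nonneg exp_weight_nonneg)
  have [measurable_cong]: "sets R_lim = sets borel"
    by (simp add: R_lim_def)
  have scaled: "k (x /\<^sub>R norm x) * exp_weight p \<alpha> s x
      = s powr \<alpha> * (k (((1 / s) *\<^sub>R x) /\<^sub>R norm ((1 / s) *\<^sub>R x)) * exp_weight p \<alpha> 1 ((1 / s) *\<^sub>R x))" for x
  proof -
    have "s powr \<alpha> * (norm x / s) powr \<alpha> = norm x powr \<alpha>"
      using \<open>0 < s\<close> by (simp add: powr_divide)
    then have "exp_weight p \<alpha> s x = s powr \<alpha> * exp_weight p \<alpha> 1 ((1 / s) *\<^sub>R x)"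
      using \<open>0 < s\<close> unfolding exp_weight_def by (simp add: mult.assoc[symmetric])
    moreover have "((1 / s) *\<^sub>R x) /\<^sub>R norm ((1 / s) *\<^sub>R x) = x /\<^sub>R norm x"
      using \<open>0 < s\<close> by (simp add: divide_inverse)
    ultimately show ?thesis
      by (simp only: mult.left_commute)
  qed
  have "(\<integral>\<^sup>+x. ennreal (k (x /\<^sub>R norm x) * exp_weight p \<alpha> s x) \<partial>R_lim)
      = ?m * (\<integral>\<^sup>+x. ennreal (k (x /\<^sub>R norm x) * exp_weight p \<alpha> s x) \<partial>?L)"
    unfolding R_lim_def by (subst nn_integral_scaled) auto
  also have "(\<integral>\<^sup>+x. ennreal (k (x /\<^sub>R norm x) * exp_weight p \<alpha> s x) \<partial>?L)
      = (\<integral>\<^sup>+x. ennreal (s powr \<alpha>) *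
          ennreal (k (((1 / s) *\<^sub>R x) /\<^sub>R norm ((1 / s) *\<^sub>R x)) * exp_weight p \<alpha> 1 ((1 / s) *\<^sub>R x)) \<partial>?L)"
    by (subst scaled) (simp only: ennreal_mult[OF powr_ge_zero nonneg])
  also have "\<dots> = ennreal (s powr \<alpha>) * (\<integral>\<^sup>+x.
          ennreal (k (((1 / s) *\<^sub>R x) /\<^sub>R norm ((1 / s) *\<^sub>R x)) * exp_weight p \<alpha> 1 ((1 / s) *\<^sub>R x)) \<partial>?L)"
    by (rule nn_integral_cmult) measurable
  also have "(\<integral>\<^sup>+x. ennreal (k (((1 / s) *\<^sub>R x) /\<^sub>R norm ((1 / s) *\<^sub>R x)) * exp_weight p \<alpha> 1 ((1 / s) *\<^sub>R x)) \<partial>?L)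
      = ennreal ((1 / s) powr \<gamma>) * (\<integral>\<^sup>+x. ennreal (k (x /\<^sub>R norm x) * exp_weight p \<alpha> 1 x) \<partial>?L)"
    using \<open>0 < s\<close> by (intro nn_integral_stable_levy_scale[OF \<sigma>]) auto
  also have "?m * (ennreal (s powr \<alpha>) * (ennreal ((1 / s) powr \<gamma>)
        * (\<integral>\<^sup>+x. ennreal (k (x /\<^sub>R norm x) * exp_weight p \<alpha> 1 x) \<partial>?L)))
      = ennreal (s powr \<alpha>) * ennreal ((1 / s) powr \<gamma>)
        * (?m * (\<integral>\<^sup>+x. ennreal (k (x /\<^sub>R norm x) * exp_weight p \<alpha> 1 x) \<partial>?L))"
    by (simp only: mult_ac)
  also have "?m * (\<integral>\<^sup>+x. ennreal (k (x /\<^sub>R norm x) * exp_weight p \<alpha> 1 x) \<partial>?L)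
      = (\<integral>\<^sup>+x. ennreal (k (x /\<^sub>R norm x) * exp_weight p \<alpha> 1 x) \<partial>R_lim)"
    unfolding R_lim_def by (subst nn_integral_scaled) auto
  also have "ennreal (s powr \<alpha>) * ennreal ((1 / s) powr \<gamma>) = ennreal (s powr (\<alpha> - \<gamma>))"
    using \<open>0 < s\<close> by (simp add: powr_divide powr_diff flip: ennreal_mult)
  finally have "(\<integral>\<^sup>+x. ennreal (k (x /\<^sub>R norm x) * exp_weight p \<alpha> s x) \<partial>R_lim)
      = ennreal (s powr (\<alpha> - \<gamma>)) * (\<integral>\<^sup>+x. ennreal (k (x /\<^sub>R norm x) * exp_weight p \<alpha> 1 x) \<partial>R_lim)" .
  then show ?thesis
    using nonneg by (simp add: integral_eq_nn_integral enn2real_mult)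
qed

text \<open>Apply the sandwich to \<open>R n\<close> and to \<open>R_lim\<close> with the same bumps; the middle terms
  converge by assumption, as \<open>tempered_levy p \<alpha> R_lim\<close> is the stable Levy measure.\<close>

lemma exp_weight_convergence:
  fixes k :: "'a \<Rightarrow> real"
  assumes k: "continuous_on UNIV k" and k_nonneg: "\<And>u. 0 \<le> k u" and k_le: "\<And>u. k u \<le> B" and "0 < s"
  shows "(\<lambda>n. LINT x|R n. k (x /\<^sub>R norm x) * exp_weight p \<alpha> s x)
    \<longlonglongrightarrow> (LINT x|R_lim. k (x /\<^sub>R norm x) * exp_weight p \<alpha> s x)"
proof -
  have k_meas: "k \<in> borel_measurable borel"
    using k by (rule borel_measurable_continuous_onI)
  define J where "J s = s powr (\<alpha> - \<gamma>) * (LINT x|R_lim. k (x /\<^sub>R norm x) * exp_weight p \<alpha> 1 x)" for s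
  have J: "(LINT x|R_lim. k (x /\<^sub>R norm x) * exp_weight p \<alpha> s x) = J s" if "0 < s" for s
    unfolding J_def by (rule exp_weight_R_lim[OF k_meas k_nonneg that])
  have "(\<lambda>n. LINT x|R n. k (x /\<^sub>R norm x) * exp_weight p \<alpha> s x) \<longlonglongrightarrow> J s"
  proof (rule tendsto_from_sandwich[OF _ \<open>0 < s\<close>])
    show "isCont J s"
      unfolding J_def using \<open>0 < s\<close> by (intro continuous_intros) auto
    fix a b :: real assume ab: "0 < a" "a < b"
    define W where "W = (\<integral>\<^sup>+t. ennreal (bump a b t * t powr (- 1 - \<alpha>)) \<partial>lborel)"
    have W: "0 < W" "W < \<infinity>"
      unfolding W_def using ab by (intro nn_integral_bump; simp)+
    then have W': "ennreal (enn2real W) = W" "0 < enn2real W"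
      by (simp_all add: enn2real_positive_iff)
    let ?f = "\<lambda>x. bump a b (norm x) * k (x /\<^sub>R norm x)"
    have supp: "bump a b t = 0" if "t < a" for t
      using that by (intro bump) auto
    have abs_k: "\<bar>k u\<bar> \<le> B" for u
      using k_nonneg[of u] k_le[of u] by simp
    have f_nonneg: "0 \<le> ?f x" for x
      by (intro mult_nonneg_nonneg bump k_nonneg)
    have real_sandwich: "enn2real W * (LINT x|S. k (x /\<^sub>R norm x) * exp_weight p \<alpha> b x) \<le> (LINT x|tempered_levy p \<alpha> S. ?f x)
      \<and> (LINT x|tempered_levy p \<alpha> S. ?f x) \<le> enn2real W * (LINT x|S. k (x /\<^sub>R norm x) * exp_weight p \<alpha> a x)"
      if S: "levy_measure S" "levy_measure (tempered_levy p \<alpha> S)" for S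
    proof -
      note sand = bump_sandwich[OF levy_measure_sets[OF S(1)] ab(1) p k_meas k_nonneg,
        where \<alpha>=\<alpha> and b=b, folded W_def]
      have int_f: "integrable (tempered_levy p \<alpha> S) ?f"
        by (rule integrable_polar[OF S(2) bump(5) bump(3) supp k_meas abs_k ab(1)])
      have int_e: "integrable S (\<lambda>x. k (x /\<^sub>R norm x) * exp_weight p \<alpha> t x)" if "0 < t" for t
        by (rule integrable_exp_weight[OF levy_measure_sets[OF S(1)] S(2) p that k_meas k_nonneg k_le])
      have e_nonneg: "0 \<le> k (x /\<^sub>R norm x) * exp_weight p \<alpha> t x" for x t
        by (intro mult_nonneg_nonneg exp_weight_nonneg k_nonneg)
      show ?thesis
        using sand integral_nonneg_le_iff_nn_integral(1)[OF int_e int_f e_nonneg f_nonneg, of b "enn2real W"]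
          integral_nonneg_le_iff_nn_integral(2)[OF int_e int_f e_nonneg f_nonneg, of a "enn2real W"] ab W'
        by simp
    qed
    have "(\<lambda>n. LINT x|tempered_levy p \<alpha> (R n). ?f x) \<longlonglongrightarrow> (LINT x|stable_levy \<gamma> \<sigma>. ?f x)"
    proof (rule conv[OF _ _ ab(1)])
      show "continuous_on UNIV ?f"
        by (rule continuous_on_polar[OF bump(4) k ab(1) supp])
      have "\<bar>?f x\<bar> \<le> \<bar>b - a\<bar> * B" for x
        using bump(3)[of a b "norm x"] abs_k[of "x /\<^sub>R norm x"] by (simp add: abs_mult mult_mono)
      then show "bounded (range ?f)"
        by (auto simp: bounded_iff)
      show "?f x = 0" if "norm x < a" for x
        using supp[OF that] by simp
    qed
    moreover have "enn2real W * J b \<le> (LINT x|stable_levy \<gamma> \<sigma>. ?f x)" "(LINT x|stable_levy \<gamma> \<sigma>. ?f x) \<le> enn2real W * J a"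
      using real_sandwich[OF levy_measure_R_lim] levy_measure_limit tempered_levy_R_lim J[of a] J[of b] ab by simp_all
    ultimately show "\<exists>W f F. 0 < W \<and> f \<longlonglongrightarrow> F
      \<and> (\<forall>n. W * (LINT x|R n. k (x /\<^sub>R norm x) * exp_weight p \<alpha> b x) \<le> f n
          \<and> f n \<le> W * (LINT x|R n. k (x /\<^sub>R norm x) * exp_weight p \<alpha> a x)) \<and> W * J b \<le> F \<and> F \<le> W * J a"
      using real_sandwich[OF levy_R levy_T] W'(2)
      by (intro exI[of _ "enn2real W"] exI[of _ "\<lambda>n. LINT x|tempered_levy p \<alpha> (R n). ?f x"]
          exI[of _ "LINT x|stable_levy \<gamma> \<sigma>. ?f x"]) auto
  qed
  then show ?thesis
    by (simp add: J[OF \<open>0 < s\<close>])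
qed

text \<open>At \<open>x = 0\<close> the default value is \<open>1\<close>; this is harmless since Levy measures do not
  charge the origin.\<close>

definition radial_coordinate :: "'a \<Rightarrow> real" where
  "radial_coordinate x = exp (- ((1 / norm x) powr p))"

lemma radial_coordinate_range: "0 < radial_coordinate x" "radial_coordinate x \<le> 1"
  by (simp_all add: radial_coordinate_def)

lemma radial_coordinate_measurable [measurable]: "radial_coordinate \<in> borel_measurable borel"
  unfolding radial_coordinate_def by measurable

text \<open>The weights with \<open>s powr p = j + 1\<close> are the monomials in the radial coordinate
  relative to the weight at \<open>s = 1\<close>.\<close>

lemma exp_weight_times_power:
  "exp_weight p \<alpha> 1 x * radial_coordinate x ^ j = exp_weight p \<alpha> (real (Suc j) powr (1 / p)) x"
proof -
  have "(real (Suc j) powr (1 / p) / norm x) powr p = real (Suc j) * (1 / norm x) powr p"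
    using p by (simp add: powr_divide powr_powr)
  then have "exp (- ((real (Suc j) powr (1 / p) / norm x) powr p))
      = exp (- ((1 / norm x) powr p)) * exp (real j * - ((1 / norm x) powr p))"
    by (simp add: ring_distribs flip: exp_add)
  then show ?thesis
    unfolding exp_weight_def radial_coordinate_def by (simp add: exp_of_nat_mult[symmetric])
qed

text \<open>Linear combinations give polynomials in the radial coordinate, and the Weierstrass
  theorem gives continuous functions: the total weight \<open>\<integral> w\<close> stays bounded, so a uniform
  approximation is good for all \<open>n\<close> simultaneously.\<close>

lemma weighted_convergence:
  fixes k :: "'a \<Rightarrow> real" and F :: "real \<Rightarrow> real"
  assumes k: "continuous_on UNIV k" and k_nonneg: "\<And>u. 0 \<le> k u" and k_le: "\<And>u. k u \<le> B"
    and F: "continuous_on {0..1} F" and F_meas [measurable]: "F \<in> borel_measurable borel"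
  shows "(\<lambda>n. LINT x|R n. k (x /\<^sub>R norm x) * exp_weight p \<alpha> 1 x * F (radial_coordinate x))
    \<longlonglongrightarrow> (LINT x|R_lim. k (x /\<^sub>R norm x) * exp_weight p \<alpha> 1 x * F (radial_coordinate x))"
proof -
  have k_meas [measurable]: "k \<in> borel_measurable borel"
    using k by (rule borel_measurable_continuous_onI)
  define w where "w x = k (x /\<^sub>R norm x) * exp_weight p \<alpha> 1 x" for x
  have w_nonneg: "0 \<le> w x" for x
    unfolding w_def by (intro mult_nonneg_nonneg exp_weight_nonneg k_nonneg)
  have w_meas [measurable]: "w \<in> borel_measurable borel"
    unfolding w_def by measurable
  define good where "good S \<longleftrightarrow> levy_measure S \<and> levy_measure (tempered_levy p \<alpha> S)" for S :: "'a measure"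
  have good: "good (R n)" "good R_lim" for n
    using levy_R levy_T levy_measure_R_lim levy_measure_limit tempered_levy_R_lim by (auto simp: good_def)
  have int_pow: "integrable S (\<lambda>x. w x * radial_coordinate x ^ j)" if "good S" for S j
  proof -
    have "integrable S (\<lambda>x. k (x /\<^sub>R norm x) * exp_weight p \<alpha> (real (Suc j) powr (1 / p)) x)"
      using that levy_measure_sets
      by (intro integrable_exp_weight[OF _ _ p _ k_meas k_nonneg k_le]) (auto simp: good_def)
    then show ?thesis
      unfolding w_def by (simp only: mult.assoc exp_weight_times_power)
  qed
  have int_w: "integrable S w" if "good S" for S
    using int_pow[OF that, of 0] by simp
  have int_bd: "integrable S (\<lambda>x. w x * G (radial_coordinate x))"
    if S: "good S" and G: "G \<in> borel_measurable borel" "\<And>t. t \<in> {0..1} \<Longrightarrow> \<bar>G t\<bar> \<le> C" for S and G :: "real \<Rightarrow> real" and C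
  proof (rule Bochner_Integration.integrable_bound)
    have [measurable_cong]: "sets S = sets borel"
      using S levy_measure_sets by (auto simp: good_def)
    show "integrable S (\<lambda>x. C * w x)"
      using int_w[OF S] by simp
    show "(\<lambda>x. w x * G (radial_coordinate x)) \<in> borel_measurable S"
      using G(1) by measurable
    have "0 \<le> C"
      using G(2)[of 0] by simp
    have "\<bar>G (radial_coordinate x)\<bar> \<le> C" for x
      using radial_coordinate_range[of x] by (intro G(2)) auto
    then have "\<bar>G (radial_coordinate x)\<bar> * \<bar>w x\<bar> \<le> C * \<bar>w x\<bar>" for x
      by (intro mult_right_mono) auto
    then show "AE x in S. norm (w x * G (radial_coordinate x)) \<le> norm (C * w x)"
      using \<open>0 \<le> C\<close> by (intro AE_I2) (simp add: abs_mult mult.commute[of "\<bar>w _\<bar>"])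
  qed
  have pow_conv: "(\<lambda>n. LINT x|R n. w x * radial_coordinate x ^ j) \<longlonglongrightarrow> (LINT x|R_lim. w x * radial_coordinate x ^ j)" for j
    unfolding w_def mult.assoc exp_weight_times_power
    by (rule exp_weight_convergence[OF k k_nonneg k_le]) simp
  have w_conv: "(\<lambda>n. LINT x|R n. w x) \<longlonglongrightarrow> (LINT x|R_lim. w x)"
    using pow_conv[of 0] by simp
  have "convergent (\<lambda>n. LINT x|R n. w x)"
    using w_conv by (rule convergentI)
  then have "Bseq (\<lambda>n. LINT x|R n. w x)"
    by (rule convergent_imp_Bseq)
  then obtain C0 where C0: "\<And>n. \<bar>LINT x|R n. w x\<bar> \<le> C0"
    by (auto simp: Bseq_def)
  define C where "C = max C0 \<bar>LINT x|R_lim. w x\<bar> + 1"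
  have C: "0 < C" "(LINT x|R n. w x) \<le> C" "(LINT x|R_lim. w x) \<le> C" for n
    using C0[of n] unfolding C_def by linarith+
  have "(\<lambda>n. LINT x|R n. w x * F (radial_coordinate x)) \<longlonglongrightarrow> (LINT x|R_lim. w x * F (radial_coordinate x))"
  proof (rule LIMSEQ_I)
    fix \<epsilon> :: real assume "0 < \<epsilon>"
    define \<eta> where "\<eta> = \<epsilon> / (3 * C)"
    have \<eta>: "0 < \<eta>" "\<eta> * C = \<epsilon> / 3"
      using \<open>0 < \<epsilon>\<close> C(1) by (simp_all add: \<eta>_def)
    obtain P where P: "real_polynomial_function P" "\<And>t. t \<in> {0..1} \<Longrightarrow> \<bar>F t - P t\<bar> < \<eta>"
      using Stone_Weierstrass_real_polynomial_function[OF _ F \<eta>(1)] by auto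
    obtain a :: "nat \<Rightarrow> real" and N where P_sum: "P = (\<lambda>t. \<Sum>i\<le>N. a i * t ^ i)"
      using real_polynomial_function_imp_sum[OF P(1)] by blast
    have P_meas: "P \<in> borel_measurable borel"
      unfolding P_sum by measurable
    have F_bd: "\<exists>D. \<forall>t\<in>{0..1}. \<bar>F t\<bar> \<le> D"
      using compact_imp_bounded[OF compact_continuous_image[OF F compact_Icc]] by (auto simp: bounded_iff)
    then obtain D where D: "\<And>t. t \<in> {0..1} \<Longrightarrow> \<bar>F t\<bar> \<le> D"
      by blast
    have P_bd: "\<bar>P t\<bar> \<le> D + \<eta>" if "t \<in> {0..1}" for t
      using P(2)[OF that] D[OF that] by linarith
    have int_F: "integrable S (\<lambda>x. w x * F (radial_coordinate x))" and int_P: "integrable S (\<lambda>x. w x * P (radial_coordinate x))" if "good S" for S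
      using int_bd[OF that F_meas D] int_bd[OF that P_meas P_bd] by auto
    have approx: "\<bar>(LINT x|S. w x * F (radial_coordinate x)) - (LINT x|S. w x * P (radial_coordinate x))\<bar> \<le> \<epsilon> / 3"
      if S: "good S" "(LINT x|S. w x) \<le> C" for S
    proof -
      have "\<bar>(LINT x|S. w x * F (radial_coordinate x)) - (LINT x|S. w x * P (radial_coordinate x))\<bar> = \<bar>LINT x|S. w x * F (radial_coordinate x) - w x * P (radial_coordinate x)\<bar>"
        using int_F[OF S(1)] int_P[OF S(1)] by simp
      also have "\<dots> \<le> (LINT x|S. \<bar>w x * F (radial_coordinate x) - w x * P (radial_coordinate x)\<bar>)"
        by (rule integral_abs_bound)
      also have "\<dots> \<le> (LINT x|S. \<eta> * w x)"
      proof (rule integral_mono)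
        fix x
        have "\<bar>F (radial_coordinate x) - P (radial_coordinate x)\<bar> \<le> \<eta>"
          using P(2)[of "radial_coordinate x"] radial_coordinate_range[of x] by simp
        then have "w x * \<bar>F (radial_coordinate x) - P (radial_coordinate x)\<bar> \<le> w x * \<eta>"
          using w_nonneg by (rule mult_left_mono)
        moreover have "\<bar>w x * F (radial_coordinate x) - w x * P (radial_coordinate x)\<bar> = w x * \<bar>F (radial_coordinate x) - P (radial_coordinate x)\<bar>"
          using w_nonneg[of x] by (simp add: abs_mult flip: right_diff_distrib)
        ultimately show "\<bar>w x * F (radial_coordinate x) - w x * P (radial_coordinate x)\<bar> \<le> \<eta> * w x"
          by (simp only: mult.commute)
      qed (use int_F[OF S(1)] int_P[OF S(1)] int_w[OF S(1)] in auto)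
      also have "\<dots> = \<eta> * (LINT x|S. w x)"
        by simp
      also have "\<dots> \<le> \<eta> * C"
        using S(2) \<eta>(1) by (intro mult_left_mono) auto
      finally show ?thesis
        using \<eta>(2) by simp
    qed
    have "(LINT x|S. w x * P (radial_coordinate x)) = (\<Sum>i\<le>N. a i * (LINT x|S. w x * radial_coordinate x ^ i))" if "good S" for S
    proof -
      have "(LINT x|S. w x * P (radial_coordinate x)) = (LINT x|S. (\<Sum>i\<le>N. a i * (w x * radial_coordinate x ^ i)))"
        unfolding P_sum by (simp add: sum_distrib_left mult.left_commute)
      also have "\<dots> = (\<Sum>i\<le>N. LINT x|S. a i * (w x * radial_coordinate x ^ i))"
        using int_pow[OF that] by (intro Bochner_Integration.integral_sum integrable_mult_right)
      finally show ?thesis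
        by simp
    qed
    then have "(\<lambda>n. LINT x|R n. w x * P (radial_coordinate x)) \<longlonglongrightarrow> (LINT x|R_lim. w x * P (radial_coordinate x))"
      using good by (simp only:) (intro tendsto_intros pow_conv)
    from tendstoD[OF this, of "\<epsilon> / 3"]
    have "\<forall>\<^sub>F n in sequentially. \<bar>(LINT x|R n. w x * P (radial_coordinate x)) - (LINT x|R_lim. w x * P (radial_coordinate x))\<bar> < \<epsilon> / 3"
      using \<open>0 < \<epsilon>\<close> unfolding dist_real_def by simp
    then have "\<forall>\<^sub>F n in sequentially. norm ((LINT x|R n. w x * F (radial_coordinate x)) - (LINT x|R_lim. w x * F (radial_coordinate x))) < \<epsilon>"
    proof eventually_elim
      case (elim n)
      then show ?case
        using approx[OF good(1) C(2), of n] approx[OF good(2) C(3)] unfolding real_norm_def by linarith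
    qed
    then show "\<exists>N. \<forall>n\<ge>N. norm ((LINT x|R n. w x * F (radial_coordinate x)) - (LINT x|R_lim. w x * F (radial_coordinate x))) < \<epsilon>"
      by (simp add: eventually_sequentially)
  qed
  then show ?thesis
    by (simp add: w_def)
qed

end

definition ramp :: "real \<Rightarrow> real \<Rightarrow> real \<Rightarrow> real" where
  "ramp a b s = max 0 (min 1 ((s - a) / (b - a)))"

lemma ramp_nonneg: "0 \<le> ramp a b s" and ramp_le_1: "ramp a b s \<le> 1"
  by (simp_all add: ramp_def)

lemma ramp_eq_0: "a < b \<Longrightarrow> s \<le> a \<Longrightarrow> ramp a b s = 0"
  by (simp add: ramp_def divide_nonpos_pos)

lemma ramp_eq_1: "a < b \<Longrightarrow> b \<le> s \<Longrightarrow> ramp a b s = 1"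
  by (simp add: ramp_def)

lemma continuous_on_ramp: "a < b \<Longrightarrow> continuous_on S (ramp a b)"
  unfolding ramp_def by (intro continuous_intros) auto

lemma ramp_measurable [measurable]: "ramp a b \<in> borel_measurable borel"
  unfolding ramp_def by measurable

lemma measure_scaled_stable_levy_ray_set:
  fixes \<sigma> :: "'a::euclidean_space measure"
  assumes \<sigma>: "finite_sphere_measure \<sigma>" and "0 < r" "0 < \<gamma>" and D: "D \<in> sets \<sigma>" and "0 < c"
  shows "measure (scaled c 1 (stable_levy \<gamma> \<sigma>)) (ray_set r D) = c * (r powr (- \<gamma>) / \<gamma>) * measure \<sigma> D"
proof -
  interpret \<sigma>: finite_measure \<sigma>
    by (rule finite_measure_finite_sphere_measure[OF \<sigma>])
  have "D \<in> sets borel"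
    using D sets_finite_sphere_measure[OF \<sigma>] by blast
  then have "emeasure (scaled c 1 (stable_levy \<gamma> \<sigma>)) (ray_set r D)
      = ennreal c * (ennreal (r powr (- \<gamma>) / \<gamma>) * ennreal (measure \<sigma> D))"
    using emeasure_stable_levy_ray_set[OF \<sigma> assms(2-4)]
    by (subst emeasure_scaled) (auto simp: \<sigma>.emeasure_eq_measure)
  also have "\<dots> = ennreal (c * (r powr (- \<gamma>) / \<gamma>) * measure \<sigma> D)"
    using \<open>0 < c\<close> \<open>0 < \<gamma>\<close> by (simp add: mult.assoc flip: ennreal_mult)
  finally show ?thesis
    unfolding measure_def[of "scaled _ _ _"] using \<open>0 < c\<close> \<open>0 < \<gamma>\<close> by (simp add: enn2real_ennreal)
qed

context tempered_levy_convergence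
begin

text \<open>Divide \<open>\<theta>\<close> by the weight at \<open>s = 1\<close> and express the quotient through the radial
  coordinate. Since \<open>\<theta>\<close> vanishes off \<open>[a, b]\<close>, the resulting function vanishes near both
  ends of the unit interval and is continuous.\<close>

lemma compact_radial_convergence:
  fixes k :: "'a \<Rightarrow> real" and \<theta> :: "real \<Rightarrow> real"
  assumes k: "continuous_on UNIV k" and k_nonneg: "\<And>u. 0 \<le> k u" and k_le: "\<And>u. k u \<le> B"
    and \<theta>: "continuous_on UNIV \<theta>" and supp: "\<And>s. s \<notin> {a..b} \<Longrightarrow> \<theta> s = 0" and ab: "0 < a" "a < b"
  shows "(\<lambda>n. LINT x|R n. \<theta> (norm x) * k (x /\<^sub>R norm x)) \<longlonglongrightarrow> (LINT x|R_lim. \<theta> (norm x) * k (x /\<^sub>R norm x))"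
proof -
  \<comment> \<open>The inverse of the radial coordinate as a function of the radius.\<close>
  define \<rho> where "\<rho> t = (- ln t) powr (- (1 / p))" for t
  define F where "F t = (if 0 < t \<and> t < 1 then \<theta> (\<rho> t) * \<rho> t powr (- \<alpha>) / t else 0)" for t
  define e where "e s = exp (- ((1 / s) powr p))" for s
  have e_range: "0 < e s" "s > 0 \<Longrightarrow> e s < 1" for s
    by (simp_all add: e_def)
  have \<rho>_e: "((1 / s) powr p) powr (- (1 / p)) = s" if "0 < s" for s
    using that p by (simp add: powr_powr powr_minus_divide)
  have low: "F t = 0" if "t < e a" for t
  proof (cases "0 < t \<and> t < 1")
    case True
    have "ln t < ln (e a)"
      using True that by simp
    then have "(1 / a) powr p < - ln t"
      by (simp add: e_def)
    then have "(- ln t) powr (- (1 / p)) < ((1 / a) powr p) powr (- (1 / p))"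
      using p ab by (intro powr_less_mono2_neg) auto
    then have "\<rho> t < a"
      using ab by (simp add: \<rho>_e \<rho>_def)
    then show ?thesis
      using supp[of "\<rho> t"] by (simp add: F_def)
  qed (auto simp: F_def)
  have high: "F t = 0" if "e b < t" for t
  proof (cases "0 < t \<and> t < 1")
    case True
    have "ln (e b) < ln t"
      using True that e_range(1)[of b] by simp
    then have "- ln t < (1 / b) powr p"
      by (simp add: e_def)
    moreover have "0 < - ln t"
      using True by simp
    ultimately have "((1 / b) powr p) powr (- (1 / p)) < (- ln t) powr (- (1 / p))"
      using p by (intro powr_less_mono2_neg) auto
    then have "b < \<rho> t"
      using ab by (simp add: \<rho>_e \<rho>_def)
    then show ?thesis
      using supp[of "\<rho> t"] by (simp add: F_def)
  qed (auto simp: F_def)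
  have F_cont: "continuous_on UNIV F"
  proof -
    have "continuous_on {0<..<1} (\<lambda>t. \<theta> (\<rho> t) * \<rho> t powr (- \<alpha>) / t)"
      unfolding \<rho>_def
      by (intro continuous_intros continuous_on_compose2[OF \<theta>]) (auto simp: powr_eq_0_iff)
    then have mid: "continuous_on {0<..<1} F"
      by (rule continuous_on_eq) (simp add: F_def)
    have "continuous_on {..<e a} F" "continuous_on {e b<..} F"
      using continuous_on_eq[OF continuous_on_const[of "{..<e a}" 0], of F]
        continuous_on_eq[OF continuous_on_const[of "{e b<..}" 0], of F] low high by auto
    with mid have "continuous_on (({..<e a} \<union> {e b<..}) \<union> {0<..<1}) F"
      by (intro continuous_on_open_Un open_Un) auto
    moreover have "({..<e a} \<union> {e b<..}) \<union> {0<..<1} = UNIV"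
    proof -
      have "t \<in> ({..<e a} \<union> {e b<..}) \<union> {0<..<1}" for t
        using e_range(1)[of a] e_range(2)[of b] ab by (cases "t \<le> 0"; cases "1 \<le> t") auto
      then show ?thesis
        by blast
    qed
    ultimately show ?thesis
      by simp
  qed
  have eq: "k (x /\<^sub>R norm x) * exp_weight p \<alpha> 1 x * F (radial_coordinate x) = \<theta> (norm x) * k (x /\<^sub>R norm x)" for x
  proof (cases "x = 0")
    case True
    then show ?thesis
      using supp[of 0] ab by simp
  next
    case False
    have v_e: "radial_coordinate x = e (norm x)"
      by (simp add: radial_coordinate_def e_def)
    have "\<rho> (radial_coordinate x) = norm x"
      using \<rho>_e[of "norm x"] False by (simp add: \<rho>_def radial_coordinate_def)
    then have "F (radial_coordinate x) = \<theta> (norm x) * norm x powr (- \<alpha>) / radial_coordinate x"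
      using e_range[of "norm x"] False by (simp add: F_def v_e)
    moreover have "exp_weight p \<alpha> 1 x = norm x powr \<alpha> * radial_coordinate x"
      by (simp add: exp_weight_def radial_coordinate_def)
    moreover have "norm x powr \<alpha> * norm x powr (- \<alpha>) = 1"
      using False by (simp add: powr_add[symmetric])
    ultimately have "exp_weight p \<alpha> 1 x * F (radial_coordinate x) = \<theta> (norm x)"
      using radial_coordinate_range(1)[of x] by simp
    then show ?thesis
      by (simp only: mult.assoc) (simp only: mult.commute)
  qed
  show ?thesis
    using weighted_convergence[OF k k_nonneg k_le continuous_on_subset[OF F_cont subset_UNIV]
        borel_measurable_continuous_onI[OF F_cont]]
    by (simp only: eq)
qed

lemma measure_R_lim_ray_set:
  assumes "0 < r" "D \<in> sets \<sigma>"
  shows "measure R_lim (ray_set r D) = r powr (- \<gamma>) * measure \<sigma> D / (\<gamma> * tempering_moment p \<alpha> \<gamma>)"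
  unfolding R_lim_def using measure_scaled_stable_levy_ray_set[OF \<sigma> assms(1) \<gamma>(1) assms(2)] moment_pos
  by (simp add: mult.commute)

lemma sphere_sets: "sphere 0 1 \<in> sets \<sigma>"
  using sets.top[of \<sigma>] by (simp add: space_finite_sphere_measure[OF \<sigma>])

definition "tail_factor r = r powr (- \<gamma>) / (\<gamma> * tempering_moment p \<alpha> \<gamma>)" for r

lemma tail_factor_pos: "0 < r \<Longrightarrow> 0 < tail_factor r"
  unfolding tail_factor_def using moment_pos \<gamma> by simp

lemma isCont_tail_factor: "0 < r \<Longrightarrow> isCont tail_factor r"
  unfolding tail_factor_def using moment_pos \<gamma> by (intro continuous_intros) auto

lemma measure_R_lim: "0 < r \<Longrightarrow> D \<in> sets \<sigma> \<Longrightarrow> measure R_lim (ray_set r D) = tail_factor r * measure \<sigma> D"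
  by (simp add: measure_R_lim_ray_set tail_factor_def)

lemma tempering_tail_finite: "emeasure (tempering p \<alpha>) {1<..} \<noteq> \<infinity>"
proof -
  have "emeasure (tempering p \<alpha>) {1<..} = (\<integral>\<^sup>+t. indicator {1<..} t \<partial>tempering p \<alpha>)"
    by simp
  also have "\<dots> \<le> (\<integral>\<^sup>+t. ennreal (t powr (\<bar>\<alpha>\<bar> + 1)) \<partial>tempering p \<alpha>)"
    by (intro nn_integral_mono) (auto simp: indicator_def intro!: ge_one_powr_ge_zero)
  also have "\<dots> < \<infinity>"
    using p by (intro tempering_moment_finite) auto
  finally show ?thesis
    by simp
qed

text \<open>A point with \<open>norm x > K\<close> contributes to \<open>tempered_levy p \<alpha> S\<close> outside the ball of
  radius \<open>K\<close> at least the mass that the tempering density gives to \<open>t > 1\<close>.\<close>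

lemma tail_mass_le:
  fixes S :: "'a measure"
  assumes S: "levy_measure S" "levy_measure (tempered_levy p \<alpha> S)" and "0 < K"
  shows "measure (tempering p \<alpha>) {1<..} * measure S {x. K < norm x}
    \<le> (LINT x|tempered_levy p \<alpha> S. ramp (K / 2) K (norm x))"
proof -
  have [measurable_cong]: "sets S = sets borel"
    by (rule levy_measure_sets[OF S(1)])
  have fin_S: "emeasure S {x. K < norm x} \<noteq> \<infinity>"
    using emeasure_levy_measure_outside_ball[OF S(1) \<open>0 < K\<close>] by simp
  have ramp_meas: "(\<lambda>x::'a. ennreal (ramp (K / 2) K (norm x))) \<in> borel_measurable borel"
    by measurable
  have int: "integrable (tempered_levy p \<alpha> S) (\<lambda>x. ramp (K / 2) K (norm x) * 1)"
    using integrable_polar[OF S(2), of "ramp (K / 2) K" 1 "K / 2" "\<lambda>_. 1" 1]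
      ramp_eq_0[of "K / 2" K] ramp_nonneg[of "K / 2" K] ramp_le_1[of "K / 2" K] \<open>0 < K\<close> by simp
  have "emeasure (tempering p \<alpha>) {1<..} * emeasure S {x. K < norm x}
      = (\<integral>\<^sup>+x. emeasure (tempering p \<alpha>) {1<..} * indicator {x. K < norm x} x \<partial>S)"
    by (subst nn_integral_cmult_indicator) auto
  also have "\<dots> \<le> (\<integral>\<^sup>+x. \<integral>\<^sup>+t. ennreal (ramp (K / 2) K (norm (t *\<^sub>R x))) \<partial>tempering p \<alpha> \<partial>S)"
  proof (rule nn_integral_mono, goal_cases)
    case (1 x)
    have "emeasure (tempering p \<alpha>) {1<..} * indicator {x. K < norm x} x
        = (\<integral>\<^sup>+t. indicator {x. K < norm x} x * indicator {1<..} t \<partial>tempering p \<alpha>)"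
      by (subst nn_integral_cmult_indicator) (auto simp: mult.commute)
    also have "\<dots> \<le> (\<integral>\<^sup>+t. ennreal (ramp (K / 2) K (norm (t *\<^sub>R x))) \<partial>tempering p \<alpha>)"
    proof (intro nn_integral_mono)
      fix t :: real
      have "K \<le> norm (t *\<^sub>R x)" if "K < norm x" "1 < t"
        using mult_mono[of 1 t K "norm x"] that \<open>0 < K\<close> by simp
      then show "indicator {x. K < norm x} x * indicator {1<..} t \<le> ennreal (ramp (K / 2) K (norm (t *\<^sub>R x)))"
        using ramp_eq_1[of "K / 2" K "norm (t *\<^sub>R x)"] \<open>0 < K\<close> by (auto simp: indicator_def)
    qed
    finally show ?case .
  qed
  also have "\<dots> = (\<integral>\<^sup>+x. ennreal (ramp (K / 2) K (norm x)) \<partial>tempered_levy p \<alpha> S)"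
    by (rule nn_integral_tempered_levy[OF levy_measure_sets[OF S(1)] ramp_meas, symmetric])
  also have "\<dots> = ennreal (LINT x|tempered_levy p \<alpha> S. ramp (K / 2) K (norm x))"
    using int ramp_nonneg by (intro nn_integral_eq_integral) auto
  finally show ?thesis
    using tempering_tail_finite fin_S ramp_nonneg[of "K / 2" K]
    by (simp add: emeasure_eq_ennreal_measure flip: ennreal_mult)
qed

lemma tempering_tail_pos: "0 < measure (tempering p \<alpha>) {1<..}"
proof -
  have "emeasure (tempering p \<alpha>) {1<..} \<noteq> 0"
  proof
    assume "emeasure (tempering p \<alpha>) {1<..} = 0"
    then have "AE t in tempering p \<alpha>. t \<notin> {1<..}"
      by (intro AE_not_in) (auto simp: null_sets_def)
    then have "AE t in lborel. 0 < ennreal (t powr (- 1 - \<alpha>) * exp (- (t powr p))) * indicator {0<..} t \<longrightarrow> t \<notin> {1<..}"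
      unfolding tempering_def by (subst (asm) AE_density) auto
    then have "AE t in lborel. \<not> (t \<in> {1<..2::real})"
      by eventually_elim (auto simp: indicator_def)
    then have "emeasure lborel {t \<in> space lborel. t \<in> {1<..2::real}} = 0"
      by (rule emeasure_eq_0_AE)
    moreover have "{t \<in> space lborel. t \<in> {1<..2::real}} = {1<..2}"
      by auto
    ultimately show False
      by simp
  qed
  moreover have "emeasure (tempering p \<alpha>) {1<..} = ennreal (measure (tempering p \<alpha>) {1<..})"
    using tempering_tail_finite by (intro emeasure_eq_ennreal_measure) simp
  ultimately have "measure (tempering p \<alpha>) {1<..} \<noteq> 0"
    by auto
  then show ?thesis
    using measure_nonneg[of "tempering p \<alpha>" "{1<..}"] by linarith
qed

text \<open>A ramp differs from a compactly supported function only beyond a large radius \<open>K\<close>.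
  There the tempered Levy measures are close to the stable one, whose tail is small, and
  \<open>tail_mass_le\<close> transfers this to \<open>R n\<close>.\<close>

lemma ramp_convergence:
  fixes k :: "'a \<Rightarrow> real"
  assumes k: "continuous_on UNIV k" and k_nonneg: "\<And>u. 0 \<le> k u" and k_le: "\<And>u. k u \<le> B" and ab: "0 < a" "a < b"
  shows "(\<lambda>n. LINT x|R n. ramp a b (norm x) * k (x /\<^sub>R norm x))
    \<longlonglongrightarrow> (LINT x|R_lim. ramp a b (norm x) * k (x /\<^sub>R norm x))"
proof (rule LIMSEQ_I)
  fix \<epsilon> :: real assume "0 < \<epsilon>"
  let ?T = "tempered_levy p \<alpha>" and ?L = "stable_levy \<gamma> \<sigma>"
  have k_meas: "k \<in> borel_measurable borel"
    using k by (rule borel_measurable_continuous_onI)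
  have abs_k: "\<bar>k u\<bar> \<le> B" for u
    using k_nonneg[of u] k_le[of u] by simp
  have B: "0 \<le> B"
    using abs_k[of 0] by simp
  define c where "c = measure (tempering p \<alpha>) {1<..}"
  have c: "0 < c"
    unfolding c_def by (rule tempering_tail_pos)
  \<comment> \<open>\<open>B / c\<close> is the natural factor; the summand \<open>1\<close> keeps \<open>q\<close> positive when \<open>B = 0\<close>.\<close>
  define q where "q = (B + 1) / c"
  have q: "0 < q"
    using B c by (simp add: q_def)
  define tail where "tail K S = (LINT x|?T S. ramp (K / 2) K (norm x))" for K and S :: "'a measure"
  obtain K where K: "b < K" "q * tail K R_lim < \<epsilon> / 3"
  proof -
    have "((\<lambda>K. q * ((K / 2) powr (- \<gamma>) / \<gamma> * measure \<sigma> (sphere 0 1))) \<longlongrightarrow> q * (0 / \<gamma> * measure \<sigma> (sphere 0 1))) at_top"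
    proof (intro tendsto_intros)
      have "filterlim (\<lambda>K::real. K / 2) at_top at_top"
        by real_asymp
      then show "((\<lambda>K. (K / 2) powr (- \<gamma>)) \<longlongrightarrow> 0) at_top"
        using \<gamma> by (intro tendsto_neg_powr) auto
    qed (use \<gamma> in auto)
    then have "\<forall>\<^sub>F K in at_top. q * ((K / 2) powr (- \<gamma>) / \<gamma> * measure \<sigma> (sphere 0 1)) < \<epsilon> / 3"
      using \<open>0 < \<epsilon>\<close> by (intro order_tendstoD(2)[of _ 0]) auto
    then have "\<forall>\<^sub>F K in at_top. b < K \<and> q * ((K / 2) powr (- \<gamma>) / \<gamma> * measure \<sigma> (sphere 0 1)) < \<epsilon> / 3"
      using eventually_gt_at_top[of b] by eventually_elim simp
    then obtain K where K: "b < K" "q * ((K / 2) powr (- \<gamma>) / \<gamma> * measure \<sigma> (sphere 0 1)) < \<epsilon> / 3"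
      using eventually_happens'[OF trivial_limit_at_top_linorder] by blast
    have "0 < K"
      using K ab by simp
    have "tail K R_lim \<le> (K / 2) powr (- \<gamma>) / \<gamma> * measure \<sigma> (sphere 0 1)"
    proof -
      interpret \<sigma>: finite_measure \<sigma>
        by (rule finite_measure_finite_sphere_measure[OF \<sigma>])
      have em: "emeasure ?L {x. K / 2 < norm x} = ennreal ((K / 2) powr (- \<gamma>) / \<gamma> * measure \<sigma> (sphere 0 1))"
        using emeasure_stable_levy_ray_set[OF \<sigma>, of "K / 2" \<gamma> "sphere 0 1"] \<open>0 < K\<close> \<gamma>(1) sphere_sets
        by (simp add: ray_set_sphere \<sigma>.emeasure_eq_measure flip: ennreal_mult)
      have "tail K R_lim \<le> (LINT x|?L. indicator {x. K / 2 < norm x} x)"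
        unfolding tail_def tempered_levy_R_lim
      proof (rule integral_mono)
        show "integrable ?L (\<lambda>x. ramp (K / 2) K (norm x))"
          using integrable_polar[OF levy_measure_limit, of "ramp (K / 2) K" 1 "K / 2" "\<lambda>_. 1" 1]
            ramp_eq_0[of "K / 2" K] ramp_nonneg[of "K / 2" K] ramp_le_1[of "K / 2" K] \<open>0 < K\<close> by simp
        show "integrable ?L (indicator {x. K / 2 < norm x} :: 'a \<Rightarrow> real)"
          using em by (intro integrable_real_indicator) auto
        show "ramp (K / 2) K (norm x) \<le> indicator {x. K / 2 < norm x} x" for x :: 'a
          using ramp_eq_0[of "K / 2" K "norm x"] ramp_le_1[of "K / 2" K "norm x"] \<open>0 < K\<close>
          by (auto simp: indicator_def)
      qed
      also have "\<dots> = (K / 2) powr (- \<gamma>) / \<gamma> * measure \<sigma> (sphere 0 1)"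
        using em \<gamma>(1) by (simp add: measure_def)
      finally show ?thesis .
    qed
    then have "q * tail K R_lim \<le> q * ((K / 2) powr (- \<gamma>) / \<gamma> * measure \<sigma> (sphere 0 1))"
      using q by (intro mult_left_mono) auto
    from order_le_less_trans[OF this K(2)] show ?thesis
      using that K(1) by blast
  qed
  have "0 < K"
    using K ab by simp
  define \<theta> where "\<theta> s = ramp a b s * (1 - ramp K (K + 1) s)" for s
  have \<theta>_supp: "\<theta> s = 0" if "s \<notin> {a..K + 1}" for s
    using that ramp_eq_0[of a b s] ramp_eq_1[of K "K + 1" s] ab by (auto simp: \<theta>_def)
  have \<theta>_cont: "continuous_on UNIV \<theta>"
    unfolding \<theta>_def using ab by (intro continuous_intros continuous_on_ramp) auto
  have \<theta>_abs: "\<bar>\<theta> s\<bar> \<le> 1" for s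
  proof -
    have "0 \<le> \<theta> s" "\<theta> s \<le> 1"
      unfolding \<theta>_def using ramp_nonneg[of a b s] ramp_nonneg[of K "K + 1" s] ramp_le_1[of a b s]
        ramp_le_1[of K "K + 1" s] by (auto intro: mult_le_one)
    then show ?thesis
      by simp
  qed
  have \<theta>_meas: "\<theta> \<in> borel_measurable borel"
    by (rule borel_measurable_continuous_onI[OF \<theta>_cont])
  have approx: "\<bar>(LINT x|S. ramp a b (norm x) * k (x /\<^sub>R norm x)) - (LINT x|S. \<theta> (norm x) * k (x /\<^sub>R norm x))\<bar> \<le> q * tail K S"
    if S: "levy_measure S" "levy_measure (?T S)" for S
  proof -
    have int1: "integrable S (\<lambda>x. ramp a b (norm x) * k (x /\<^sub>R norm x))"
      using ab ramp_nonneg[of a b] ramp_le_1[of a b]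
      by (intro integrable_polar[OF S(1) ramp_measurable _ _ k_meas abs_k ab(1), of _ _ 1])
         (auto simp: ramp_eq_0)
    have int2: "integrable S (\<lambda>x. \<theta> (norm x) * k (x /\<^sub>R norm x))"
      using \<theta>_supp by (intro integrable_polar[OF S(1) \<theta>_meas \<theta>_abs _ k_meas abs_k ab(1)]) auto
    have fin: "emeasure S {x. K < norm x} < \<infinity>"
      by (rule emeasure_levy_measure_outside_ball[OF S(1) \<open>0 < K\<close>])
    have int3: "integrable S (\<lambda>x. B * indicator {x. K < norm x} x)"
      using fin levy_measure_sets[OF S(1)] by (intro integrable_mult_right integrable_real_indicator) auto
    have "\<bar>(LINT x|S. ramp a b (norm x) * k (x /\<^sub>R norm x)) - (LINT x|S. \<theta> (norm x) * k (x /\<^sub>R norm x))\<bar>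
        = \<bar>LINT x|S. ramp a b (norm x) * k (x /\<^sub>R norm x) - \<theta> (norm x) * k (x /\<^sub>R norm x)\<bar>"
      using int1 int2 by simp
    also have "\<dots> \<le> (LINT x|S. \<bar>ramp a b (norm x) * k (x /\<^sub>R norm x) - \<theta> (norm x) * k (x /\<^sub>R norm x)\<bar>)"
      by (rule integral_abs_bound)
    also have "\<dots> \<le> (LINT x|S. B * indicator {x. K < norm x} x)"
    proof (rule integral_mono[OF _ int3])
      show "integrable S (\<lambda>x. \<bar>ramp a b (norm x) * k (x /\<^sub>R norm x) - \<theta> (norm x) * k (x /\<^sub>R norm x)\<bar>)"
        using int1 int2 by simp
      fix x :: 'a
      have "ramp a b (norm x) * k (x /\<^sub>R norm x) - \<theta> (norm x) * k (x /\<^sub>R norm x)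
          = (ramp a b (norm x) * ramp K (K + 1) (norm x)) * k (x /\<^sub>R norm x)"
        by (simp add: \<theta>_def algebra_simps)
      moreover have "\<bar>(ramp a b (norm x) * ramp K (K + 1) (norm x)) * k (x /\<^sub>R norm x)\<bar> \<le> 1 * B"
        unfolding abs_mult using ramp_nonneg[of _ _ "norm x"] ramp_le_1[of _ _ "norm x"] abs_k
        by (intro mult_mono mult_le_one) auto
      moreover have "ramp K (K + 1) (norm x) = 0" if "\<not> K < norm x"
        using that by (intro ramp_eq_0) auto
      ultimately show "\<bar>ramp a b (norm x) * k (x /\<^sub>R norm x) - \<theta> (norm x) * k (x /\<^sub>R norm x)\<bar> \<le> B * indicator {x. K < norm x} x"
        by (cases "K < norm x") (simp_all add: indicator_def)
    qed
    also have "\<dots> = B * measure S {x. K < norm x}"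
      using levy_measure_sets[OF S(1)] by (simp add: sets_eq_imp_space_eq)
    also have "\<dots> \<le> (B + 1) * (tail K S / c)"
    proof (intro mult_mono)
      show "measure S {x. K < norm x} \<le> tail K S / c"
        using tail_mass_le[OF S \<open>0 < K\<close>] c unfolding tail_def c_def by (simp add: field_simps)
    qed (use B in auto)
    finally show ?thesis
      by (simp add: q_def)
  qed
  have "(\<lambda>n. LINT x|R n. \<theta> (norm x) * k (x /\<^sub>R norm x)) \<longlonglongrightarrow> (LINT x|R_lim. \<theta> (norm x) * k (x /\<^sub>R norm x))"
    using K ab \<theta>_supp
    by (intro compact_radial_convergence[where a=a and b="K + 1", OF k k_nonneg k_le \<theta>_cont]) auto
  from tendstoD[OF this, of "\<epsilon> / 3"]
  have ev1: "\<forall>\<^sub>F n in sequentially. \<bar>(LINT x|R n. \<theta> (norm x) * k (x /\<^sub>R norm x))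
      - (LINT x|R_lim. \<theta> (norm x) * k (x /\<^sub>R norm x))\<bar> < \<epsilon> / 3"
    using \<open>0 < \<epsilon>\<close> unfolding dist_real_def by simp
  have "(\<lambda>n. tail K (R n)) \<longlonglongrightarrow> tail K R_lim"
    unfolding tail_def tempered_levy_R_lim
  proof (rule conv)
    show "continuous_on UNIV (\<lambda>x::'a. ramp (K / 2) K (norm x))"
      using \<open>0 < K\<close> by (intro continuous_on_compose2[OF continuous_on_ramp] continuous_intros) auto
    show "bounded (range (\<lambda>x::'a. ramp (K / 2) K (norm x)))"
      using ramp_nonneg ramp_le_1 by (auto simp: bounded_iff intro!: exI[of _ 1])
    show "0 < K / 2"
      using \<open>0 < K\<close> by simp
    show "ramp (K / 2) K (norm x) = 0" if "norm x < K / 2" for x :: 'a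
      using that \<open>0 < K\<close> by (intro ramp_eq_0) auto
  qed
  then have "(\<lambda>n. q * tail K (R n)) \<longlonglongrightarrow> q * tail K R_lim"
    by (intro tendsto_intros)
  then have ev2: "\<forall>\<^sub>F n in sequentially. q * tail K (R n) < \<epsilon> / 3"
    using K(2) by (rule order_tendstoD)
  have "levy_measure (?T R_lim)"
    by (simp add: tempered_levy_R_lim levy_measure_limit)
  note approx_lim = approx[OF levy_measure_R_lim this]
  have "\<forall>\<^sub>F n in sequentially. norm ((LINT x|R n. ramp a b (norm x) * k (x /\<^sub>R norm x))
      - (LINT x|R_lim. ramp a b (norm x) * k (x /\<^sub>R norm x))) < \<epsilon>"
    using ev1 ev2
  proof eventually_elim
    case (elim n)
    show ?case
      using approx[OF levy_R levy_T, of n] approx_lim elim K(2) unfolding real_norm_def by linarith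
  qed
  then show "\<exists>N. \<forall>n\<ge>N. norm ((LINT x|R n. ramp a b (norm x) * k (x /\<^sub>R norm x))
      - (LINT x|R_lim. ramp a b (norm x) * k (x /\<^sub>R norm x))) < \<epsilon>"
    by (simp add: eventually_sequentially)
qed

text \<open>The indicator of the set is dominated by a ramp, ending at \<open>r\<close>, times a Lipschitz
  function of the direction that decreases to the indicator of \<open>C\<close>.\<close>

lemma ray_set_closed_upper_bound:
  assumes C: "closed C" "C \<subseteq> sphere 0 1" and "0 < r" and y: "tail_factor r * measure \<sigma> C < y"
  shows "\<forall>\<^sub>F n in sequentially. measure (R n) (ray_set r C) < y"
proof (cases "C = {}")
  case True
  then have "ray_set r C = {}"
    by (simp add: ray_set_def)
  then show ?thesis
    using y True by simp
next
  case False
  have C_sets: "C \<in> sets \<sigma>" and C_borel [measurable]: "C \<in> sets borel"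
    using C by (auto simp: sets_finite_sphere_measure[OF \<sigma>])
  have "(tail_factor \<longlongrightarrow> tail_factor r) (at_left r)"
    using isCont_tail_factor[OF \<open>0 < r\<close>] by (simp add: isCont_def filterlim_at_split)
  then have "((\<lambda>s. tail_factor s * measure \<sigma> C) \<longlongrightarrow> tail_factor r * measure \<sigma> C) (at_left r)"
    by (intro tendsto_intros)
  then have "\<forall>\<^sub>F s in at_left r. tail_factor s * measure \<sigma> C < y"
    using y by (rule order_tendstoD)
  moreover have "\<forall>\<^sub>F s in at_left r. 0 < s"
    using \<open>0 < r\<close> by (intro order_tendstoD(1)[OF tendsto_ident_at])
  ultimately have "\<forall>\<^sub>F s in at_left r. 0 < s \<and> tail_factor s * measure \<sigma> C < y"
    by eventually_elim simp
  then obtain s where s: "0 < s" "s < r" "tail_factor s * measure \<sigma> C < y"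
    unfolding eventually_at_left_field by (metis dense)
  define k where "k j u = max 0 (1 - real j * infdist u C)" for j u
  have k_cont: "continuous_on UNIV (k j)" for j
    unfolding k_def by (intro continuous_intros)
  have k_bd: "0 \<le> k j u" "k j u \<le> 1" for j u
    using infdist_nonneg[of u C] by (auto simp: k_def)
  have k_meas [measurable]: "k j \<in> borel_measurable borel" for j
    by (rule borel_measurable_continuous_onI[OF k_cont])
  have k_lim: "(\<lambda>j. k j u) \<longlonglongrightarrow> indicator C u" for u
  proof (cases "u \<in> C")
    case True
    then show ?thesis
      by (simp add: k_def)
  next
    case u: False
    then have "0 < infdist u C"
      using C(1) False by (simp add: infdist_pos_not_in_closed)
    then obtain N :: nat where N: "1 < real N * infdist u C"
      using reals_Archimedean3 by blast
    have "k j u = 0" if "N \<le> j" for j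
    proof -
      have "real N * infdist u C \<le> real j * infdist u C"
        using that infdist_nonneg by (intro mult_right_mono) auto
      then show ?thesis
        using N by (simp add: k_def)
    qed
    then show ?thesis
      using u by (intro tendsto_eventually) (auto simp: eventually_sequentially)
  qed
  have [measurable_cong]: "sets R_lim = sets borel"
    by (simp add: R_lim_def)
  have fin: "emeasure R_lim {x. s < norm x} < \<infinity>"
    by (rule emeasure_levy_measure_outside_ball[OF levy_measure_R_lim s(1)])
  have ind_int: "integrable R_lim (\<lambda>x. indicator {x. s < norm x} x :: real)"
    using fin by (intro integrable_real_indicator) auto
  have "(\<lambda>j. LINT x|R_lim. indicator {x. s < norm x} x * k j (x /\<^sub>R norm x))
      \<longlonglongrightarrow> (LINT x|R_lim. indicator {x. s < norm x} x * indicator C (x /\<^sub>R norm x))"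
  proof (rule integral_dominated_convergence[OF _ _ ind_int])
    show "AE x in R_lim. (\<lambda>j. indicator {x. s < norm x} x * k j (x /\<^sub>R norm x))
        \<longlonglongrightarrow> indicator {x. s < norm x} x * indicator C (x /\<^sub>R norm x)"
      by (intro AE_I2 tendsto_intros k_lim)
    show "AE x in R_lim. norm (indicator {x. s < norm x} x * k j (x /\<^sub>R norm x)) \<le> indicator {x. s < norm x} x" for j
      using k_bd[of j] by (auto simp: indicator_def)
    show "(\<lambda>x. indicator {x. s < norm x} x * indicator C (x /\<^sub>R norm x) :: real) \<in> borel_measurable R_lim"
      by measurable
  qed measurable
  also have "(LINT x|R_lim. indicator {x. s < norm x} x * indicator C (x /\<^sub>R norm x) :: real)
      = (LINT x|R_lim. indicator (ray_set s C) x)"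
    by (intro Bochner_Integration.integral_cong refl) (auto simp: ray_set_def indicator_def)
  also have "\<dots> = tail_factor s * measure \<sigma> C"
    using measure_R_lim[OF s(1) C_sets] by (simp add: R_lim_def sets_eq_imp_space_eq[OF sets_scaled])
  finally have "\<forall>\<^sub>F j in sequentially. (LINT x|R_lim. indicator {x. s < norm x} x * k j (x /\<^sub>R norm x)) < y"
    using s(3) by (rule order_tendstoD)
  then obtain j where j: "(LINT x|R_lim. indicator {x. s < norm x} x * k j (x /\<^sub>R norm x)) < y"
    by (auto simp: eventually_sequentially)
  have int_ramp: "integrable S (\<lambda>x. ramp s r (norm x) * k j (x /\<^sub>R norm x))" if S: "levy_measure S" for S
    using k_bd[of j] s ramp_nonneg[of s r] ramp_le_1[of s r]
    by (intro integrable_polar[where A=1 and B=1, OF S ramp_measurable _ _ k_meas _ s(1)])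
       (auto simp: ramp_eq_0)
  have "(LINT x|R_lim. ramp s r (norm x) * k j (x /\<^sub>R norm x))
      \<le> (LINT x|R_lim. indicator {x. s < norm x} x * k j (x /\<^sub>R norm x))"
  proof (rule integral_mono[OF int_ramp[OF levy_measure_R_lim]])
    show "integrable R_lim (\<lambda>x. indicator {x. s < norm x} x * k j (x /\<^sub>R norm x))"
    proof (rule Bochner_Integration.integrable_bound[OF ind_int])
      show "(\<lambda>x. indicator {x. s < norm x} x * k j (x /\<^sub>R norm x)) \<in> borel_measurable R_lim"
        by measurable
    qed (use k_bd[of j] in \<open>auto simp: indicator_def\<close>)
    show "ramp s r (norm x) * k j (x /\<^sub>R norm x) \<le> indicator {x. s < norm x} x * k j (x /\<^sub>R norm x)" for x
      using ramp_eq_0[of s r "norm x"] ramp_le_1[of s r "norm x"] k_bd s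
      by (intro mult_right_mono) (auto simp: indicator_def)
  qed
  then have "(LINT x|R_lim. ramp s r (norm x) * k j (x /\<^sub>R norm x)) < y"
    using j by linarith
  then have "\<forall>\<^sub>F n in sequentially. (LINT x|R n. ramp s r (norm x) * k j (x /\<^sub>R norm x)) < y"
    by (rule order_tendstoD[OF ramp_convergence[OF k_cont k_bd s(1,2)]])
  then show ?thesis
  proof eventually_elim
    case (elim n)
    have sets_n: "sets (R n) = sets borel"
      by (rule levy_measure_sets[OF levy_R])
    have meas: "ray_set r C \<in> sets (R n)"
      using C_borel by (simp add: sets_n)
    have "emeasure (R n) (ray_set r C) \<le> emeasure (R n) {x. r < norm x}"
      by (intro emeasure_mono) (auto simp: ray_set_def sets_n)
    also have "\<dots> < \<infinity>"
      by (rule emeasure_levy_measure_outside_ball[OF levy_R \<open>0 < r\<close>])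
    finally have int: "integrable (R n) (indicator (ray_set r C) :: 'a \<Rightarrow> real)"
      using meas by (intro integrable_real_indicator) auto
    have "measure (R n) (ray_set r C) = (LINT x|R n. indicator (ray_set r C) x)"
      using meas by (simp add: sets_eq_imp_space_eq[OF sets_n])
    also have "\<dots> \<le> (LINT x|R n. ramp s r (norm x) * k j (x /\<^sub>R norm x))"
    proof (rule integral_mono[OF int int_ramp[OF levy_R]])
      show "indicator (ray_set r C) x \<le> ramp s r (norm x) * k j (x /\<^sub>R norm x)" for x
        using s ramp_nonneg[of s r] k_bd[of j]
        by (auto simp: indicator_def ray_set_def ramp_eq_1 k_def)
    qed
    finally show ?case
      using elim by linarith
  qed
qed

end

section \<open>Ray sets over continuity sets and regular variation\<close>

definition continuity_set :: "'a::euclidean_space measure \<Rightarrow> 'a set \<Rightarrow> bool" where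
  "continuity_set \<sigma> D \<longleftrightarrow> D \<in> sets \<sigma> \<and> emeasure \<sigma> (top_of_set (sphere 0 1) frontier_of D) = 0"

lemma frontier_of_sets:
  assumes \<sigma>: "finite_sphere_measure \<sigma>"
  shows "top_of_set (sphere 0 1) frontier_of D \<in> sets \<sigma>"
proof -
  have "closedin (top_of_set (sphere 0 1)) (top_of_set (sphere 0 1) frontier_of D)"
    by (rule closedin_frontier_of)
  then have "closed (top_of_set (sphere 0 1) frontier_of D)"
    by (rule closedin_closed_trans) simp
  then show ?thesis
    using sets_finite_sphere_measure[OF \<sigma>] frontier_of_subset_topspace[of "top_of_set (sphere 0 1)" D] by auto
qed

lemma continuity_set_complement:
  assumes \<sigma>: "finite_sphere_measure \<sigma>" and D: "continuity_set \<sigma> D"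
  shows "continuity_set \<sigma> (sphere 0 1 - D)"
proof -
  have "sphere 0 1 - D \<in> sets \<sigma>"
    using D sets.compl_sets[of D \<sigma>] by (simp add: continuity_set_def space_finite_sphere_measure[OF \<sigma>])
  then show ?thesis
    using D frontier_of_complement[of "top_of_set (sphere 0 1)" D] by (simp add: continuity_set_def)
qed

lemma continuity_set_Int:
  assumes \<sigma>: "finite_sphere_measure \<sigma>" and D: "continuity_set \<sigma> D" and E: "continuity_set \<sigma> E"
  shows "continuity_set \<sigma> (D \<inter> E)"
proof -
  let ?X = "top_of_set (sphere 0 1)"
  have "emeasure \<sigma> (?X frontier_of (D \<inter> E)) \<le> emeasure \<sigma> (?X frontier_of D \<union> ?X frontier_of E)"
    using frontier_of_Int_subset[of ?X D E] by (intro emeasure_mono sets.Un frontier_of_sets[OF \<sigma>])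
  also have "\<dots> \<le> emeasure \<sigma> (?X frontier_of D) + emeasure \<sigma> (?X frontier_of E)"
    by (intro emeasure_subadditive frontier_of_sets[OF \<sigma>])
  also have "\<dots> = 0"
    using D E by (simp add: continuity_set_def)
  finally show ?thesis
    using D E by (simp add: continuity_set_def sets.Int)
qed

lemma continuity_set_sphere: "finite_sphere_measure \<sigma> \<Longrightarrow> continuity_set \<sigma> (sphere 0 1)"
  for \<sigma> :: "'a::euclidean_space measure"
  using frontier_of_topspace[of "top_of_set (sphere (0::'a) 1)"] sets.top[of \<sigma>]
  by (simp add: continuity_set_def space_finite_sphere_measure)

lemma measure_closure_continuity_set:
  assumes \<sigma>: "finite_sphere_measure \<sigma>" and D: "continuity_set \<sigma> D"
  shows "closure D \<subseteq> sphere 0 1" "measure \<sigma> (closure D) = measure \<sigma> D"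
proof -
  interpret \<sigma>: finite_measure \<sigma>
    by (rule finite_measure_finite_sphere_measure[OF \<sigma>])
  let ?X = "top_of_set (sphere 0 1)"
  have D_sets: "D \<in> sets \<sigma>" and D_sub: "D \<subseteq> sphere 0 1"
    using D sets_finite_sphere_measure[OF \<sigma>] by (auto simp: continuity_set_def)
  show cl: "closure D \<subseteq> sphere 0 1"
    using closure_mono[OF D_sub] by simp
  have cl_sets: "closure D \<in> sets \<sigma>"
    using cl by (simp add: sets_finite_sphere_measure[OF \<sigma>])
  have "?X closure_of D = closure D"
    using cl D_sub by (simp add: closure_of_subtopology Int_absorb1 Int_absorb2)
  moreover have "?X interior_of D \<subseteq> D"
    by (rule interior_of_subset)
  ultimately have "closure D - D \<subseteq> ?X frontier_of D"
    by (auto simp: frontier_of_def)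
  then have "emeasure \<sigma> (closure D - D) \<le> emeasure \<sigma> (?X frontier_of D)"
    by (intro emeasure_mono frontier_of_sets[OF \<sigma>])
  then have "measure \<sigma> (closure D - D) \<le> 0"
    using D by (simp add: continuity_set_def \<sigma>.emeasure_eq_measure)
  then have "measure \<sigma> (closure D - D) = 0"
    using measure_nonneg by (rule antisym)
  moreover have "measure \<sigma> (closure D - D) = measure \<sigma> (closure D) - measure \<sigma> D"
    using cl_sets D_sets by (intro \<sigma>.finite_measure_Diff closure_subset)
  ultimately show "measure \<sigma> (closure D) = measure \<sigma> D"
    by simp
qed

lemma fmeasurable_ray_set:
  assumes M: "levy_measure M" and "0 < r" and D: "D \<in> sets borel"
  shows "ray_set r D \<in> fmeasurable M"
proof (rule fmeasurableI)
  show "ray_set r D \<in> sets M"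
    using D by (simp add: levy_measure_sets[OF M])
  have "emeasure M (ray_set r D) \<le> emeasure M {x. r < norm x}"
    by (intro emeasure_mono) (auto simp: ray_set_def levy_measure_sets[OF M])
  also have "\<dots> < \<infinity>"
    by (rule emeasure_levy_measure_outside_ball[OF M \<open>0 < r\<close>])
  finally show "emeasure M (ray_set r D) < \<infinity>" .
qed

lemma measure_ray_set_complement:
  assumes M: "levy_measure M" and "0 < r" and D: "D \<in> sets borel" "D \<subseteq> sphere 0 1"
  shows "measure M (ray_set r (sphere 0 1)) = measure M (ray_set r D) + measure M (ray_set r (sphere 0 1 - D))"
proof -
  have "ray_set r (sphere 0 1) = ray_set r D \<union> ray_set r (sphere 0 1 - D)"
    "ray_set r D \<inter> ray_set r (sphere 0 1 - D) = {}"
    using D(2) by (auto simp: ray_set_def)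
  moreover have "sphere 0 1 - D \<in> sets borel"
    using D(1) by auto
  ultimately show ?thesis
    using measure_Un2[OF fmeasurable_ray_set[OF M \<open>0 < r\<close> D(1)]
        fmeasurable_ray_set[OF M \<open>0 < r\<close>, of "sphere 0 1 - D"]]
    by (simp add: Diff_triv Int_commute)
qed

context tempered_levy_convergence
begin

lemma ray_set_total_lower_bound:
  assumes "0 < r" and y: "y < tail_factor r * measure \<sigma> (sphere 0 1)"
  shows "\<forall>\<^sub>F n in sequentially. y < measure (R n) (ray_set r (sphere 0 1))"
proof -
  have "(tail_factor \<longlongrightarrow> tail_factor r) (at_right r)"
    using isCont_tail_factor[OF \<open>0 < r\<close>] by (simp add: isCont_def filterlim_at_split)
  then have "((\<lambda>s. tail_factor s * measure \<sigma> (sphere 0 1)) \<longlongrightarrow> tail_factor r * measure \<sigma> (sphere 0 1)) (at_right r)"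
    by (intro tendsto_intros)
  then have "\<forall>\<^sub>F s in at_right r. y < tail_factor s * measure \<sigma> (sphere 0 1)"
    using y by (rule order_tendstoD)
  then obtain s where s: "r < s" "y < tail_factor s * measure \<sigma> (sphere 0 1)"
    unfolding eventually_at_right_field by (metis dense)
  have S_borel: "sphere (0::'a) 1 \<in> sets borel"
    by simp
  have int: "integrable M (\<lambda>x. ramp r s (norm x) * 1)" if M: "levy_measure M" for M :: "'a measure"
    using s(1) ramp_nonneg[of r s] ramp_le_1[of r s]
    by (intro integrable_polar[where A=1 and B=1 and a=r, OF M ramp_measurable _ _ borel_measurable_const _ \<open>0 < r\<close>])
       (auto simp: ramp_eq_0)
  have ind: "integrable M (indicator (ray_set t (sphere 0 1)) :: 'a \<Rightarrow> real)"
    "(LINT x|M. indicator (ray_set t (sphere 0 1)) x) = measure M (ray_set t (sphere 0 1))"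
    if "levy_measure M" "0 < t" for M t
    using fmeasurable_ray_set[OF that S_borel] levy_measure_sets[OF that(1)]
    by (auto intro!: integrable_real_indicator simp: fmeasurable_def sets_eq_imp_space_eq)
  have "tail_factor s * measure \<sigma> (sphere 0 1) = (LINT x|R_lim. indicator (ray_set s (sphere 0 1)) x)"
    using s(1) \<open>0 < r\<close> ind[OF levy_measure_R_lim, of s] measure_R_lim[of s "sphere 0 1"] sphere_sets by simp
  also have "\<dots> \<le> (LINT x|R_lim. ramp r s (norm x) * 1)"
    using s(1) \<open>0 < r\<close> ramp_nonneg[of r s]
    by (intro integral_mono ind int levy_measure_R_lim) (auto simp: indicator_def ray_set_def ramp_eq_1)
  finally have "y < (LINT x|R_lim. ramp r s (norm x) * 1)"
    using s(2) by linarith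
  then have "\<forall>\<^sub>F n in sequentially. y < (LINT x|R n. ramp r s (norm x) * 1)"
    using s(1) \<open>0 < r\<close> by (intro order_tendstoD(1)[OF ramp_convergence[where k="\<lambda>_. 1" and B=1]]) auto
  then show ?thesis
  proof eventually_elim
    case (elim n)
    have "(LINT x|R n. ramp r s (norm x) * 1) \<le> (LINT x|R n. indicator (ray_set r (sphere 0 1)) x)"
    proof (intro integral_mono ind int levy_R \<open>0 < r\<close>)
      fix x :: 'a
      show "ramp r s (norm x) * 1 \<le> indicator (ray_set r (sphere 0 1)) x"
        using ramp_eq_0[OF s(1), of "norm x"] ramp_le_1[of r s "norm x"] \<open>0 < r\<close>
        by (cases "r < norm x") (auto simp: indicator_def ray_set_sphere)
    qed
    then show ?case
      using elim ind(2)[OF levy_R \<open>0 < r\<close>, of n] by linarith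
  qed
qed

text \<open>The upper bound for closed sets applies to the closures of \<open>D\<close> and of its complement
  in the sphere, which have the same \<open>\<sigma>\<close>-measure as the sets themselves. Subtracting the
  latter from the total mass gives the lower bound.\<close>

theorem ray_set_convergence:
  assumes "0 < r" and D: "continuity_set \<sigma> D"
  shows "(\<lambda>n. measure (R n) (ray_set r D)) \<longlonglongrightarrow> tail_factor r * measure \<sigma> D"
proof -
  interpret \<sigma>: finite_measure \<sigma>
    by (rule finite_measure_finite_sphere_measure[OF \<sigma>])
  have upper: "\<forall>\<^sub>F n in sequentially. measure (R n) (ray_set r E) < y"
    if E: "continuity_set \<sigma> E" and y: "tail_factor r * measure \<sigma> E < y" for E y
  proof -
    have "\<forall>\<^sub>F n in sequentially. measure (R n) (ray_set r (closure E)) < y"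
      using y measure_closure_continuity_set[OF \<sigma> E]
      by (intro ray_set_closed_upper_bound \<open>0 < r\<close>) auto
    then show ?thesis
    proof eventually_elim
      case (elim n)
      have "measure (R n) (ray_set r E) \<le> measure (R n) (ray_set r (closure E))"
      proof (rule measure_mono_fmeasurable)
        show "ray_set r E \<subseteq> ray_set r (closure E)"
          using closure_subset[of E] by (auto simp: ray_set_def)
        show "ray_set r E \<in> sets (R n)"
          using E sets_finite_sphere_measure[OF \<sigma>] levy_measure_sets[OF levy_R, of n]
          by (simp add: continuity_set_def ray_set_measurable)
        show "ray_set r (closure E) \<in> fmeasurable (R n)"
          by (intro fmeasurable_ray_set levy_R \<open>0 < r\<close>) simp
      qed
      then show ?case
        using elim by linarith
    qed
  qed
  show ?thesis
  proof (rule order_tendstoI)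
    show "\<forall>\<^sub>F n in sequentially. measure (R n) (ray_set r D) < y" if "tail_factor r * measure \<sigma> D < y" for y
      using upper[OF D that] .
    fix y assume y: "y < tail_factor r * measure \<sigma> D"
    define \<eta> where "\<eta> = (tail_factor r * measure \<sigma> D - y) / 2"
    have \<eta>: "0 < \<eta>"
      using y by (simp add: \<eta>_def)
    have D': "D \<in> sets borel" "D \<subseteq> sphere 0 1" "D \<in> sets \<sigma>"
      using D sets_finite_sphere_measure[OF \<sigma>] by (auto simp: continuity_set_def)
    have "measure \<sigma> (sphere 0 1 - D) = measure \<sigma> (sphere 0 1) - measure \<sigma> D"
      using D' sphere_sets by (intro \<sigma>.finite_measure_Diff)
    then have V_diff: "tail_factor r * measure \<sigma> (sphere 0 1 - D) = tail_factor r * measure \<sigma> (sphere 0 1) - tail_factor r * measure \<sigma> D"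
      by (simp add: right_diff_distrib)
    have "\<forall>\<^sub>F n in sequentially. tail_factor r * measure \<sigma> (sphere 0 1) - \<eta> < measure (R n) (ray_set r (sphere 0 1))"
      using \<eta> by (intro ray_set_total_lower_bound \<open>0 < r\<close>) simp
    moreover have "\<forall>\<^sub>F n in sequentially.
        measure (R n) (ray_set r (sphere 0 1 - D)) < tail_factor r * measure \<sigma> (sphere 0 1 - D) + \<eta>"
      using \<eta> by (intro upper continuity_set_complement[OF \<sigma> D]) simp
    ultimately show "\<forall>\<^sub>F n in sequentially. y < measure (R n) (ray_set r D)"
    proof eventually_elim
      case (elim n)
      have "measure (R n) (ray_set r (sphere 0 1))
          = measure (R n) (ray_set r D) + measure (R n) (ray_set r (sphere 0 1 - D))"
        by (rule measure_ray_set_complement[OF levy_R \<open>0 < r\<close> D'(1,2)])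
      moreover have "2 * \<eta> = tail_factor r * measure \<sigma> D - y"
        by (simp add: \<eta>_def)
      ultimately show ?case
        using elim V_diff by linarith
    qed
  qed
qed

end

lemma ray_set_scaled:
  "0 < a \<Longrightarrow> {x. a *\<^sub>R x \<in> ray_set r D} = ray_set (r / a) D" for D :: "'a::euclidean_space set"
proof -
  assume a: "0 < a"
  have 1: "(a *\<^sub>R x) /\<^sub>R norm (a *\<^sub>R x) = x /\<^sub>R norm x" for x :: 'a
    using a by (simp add: mult.assoc[symmetric])
  have 2: "r < norm (a *\<^sub>R x) \<longleftrightarrow> r / a < norm x" for x :: 'a
    using a by (simp add: divide_less_eq mult.commute)
  show ?thesis
    by (simp only: ray_set_def mem_Collect_eq 1 2)
qed

lemma measure_scaled_ray_set:
  assumes "sets R = sets borel" "D \<in> sets borel" "0 < a" "0 \<le> c"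
  shows "measure (scaled c a R) (ray_set r D) = c * measure R (ray_set (r / a) D)"
  using assms by (simp add: measure_def emeasure_scaled ray_set_scaled enn2real_mult)

text \<open>For a Levy measure the tails are finite, and everything can be said in terms of ray
  sets.\<close>

lemma regularly_varying_iff:
  fixes \<nu> \<sigma> :: "'a::euclidean_space measure"
  assumes \<nu>: "levy_measure \<nu>" and \<sigma>: "finite_sphere_measure \<sigma>"
  shows "regularly_varying \<rho> \<sigma> \<nu> \<longleftrightarrow> 0 \<le> \<rho> \<and> emeasure \<sigma> (sphere 0 1) \<noteq> 0
    \<and> (\<forall>s>0. 0 < measure \<nu> (ray_set s (sphere 0 1)))
    \<and> (\<forall>t>0. \<forall>D. continuity_set \<sigma> D \<longrightarrow>
        ((\<lambda>r. measure \<nu> (ray_set (r * t) D) / measure \<nu> (ray_set r (sphere 0 1)))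
          \<longlongrightarrow> t powr (- \<rho>) * (measure \<sigma> D / measure \<sigma> (sphere 0 1))) at_top)"
proof -
  have sets: "D \<in> sets (restrict_space borel (sphere 0 1)) \<longleftrightarrow> D \<in> sets \<sigma>" for D
    using \<sigma> by (simp add: finite_sphere_measure_def)
  have S_borel: "sphere (0::'a) 1 \<in> sets borel"
    by simp
  have pos: "0 < measure \<nu> (ray_set s (sphere 0 1)) \<longleftrightarrow> 0 < emeasure \<nu> {x. s < norm x}" if "0 < s" for s
  proof -
    have "emeasure \<nu> {x. s < norm x} = ennreal (measure \<nu> (ray_set s (sphere 0 1)))"
      using fmeasurable_ray_set[OF \<nu> that S_borel] that
      by (simp add: ray_set_sphere emeasure_eq_measure2)
    then show ?thesis
      by (simp add: ennreal_less_zero_iff)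
  qed
  have fin: "\<exists>T>0. emeasure \<nu> {x. norm x > T} < \<infinity>"
    using emeasure_levy_measure_outside_ball[OF \<nu>, of 1] by (intro exI[of _ 1]) auto
  have lim: "((\<lambda>r. measure \<nu> {x. norm x > r * t \<and> x /\<^sub>R norm x \<in> D} / measure \<nu> {x. norm x > r}) \<longlongrightarrow> l) at_top
    \<longleftrightarrow> ((\<lambda>r. measure \<nu> (ray_set (r * t) D) / measure \<nu> (ray_set r (sphere 0 1))) \<longlongrightarrow> l) at_top" for t D l
    unfolding ray_set_def[of _ D]
    by (rule tendsto_cong, use eventually_ge_at_top[of 0] in eventually_elim) (simp add: ray_set_sphere)
  show ?thesis
    unfolding regularly_varying_def lim sets continuity_set_def
    using \<sigma> fin pos levy_measure_sets[OF \<nu>] by auto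
qed

text \<open>Compare a level \<open>s\<close> with the first \<open>1 / a n\<close> that exceeds it: with \<open>n\<close> its index, \<open>s\<close>
  lies between \<open>1 / a (n - 1)\<close> and \<open>1 / a n\<close>. The tail is monotone and \<open>n / (n - 1)\<close> tends
  to \<open>1\<close>.\<close>

lemma regularly_varying_from_sequence:
  fixes R \<sigma> :: "'a::euclidean_space measure"
  assumes R: "levy_measure R" and \<sigma>: "finite_sphere_measure \<sigma>" and \<sigma>0: "emeasure \<sigma> (sphere 0 1) \<noteq> 0"
    and "0 < \<gamma>" "0 < c" and a: "\<And>n. 0 < a n"
    and conv: "\<And>r D. 0 < r \<Longrightarrow> continuity_set \<sigma> D \<Longrightarrow>
      (\<lambda>n. real n * measure R (ray_set (r / a n) D)) \<longlonglongrightarrow> c * r powr (- \<gamma>) * measure \<sigma> D"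
  shows "regularly_varying \<gamma> \<sigma> R"
proof -
  interpret \<sigma>: finite_measure \<sigma>
    by (rule finite_measure_finite_sphere_measure[OF \<sigma>])
  let ?S = "sphere 0 1 :: 'a set"
  define G where "G s D = measure R (ray_set s D)" for s D
  define g where "g r D = c * r powr (- \<gamma>) * measure \<sigma> D" for r D
  have S: "continuity_set \<sigma> ?S"
    by (rule continuity_set_sphere[OF \<sigma>])
  have \<sigma>S: "0 < measure \<sigma> ?S"
    using \<sigma>0 by (simp add: \<sigma>.emeasure_eq_measure zero_less_measure_iff)
  have G_mono: "G t D \<le> G s D" if "0 < s" "s \<le> t" "continuity_set \<sigma> D" for s t D
  proof -
    have D: "D \<in> sets borel"
      using that(3) sets_finite_sphere_measure[OF \<sigma>] by (simp add: continuity_set_def)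
    show ?thesis
      unfolding G_def using fmeasurable_ray_set[OF R _ D] that(1,2)
      by (intro measure_mono_fmeasurable) (auto simp: ray_set_def fmeasurableD intro!: fmeasurableD)
  qed
  have G_nonneg: "0 \<le> G s D" for s D
    by (simp add: G_def)
  have convG: "(\<lambda>n. real n * G (r / a n) D) \<longlonglongrightarrow> g r D" if "0 < r" "continuity_set \<sigma> D" for r D
    unfolding G_def g_def by (rule conv[OF that])
  have g_pos: "0 < g r ?S" if "0 < r" for r
    using that \<open>0 < c\<close> \<sigma>S by (simp add: g_def)
  \<comment> \<open>If \<open>a n \<ge> \<epsilon>\<close> infinitely often, then \<open>n\<close> times any fixed tail stays bounded along these
    \<open>n\<close>, so all tails vanish and the limit is \<open>0\<close>.\<close>
  have a_lim: "a \<longlonglongrightarrow> 0"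
  proof (rule ccontr)
    assume "\<not> a \<longlonglongrightarrow> 0"
    then obtain \<epsilon> where \<epsilon>: "0 < \<epsilon>" "\<And>N. \<exists>n\<ge>N. \<epsilon> \<le> a n"
      using a unfolding LIMSEQ_iff by (auto simp: not_less abs_of_pos)
    have G0: "G s ?S = 0" if "0 < s" for s
    proof (rule ccontr)
      assume "G s ?S \<noteq> 0"
      then have pos: "0 < G s ?S"
        using G_nonneg[of s ?S] by linarith
      define r where "r = s * \<epsilon>"
      have r: "0 < r"
        using \<open>0 < s\<close> \<epsilon>(1) by (simp add: r_def)
      have "(\<lambda>n. real n * G (r / a n) ?S) \<longlonglongrightarrow> g r ?S"
        by (rule convG[OF r S])
      then have ev: "\<forall>\<^sub>F n in sequentially. real n * G (r / a n) ?S < g r ?S + 1"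
        by (rule order_tendstoD) simp
      have "\<forall>\<^sub>F n in sequentially. (g r ?S + 1) / G s ?S < real n"
        using filterlim_real_sequentially by (simp add: filterlim_at_top_dense)
      with ev have "\<forall>\<^sub>F n in sequentially. real n * G (r / a n) ?S < g r ?S + 1 \<and> (g r ?S + 1) / G s ?S < real n"
        by (rule eventually_conj)
      then obtain N where N: "\<And>n. N \<le> n \<Longrightarrow> real n * G (r / a n) ?S < g r ?S + 1"
        "\<And>n. N \<le> n \<Longrightarrow> (g r ?S + 1) / G s ?S < real n"
        unfolding eventually_sequentially by blast
      obtain n where n: "N \<le> n" "\<epsilon> \<le> a n"
        using \<epsilon>(2) by blast
      have "r / a n \<le> s"
        using n(2) a[of n] \<open>0 < s\<close> by (simp add: r_def divide_le_eq mult_left_mono)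
      then have "G s ?S \<le> G (r / a n) ?S"
        using r a[of n] by (intro G_mono S) auto
      then have "real n * G s ?S \<le> real n * G (r / a n) ?S"
        by (intro mult_left_mono) auto
      then have "real n * G s ?S < g r ?S + 1"
        using N(1)[OF n(1)] by linarith
      moreover have "g r ?S + 1 < real n * G s ?S"
        using N(2)[OF n(1)] pos by (simp add: divide_less_eq)
      ultimately show False
        by linarith
    qed
    have "(\<lambda>n. real n * G (1 / a n) ?S) \<longlonglongrightarrow> g 1 ?S"
      by (intro convG S) simp
    then have "(\<lambda>n. 0 :: real) \<longlonglongrightarrow> g 1 ?S"
      using G0 a by simp
    then show False
      using g_pos[of 1] LIMSEQ_unique[OF tendsto_const] by fastforce
  qed
  have inv_a: "filterlim (\<lambda>n. 1 / a n) at_top sequentially"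
    using filterlim_inverse_at_top[OF a_lim] a by (simp add: inverse_eq_divide)
  have G_pos: "0 < G s ?S" if "0 < s" for s
  proof -
    have "(\<lambda>n. real n * G (1 / a n) ?S) \<longlonglongrightarrow> g 1 ?S"
      by (intro convG S) simp
    then have "\<forall>\<^sub>F n in sequentially. 0 < real n * G (1 / a n) ?S"
      using g_pos[of 1] by (intro order_tendstoD) auto
    moreover have "\<forall>\<^sub>F n in sequentially. s < 1 / a n"
      using inv_a by (simp add: filterlim_at_top_dense)
    ultimately have "\<forall>\<^sub>F n in sequentially. 0 < real n * G (1 / a n) ?S \<and> s < 1 / a n"
      by (rule eventually_conj)
    then obtain n where n: "0 < real n * G (1 / a n) ?S" "s < 1 / a n"
      by (auto simp: eventually_sequentially)
    have "0 < G (1 / a n) ?S"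
      using n(1) G_nonneg by (simp add: zero_less_mult_iff)
    also have "\<dots> \<le> G s ?S"
      using n(2) \<open>0 < s\<close> by (intro G_mono S) auto
    finally show ?thesis .
  qed
  define N where "N s = (LEAST n. s < 1 / a n)" for s
  have ex_N: "\<exists>n. s < 1 / a n" for s
    using inv_a by (auto simp: filterlim_at_top_dense eventually_sequentially)
  have N1: "s < 1 / a (N s)" for s
    unfolding N_def by (rule LeastI_ex[OF ex_N])
  have N2: "1 / a n \<le> s" if "n < N s" for n s
    using not_less_Least[OF that[unfolded N_def]] by simp
  have N_lim: "filterlim N at_top at_top"
    unfolding filterlim_at_top
  proof
    fix m
    have "m \<le> N s" if "Max ((\<lambda>n. 1 / a n) ` {..m}) \<le> s" for s
    proof (rule ccontr)
      assume "\<not> m \<le> N s"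
      then have "1 / a (N s) \<le> Max ((\<lambda>n. 1 / a n) ` {..m})"
        by (intro Max_ge) auto
      then show False
        using N1[of s] that by linarith
    qed
    then show "\<forall>\<^sub>F s in at_top. m \<le> N s"
      unfolding eventually_at_top_linorder by blast
  qed
  have N_pred_lim: "filterlim (\<lambda>s. N s - 1) at_top at_top"
    using filterlim_compose[OF filterlim_minus_const_nat_at_top N_lim] .
  have main: "((\<lambda>s. real (N s) * G (s * t) D) \<longlongrightarrow> g t D) at_top" if t: "0 < t" and D: "continuity_set \<sigma> D" for t D
  proof (rule tendsto_sandwich)
    have lower: "real (N s) * G (t / a (N s)) D \<le> real (N s) * G (s * t) D" if "0 < s" for s
    proof -
      have "s * t \<le> t / a (N s)"
        using N1[of s] t by (simp add: field_simps mult_left_mono less_imp_le a)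
      then show ?thesis
        using t that by (intro mult_left_mono G_mono D) auto
    qed
    show "\<forall>\<^sub>F s in at_top. real (N s) * G (t / a (N s)) D \<le> real (N s) * G (s * t) D"
      using eventually_gt_at_top[of 0] by eventually_elim (rule lower)
    show "((\<lambda>s. real (N s) * G (t / a (N s)) D) \<longlongrightarrow> g t D) at_top"
      using filterlim_compose[OF convG[OF t D] N_lim] .
    have upper: "real (N s) * G (s * t) D
        \<le> real (N s) / real (N s - 1) * (real (N s - 1) * G (t / a (N s - 1)) D)" if "2 \<le> N s" for s
    proof -
      have "N s - 1 < N s"
        using that by simp
      then have "1 / a (N s - 1) \<le> s"
        by (rule N2)
      then have "t / a (N s - 1) \<le> s * t"
        using t a[of "N s - 1"] by (simp add: field_simps)
      then have "G (s * t) D \<le> G (t / a (N s - 1)) D"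
        using t a[of "N s - 1"] by (intro G_mono D) auto
      then have "real (N s) * G (s * t) D \<le> real (N s) * G (t / a (N s - 1)) D"
        by (intro mult_left_mono) auto
      then show ?thesis
        using that by simp
    qed
    show "\<forall>\<^sub>F s in at_top. real (N s) * G (s * t) D
        \<le> real (N s) / real (N s - 1) * (real (N s - 1) * G (t / a (N s - 1)) D)"
      using N_lim[unfolded filterlim_at_top, rule_format, of 2] by eventually_elim (rule upper)
    have "(\<lambda>n. real n / real (n - 1)) \<longlonglongrightarrow> 1"
    proof -
      have "(\<lambda>n. real (Suc n) / real n) \<longlonglongrightarrow> 1"
        by real_asymp
      then have "(\<lambda>n. real (Suc n) / real (Suc n - 1)) \<longlonglongrightarrow> 1"
        by simp
      then show ?thesis
        by (rule filterlim_sequentially_Suc[THEN iffD1])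
    qed
    from filterlim_compose[OF this N_lim]
    have "((\<lambda>s. real (N s) / real (N s - 1)) \<longlongrightarrow> 1) at_top" .
    moreover have "((\<lambda>s. real (N s - 1) * G (t / a (N s - 1)) D) \<longlongrightarrow> g t D) at_top"
      using filterlim_compose[OF convG[OF t D] N_pred_lim] .
    ultimately have "((\<lambda>s. real (N s) / real (N s - 1) * (real (N s - 1) * G (t / a (N s - 1)) D)) \<longlongrightarrow> 1 * g t D) at_top"
      by (rule tendsto_mult)
    then show "((\<lambda>s. real (N s) / real (N s - 1) * (real (N s - 1) * G (t / a (N s - 1)) D)) \<longlongrightarrow> g t D) at_top"
      by simp
  qed
  have ratio: "((\<lambda>s. G (s * t) D / G s ?S) \<longlongrightarrow> t powr (- \<gamma>) * (measure \<sigma> D / measure \<sigma> ?S)) at_top"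
    if t: "0 < t" and D: "continuity_set \<sigma> D" for t D
  proof -
    have "((\<lambda>s. (real (N s) * G (s * t) D) / (real (N s) * G (s * 1) ?S)) \<longlongrightarrow> g t D / g 1 ?S) at_top"
      using g_pos[of 1] by (intro tendsto_divide main t D S) auto
    moreover have "\<forall>\<^sub>F s in at_top. (real (N s) * G (s * t) D) / (real (N s) * G (s * 1) ?S) = G (s * t) D / G s ?S"
      using N_lim[unfolded filterlim_at_top, rule_format, of 1] by eventually_elim simp
    ultimately have "((\<lambda>s. G (s * t) D / G s ?S) \<longlongrightarrow> g t D / g 1 ?S) at_top"
      by (rule Lim_transform_eventually)
    moreover have "g t D / g 1 ?S = t powr (- \<gamma>) * (measure \<sigma> D / measure \<sigma> ?S)"
      using \<open>0 < c\<close> by (simp add: g_def)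
    ultimately show ?thesis
      by simp
  qed
  show ?thesis
    unfolding regularly_varying_iff[OF R \<sigma>]
    using \<open>0 < \<gamma>\<close> \<sigma>0 G_pos ratio unfolding G_def by simp
qed

text \<open>The normed sums have Levy measures \<open>tempered_levy p \<alpha> (scaled n (a n) R)\<close>; so the
  measures \<open>scaled n (a n) R\<close> converge on ray sets, which is regular variation along
  \<open>1 / a n\<close>.\<close>

theorem regularly_varying_if_in_domain_of_attraction:
  fixes \<sigma> :: "'a::euclidean_space measure"
  assumes TS: "is_TS p \<alpha> R b \<mu>" and \<sigma>: "finite_sphere_measure \<sigma>" "emeasure \<sigma> (sphere 0 1) \<noteq> 0"
    and "\<alpha> < \<gamma>" and \<nu>: "is_stable \<gamma> \<sigma> \<nu>" and attr: "in_domain_of_attraction \<mu> \<nu>"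
  shows "regularly_varying \<gamma> \<sigma> R"
proof -
  have p: "\<alpha> < 2" "0 < p" and R: "rosinski_measure \<alpha> R" and ID: "is_ID (tempered_levy p \<alpha> R) b \<mu>"
    using TS by (auto simp: is_TS_def)
  have levy_R: "levy_measure R"
    by (rule levy_measure_rosinski_measure[OF R p(1)])
  have levy_T: "levy_measure (tempered_levy p \<alpha> R)"
    using ID by (simp add: is_ID_iff)
  have \<gamma>: "0 < \<gamma>" "\<gamma> < 2"
    using \<nu> by (auto simp: is_stable_def)
  obtain b' where ID_\<nu>: "is_ID (stable_levy \<gamma> \<sigma>) b' \<nu>"
    using \<nu> by (auto simp: is_stable_def)
  obtain a e where a: "\<And>n. 0 < a n" and conv: "conv_in_dist (\<lambda>n. normed_sum_law \<mu> (a n) (e n) n) \<nu>"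
    using attr unfolding in_domain_of_attraction_def by blast
  define Rn where "Rn n = scaled (real n) (a n) R" for n
  have T_Rn: "tempered_levy p \<alpha> (Rn n) = scaled (real n) (a n) (tempered_levy p \<alpha> R)" for n
    unfolding Rn_def by (rule tempered_levy_scaled[OF levy_measure_sets[OF levy_R]])
  have "\<exists>d. is_ID (tempered_levy p \<alpha> (Rn n)) d (normed_sum_law \<mu> (a n) (e n) n)" for n
    unfolding T_Rn using is_ID_normed_sum_law[OF ID a] by blast
  then obtain d where ID_n: "\<And>n. is_ID (tempered_levy p \<alpha> (Rn n)) (d n) (normed_sum_law \<mu> (a n) (e n) n)"
    by metis
  have nonzero: "emeasure (stable_levy \<gamma> \<sigma>) UNIV \<noteq> 0"
  proof
    assume "emeasure (stable_levy \<gamma> \<sigma>) UNIV = 0"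
    then have "emeasure (stable_levy \<gamma> \<sigma>) (ray_set 1 (sphere 0 1)) = 0"
      using emeasure_mono[of "ray_set 1 (sphere 0 1)" UNIV "stable_levy \<gamma> \<sigma>"] by simp
    moreover have "sphere 0 1 \<in> sets \<sigma>"
      using continuity_set_sphere[OF \<sigma>(1)] by (simp add: continuity_set_def)
    ultimately show False
      using \<sigma> \<gamma> by (simp add: emeasure_stable_levy_ray_set)
  qed
  interpret C: tempered_levy_convergence Rn \<sigma> p \<alpha> \<gamma>
  proof
    show "levy_measure (Rn n)" for n
      unfolding Rn_def using a[of n] by (intro levy_measure_scaled levy_R) auto
    show "levy_measure (tempered_levy p \<alpha> (Rn n))" for n
      using ID_n by (auto simp: is_ID_iff)
    show "(\<lambda>n. LINT x|tempered_levy p \<alpha> (Rn n). f x) \<longlonglongrightarrow> (LINT x|stable_levy \<gamma> \<sigma>. f x)"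
      if "continuous_on UNIV f" "bounded (range f)" "0 < r" "\<And>x. norm x < r \<Longrightarrow> f x = 0" for f :: "'a \<Rightarrow> real" and r
      by (rule ID_convergence_imp_levy_measure_convergence[OF conv ID_n ID_\<nu> nonzero that])
  qed (use \<sigma> p \<gamma> \<open>\<alpha> < \<gamma>\<close> in auto)
  show ?thesis
  proof (rule regularly_varying_from_sequence[OF levy_R \<sigma> \<gamma>(1) _ a])
    show "0 < C.tail_factor 1"
      by (rule C.tail_factor_pos) simp
    fix r D assume r: "0 < (r::real)" and D: "continuity_set \<sigma> D"
    have "C.tail_factor r = C.tail_factor 1 * r powr (- \<gamma>)"
      by (simp add: C.tail_factor_def)
    moreover have "D \<in> sets borel"
      using D sets_finite_sphere_measure[OF \<sigma>(1)] by (simp add: continuity_set_def)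
    ultimately show "(\<lambda>n. real n * measure R (ray_set (r / a n) D)) \<longlonglongrightarrow> C.tail_factor 1 * r powr (- \<gamma>) * measure \<sigma> D"
      using C.ray_set_convergence[OF r D] measure_scaled_ray_set[OF levy_measure_sets[OF levy_R] _ a]
      unfolding Rn_def by simp
  qed
qed

section \<open>Integrals over annuli\<close>

text \<open>The law of \<open>dist u\<close> under a finite measure has at most countably many atoms.\<close>

lemma ex_null_radius:
  fixes \<sigma> :: "'a::euclidean_space measure"
  assumes \<sigma>: "finite_sphere_measure \<sigma>" and "0 < \<delta>"
  obtains \<rho> where "0 < \<rho>" "\<rho> < \<delta>" "emeasure \<sigma> {v \<in> sphere 0 1. dist u v = \<rho>} = 0"
proof -
  interpret \<sigma>: finite_measure \<sigma>
    by (rule finite_measure_finite_sphere_measure[OF \<sigma>])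
  note [measurable] = finite_sphere_measure_measurable_id[OF \<sigma>]
  have m: "(\<lambda>v. dist u v) \<in> \<sigma> \<rightarrow>\<^sub>M borel"
    by measurable
  interpret d: finite_measure "distr \<sigma> borel (\<lambda>v. dist u v)"
    by (rule \<sigma>.finite_measure_distr[OF m])
  have "\<exists>\<rho>. \<rho> \<in> {0<..<\<delta>} - {x. measure (distr \<sigma> borel (\<lambda>v. dist u v)) {x} \<noteq> 0}"
    using uncountable_open_interval[of 0 \<delta>] \<open>0 < \<delta>\<close> uncountable_minus_countable[OF _ d.countable_support]
    by (metis countable_empty ex_in_conv)
  then obtain \<rho> where \<rho>: "0 < \<rho>" "\<rho> < \<delta>" "measure (distr \<sigma> borel (\<lambda>v. dist u v)) {\<rho>} = 0"
    by auto
  have "(\<lambda>v. dist u v) -` {\<rho>} \<inter> space \<sigma> = {v \<in> sphere 0 1. dist u v = \<rho>}"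
    by (auto simp: space_finite_sphere_measure[OF \<sigma>])
  then have "emeasure \<sigma> {v \<in> sphere 0 1. dist u v = \<rho>} = 0"
    using \<rho>(3) m by (simp add: measure_distr \<sigma>.emeasure_eq_measure)
  then show ?thesis
    using that \<rho> by blast
qed

lemma continuity_set_ball:
  fixes \<sigma> :: "'a::euclidean_space measure"
  assumes \<sigma>: "finite_sphere_measure \<sigma>" and null: "emeasure \<sigma> {v \<in> sphere 0 1. dist u v = \<rho>} = 0"
  shows "continuity_set \<sigma> (sphere 0 1 \<inter> ball u \<rho>)"
proof -
  let ?X = "top_of_set (sphere (0::'a) 1)" and ?B = "sphere 0 1 \<inter> ball u \<rho>"
  have B_sets: "?B \<in> sets \<sigma>" "{v \<in> sphere 0 1. dist u v = \<rho>} \<in> sets \<sigma>"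
    by (auto simp: sets_finite_sphere_measure[OF \<sigma>] intro!: borel_closed closed_Collect_eq continuous_intros)
  have "?X closure_of ?B \<subseteq> sphere 0 1 \<inter> cball u \<rho>"
  proof (rule closure_of_minimal)
    show "closedin ?X (sphere 0 1 \<inter> cball u \<rho>)"
      by (rule closedin_closed_Int) simp
  qed auto
  moreover have "?X interior_of ?B = ?B"
    by (simp add: interior_of_openin openin_open_Int)
  ultimately have "?X frontier_of ?B \<subseteq> {v \<in> sphere 0 1. dist u v = \<rho>}"
    unfolding frontier_of_def by (auto simp: less_le)
  then have "emeasure \<sigma> (?X frontier_of ?B) \<le> emeasure \<sigma> {v \<in> sphere 0 1. dist u v = \<rho>}"
    using B_sets(2) by (rule emeasure_mono)
  then show ?thesis
    using B_sets null by (simp add: continuity_set_def)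
qed

lemma sphere_partition:
  fixes \<sigma> :: "'a::euclidean_space measure"
  assumes \<sigma>: "finite_sphere_measure \<sigma>" and "0 < \<delta>"
  obtains m :: nat and D and u :: "nat \<Rightarrow> 'a" where
    "\<And>i. i < m \<Longrightarrow> continuity_set \<sigma> (D i)" "disjoint_family_on D {..<m}" "(\<Union>i<m. D i) = sphere 0 1"
    "\<And>i v. i < m \<Longrightarrow> v \<in> D i \<Longrightarrow> dist (u i) v < \<delta>" "\<And>i. i < m \<Longrightarrow> u i \<in> sphere 0 1"
proof -
  have "\<exists>\<rho>. 0 < \<rho> \<and> \<rho> < \<delta> \<and> emeasure \<sigma> {v \<in> sphere 0 1. dist u v = \<rho>} = 0" for u
    using ex_null_radius[OF \<sigma> \<open>0 < \<delta>\<close>, of u] by blast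
  then obtain \<rho> where \<rho>: "\<And>u. 0 < \<rho> u" "\<And>u. \<rho> u < \<delta>" "\<And>u. emeasure \<sigma> {v \<in> sphere 0 1. dist u v = \<rho> u} = 0"
    by metis
  have cover: "sphere 0 1 \<subseteq> (\<Union>u\<in>sphere (0::'a) 1. ball u (\<rho> u))"
    using \<rho>(1) by force
  obtain C where C: "C \<subseteq> sphere 0 1" "finite C" "sphere (0::'a) 1 \<subseteq> (\<Union>u\<in>C. ball u (\<rho> u))"
    by (rule compactE_image[OF compact_sphere _ cover]) auto
  obtain us where us: "set us = C"
    using finite_list[OF C(2)] by blast
  define B where "B i = sphere 0 1 \<inter> ball (us ! i) (\<rho> (us ! i))" for i
  define D where "D i = B i - (\<Union>j<i. B j)" for i
  have B_cont: "continuity_set \<sigma> (B i)" for i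
    unfolding B_def by (rule continuity_set_ball[OF \<sigma> \<rho>(3)])
  have D_cont: "continuity_set \<sigma> (D i)" for i
  proof -
    have "continuity_set \<sigma> (B i - (\<Union>j<k. B j))" for k
    proof (induction k)
      case 0
      then show ?case
        using B_cont by simp
    next
      case (Suc k)
      have "B i - (\<Union>j<Suc k. B j) = (B i - (\<Union>j<k. B j)) \<inter> (sphere 0 1 - B k)"
        by (auto simp: lessThan_Suc B_def)
      then show ?case
        using continuity_set_Int[OF \<sigma> Suc continuity_set_complement[OF \<sigma> B_cont]] by simp
    qed
    then show ?thesis
      by (simp add: D_def)
  qed
  have "disjoint_family_on D {..<length us}"
    unfolding disjoint_family_on_def D_def
  proof (intro ballI impI)
    fix i j :: nat assume "i \<noteq> j"
    then consider "i < j" | "j < i"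
      by linarith
    then show "(B i - (\<Union>j<i. B j)) \<inter> (B j - (\<Union>j<j. B j)) = {}"
      by cases auto
  qed
  moreover have "(\<Union>i<length us. D i) = sphere 0 1"
  proof
    show "(\<Union>i<length us. D i) \<subseteq> sphere 0 1"
      by (auto simp: D_def B_def)
    show "sphere 0 1 \<subseteq> (\<Union>i<length us. D i)"
    proof
      fix x :: 'a assume x: "x \<in> sphere 0 1"
      then obtain w where "w \<in> C" "x \<in> ball w (\<rho> w)"
        using C(3) by blast
      then obtain i where i: "i < length us" "x \<in> B i"
        using x us by (auto simp: in_set_conv_nth B_def)
      define i0 where "i0 = (LEAST i. x \<in> B i)"
      have "x \<in> B i0" "i0 \<le> i"
        unfolding i0_def using i(2) by (auto intro: LeastI Least_le)
      moreover have "x \<notin> B j" if "j < i0" for j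
        using not_less_Least[OF that[unfolded i0_def]] .
      ultimately have "x \<in> D i0" "i0 < length us"
        using i(1) by (auto simp: D_def)
      then show "x \<in> (\<Union>i<length us. D i)"
        by blast
    qed
  qed
  moreover have "dist (us ! i) v < \<delta>" if "v \<in> D i" for i v
    using that \<rho>(2)[of "us ! i"] by (auto simp: D_def B_def)
  moreover have "us ! i \<in> sphere 0 1" if "i < length us" for i
    using that us C(1) nth_mem by blast
  ultimately show ?thesis
    using D_cont by (intro that[of "length us" D "(!) us"]) auto
qed

text \<open>The annulus is cut into cells that are products of a radial interval and a small
  continuity set. On them \<open>h\<close> is almost constant by uniform continuity, and the masses of
  the cells, being differences of masses of ray sets, converge. The total mass of the
  annulus stays bounded.\<close>

lemma annulus_integral_convergence:
  fixes N :: "nat \<Rightarrow> 'a::euclidean_space measure" and \<sigma> N' :: "'a measure" and h :: "'a \<Rightarrow> real"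
  assumes \<sigma>: "finite_sphere_measure \<sigma>" and N: "\<And>n. levy_measure (N n)" and N': "levy_measure N'"
    and conv: "\<And>r D. 0 < r \<Longrightarrow> continuity_set \<sigma> D \<Longrightarrow>
      (\<lambda>n. measure (N n) (ray_set r D)) \<longlonglongrightarrow> measure N' (ray_set r D)"
    and h: "continuous_on {x. x \<noteq> 0} h" and h_meas [measurable]: "h \<in> borel_measurable borel"
    and \<epsilon>K: "0 < \<epsilon>" "\<epsilon> < K"
  shows "(\<lambda>n. LINT x|N n. indicator {x. \<epsilon> < norm x \<and> norm x \<le> K} x * h x)
    \<longlonglongrightarrow> (LINT x|N'. indicator {x. \<epsilon> < norm x \<and> norm x \<le> K} x * h x)"
proof (rule LIMSEQ_I)
  fix e :: real assume "0 < e"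
  let ?S = "sphere 0 1 :: 'a set"
  define A where "A = {x::'a. \<epsilon> < norm x \<and> norm x \<le> K}"
  have A_meas [measurable]: "A \<in> sets borel"
    unfolding A_def by measurable
  have S: "continuity_set \<sigma> ?S"
    by (rule continuity_set_sphere[OF \<sigma>])
  have cs_borel: "D \<in> sets borel" if "continuity_set \<sigma> D" for D
    using that sets_finite_sphere_measure[OF \<sigma>] by (simp add: continuity_set_def)
  have "convergent (\<lambda>n. measure (N n) (ray_set \<epsilon> ?S))"
    using conv[OF \<epsilon>K(1) S] by (rule convergentI)
  then have "Bseq (\<lambda>n. measure (N n) (ray_set \<epsilon> ?S))"
    by (rule convergent_imp_Bseq)
  then obtain C0 where C0: "\<And>n. \<bar>measure (N n) (ray_set \<epsilon> ?S)\<bar> \<le> C0"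
    by (auto simp: Bseq_def)
  define C where "C = max C0 (measure N' (ray_set \<epsilon> ?S)) + 1"
  have C: "0 < C" "measure (N n) (ray_set \<epsilon> ?S) \<le> C" "measure N' (ray_set \<epsilon> ?S) \<le> C" for n
    using C0[of n] measure_nonneg[of N' "ray_set \<epsilon> ?S"] unfolding C_def by linarith+
  define \<eta> where "\<eta> = e / (3 * C)"
  have \<eta>: "0 < \<eta>" "\<eta> * C = e / 3"
    using \<open>0 < e\<close> C(1) by (simp_all add: \<eta>_def)
  define A' where "A' = {x::'a. \<epsilon> \<le> norm x \<and> norm x \<le> K}"
  have "A' = cball 0 K - ball 0 \<epsilon>"
    by (auto simp: A'_def)
  then have "compact A'"
    by (simp add: compact_diff)
  moreover have "continuous_on A' h"
    using \<epsilon>K by (intro continuous_on_subset[OF h]) (auto simp: A'_def)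
  ultimately have "uniformly_continuous_on A' h"
    by (intro compact_uniformly_continuous)
  then obtain \<delta> where \<delta>: "0 < \<delta>" "\<And>x y. x \<in> A' \<Longrightarrow> y \<in> A' \<Longrightarrow> dist x y < \<delta> \<Longrightarrow> dist (h x) (h y) < \<eta>"
    using \<eta>(1) unfolding uniformly_continuous_on_def by metis
  have h_bd: "\<exists>B. \<forall>x\<in>A'. \<bar>h x\<bar> \<le> B"
    using compact_imp_bounded[OF compact_continuous_image[OF \<open>continuous_on A' h\<close> \<open>compact A'\<close>]]
    by (auto simp: bounded_iff)
  then obtain B where B: "\<And>x. x \<in> A' \<Longrightarrow> \<bar>h x\<bar> \<le> B"
    by blast
  obtain m :: nat and D and u :: "nat \<Rightarrow> 'a" where D: "\<And>i. i < m \<Longrightarrow> continuity_set \<sigma> (D i)"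
    and D_disj: "disjoint_family_on D {..<m}" and D_UN: "(\<Union>i<m. D i) = ?S"
    and D_near: "\<And>i v. i < m \<Longrightarrow> v \<in> D i \<Longrightarrow> dist (u i) v < \<delta> / (2 * K)" and u: "\<And>i. i < m \<Longrightarrow> u i \<in> ?S"
    using sphere_partition[OF \<sigma>, of "\<delta> / (2 * K)"] \<delta>(1) \<epsilon>K by auto
  obtain M :: nat where M: "2 * (K - \<epsilon>) / \<delta> < real M"
    using reals_Archimedean2 by blast
  then have "0 < M"
    using \<epsilon>K \<delta>(1) by (metis divide_pos_pos less_trans mult_pos_pos diff_gt_0_iff_gt of_nat_0_less_iff zero_less_numeral)
  define t where "t j = \<epsilon> + (K - \<epsilon>) * real j / real M" for j :: nat
  have t_0: "t 0 = \<epsilon>" and t_M: "t M = K"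
    using \<open>0 < M\<close> by (simp_all add: t_def)
  have t_step: "t (Suc j) - t j < \<delta> / 2" for j
  proof -
    have "t (Suc j) - t j = (K - \<epsilon>) / real M"
      by (simp add: t_def ring_distribs add_divide_distrib diff_divide_distrib)
    also have "\<dots> < \<delta> / 2"
      using M \<open>0 < M\<close> \<delta>(1) by (simp add: field_simps)
    finally show ?thesis .
  qed
  have t_mono: "t i \<le> t j" if "i \<le> j" for i j
    using that \<epsilon>K by (simp add: t_def divide_right_mono mult_left_mono)
  have t_pos: "0 < t j" for j
    using t_mono[of 0 j] t_0 \<epsilon>K by simp
  define cell where "cell = (\<lambda>(i, j). ray_set (t j) (D i) - ray_set (t (Suc j)) (D i))"
  define I where "I = {..<m} \<times> {..<M}"
  have "finite I"
    by (simp add: I_def)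
  have cell_iff: "x \<in> cell (i, j) \<longleftrightarrow> t j < norm x \<and> norm x \<le> t (Suc j) \<and> x /\<^sub>R norm x \<in> D i" for x i j
    by (auto simp: cell_def ray_set_def)
  have cell_meas [measurable]: "cell q \<in> sets borel" if "q \<in> I" for q
    using that D cs_borel unfolding cell_def I_def by (auto intro!: sets.Diff ray_set_measurable)
  have cell_sub: "cell q \<subseteq> A" if q_I: "q \<in> I" for q
  proof
    fix x assume x: "x \<in> cell q"
    obtain i j where q: "q = (i, j)" "j < M"
      using q_I by (auto simp: I_def)
    then have "\<epsilon> \<le> t j" "t (Suc j) \<le> K"
      using t_mono[of 0 j] t_mono[of "Suc j" M] t_0 t_M by auto
    then show "x \<in> A"
      using x q by (auto simp: cell_iff A_def)
  qed
  have cover: "\<exists>q\<in>I. x \<in> cell q" if x: "x \<in> A" for x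
  proof -
    have "x \<noteq> 0"
      using x \<epsilon>K by (auto simp: A_def)
    then have "x /\<^sub>R norm x \<in> ?S"
      by simp
    then obtain i where i: "i < m" "x /\<^sub>R norm x \<in> D i"
      using D_UN by blast
    define j where "j = (LEAST j. norm x \<le> t j)"
    have "norm x \<le> t M"
      using x by (simp add: A_def t_M)
    then have j1: "norm x \<le> t j" "j \<le> M"
      unfolding j_def by (auto intro: LeastI Least_le)
    have "j \<noteq> 0"
    proof
      assume "j = 0"
      then show False
        using j1(1) x t_0 by (simp add: A_def)
    qed
    then obtain j' where j': "j = Suc j'"
      using not0_implies_Suc by blast
    have "t j' < norm x"
      using not_less_Least[of j' "\<lambda>j. norm x \<le> t j"] j' unfolding j_def by simp
    then have "x \<in> cell (i, j')"
      using i j1 j' by (simp add: cell_iff)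
    moreover have "(i, j') \<in> I"
      using i j1 j' by (simp add: I_def)
    ultimately show ?thesis
      by blast
  qed
  have uniq: "q = q'" if "q \<in> I" "q' \<in> I" "x \<in> cell q" "x \<in> cell q'" for q q' x
  proof -
    obtain i j i' j' where q: "q = (i, j)" "q' = (i', j')" and ij: "i < m" "i' < m"
      using \<open>q \<in> I\<close> \<open>q' \<in> I\<close> by (auto simp: I_def)
    have "i = i'"
      using that q ij D_disj by (auto simp: cell_iff disjoint_family_on_def)
    moreover have "\<not> j < j'" "\<not> j' < j"
      using that q t_mono[of "Suc j" j'] t_mono[of "Suc j'" j] by (auto simp: cell_iff)
    ultimately show ?thesis
      using q by simp
  qed
  define pt where "pt = (\<lambda>(i, j). t (Suc j) *\<^sub>R u i)"
  have pt: "\<bar>h x - h (pt q)\<bar> \<le> \<eta>" if q: "q \<in> I" and x: "x \<in> cell q" for q x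
  proof -
    obtain i j where ij: "q = (i, j)" "i < m" "j < M"
      using q by (auto simp: I_def)
    have xc: "t j < norm x" "norm x \<le> t (Suc j)" "x /\<^sub>R norm x \<in> D i"
      using x ij by (auto simp: cell_iff)
    have "norm (u i) = 1"
      using u[OF ij(2)] by simp
    have tK: "t (Suc j) \<le> K" "\<epsilon> \<le> t (Suc j)"
      using t_mono[of "Suc j" M] t_mono[of 0 "Suc j"] t_M t_0 ij by auto
    then have pA: "pt q \<in> A'"
      using ij t_pos[of "Suc j"] \<open>norm (u i) = 1\<close> by (simp add: A'_def pt_def)
    have xA: "x \<in> A'"
      using cell_sub[OF q] x by (auto simp: A_def A'_def)
    have x0: "0 < norm x"
      using xc(1) t_pos[of j] by linarith
    have "x - pt q = norm x *\<^sub>R (x /\<^sub>R norm x - u i) + (norm x - t (Suc j)) *\<^sub>R u i"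
      using ij x0 by (simp add: pt_def algebra_simps)
    then have "norm (x - pt q) \<le> norm x * norm (x /\<^sub>R norm x - u i) + \<bar>norm x - t (Suc j)\<bar>"
      using norm_triangle_ineq[of "norm x *\<^sub>R (x /\<^sub>R norm x - u i)" "(norm x - t (Suc j)) *\<^sub>R u i"] \<open>norm (u i) = 1\<close>
      by simp
    also have "\<dots> < \<delta> / 2 + \<delta> / 2"
    proof (rule add_le_less_mono)
      have "norm (x /\<^sub>R norm x - u i) < \<delta> / (2 * K)"
        using D_near[OF ij(2) xc(3)] by (simp add: dist_norm norm_minus_commute)
      then have "norm x * norm (x /\<^sub>R norm x - u i) \<le> K * (\<delta> / (2 * K))"
        using xA \<epsilon>K by (intro mult_mono) (auto simp: A'_def)
      then show "norm x * norm (x /\<^sub>R norm x - u i) \<le> \<delta> / 2"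
        using \<epsilon>K by simp
      show "\<bar>norm x - t (Suc j)\<bar> < \<delta> / 2"
        using xc(1,2) t_step[of j] by linarith
    qed
    finally have "dist x (pt q) < \<delta>"
      by (simp add: dist_norm)
    then show ?thesis
      using \<delta>(2)[OF xA pA] by (simp add: dist_real_def less_imp_le)
  qed
  define g where "g x = (\<Sum>q\<in>I. h (pt q) * indicator (cell q) x)" for x
  have hg: "\<bar>indicator A x * h x - g x\<bar> \<le> \<eta> * indicator (ray_set \<epsilon> ?S) x" for x
  proof (cases "x \<in> A")
    case True
    then obtain q where q: "q \<in> I" "x \<in> cell q"
      using cover by blast
    have zero: "h (pt q') * indicator (cell q') x = 0" if "q' \<in> I - {q}" for q'
    proof -
      have "x \<notin> cell q'"
        using that q uniq[of q' q x] by blast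
      then show ?thesis
        by simp
    qed
    have "g x = (\<Sum>q'\<in>{q}. h (pt q') * indicator (cell q') x)"
      unfolding g_def by (rule sum.mono_neutral_right[OF \<open>finite I\<close>]) (use q(1) zero in blast)+
    moreover have "x \<in> ray_set \<epsilon> ?S"
      using True \<epsilon>K by (simp add: ray_set_sphere A_def)
    ultimately show ?thesis
      using pt[OF q] q(2) True by simp
  next
    case False
    then have "g x = 0"
      unfolding g_def using cell_sub by (intro sum.neutral) (auto simp: indicator_def)
    then show ?thesis
      using False \<eta>(1) by (simp add: indicator_def)
  qed
  have int_cell: "integrable P (indicator (cell q) :: 'a \<Rightarrow> real)"
    and measure_cell: "q = (i, j) \<Longrightarrow> measure P (cell q) = measure P (ray_set (t j) (D i)) - measure P (ray_set (t (Suc j)) (D i))"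
    if P: "levy_measure P" and q: "q \<in> I" for P q i j
  proof -
    obtain i' j' where ij: "q = (i', j')" "i' < m"
      using q by (auto simp: I_def)
    have sub: "ray_set (t (Suc j')) (D i') \<subseteq> ray_set (t j') (D i')"
      using t_mono[of j' "Suc j'"] by (auto simp: ray_set_def)
    have fm: "ray_set (t j) (D i') \<in> fmeasurable P" for j
      by (rule fmeasurable_ray_set[OF P t_pos cs_borel[OF D[OF ij(2)]]])
    then have "cell q \<in> fmeasurable P"
      unfolding ij cell_def by (auto intro: fmeasurable.Diff)
    then show "integrable P (indicator (cell q) :: 'a \<Rightarrow> real)"
      by (intro integrable_real_indicator) (auto simp: fmeasurable_def)
    show "measure P (cell q) = measure P (ray_set (t j) (D i)) - measure P (ray_set (t (Suc j)) (D i))" if "q = (i, j)"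
      using that ij fm sub by (simp add: cell_def measure_Diff fmeasurableD fmeasurableD2)
  qed
  have int_A: "integrable P (\<lambda>x. indicator A x * h x)" if P: "levy_measure P" for P
  proof (rule Bochner_Integration.integrable_bound)
    have [measurable_cong]: "sets P = sets borel"
      by (rule levy_measure_sets[OF P])
    show "integrable P (\<lambda>x. B * indicator (ray_set \<epsilon> ?S) x)"
      using fmeasurable_ray_set[OF P \<epsilon>K(1) cs_borel[OF S]]
      by (intro integrable_mult_right integrable_real_indicator) (auto simp: fmeasurable_def)
    show "(\<lambda>x. indicator A x * h x) \<in> borel_measurable P"
      by measurable
    show "AE x in P. norm (indicator A x * h x) \<le> norm (B * indicator (ray_set \<epsilon> ?S) x)"
    proof (intro AE_I2)
      fix x
      show "norm (indicator A x * h x) \<le> norm (B * indicator (ray_set \<epsilon> ?S) x)"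
      proof (cases "x \<in> A")
        case True
        then have "\<bar>h x\<bar> \<le> B" "x \<in> ray_set \<epsilon> ?S"
          using B[of x] \<epsilon>K by (auto simp: A_def A'_def ray_set_sphere)
        then show ?thesis
          using True by simp
      qed simp
    qed
  qed
  have approx: "\<bar>(LINT x|P. indicator A x * h x) - (\<Sum>q\<in>I. h (pt q) * measure P (cell q))\<bar> \<le> e / 3"
    if P: "levy_measure P" "measure P (ray_set \<epsilon> ?S) \<le> C" for P
  proof -
    have [measurable_cong]: "sets P = sets borel"
      by (rule levy_measure_sets[OF P(1)])
    have space_P: "space P = UNIV"
      using levy_measure_sets[OF P(1)] by (simp add: sets_eq_imp_space_eq)
    have int_g: "integrable P g"
      unfolding g_def using int_cell[OF P(1)] by (intro Bochner_Integration.integrable_sum integrable_mult_right)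
    have "(LINT x|P. g x) = (\<Sum>q\<in>I. h (pt q) * measure P (cell q))"
      unfolding g_def using int_cell[OF P(1)]
      by (subst Bochner_Integration.integral_sum) (auto simp: space_P)
    then have "\<bar>(LINT x|P. indicator A x * h x) - (\<Sum>q\<in>I. h (pt q) * measure P (cell q))\<bar>
        = \<bar>LINT x|P. indicator A x * h x - g x\<bar>"
      using int_g int_A[OF P(1)] by simp
    also have "\<dots> \<le> (LINT x|P. \<bar>indicator A x * h x - g x\<bar>)"
      by (rule integral_abs_bound)
    also have "\<dots> \<le> (LINT x|P. \<eta> * indicator (ray_set \<epsilon> ?S) x)"
    proof (rule integral_mono[OF _ _ hg])
      show "integrable P (\<lambda>x. \<bar>indicator A x * h x - g x\<bar>)"
        using int_g int_A[OF P(1)] by simp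
      show "integrable P (\<lambda>x. \<eta> * indicator (ray_set \<epsilon> ?S) x)"
        using fmeasurable_ray_set[OF P(1) \<epsilon>K(1) cs_borel[OF S]]
        by (intro integrable_mult_right integrable_real_indicator) (auto simp: fmeasurable_def)
    qed
    also have "\<dots> = \<eta> * measure P (ray_set \<epsilon> ?S)"
      by (simp add: space_P)
    also have "\<dots> \<le> \<eta> * C"
      using P(2) \<eta>(1) by (intro mult_left_mono) auto
    finally show ?thesis
      using \<eta>(2) by simp
  qed
  have "(\<lambda>n. \<Sum>q\<in>I. h (pt q) * measure (N n) (cell q)) \<longlonglongrightarrow> (\<Sum>q\<in>I. h (pt q) * measure N' (cell q))"
  proof (intro tendsto_sum tendsto_mult tendsto_const)
    fix q assume q: "q \<in> I"
    then obtain i j where ij: "q = (i, j)" "i < m"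
      by (auto simp: I_def)
    show "(\<lambda>n. measure (N n) (cell q)) \<longlonglongrightarrow> measure N' (cell q)"
      unfolding measure_cell[OF N q ij(1)] measure_cell[OF N' q ij(1)]
      by (intro tendsto_diff conv t_pos D ij)
  qed
  from tendstoD[OF this, of "e / 3"]
  have "\<forall>\<^sub>F n in sequentially. \<bar>(\<Sum>q\<in>I. h (pt q) * measure (N n) (cell q)) - (\<Sum>q\<in>I. h (pt q) * measure N' (cell q))\<bar> < e / 3"
    using \<open>0 < e\<close> unfolding dist_real_def by simp
  then have "\<forall>\<^sub>F n in sequentially. norm ((LINT x|N n. indicator A x * h x) - (LINT x|N'. indicator A x * h x)) < e"
  proof eventually_elim
    case (elim n)
    then show ?case
      using approx[OF N C(2), of n] approx[OF N' C(3)] unfolding real_norm_def by linarith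
  qed
  then show "\<exists>no. \<forall>n\<ge>no. norm ((LINT x|N n. indicator {x. \<epsilon> < norm x \<and> norm x \<le> K} x * h x)
      - (LINT x|N'. indicator {x. \<epsilon> < norm x \<and> norm x \<le> K} x * h x)) < e"
    by (simp add: eventually_sequentially A_def)
qed

section \<open>Norming sequences and truncated moments\<close>

locale regularly_varying_levy_measure =
  fixes R \<sigma> :: "'a::euclidean_space measure" and \<gamma> :: real
  assumes R: "levy_measure R" and \<sigma>: "finite_sphere_measure \<sigma>" and \<gamma>: "0 < \<gamma>" "\<gamma> < 2"
    and rv: "regularly_varying \<gamma> \<sigma> R"
begin

definition "tail_mass s = measure R (ray_set s (sphere 0 1))"

lemma tail_mass_pos: "0 < s \<Longrightarrow> 0 < tail_mass s"
  using rv unfolding regularly_varying_iff[OF R \<sigma>] tail_mass_def by blast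

lemma \<sigma>_pos: "0 < measure \<sigma> (sphere 0 1)"
proof -
  interpret \<sigma>: finite_measure \<sigma>
    by (rule finite_measure_finite_sphere_measure[OF \<sigma>])
  have "emeasure \<sigma> (sphere 0 1) \<noteq> 0"
    using rv by (simp add: regularly_varying_def)
  then show ?thesis
    by (simp add: \<sigma>.emeasure_eq_measure zero_less_measure_iff)
qed

lemma ratio_lim:
  assumes "0 < t" "continuity_set \<sigma> D"
  shows "((\<lambda>s. measure R (ray_set (s * t) D) / tail_mass s)
    \<longlongrightarrow> t powr (- \<gamma>) * (measure \<sigma> D / measure \<sigma> (sphere 0 1))) at_top"
  using rv assms unfolding regularly_varying_iff[OF R \<sigma>] tail_mass_def by blast

lemma tail_mass_ratio_lim:
  assumes "0 < t"
  shows "((\<lambda>s. tail_mass (s * t) / tail_mass s) \<longlongrightarrow> t powr (- \<gamma>)) at_top"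
  using ratio_lim[OF assms continuity_set_sphere[OF \<sigma>]] \<sigma>_pos by (simp add: tail_mass_def)

lemma tail_mass_mono: "0 < s \<Longrightarrow> s \<le> t \<Longrightarrow> tail_mass t \<le> tail_mass s"
  unfolding tail_mass_def using fmeasurable_ray_set[OF R, of _ "sphere 0 1"]
  by (intro measure_mono_fmeasurable) (auto simp: ray_set_def intro: fmeasurableD)

lemma tail_mass_small:
  assumes "0 < e"
  obtains s where "0 < s" "tail_mass s < e"
proof -
  define A where "A n = ray_set (real (Suc n)) (sphere (0::'a) 1)" for n
  have fm: "A n \<in> fmeasurable R" for n
    unfolding A_def by (rule fmeasurable_ray_set[OF R]) auto
  have "(\<lambda>n. measure R (A n)) \<longlonglongrightarrow> measure R (\<Inter>n. A n)"
  proof (rule Lim_measure_decseq)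
    show "range A \<subseteq> sets R"
      using fm by (auto intro: fmeasurableD)
    show "decseq A"
      by (auto simp: decseq_def A_def ray_set_def)
    show "emeasure R (A n) \<noteq> \<infinity>" for n
      using fm[of n] by (auto simp: fmeasurable_def)
  qed
  moreover have "(\<Inter>n. A n) = {}"
  proof -
    have "\<exists>n. x \<notin> A n" for x
    proof -
      obtain n :: nat where "norm x \<le> real n"
        using real_arch_simple by blast
      then show ?thesis
        by (intro exI[of _ n]) (simp add: A_def ray_set_def)
    qed
    then show ?thesis
      by blast
  qed
  ultimately have "\<forall>\<^sub>F n in sequentially. measure R (A n) < e"
    using \<open>0 < e\<close> by (intro order_tendstoD(2)[of _ 0]) auto
  then obtain n where "measure R (A n) < e"
    by (auto simp: eventually_sequentially)
  then show ?thesis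
    using that[of "real (Suc n)"] by (simp add: A_def tail_mass_def)
qed

text \<open>\<open>s n\<close> is the \<open>1 / n\<close>-quantile of the tail. The tail may jump at \<open>s n\<close>, but \<open>n\<close> times
  the tail is at least \<open>1\<close> just before and at most \<open>1\<close> just after \<open>s n\<close>, and regular
  variation makes the ratio of the tail at \<open>t s n\<close> and at \<open>s n\<close> converge to a value close to
  \<open>1\<close> for \<open>t\<close> near \<open>1\<close>.\<close>

lemma ex_quantile_sequence:
  obtains s where "filterlim s at_top sequentially" "\<And>n. 0 < s n" "(\<lambda>n. real n * tail_mass (s n)) \<longlonglongrightarrow> 1"
proof -
  define X where "X n = {s. 0 < s \<and> 1 < real n * tail_mass s}" for n
  \<comment> \<open>Only finitely many \<open>X n\<close> are empty; for these the value \<open>1\<close> is arbitrary.\<close>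
  define s where "s n = (if X n = {} then 1 else Sup (X n))" for n
  have bdd: "bdd_above (X n)" for n
  proof -
    obtain t where t: "0 < t" "tail_mass t < 1 / (real n + 1)"
      using tail_mass_small[of "1 / (real n + 1)"] by (metis add_pos_nonneg of_nat_0_le_iff zero_less_divide_1_iff zero_less_one add.commute)
    have "u \<le> t" if "u \<in> X n" for u
    proof (rule ccontr)
      assume "\<not> u \<le> t"
      then have "tail_mass u < 1 / (real n + 1)"
        using tail_mass_mono[of t u] t by simp
      then have "real n * tail_mass u \<le> real n * (1 / (real n + 1))"
        by (intro mult_left_mono) auto
      also have "\<dots> \<le> 1"
        by (simp add: field_simps)
      finally show False
        using that by (simp add: X_def)
    qed
    then show ?thesis
      by (rule bdd_aboveI)
  qed
  have mem: "\<forall>\<^sub>F n in sequentially. K \<in> X n" if "0 < K" for K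
  proof -
    have "\<forall>\<^sub>F n in sequentially. 1 / tail_mass K < real n"
      using filterlim_real_sequentially by (simp add: filterlim_at_top_dense)
    then show ?thesis
      by eventually_elim (use tail_mass_pos[OF that] that in \<open>simp add: X_def divide_less_eq\<close>)
  qed
  have ge: "K \<le> s n" if "K \<in> X n" for K n
    using that bdd[of n] by (auto simp: s_def intro: cSup_upper)
  have s_lim: "filterlim s at_top sequentially"
    unfolding filterlim_at_top
  proof
    fix Z :: real
    have "0 < max Z 1"
      by simp
    from mem[OF this] show "\<forall>\<^sub>F n in sequentially. Z \<le> s n"
      by eventually_elim (use ge in force)
  qed
  have s_pos: "0 < s n" for n
  proof (cases "X n = {}")
    case False
    then obtain K where "K \<in> X n"
      by blast
    then show ?thesis
      using ge[of K n] by (simp add: X_def)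
  qed (simp add: s_def)
  have above: "real n * tail_mass t \<le> 1" if "s n < t" for n t
  proof (rule ccontr)
    assume "\<not> ?thesis"
    then have "t \<in> X n"
      using that s_pos[of n] by (simp add: X_def)
    then show False
      using ge[of t n] that by simp
  qed
  have below: "1 < real n * tail_mass t" if ne: "X n \<noteq> {}" and t: "0 < t" "t < s n" for n t
  proof -
    have "t < Sup (X n)"
      using ne t by (simp add: s_def)
    then obtain u where u: "u \<in> X n" "t < u"
      using less_cSup_iff[OF ne bdd] by blast
    have "1 < real n * tail_mass u"
      using u by (simp add: X_def)
    also have "\<dots> \<le> real n * tail_mass t"
      using u t by (intro mult_left_mono tail_mass_mono) auto
    finally show ?thesis .
  qed
  have L: "(\<lambda>n. tail_mass (s n * t) / tail_mass (s n)) \<longlonglongrightarrow> t powr (- \<gamma>)" if "0 < t" for t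
    using filterlim_compose[OF tail_mass_ratio_lim[OF that] s_lim] .
  have L_inv: "(\<lambda>n. tail_mass (s n) / tail_mass (s n * t)) \<longlonglongrightarrow> t powr \<gamma>" if "0 < t" for t
    using tendsto_inverse[OF L[OF that]] that by (simp add: powr_minus)
  have powr_lim: "((\<lambda>t. t powr \<gamma>) \<longlongrightarrow> 1 powr \<gamma>) (at 1)"
    by (intro tendsto_intros) auto
  have "(\<lambda>n. real n * tail_mass (s n)) \<longlonglongrightarrow> 1"
  proof (rule order_tendstoI)
    fix y :: real assume "y < 1"
    then have "\<forall>\<^sub>F t in at_left 1. y < t powr \<gamma>"
      using powr_lim by (intro order_tendstoD[of _ 1]) (simp_all add: filterlim_at_split)
    moreover have "\<forall>\<^sub>F t in at_left (1::real). 0 < t"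
      by (intro order_tendstoD(1)[OF tendsto_ident_at]) simp
    ultimately have "\<forall>\<^sub>F t in at_left 1. 0 < t \<and> y < t powr \<gamma>"
      by eventually_elim simp
    then obtain t where t: "0 < t" "t < 1" "y < t powr \<gamma>"
      unfolding eventually_at_left_field by (metis dense)
    have "\<forall>\<^sub>F n in sequentially. y < tail_mass (s n) / tail_mass (s n * t)"
      using L_inv[OF t(1)] t(3) by (rule order_tendstoD)
    then show "\<forall>\<^sub>F n in sequentially. y < real n * tail_mass (s n)"
      using mem[of 1, OF zero_less_one]
    proof eventually_elim
      case (elim n)
      have pos: "0 < tail_mass (s n * t)" "0 < tail_mass (s n)"
        using s_pos t by (auto intro!: tail_mass_pos)
      have "1 < real n * tail_mass (s n * t)"
        using elim(2) s_pos[of n] t by (intro below) auto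
      then have "(tail_mass (s n) / tail_mass (s n * t)) * 1 < (tail_mass (s n) / tail_mass (s n * t)) * (real n * tail_mass (s n * t))"
        using pos by (intro mult_strict_left_mono) auto
      then show ?case
        using elim(1) pos by (simp add: mult.commute)
    qed
  next
    fix y :: real assume "1 < y"
    then have "\<forall>\<^sub>F t in at_right 1. t powr \<gamma> < y"
      using powr_lim by (intro order_tendstoD[of _ 1]) (simp_all add: filterlim_at_split)
    then obtain t where t: "1 < t" "t powr \<gamma> < y"
      unfolding eventually_at_right_field by (metis dense)
    have "0 < t"
      using t(1) by simp
    then have "\<forall>\<^sub>F n in sequentially. tail_mass (s n) / tail_mass (s n * t) < y"
      using L_inv t(2) by (intro order_tendstoD(2)[of _ "t powr \<gamma>"]) auto
    then show "\<forall>\<^sub>F n in sequentially. real n * tail_mass (s n) < y"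
    proof eventually_elim
      case (elim n)
      have pos: "0 < tail_mass (s n * t)" "0 < tail_mass (s n)"
        using s_pos t by (auto intro!: tail_mass_pos)
      have "real n * tail_mass (s n * t) \<le> 1"
        using s_pos[of n] t by (intro above) simp
      then have "(tail_mass (s n) / tail_mass (s n * t)) * (real n * tail_mass (s n * t)) \<le> (tail_mass (s n) / tail_mass (s n * t)) * 1"
        using pos by (intro mult_left_mono) auto
      then show ?case
        using elim pos by (simp add: mult.commute)
    qed
  qed
  then show ?thesis
    using that s_lim s_pos by blast
qed

text \<open>Rescaling the quantiles adjusts the constant in the limit, since the tail has index
  \<open>- \<gamma>\<close>.\<close>

lemma ex_norming_sequence:
  assumes "0 < c"
  obtains a where "\<And>n. 0 < a n" "filterlim (\<lambda>n. 1 / a n) at_top sequentially"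
    "\<And>r D. 0 < r \<Longrightarrow> continuity_set \<sigma> D \<Longrightarrow>
      (\<lambda>n. real n * measure R (ray_set (r / a n) D)) \<longlonglongrightarrow> c * r powr (- \<gamma>) * measure \<sigma> D"
proof -
  obtain s where s: "filterlim s at_top sequentially" "\<And>n. 0 < s n" "(\<lambda>n. real n * tail_mass (s n)) \<longlonglongrightarrow> 1"
    using ex_quantile_sequence by blast
  define q where "q = (c * measure \<sigma> (sphere 0 1)) powr (1 / \<gamma>)"
  have q: "0 < q" "q powr \<gamma> = c * measure \<sigma> (sphere 0 1)"
    using \<open>0 < c\<close> \<sigma>_pos \<gamma> by (simp_all add: q_def powr_powr)
  define a where "a n = q / s n" for n
  have "(\<lambda>n. real n * measure R (ray_set (r / a n) D)) \<longlonglongrightarrow> c * r powr (- \<gamma>) * measure \<sigma> D"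
    if r: "0 < r" and D: "continuity_set \<sigma> D" for r D
  proof -
    have "(\<lambda>n. measure R (ray_set (s n * (r / q)) D) / tail_mass (s n))
        \<longlonglongrightarrow> (r / q) powr (- \<gamma>) * (measure \<sigma> D / measure \<sigma> (sphere 0 1))"
      using filterlim_compose[OF ratio_lim[OF _ D, of "r / q"] s(1)] r q(1) by simp
    then have "(\<lambda>n. (real n * tail_mass (s n)) * (measure R (ray_set (s n * (r / q)) D) / tail_mass (s n)))
        \<longlonglongrightarrow> 1 * ((r / q) powr (- \<gamma>) * (measure \<sigma> D / measure \<sigma> (sphere 0 1)))"
      by (intro tendsto_mult s(3))
    moreover have "(real n * tail_mass (s n)) * (measure R (ray_set (s n * (r / q)) D) / tail_mass (s n))
        = real n * measure R (ray_set (r / a n) D)" for n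
      using tail_mass_pos[OF s(2)[of n]] by (simp add: a_def mult.commute)
    moreover have "(r / q) powr (- \<gamma>) = r powr (- \<gamma>) * (c * measure \<sigma> (sphere 0 1))"
      using r q by (simp add: powr_minus powr_divide field_simps)
    ultimately show ?thesis
      using \<sigma>_pos by (simp add: mult_ac)
  qed
  moreover have "filterlim (\<lambda>n. 1 / a n) at_top sequentially"
  proof -
    have "filterlim (\<lambda>n. (1 / q) * s n) at_top sequentially"
      using q(1) by (intro filterlim_tendsto_pos_mult_at_top[OF tendsto_const _ s(1)]) simp
    then show ?thesis
      by (simp add: a_def)
  qed
  ultimately show ?thesis
    using that[of a] s(2) q(1) by (simp add: a_def)
qed

lemma integrable_truncated_square:
  "integrable R (\<lambda>x. (norm x)\<^sup>2 * indicator {x. norm x \<le> s} x)"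
proof (rule integrable_levy_measure[OF R])
  fix x :: 'a
  show "norm ((norm x)\<^sup>2 * indicator {x. norm x \<le> s} x) \<le> max 1 (s\<^sup>2) * min ((norm x)\<^sup>2) 1"
  proof (cases "norm x \<le> s")
    case True
    then have sq: "(norm x)\<^sup>2 \<le> s\<^sup>2"
      by (intro power_mono) auto
    show ?thesis
    proof (cases "(norm x)\<^sup>2 \<le> 1")
      case True
      then show ?thesis
        by (simp add: indicator_def mult_right_mono[of 1 "max 1 (s\<^sup>2)" "(norm x)\<^sup>2", simplified])
    next
      case False
      then show ?thesis
        using sq by (simp add: indicator_def max.coboundedI2)
    qed
  qed simp
qed measurable

text \<open>The elementary half of Karamata's theorem. As \<open>\<gamma> < 2\<close>, the function
  \<open>H s = s\<^sup>2 tail_mass s\<close> eventually grows by a factor \<open>q > 1\<close> under doubling, while the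
  truncated moment \<open>U\<close> increases by at most \<open>4 H\<close>. So \<open>U \<le> C H\<close> propagates from \<open>s\<close> to \<open>2 s\<close>
  as soon as \<open>C + 4 \<le> C q\<close>.\<close>

lemma truncated_second_moment_bound:
  obtains C s0 where "0 < s0" "0 < C"
    "\<And>s. s0 \<le> s \<Longrightarrow> (LINT x|R. (norm x)\<^sup>2 * indicator {x. norm x \<le> s} x) \<le> C * s\<^sup>2 * tail_mass s"
proof -
  define U where "U s = (LINT x|R. (norm x)\<^sup>2 * indicator {x. norm x \<le> s} x)" for s
  define H where "H s = s\<^sup>2 * tail_mass s" for s
  have "(2::real) powr \<gamma> < 2 powr 2"
    using \<gamma> by (intro powr_less_mono) auto
  then have "(1::real) < 4 * 2 powr (- \<gamma>)"
    by (simp add: powr_minus field_simps)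
  then obtain q :: real where q: "1 < q" "q < 4 * 2 powr (- \<gamma>)"
    using dense by blast
  have "\<forall>\<^sub>F s in at_top. q / 4 < tail_mass (s * 2) / tail_mass s"
    using q by (intro order_tendstoD(1)[OF tail_mass_ratio_lim]) auto
  then obtain s1 where s1: "\<And>s. s1 \<le> s \<Longrightarrow> q / 4 < tail_mass (s * 2) / tail_mass s"
    unfolding eventually_at_top_linorder by blast
  define s0 where "s0 = max s1 1"
  have s0: "0 < s0"
    by (simp add: s0_def)
  have H_grow: "q * H s \<le> H (2 * s)" if "s0 \<le> s" for s
  proof -
    have "0 < s"
      using that s0 by simp
    have "q / 4 * tail_mass s \<le> tail_mass (s * 2)"
      using s1[of s] that tail_mass_pos[OF \<open>0 < s\<close>] by (simp add: s0_def field_simps)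
    then have "4 * s\<^sup>2 * (q / 4 * tail_mass s) \<le> 4 * s\<^sup>2 * tail_mass (s * 2)"
      by (intro mult_left_mono) auto
    then show ?thesis
      by (simp add: H_def power_mult_distrib mult_ac)
  qed
  have H_pos: "0 < H s" if "0 < s" for s
    using tail_mass_pos[OF that] that by (simp add: H_def)
  have U_step: "U (2 * s) \<le> U s + 4 * H s" if "0 < s" for s
  proof -
    have fm: "ray_set s (sphere 0 1) \<in> fmeasurable R"
      by (rule fmeasurable_ray_set[OF R that]) auto
    have int: "integrable R (\<lambda>x. (2 * s)\<^sup>2 * indicator (ray_set s (sphere 0 1)) x)"
      using fm by (intro integrable_mult_right integrable_real_indicator) (auto simp: fmeasurable_def)
    have "U (2 * s) \<le> (LINT x|R. (norm x)\<^sup>2 * indicator {x. norm x \<le> s} x + (2 * s)\<^sup>2 * indicator (ray_set s (sphere 0 1)) x)"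
      unfolding U_def
    proof (rule integral_mono[OF integrable_truncated_square])
      show "integrable R (\<lambda>x. (norm x)\<^sup>2 * indicator {x. norm x \<le> s} x + (2 * s)\<^sup>2 * indicator (ray_set s (sphere 0 1)) x)"
        by (intro Bochner_Integration.integrable_add integrable_truncated_square int)
      fix x :: 'a
      show "(norm x)\<^sup>2 * indicator {x. norm x \<le> 2 * s} x
          \<le> (norm x)\<^sup>2 * indicator {x. norm x \<le> s} x + (2 * s)\<^sup>2 * indicator (ray_set s (sphere 0 1)) x"
        using that power_mono[of "norm x" "2 * s" 2]
        by (auto simp: indicator_def ray_set_sphere)
    qed
    also have "\<dots> = U s + (2 * s)\<^sup>2 * tail_mass s"
      unfolding U_def tail_mass_def using int integrable_truncated_square levy_measure_sets[OF R]
      by (simp add: sets_eq_imp_space_eq)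
    finally show ?thesis
      by (simp add: H_def power_mult_distrib)
  qed
  have U_mono: "U s \<le> U t" if "s \<le> t" for s t
    unfolding U_def using that
    by (intro integral_mono integrable_truncated_square) (auto simp: indicator_def)
  define h0 where "h0 = s0\<^sup>2 * tail_mass (2 * s0)"
  have h0: "0 < h0"
    unfolding h0_def using s0 tail_mass_pos[of "2 * s0"] by simp
  define C where "C = max (U (2 * s0) / h0) (4 / (q - 1))"
  have C: "0 < C"
    using q(1) by (simp add: C_def less_max_iff_disj)
  have "4 / (q - 1) \<le> C"
    by (simp add: C_def)
  then have Cq: "C + 4 \<le> C * q"
    using q(1) by (simp add: field_simps)
  have "U s \<le> C * H s" if "s0 \<le> s" "s \<le> s0 * 2 ^ Suc k" for s k
    using that
  proof (induction k arbitrary: s)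
    case 0
    have "h0 \<le> H s"
      unfolding h0_def H_def using 0 s0 tail_mass_pos[of "2 * s0"]
      by (intro mult_mono power_mono tail_mass_mono) auto
    have "U s \<le> U (2 * s0)"
      using 0 by (intro U_mono) simp
    also have "\<dots> \<le> C * h0"
      using h0 by (simp add: C_def pos_divide_le_eq[symmetric])
    also have "\<dots> \<le> C * H s"
      using \<open>h0 \<le> H s\<close> C by (intro mult_left_mono) auto
    finally show ?case .
  next
    case (Suc k)
    show ?case
    proof (cases "s \<le> s0 * 2 ^ Suc k")
      case True
      then show ?thesis
        using Suc by blast
    next
      case False
      define t where "t = s / 2"
      have "s0 \<le> s0 * 2 ^ k"
        using s0 by simp
      then have t: "s0 \<le> t" "t \<le> s0 * 2 ^ Suc k" "s = 2 * t"
        using Suc.prems False by (auto simp: t_def)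
      then have "0 < t"
        using s0 by simp
      have "U s \<le> U t + 4 * H t"
        unfolding t(3) by (rule U_step[OF \<open>0 < t\<close>])
      also have "\<dots> \<le> C * H t + 4 * H t"
        using Suc.IH[OF t(1,2)] by simp
      also have "\<dots> \<le> C * (q * H t)"
        using mult_right_mono[OF Cq, of "H t"] H_pos[OF \<open>0 < t\<close>] by (simp add: ring_distribs)
      also have "\<dots> \<le> C * H s"
        unfolding t(3) using C by (intro mult_left_mono H_grow t) auto
      finally show ?thesis .
    qed
  qed
  moreover have "\<exists>k. s \<le> s0 * 2 ^ Suc k" for s
  proof -
    obtain k where "s / s0 < 2 ^ k"
      using real_arch_pow[of 2 "s / s0"] by auto
    then have "s < s0 * 2 ^ k"
      using s0 by (simp add: divide_less_eq mult.commute)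
    also have "\<dots> \<le> s0 * 2 ^ Suc k"
      using s0 by simp
    finally show ?thesis
      by (intro exI[of _ k]) simp
  qed
  ultimately have "U s \<le> C * H s" if "s0 \<le> s" for s
    using that by blast
  then show ?thesis
    using that[OF s0 C] by (simp add: U_def H_def mult.assoc)
qed

text \<open>As \<open>\<beta> < \<gamma>\<close>, the function \<open>H s = s powr \<beta> * tail_mass s\<close> eventually shrinks by a factor
  \<open>\<theta> < 1\<close> under doubling, and the tail moment is bounded by a geometric series over dyadic
  shells.\<close>

lemma tail_moment_bound:
  assumes \<beta>: "0 < \<beta>" "\<beta> < \<gamma>"
  obtains C s0 where "0 < s0" "0 < C"
    "\<And>s. s0 \<le> s \<Longrightarrow> integrable R (\<lambda>x. norm x powr \<beta> * indicator {x. s < norm x} x)"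
    "\<And>s. s0 \<le> s \<Longrightarrow> (LINT x|R. norm x powr \<beta> * indicator {x. s < norm x} x) \<le> C * s powr \<beta> * tail_mass s"
proof -
  have [measurable_cong]: "sets R = sets borel"
    by (rule levy_measure_sets[OF R])
  define H where "H s = s powr \<beta> * tail_mass s" for s
  have "(2::real) powr \<beta> * 2 powr (- \<gamma>) < 1"
    using \<beta> by (simp add: powr_add[symmetric] powr_less_one)
  then obtain \<theta> where \<theta>: "2 powr \<beta> * 2 powr (- \<gamma>) < \<theta>" "\<theta> < 1"
    using dense by blast
  have \<theta>0: "0 < \<theta>"
    using \<theta>(1) by (smt (verit) mult_nonneg_nonneg powr_ge_zero)
  have "\<forall>\<^sub>F s in at_top. tail_mass (s * 2) / tail_mass s < \<theta> / 2 powr \<beta>"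
    using \<theta> by (intro order_tendstoD(2)[OF tail_mass_ratio_lim]) (auto simp: field_simps)
  then obtain s1 where s1: "\<And>s. s1 \<le> s \<Longrightarrow> tail_mass (s * 2) / tail_mass s < \<theta> / 2 powr \<beta>"
    unfolding eventually_at_top_linorder by blast
  define s0 where "s0 = max s1 1"
  have s0: "0 < s0"
    by (simp add: s0_def)
  have H_step: "H (2 * s) \<le> \<theta> * H s" if "s0 \<le> s" for s
  proof -
    have "0 < s"
      using that s0 by simp
    have "tail_mass (s * 2) \<le> \<theta> / 2 powr \<beta> * tail_mass s"
      using s1[of s] that tail_mass_pos[OF \<open>0 < s\<close>] by (simp add: s0_def field_simps)
    then have "(2 * s) powr \<beta> * tail_mass (s * 2) \<le> (2 * s) powr \<beta> * (\<theta> / 2 powr \<beta> * tail_mass s)"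
      by (intro mult_left_mono) auto
    then show ?thesis
      using \<open>0 < s\<close> by (simp add: H_def powr_mult mult_ac)
  qed
  have H_pow: "H (2 ^ j * s) \<le> \<theta> ^ j * H s" if "s0 \<le> s" for s j
  proof (induction j)
    case (Suc j)
    have "1 * s \<le> 2 ^ j * s"
      using that s0 by (intro mult_right_mono) auto
    then have "H (2 * (2 ^ j * s)) \<le> \<theta> * H (2 ^ j * s)"
      using that by (intro H_step) simp
    also have "\<dots> \<le> \<theta> * (\<theta> ^ j * H s)"
      using Suc \<theta>0 by (intro mult_left_mono) auto
    finally show ?case
      by (simp add: mult.assoc)
  qed simp
  define C where "C = 2 powr \<beta> / (1 - \<theta>)"
  have C: "0 < C"
    using \<theta> by (simp add: C_def)
  have bound: "(\<integral>\<^sup>+x. ennreal (norm x powr \<beta> * indicator {x. s < norm x} x) \<partial>R) \<le> ennreal (C * H s)" if s: "s0 \<le> s" for s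
  proof -
    have s_pos: "0 < s"
      using s s0 by simp
    have H_nonneg: "0 \<le> H s"
      using tail_mass_pos[OF s_pos] by (simp add: H_def)
    let ?B = "\<lambda>j. ray_set (2 ^ j * s) (sphere (0::'a) 1)"
    have fm: "?B j \<in> fmeasurable R" for j
      using s_pos by (intro fmeasurable_ray_set[OF R]) auto
    have "(\<integral>\<^sup>+x. ennreal (norm x powr \<beta> * indicator {x. s < norm x} x) \<partial>R)
        \<le> (\<integral>\<^sup>+x. (\<Sum>j. ennreal ((2 * (2 ^ j * s)) powr \<beta>) * indicator (?B j) x) \<partial>R)"
    proof (intro nn_integral_mono)
      fix x :: 'a
      show "ennreal (norm x powr \<beta> * indicator {x. s < norm x} x)
          \<le> (\<Sum>j. ennreal ((2 * (2 ^ j * s)) powr \<beta>) * indicator (?B j) x)"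
      proof (cases "s < norm x")
        case True
        define k where "k = (LEAST k. norm x \<le> 2 ^ k * s)"
        obtain k0 where "norm x / s < 2 ^ k0"
          using real_arch_pow[of 2 "norm x / s"] by auto
        then have "norm x \<le> 2 ^ k0 * s"
          using s_pos by (simp add: divide_less_eq)
        then have k: "norm x \<le> 2 ^ k * s"
          unfolding k_def by (rule LeastI)
        have "k \<noteq> 0"
          using k True by (intro notI) simp
        then obtain j where j: "k = Suc j"
          using not0_implies_Suc by blast
        have "2 ^ j * s < norm x"
          using not_less_Least[of j "\<lambda>k. norm x \<le> 2 ^ k * s"] j unfolding k_def by simp
        then have mem: "x \<in> ?B j"
          using s_pos by (simp add: ray_set_sphere)
        have "norm x powr \<beta> \<le> (2 * (2 ^ j * s)) powr \<beta>"
          using k j \<beta> by (intro powr_mono2) (auto simp: mult.assoc)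
        then have "ennreal (norm x powr \<beta> * indicator {x. s < norm x} x)
            \<le> ennreal ((2 * (2 ^ j * s)) powr \<beta>) * indicator (?B j) x"
          using True mem by (simp add: ennreal_leI)
        also have "\<dots> = (\<Sum>i\<in>{j}. ennreal ((2 * (2 ^ i * s)) powr \<beta>) * indicator (?B i) x)"
          by (simp only: sum.insert finite.emptyI empty_iff not_False_eq_True sum.empty add_0_right)
        also have "\<dots> \<le> (\<Sum>i. ennreal ((2 * (2 ^ i * s)) powr \<beta>) * indicator (?B i) x)"
          by (rule sum_le_suminf) auto
        finally show ?thesis .
      qed simp
    qed
    also have "\<dots> = (\<Sum>j. \<integral>\<^sup>+x. ennreal ((2 * (2 ^ j * s)) powr \<beta>) * indicator (?B j) x \<partial>R)"
      using fm by (intro nn_integral_suminf) (auto intro!: borel_measurable_times_ennreal borel_measurable_indicator dest: fmeasurableD)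
    also have "\<dots> \<le> (\<Sum>j. ennreal (2 powr \<beta> * H s * \<theta> ^ j))"
    proof (rule suminf_le)
      fix j
      have "(\<integral>\<^sup>+x. ennreal ((2 * (2 ^ j * s)) powr \<beta>) * indicator (?B j) x \<partial>R)
          = ennreal ((2 * (2 ^ j * s)) powr \<beta>) * ennreal (tail_mass (2 ^ j * s))"
        using fm[of j] by (subst nn_integral_cmult_indicator) (auto simp: tail_mass_def fmeasurableD emeasure_eq_measure2)
      also have "\<dots> = ennreal (2 powr \<beta> * H (2 ^ j * s))"
        using s_pos by (simp add: H_def powr_mult tail_mass_def mult_ac flip: ennreal_mult)
      also have "\<dots> \<le> ennreal (2 powr \<beta> * H s * \<theta> ^ j)"
        using H_pow[OF s, of j] by (intro ennreal_leI) (simp add: mult_ac)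
      finally show "(\<integral>\<^sup>+x. ennreal ((2 * (2 ^ j * s)) powr \<beta>) * indicator (?B j) x \<partial>R) \<le> ennreal (2 powr \<beta> * H s * \<theta> ^ j)" .
    qed auto
    also have "\<dots> = ennreal (\<Sum>j. 2 powr \<beta> * H s * \<theta> ^ j)"
      using \<theta> \<theta>0 H_nonneg by (intro suminf_ennreal2) (auto intro!: summable_mult summable_geometric)
    also have "(\<Sum>j. 2 powr \<beta> * H s * \<theta> ^ j) = C * H s"
      using \<theta> \<theta>0 by (simp add: suminf_mult summable_geometric suminf_geometric C_def)
    finally show ?thesis .
  qed
  have int: "integrable R (\<lambda>x. norm x powr \<beta> * indicator {x. s < norm x} x)" if s: "s0 \<le> s" for s
  proof (rule integrableI_nonneg)
    show "(\<integral>\<^sup>+x. ennreal (norm x powr \<beta> * indicator {x. s < norm x} x) \<partial>R) < \<infinity>"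
      using bound[OF s] by (rule le_less_trans) simp
  qed auto
  have "(LINT x|R. norm x powr \<beta> * indicator {x. s < norm x} x) \<le> C * s powr \<beta> * tail_mass s" if s: "s0 \<le> s" for s
  proof -
    have "0 \<le> C * H s"
      using C tail_mass_pos[of s] s s0 by (simp add: H_def)
    moreover have "ennreal (LINT x|R. norm x powr \<beta> * indicator {x. s < norm x} x) \<le> ennreal (C * H s)"
      using bound[OF s] int[OF s] by (subst nn_integral_eq_integral[symmetric]) auto
    ultimately show ?thesis
      by (simp add: H_def mult.assoc)
  qed
  then show ?thesis
    using that[OF s0 C] int by blast
qed

end

section \<open>Convergence of integrals against rescaled measures\<close>

lemma integrable_scaled:
  fixes f :: "'a::euclidean_space \<Rightarrow> real"
  assumes N: "sets N = sets borel" and f: "f \<in> borel_measurable borel" and int: "integrable N (\<lambda>x. f (a *\<^sub>R x))" and "0 \<le> c"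
  shows "integrable (scaled c a N) f"
proof -
  have [measurable_cong]: "sets N = sets borel" by fact
  note f [measurable]
  have "integrable (distr N borel (\<lambda>x. a *\<^sub>R x)) f"
    using int by (subst integrable_distr_eq) auto
  then show ?thesis
    unfolding scaled_def using \<open>0 \<le> c\<close> by (subst integrable_density) auto
qed

context regularly_varying_levy_measure
begin

text \<open>The Karamata bounds, rescaled. As \<open>\<beta> < \<gamma> < 2\<close>, the right-hand sides vanish as \<open>\<epsilon> \<rightarrow> 0\<close>
  and as \<open>K \<rightarrow> \<infinity>\<close>.\<close>

lemma scaled_moment_bounds:
  assumes \<beta>: "0 < \<beta>" "\<beta> < \<gamma>" and a: "\<And>n. 0 < a n" "filterlim (\<lambda>n. 1 / a n) at_top sequentially" and "0 < c"
    and conv: "\<And>r. 0 < r \<Longrightarrow> (\<lambda>n. real n * tail_mass (r / a n)) \<longlonglongrightarrow> c * r powr (- \<gamma>)"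
  obtains C where "0 < C"
    "\<And>\<epsilon>. 0 < \<epsilon> \<Longrightarrow> \<forall>\<^sub>F n in sequentially.
      (LINT x|scaled (real n) (a n) R. (norm x)\<^sup>2 * indicator {x. norm x \<le> \<epsilon>} x) \<le> C * \<epsilon> powr (2 - \<gamma>)"
    "\<And>K. 0 < K \<Longrightarrow> \<forall>\<^sub>F n in sequentially.
      (LINT x|scaled (real n) (a n) R. norm x powr \<beta> * indicator {x. K < norm x} x) \<le> C * K powr (\<beta> - \<gamma>)"
proof -
  have sets_R: "sets R = sets borel"
    by (rule levy_measure_sets[OF R])
  obtain C1 s1 where C1: "0 < s1" "0 < C1"
    "\<And>s. s1 \<le> s \<Longrightarrow> (LINT x|R. (norm x)\<^sup>2 * indicator {x. norm x \<le> s} x) \<le> C1 * s\<^sup>2 * tail_mass s"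
    using truncated_second_moment_bound by blast
  obtain C2 s2 where C2: "0 < s2" "0 < C2"
    "\<And>s. s2 \<le> s \<Longrightarrow> (LINT x|R. norm x powr \<beta> * indicator {x. s < norm x} x) \<le> C2 * s powr \<beta> * tail_mass s"
  proof (rule tail_moment_bound[OF \<beta>])
    fix C s0
    assume "0 < s0" "0 < C"
      "\<And>s. s0 \<le> s \<Longrightarrow> (LINT x|R. norm x powr \<beta> * indicator {x. s < norm x} x) \<le> C * s powr \<beta> * tail_mass s"
    then show thesis
      by (rule that)
  qed
  define C where "C = max C1 C2 * (2 * c)"
  have C: "0 < C" "C1 * (2 * c) \<le> C" "C2 * (2 * c) \<le> C"
  proof -
    have "0 \<le> 2 * c" "0 < max C1 C2"
      using C1(2) \<open>0 < c\<close> by auto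
    then show "0 < C" "C1 * (2 * c) \<le> C" "C2 * (2 * c) \<le> C"
      unfolding C_def using \<open>0 < c\<close> by (auto intro: mult_right_mono)
  qed
  have ev: "\<forall>\<^sub>F n in sequentially. max s1 s2 \<le> r / a n \<and> real n * tail_mass (r / a n) \<le> (2 * c) * r powr (- \<gamma>)" if "0 < r" for r
  proof -
    have "filterlim (\<lambda>n. r * (1 / a n)) at_top sequentially"
      by (rule filterlim_tendsto_pos_mult_at_top[OF tendsto_const that a(2)])
    from this[unfolded filterlim_at_top, rule_format, of "max s1 s2"]
    have "\<forall>\<^sub>F n in sequentially. max s1 s2 \<le> r / a n"
      by simp
    moreover have "\<forall>\<^sub>F n in sequentially. real n * tail_mass (r / a n) < (2 * c) * r powr (- \<gamma>)"
      using \<open>0 < c\<close> that by (intro order_tendstoD(2)[OF conv[OF that]]) simp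
    ultimately show ?thesis
      by eventually_elim simp
  qed
  have "\<forall>\<^sub>F n in sequentially.
      (LINT x|scaled (real n) (a n) R. (norm x)\<^sup>2 * indicator {x. norm x \<le> \<epsilon>} x) \<le> C * \<epsilon> powr (2 - \<gamma>)"
    if \<epsilon>: "0 < \<epsilon>" for \<epsilon>
    using ev[OF \<epsilon>]
  proof eventually_elim
    case (elim n)
    have "(LINT x|scaled (real n) (a n) R. (norm x)\<^sup>2 * indicator {x. norm x \<le> \<epsilon>} x)
        = real n * (LINT x|R. (norm (a n *\<^sub>R x))\<^sup>2 * indicator {x. norm x \<le> \<epsilon>} (a n *\<^sub>R x))"
      by (subst integral_scaled[OF sets_R]) auto
    also have "(LINT x|R. (norm (a n *\<^sub>R x))\<^sup>2 * indicator {x. norm x \<le> \<epsilon>} (a n *\<^sub>R x))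
        = (LINT x|R. (a n)\<^sup>2 * ((norm x)\<^sup>2 * indicator {x. norm x \<le> \<epsilon> / a n} x))"
      using a(1)[of n] by (intro Bochner_Integration.integral_cong refl)
        (auto simp: power_mult_distrib indicator_def field_simps)
    also have "\<dots> = (a n)\<^sup>2 * (LINT x|R. (norm x)\<^sup>2 * indicator {x. norm x \<le> \<epsilon> / a n} x)"
      by simp
    also have "real n * \<dots> \<le> real n * ((a n)\<^sup>2 * (C1 * (\<epsilon> / a n)\<^sup>2 * tail_mass (\<epsilon> / a n)))"
      using elim by (intro mult_left_mono C1) auto
    also have "\<dots> = C1 * \<epsilon>\<^sup>2 * (real n * tail_mass (\<epsilon> / a n))"
      using a(1)[of n] by (simp add: power_divide)
    also have "\<dots> \<le> C1 * \<epsilon>\<^sup>2 * ((2 * c) * \<epsilon> powr (- \<gamma>))"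
      using elim C1(2) by (intro mult_left_mono) auto
    also have "\<dots> = C1 * (2 * c) * \<epsilon> powr (2 - \<gamma>)"
      using \<epsilon> by (simp add: powr_diff powr_minus divide_inverse powr_numeral mult_ac)
    also have "\<dots> \<le> C * \<epsilon> powr (2 - \<gamma>)"
      using C(2) by (intro mult_right_mono) auto
    finally show ?case .
  qed
  moreover have "\<forall>\<^sub>F n in sequentially.
      (LINT x|scaled (real n) (a n) R. norm x powr \<beta> * indicator {x. K < norm x} x) \<le> C * K powr (\<beta> - \<gamma>)"
    if K: "0 < K" for K
    using ev[OF K]
  proof eventually_elim
    case (elim n)
    have "(LINT x|scaled (real n) (a n) R. norm x powr \<beta> * indicator {x. K < norm x} x)
        = real n * (LINT x|R. norm (a n *\<^sub>R x) powr \<beta> * indicator {x. K < norm x} (a n *\<^sub>R x))"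
      by (subst integral_scaled[OF sets_R]) auto
    also have "(LINT x|R. norm (a n *\<^sub>R x) powr \<beta> * indicator {x. K < norm x} (a n *\<^sub>R x))
        = (LINT x|R. a n powr \<beta> * (norm x powr \<beta> * indicator {x. K / a n < norm x} x))"
      using a(1)[of n] by (intro Bochner_Integration.integral_cong refl)
        (auto simp: powr_mult indicator_def field_simps)
    also have "\<dots> = a n powr \<beta> * (LINT x|R. norm x powr \<beta> * indicator {x. K / a n < norm x} x)"
      by simp
    also have "real n * \<dots> \<le> real n * (a n powr \<beta> * (C2 * (K / a n) powr \<beta> * tail_mass (K / a n)))"
      using elim by (intro mult_left_mono C2) auto
    also have "\<dots> = C2 * K powr \<beta> * (real n * tail_mass (K / a n))"
      using a(1)[of n] by (simp add: powr_divide)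
    also have "\<dots> \<le> C2 * K powr \<beta> * ((2 * c) * K powr (- \<gamma>))"
      using elim C2(2) by (intro mult_left_mono) auto
    also have "\<dots> = C2 * (2 * c) * K powr (\<beta> - \<gamma>)"
      using K by (simp add: powr_diff powr_minus divide_inverse mult_ac)
    also have "\<dots> \<le> C * K powr (\<beta> - \<gamma>)"
      using C(3) by (intro mult_right_mono) auto
    finally show ?case .
  qed
  ultimately show ?thesis
    using that C(1) by blast
qed

lemma integrable_min_powr:
  assumes \<beta>: "0 < \<beta>" "\<beta> < \<gamma>"
  shows "integrable R (\<lambda>x. min ((norm x)\<^sup>2) (norm x powr \<beta>))"
proof -
  have sets_R [measurable_cong]: "sets R = sets borel"
    by (rule levy_measure_sets[OF R])
  obtain s where s: "integrable R (\<lambda>x. norm x powr \<beta> * indicator {x. s < norm x} x)"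
    using tail_moment_bound[OF \<beta>] by (metis order_refl)
  show ?thesis
  proof (rule Bochner_Integration.integrable_bound)
    show "integrable R (\<lambda>x. (norm x)\<^sup>2 * indicator {x. norm x \<le> s} x + norm x powr \<beta> * indicator {x. s < norm x} x)"
      by (intro Bochner_Integration.integrable_add integrable_truncated_square s)
    show "AE x in R. norm (min ((norm x)\<^sup>2) (norm x powr \<beta>))
        \<le> norm ((norm x)\<^sup>2 * indicator {x. norm x \<le> s} x + norm x powr \<beta> * indicator {x. s < norm x} x)"
      by (intro AE_I2) (auto simp: indicator_def)
  qed measurable
qed

text \<open>Split at \<open>norm x = \<epsilon>\<close> and \<open>norm x = K\<close>. The annulus is handled by convergence on ray
  sets, the two remainders are uniformly small by the moment bounds.\<close>

lemma scaled_integral_convergence: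
  assumes \<beta>: "0 < \<beta>" "\<beta> < \<gamma>" and a: "\<And>n. 0 < a n" "filterlim (\<lambda>n. 1 / a n) at_top sequentially" and "0 < c"
    and conv: "\<And>r D. 0 < r \<Longrightarrow> continuity_set \<sigma> D \<Longrightarrow>
      (\<lambda>n. real n * measure R (ray_set (r / a n) D)) \<longlonglongrightarrow> c * r powr (- \<gamma>) * measure \<sigma> D"
    and N': "levy_measure N'"
    and N'_ray: "\<And>r D. 0 < r \<Longrightarrow> continuity_set \<sigma> D \<Longrightarrow> measure N' (ray_set r D) = c * r powr (- \<gamma>) * measure \<sigma> D"
    and h: "continuous_on {x. x \<noteq> 0} h" and h_meas: "h \<in> borel_measurable borel"
    and h_le: "\<And>x. \<bar>h x\<bar> \<le> B * min ((norm x)\<^sup>2) (norm x powr \<beta>)" and int': "integrable N' h"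
  shows "(\<lambda>n. LINT x|scaled (real n) (a n) R. h x :: real) \<longlonglongrightarrow> (LINT x|N'. h x)"
proof (rule LIMSEQ_I)
  fix e :: real assume "0 < e"
  define N where "N n = scaled (real n) (a n) R" for n
  have sets_R: "sets R = sets borel"
    by (rule levy_measure_sets[OF R])
  have N_levy: "levy_measure (N n)" for n
    unfolding N_def using a(1)[of n] by (intro levy_measure_scaled R) auto
  have B: "0 \<le> B"
  proof -
    obtain x :: 'a where "norm x = 1"
      using vector_choose_size[of 1] by auto
    then show ?thesis
      using h_le[of x] by simp
  qed
  have cs_borel: "D \<in> sets borel" if "continuity_set \<sigma> D" for D
    using that sets_finite_sphere_measure[OF \<sigma>] by (simp add: continuity_set_def)
  have N_conv: "(\<lambda>n. measure (N n) (ray_set r D)) \<longlonglongrightarrow> measure N' (ray_set r D)"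
    if "0 < r" "continuity_set \<sigma> D" for r D
    using conv[OF that] measure_scaled_ray_set[OF sets_R cs_borel[OF that(2)] a(1)]
    by (simp add: N_def N'_ray[OF that])
  have int_min: "integrable (N n) (\<lambda>x. min ((norm x)\<^sup>2) (norm x powr \<beta>))" for n
    unfolding N_def
  proof (rule integrable_scaled[OF sets_R])
    have [measurable_cong]: "sets R = sets borel" by (rule sets_R)
    show "integrable R (\<lambda>x. min ((norm (a n *\<^sub>R x))\<^sup>2) (norm (a n *\<^sub>R x) powr \<beta>))"
    proof (rule Bochner_Integration.integrable_bound)
      let ?m = "max ((a n)\<^sup>2) (a n powr \<beta>)"
      show "integrable R (\<lambda>x. ?m * min ((norm x)\<^sup>2) (norm x powr \<beta>))"
        by (intro integrable_mult_right integrable_min_powr \<beta>)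
      show "AE x in R. norm (min ((norm (a n *\<^sub>R x))\<^sup>2) (norm (a n *\<^sub>R x) powr \<beta>))
          \<le> norm (?m * min ((norm x)\<^sup>2) (norm x powr \<beta>))"
      proof (intro AE_I2)
        fix x :: 'a
        have "(norm (a n *\<^sub>R x))\<^sup>2 \<le> ?m * (norm x)\<^sup>2" "norm (a n *\<^sub>R x) powr \<beta> \<le> ?m * norm x powr \<beta>"
          using a(1)[of n] by (auto simp: power_mult_distrib powr_mult intro!: mult_right_mono)
        moreover have "0 \<le> ?m"
          by (simp add: le_max_iff_disj)
        ultimately have "min ((norm (a n *\<^sub>R x))\<^sup>2) (norm (a n *\<^sub>R x) powr \<beta>)
            \<le> ?m * min ((norm x)\<^sup>2) (norm x powr \<beta>)"
          unfolding min_mult_distrib_left by (simp only: if_True min.mono)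
        moreover have "0 \<le> min ((norm (a n *\<^sub>R x))\<^sup>2) (norm (a n *\<^sub>R x) powr \<beta>)"
          by simp
        ultimately show "norm (min ((norm (a n *\<^sub>R x))\<^sup>2) (norm (a n *\<^sub>R x) powr \<beta>))
          \<le> norm (?m * min ((norm x)\<^sup>2) (norm x powr \<beta>))"
          unfolding real_norm_def by linarith
      qed
    qed measurable
  qed auto
  have convG: "(\<lambda>n. real n * tail_mass (r / a n)) \<longlonglongrightarrow> (c * measure \<sigma> (sphere 0 1)) * r powr (- \<gamma>)" if "0 < r" for r
    using conv[OF that continuity_set_sphere[OF \<sigma>]] by (simp add: tail_mass_def mult_ac)
  have c\<sigma>: "0 < c * measure \<sigma> (sphere 0 1)"
    using \<open>0 < c\<close> \<sigma>_pos by simp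
  obtain C where C: "0 < C"
    and C1: "\<And>\<epsilon>. 0 < \<epsilon> \<Longrightarrow> \<forall>\<^sub>F n in sequentially. (LINT x|N n. (norm x)\<^sup>2 * indicator {x. norm x \<le> \<epsilon>} x) \<le> C * \<epsilon> powr (2 - \<gamma>)"
    and C2: "\<And>K. 0 < K \<Longrightarrow> \<forall>\<^sub>F n in sequentially. (LINT x|N n. norm x powr \<beta> * indicator {x. K < norm x} x) \<le> C * K powr (\<beta> - \<gamma>)"
    unfolding N_def using scaled_moment_bounds[OF \<beta> a c\<sigma> convG] by blast
  \<comment> \<open>One parameter for both cut-offs: \<open>\<epsilon> = 1 / (j + 1)\<close> and \<open>K = j + 2\<close>; the summand \<open>1\<close>
    keeps \<open>\<epsilon> < K\<close> for \<open>j = 0\<close>.\<close>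
  define A where "A j = {x::'a. 1 / real (Suc j) < norm x \<and> norm x \<le> real (Suc j) + 1}" for j
  have A_meas [measurable]: "A j \<in> sets borel" for j
    unfolding A_def by measurable
  have "(\<lambda>j. LINT x|N'. indicator (A j) x * h x) \<longlonglongrightarrow> (LINT x|N'. h x)"
  proof (rule integral_dominated_convergence[where w="\<lambda>x. \<bar>h x\<bar>"])
    have [measurable_cong]: "sets N' = sets borel"
      by (rule levy_measure_sets[OF N'])
    show "h \<in> borel_measurable N'"
      by (rule borel_measurable_sets_eq_borel[OF levy_measure_sets[OF N'] h_meas])
    then show "(\<lambda>x. indicator (A j) x * h x) \<in> borel_measurable N'" for j
      by measurable
    show "integrable N' (\<lambda>x. \<bar>h x\<bar>)"
      using int' by simp
    show "AE x in N'. norm (indicator (A j) x * h x) \<le> \<bar>h x\<bar>" for j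
      by (auto simp: indicator_def)
    show "AE x in N'. (\<lambda>j. indicator (A j) x * h x) \<longlonglongrightarrow> h x"
    proof (intro AE_I2 tendsto_eventually)
      fix x :: 'a
      show "\<forall>\<^sub>F j in sequentially. indicator (A j) x * h x = h x"
      proof (cases "x = 0")
        case True
        then have "h x = 0"
          using h_le[of x] by simp
        then show ?thesis
          by simp
      next
        case False
        have "\<forall>\<^sub>F j in sequentially. norm x < real j"
          using filterlim_real_sequentially by (simp add: filterlim_at_top_dense)
        moreover have "\<forall>\<^sub>F j in sequentially. 1 / real (Suc j) < norm x"
          using False LIMSEQ_Suc[OF lim_1_over_n] by (intro order_tendstoD(2)[of _ 0]) auto
        ultimately show ?thesis
          by eventually_elim (simp add: A_def)
      qed
    qed
  qed
  from tendstoD[OF this, of "e / 4"]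
  have ev1: "\<forall>\<^sub>F j in sequentially. \<bar>(LINT x|N'. indicator (A j) x * h x) - (LINT x|N'. h x)\<bar> < e / 4"
    using \<open>0 < e\<close> unfolding dist_real_def by simp
  have "(\<lambda>j. B * (C * (1 / real (Suc j)) powr (2 - \<gamma>))) \<longlonglongrightarrow> B * (C * 0)"
  proof (intro tendsto_intros)
    show "(\<lambda>j. (1 / real (Suc j)) powr (2 - \<gamma>)) \<longlonglongrightarrow> 0"
      using \<gamma> by real_asymp
  qed
  then have ev2: "\<forall>\<^sub>F j in sequentially. B * (C * (1 / real (Suc j)) powr (2 - \<gamma>)) < e / 8"
    using \<open>0 < e\<close> by (intro order_tendstoD(2)[of _ 0]) auto
  have "(\<lambda>j. B * (C * (real (Suc j) + 1) powr (\<beta> - \<gamma>))) \<longlonglongrightarrow> B * (C * 0)"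
  proof (intro tendsto_intros)
    show "(\<lambda>j. (real (Suc j) + 1) powr (\<beta> - \<gamma>)) \<longlonglongrightarrow> 0"
      using \<beta> by real_asymp
  qed
  then have ev3: "\<forall>\<^sub>F j in sequentially. B * (C * (real (Suc j) + 1) powr (\<beta> - \<gamma>)) < e / 8"
    using \<open>0 < e\<close> by (intro order_tendstoD(2)[of _ 0]) auto
  obtain j where j: "\<bar>(LINT x|N'. indicator (A j) x * h x) - (LINT x|N'. h x)\<bar> < e / 4"
    "B * (C * (1 / real (Suc j)) powr (2 - \<gamma>)) < e / 8" "B * (C * (real (Suc j) + 1) powr (\<beta> - \<gamma>)) < e / 8"
    using eventually_happens'[OF _ eventually_conj[OF ev1 eventually_conj[OF ev2 ev3]]] by auto
  define \<epsilon> K where "\<epsilon> = 1 / real (Suc j)" and "K = real (Suc j) + 1"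
  have \<epsilon>K: "0 < \<epsilon>" "\<epsilon> \<le> 1" "1 \<le> K" "\<epsilon> < K" "0 < K"
  proof -
    show "0 < \<epsilon>" "0 < K" and K: "1 \<le> K" and le: "\<epsilon> \<le> 1"
      by (simp_all add: \<epsilon>_def K_def)
    have "1 < K"
      by (simp add: K_def)
    with le show "\<epsilon> < K"
      by linarith
  qed
  have A_eq: "A j = {x. \<epsilon> < norm x \<and> norm x \<le> K}"
    by (simp add: A_def \<epsilon>_def K_def)
  have "(\<lambda>n. LINT x|N n. indicator (A j) x * h x) \<longlonglongrightarrow> (LINT x|N'. indicator (A j) x * h x)"
    unfolding A_eq by (rule annulus_integral_convergence[OF \<sigma> N_levy N' N_conv h h_meas \<epsilon>K(1,4)])
  from tendstoD[OF this, of "e / 4"]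
  have ev4: "\<forall>\<^sub>F n in sequentially. \<bar>(LINT x|N n. indicator (A j) x * h x) - (LINT x|N'. indicator (A j) x * h x)\<bar> < e / 4"
    using \<open>0 < e\<close> unfolding dist_real_def by simp
  have small: "(norm x)\<^sup>2 \<le> norm x powr \<beta>" if "norm x \<le> 1" for x :: 'a
  proof (cases "x = 0")
    case False
    have "norm x powr 2 \<le> norm x powr \<beta>"
      using that \<beta> \<gamma> by (intro powr_mono') auto
    then show ?thesis
      using False by (simp add: powr_numeral)
  qed simp
  have large: "norm x powr \<beta> \<le> (norm x)\<^sup>2" if "1 \<le> norm x" for x :: 'a
  proof -
    have "norm x powr \<beta> \<le> norm x powr 2"
      using that \<beta> \<gamma> by (intro powr_mono) auto
    then show ?thesis
      using that by (simp add: powr_numeral)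
  qed
  have approx: "\<bar>(LINT x|N n. h x) - (LINT x|N n. indicator (A j) x * h x)\<bar>
      \<le> B * (LINT x|N n. (norm x)\<^sup>2 * indicator {x. norm x \<le> \<epsilon>} x)
        + B * (LINT x|N n. norm x powr \<beta> * indicator {x. K < norm x} x)" for n
  proof -
    have sets_N [measurable_cong]: "sets (N n) = sets borel"
      by (simp add: N_def)
    have h_N [measurable]: "h \<in> borel_measurable (N n)"
      by (rule borel_measurable_sets_eq_borel[OF sets_N h_meas])
    have i1: "integrable (N n) (\<lambda>x. (norm x)\<^sup>2 * indicator {x. norm x \<le> \<epsilon>} x)"
    proof (rule Bochner_Integration.integrable_bound[OF int_min])
      show "AE x in N n. norm ((norm x)\<^sup>2 * indicator {x. norm x \<le> \<epsilon>} x) \<le> norm (min ((norm x)\<^sup>2) (norm x powr \<beta>))"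
        using small \<epsilon>K by (intro AE_I2) (auto simp: indicator_def min_def)
    qed measurable
    have i2: "integrable (N n) (\<lambda>x. norm x powr \<beta> * indicator {x. K < norm x} x)"
    proof (rule Bochner_Integration.integrable_bound[OF int_min])
      show "AE x in N n. norm (norm x powr \<beta> * indicator {x. K < norm x} x) \<le> norm (min ((norm x)\<^sup>2) (norm x powr \<beta>))"
        using large \<epsilon>K by (intro AE_I2) (auto simp: indicator_def min_def)
    qed measurable
    have i3: "integrable (N n) h"
    proof (rule Bochner_Integration.integrable_bound)
      show "integrable (N n) (\<lambda>x. B * min ((norm x)\<^sup>2) (norm x powr \<beta>))"
        using int_min by simp
      show "AE x in N n. norm (h x) \<le> norm (B * min ((norm x)\<^sup>2) (norm x powr \<beta>))"
        using h_le B by (intro AE_I2) (simp add: abs_mult)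
    qed measurable
    have i4: "integrable (N n) (\<lambda>x. indicator (A j) x * h x)"
      by (rule Bochner_Integration.integrable_bound[OF i3]) (measurable, auto simp: indicator_def)
    have "\<bar>(LINT x|N n. h x) - (LINT x|N n. indicator (A j) x * h x)\<bar> = \<bar>LINT x|N n. h x - indicator (A j) x * h x\<bar>"
      using i3 i4 by simp
    also have "\<dots> \<le> (LINT x|N n. \<bar>h x - indicator (A j) x * h x\<bar>)"
      by (rule integral_abs_bound)
    also have "\<dots> \<le> (LINT x|N n. B * ((norm x)\<^sup>2 * indicator {x. norm x \<le> \<epsilon>} x) + B * (norm x powr \<beta> * indicator {x. K < norm x} x))"
    proof (rule integral_mono)
      fix x :: 'a
      have "\<bar>h x\<bar> \<le> B * (norm x)\<^sup>2" "\<bar>h x\<bar> \<le> B * norm x powr \<beta>"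
        using order_trans[OF h_le[of x] mult_left_mono[OF min.cobounded1 B]]
          order_trans[OF h_le[of x] mult_left_mono[OF min.cobounded2 B]] by auto
      then show "\<bar>h x - indicator (A j) x * h x\<bar>
          \<le> B * ((norm x)\<^sup>2 * indicator {x. norm x \<le> \<epsilon>} x) + B * (norm x powr \<beta> * indicator {x. K < norm x} x)"
        using B by (auto simp: indicator_def A_eq)
    qed (use i1 i2 i3 i4 in auto)
    also have "\<dots> = B * (LINT x|N n. (norm x)\<^sup>2 * indicator {x. norm x \<le> \<epsilon>} x)
        + B * (LINT x|N n. norm x powr \<beta> * indicator {x. K < norm x} x)"
      using i1 i2 by simp
    finally show ?thesis .
  qed
  have "\<forall>\<^sub>F n in sequentially. norm ((LINT x|N n. h x) - (LINT x|N'. h x)) < e"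
    using ev4 C1[OF \<epsilon>K(1)] C2[OF \<epsilon>K(5)]
  proof eventually_elim
    case (elim n)
    have "B * (LINT x|N n. (norm x)\<^sup>2 * indicator {x. norm x \<le> \<epsilon>} x) \<le> B * (C * \<epsilon> powr (2 - \<gamma>))"
      "B * (LINT x|N n. norm x powr \<beta> * indicator {x. K < norm x} x) \<le> B * (C * K powr (\<beta> - \<gamma>))"
      using elim B by (auto intro!: mult_left_mono)
    then show ?case
      using approx[of n] j elim(1) unfolding real_norm_def \<epsilon>_def K_def by linarith
  qed
  then show "\<exists>no. \<forall>n\<ge>no. norm ((LINT x|scaled (real n) (a n) R. h x) - (LINT x|N'. h x)) < e"
    by (simp add: eventually_sequentially N_def)
qed

end

section \<open>Averages over the tempering density\<close>

text \<open>The adjoint of \<open>tempered_levy\<close>, acting on test functions instead of measures.\<close>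

definition tempering_average :: "real \<Rightarrow> real \<Rightarrow> ('a::euclidean_space \<Rightarrow> real) \<Rightarrow> 'a \<Rightarrow> real" where
  "tempering_average p \<alpha> f x = (LINT t|tempering p \<alpha>. f (t *\<^sub>R x))"

lemma
  assumes "0 < p" "\<alpha> < q"
  shows integrable_tempering_powr: "integrable (tempering p \<alpha>) (\<lambda>t. t powr q)"
    and integral_tempering_powr: "(LINT t|tempering p \<alpha>. t powr q) = tempering_moment p \<alpha> q"
proof -
  show "integrable (tempering p \<alpha>) (\<lambda>t. t powr q)"
    using tempering_moment_finite[OF assms] by (intro integrableI_nonneg) auto
  show "(LINT t|tempering p \<alpha>. t powr q) = tempering_moment p \<alpha> q"
    unfolding tempering_moment_def by (rule integral_eq_nn_integral) auto
qed

text \<open>Test functions with the size of the integrand of the Levy-Khintchine exponent.\<close>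

locale tempered_test_function =
  fixes p \<alpha> \<beta> :: real and f :: "'a::euclidean_space \<Rightarrow> real" and B :: real
  assumes p: "0 < p" and \<beta>: "0 < \<beta>" "\<alpha> < \<beta>" "\<beta> < 2"
    and f: "continuous_on UNIV f" and f_le: "\<And>x. \<bar>f x\<bar> \<le> B * min ((norm x)\<^sup>2) 1"
begin

lemma B_nonneg: "0 \<le> B"
proof -
  obtain x :: 'a where "norm x = 1"
    using vector_choose_size[of 1] by auto
  then show ?thesis
    using f_le[of x] by simp
qed

lemma f_measurable [measurable]: "f \<in> borel_measurable borel"
  by (rule borel_measurable_continuous_onI[OF f])

lemma f_ray_le:
  assumes "0 < t"
  shows "\<bar>f (t *\<^sub>R x)\<bar> \<le> B * norm x powr \<beta> * t powr \<beta>" "\<bar>f (t *\<^sub>R x)\<bar> \<le> B * (norm x)\<^sup>2 * t powr 2"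
proof -
  let ?y = "norm (t *\<^sub>R x)"
  have "min (?y\<^sup>2) 1 \<le> ?y powr \<beta>"
  proof (cases "?y \<le> 1")
    case True
    have "?y powr 2 \<le> ?y powr \<beta>"
      using True \<beta> by (intro powr_mono') auto
    then show ?thesis
      by (simp add: min_le_iff_disj)
  next
    case False
    then show ?thesis
      using \<beta> by (simp add: min_le_iff_disj ge_one_powr_ge_zero)
  qed
  also have "\<dots> = norm x powr \<beta> * t powr \<beta>"
    using assms by (simp add: powr_mult mult.commute)
  finally have "B * min (?y\<^sup>2) 1 \<le> B * (norm x powr \<beta> * t powr \<beta>)"
    by (rule mult_left_mono[OF _ B_nonneg])
  with f_le[of "t *\<^sub>R x"] show "\<bar>f (t *\<^sub>R x)\<bar> \<le> B * norm x powr \<beta> * t powr \<beta>"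
    by (simp only: mult.assoc)
  have "?y\<^sup>2 = (norm x)\<^sup>2 * t powr 2"
    using assms by (simp add: power_mult_distrib powr_numeral)
  then have "B * min (?y\<^sup>2) 1 \<le> B * ((norm x)\<^sup>2 * t powr 2)"
    by (intro mult_left_mono B_nonneg) simp
  with f_le[of "t *\<^sub>R x"] show "\<bar>f (t *\<^sub>R x)\<bar> \<le> B * (norm x)\<^sup>2 * t powr 2"
    by (simp only: mult.assoc)
qed

lemma integrable_ray: "integrable (tempering p \<alpha>) (\<lambda>t. f (t *\<^sub>R x))"
proof (rule Bochner_Integration.integrable_bound)
  show "integrable (tempering p \<alpha>) (\<lambda>t. B * norm x powr \<beta> * t powr \<beta>)"
    by (intro integrable_mult_right integrable_tempering_powr p \<beta>)
  show "AE t in tempering p \<alpha>. norm (f (t *\<^sub>R x)) \<le> norm (B * norm x powr \<beta> * t powr \<beta>)"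
    using AE_tempering_pos
  proof eventually_elim
    case (elim t)
    then show ?case
      using f_ray_le(1)[of t x] B_nonneg by (simp add: abs_mult)
  qed
qed measurable

text \<open>Use the moments of order \<open>2\<close> and \<open>\<beta>\<close> of the tempering density, both finite as
  \<open>\<alpha> < \<beta> < 2\<close>. Boundedness of \<open>f\<close> alone would not do: for \<open>\<alpha> \<ge> 0\<close> the tempering density has
  infinite mass near \<open>0\<close>.\<close>

lemma tempering_average_le:
  "\<bar>tempering_average p \<alpha> f x\<bar>
    \<le> B * max (tempering_moment p \<alpha> 2) (tempering_moment p \<alpha> \<beta>) * min ((norm x)\<^sup>2) (norm x powr \<beta>)"
proof -
  have le: "\<bar>tempering_average p \<alpha> f x\<bar> \<le> C * tempering_moment p \<alpha> q"
    if "\<alpha> < q" "\<And>t. 0 < t \<Longrightarrow> \<bar>f (t *\<^sub>R x)\<bar> \<le> C * t powr q" for C q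
  proof -
    have "\<bar>tempering_average p \<alpha> f x\<bar> \<le> (LINT t|tempering p \<alpha>. \<bar>f (t *\<^sub>R x)\<bar>)"
      unfolding tempering_average_def by (rule integral_abs_bound)
    also have "\<dots> \<le> (LINT t|tempering p \<alpha>. C * t powr q)"
    proof (rule integral_mono_AE)
      show "integrable (tempering p \<alpha>) (\<lambda>t. \<bar>f (t *\<^sub>R x)\<bar>)"
        using integrable_ray by simp
      show "integrable (tempering p \<alpha>) (\<lambda>t. C * t powr q)"
        by (intro integrable_mult_right integrable_tempering_powr p that)
      show "AE t in tempering p \<alpha>. \<bar>f (t *\<^sub>R x)\<bar> \<le> C * t powr q"
        using AE_tempering_pos by eventually_elim (rule that)
    qed
    finally show ?thesis
      using integral_tempering_powr[OF p that(1)] by simp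
  qed
  let ?m = "max (tempering_moment p \<alpha> 2) (tempering_moment p \<alpha> \<beta>)"
  have "\<bar>tempering_average p \<alpha> f x\<bar> \<le> B * (norm x)\<^sup>2 * tempering_moment p \<alpha> 2"
    using \<beta> f_ray_le by (intro le) auto
  also have "\<dots> \<le> B * (norm x)\<^sup>2 * ?m"
    using B_nonneg by (intro mult_left_mono) auto
  finally have 1: "\<bar>tempering_average p \<alpha> f x\<bar> \<le> B * ?m * (norm x)\<^sup>2"
    by (simp only: mult_ac)
  have "\<bar>tempering_average p \<alpha> f x\<bar> \<le> B * norm x powr \<beta> * tempering_moment p \<alpha> \<beta>"
    using \<beta> f_ray_le by (intro le) auto
  also have "\<dots> \<le> B * norm x powr \<beta> * ?m"
    using B_nonneg by (intro mult_left_mono) auto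
  finally have 2: "\<bar>tempering_average p \<alpha> f x\<bar> \<le> B * ?m * norm x powr \<beta>"
    by (simp only: mult_ac)
  from 1 2 show ?thesis
    by (cases "(norm x)\<^sup>2 \<le> norm x powr \<beta>") (simp_all only: min.absorb1 min.absorb2 linear not_le less_imp_le)
qed

lemma continuous_on_tempering_average: "continuous_on UNIV (tempering_average p \<alpha> f)"
proof (rule continuous_at_imp_continuous_on, rule ballI, unfold continuous_at_sequentially, intro allI impI)
  fix x and X :: "nat \<Rightarrow> 'a"
  assume X: "X \<longlonglongrightarrow> x"
  then obtain K where K: "0 < K" "\<And>n. norm (X n) \<le> K"
    using convergent_imp_Bseq[of X] unfolding Bseq_def convergent_def by blast
  have "(\<lambda>n. LINT t|tempering p \<alpha>. f (t *\<^sub>R X n)) \<longlonglongrightarrow> (LINT t|tempering p \<alpha>. f (t *\<^sub>R x))"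
  proof (rule integral_dominated_convergence)
    show "integrable (tempering p \<alpha>) (\<lambda>t. B * K powr \<beta> * t powr \<beta>)"
      by (intro integrable_mult_right integrable_tempering_powr p \<beta>)
    show "AE t in tempering p \<alpha>. (\<lambda>n. f (t *\<^sub>R X n)) \<longlonglongrightarrow> f (t *\<^sub>R x)"
      using f by (intro AE_I2 continuous_on_tendsto_compose[OF f] tendsto_intros X) auto
    show "AE t in tempering p \<alpha>. norm (f (t *\<^sub>R X n)) \<le> B * K powr \<beta> * t powr \<beta>" for n
      using AE_tempering_pos
    proof eventually_elim
      case (elim t)
      have "B * norm (X n) powr \<beta> * t powr \<beta> \<le> B * K powr \<beta> * t powr \<beta>"
        using K \<beta> B_nonneg by (intro mult_right_mono mult_left_mono powr_mono2) auto
      with f_ray_le(1)[OF elim, of "X n"] show ?case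
        by simp
    qed
  qed measurable
  then show "(tempering_average p \<alpha> f \<circ> X) \<longlonglongrightarrow> tempering_average p \<alpha> f x"
    by (simp add: tempering_average_def comp_def)
qed

lemma tempering_average_measurable: "tempering_average p \<alpha> f \<in> borel_measurable borel"
  by (rule borel_measurable_continuous_onI[OF continuous_on_tempering_average])

lemma
  assumes S: "sets S = sets borel" and nonneg: "\<And>x. 0 \<le> f x"
  shows integral_tempered_levy: "(LINT x|tempered_levy p \<alpha> S. f x) = (LINT x|S. tempering_average p \<alpha> f x)"
    and integrable_tempering_average:
      "integrable (tempered_levy p \<alpha> S) f \<Longrightarrow> integrable S (tempering_average p \<alpha> f)"
proof -
  have meas: "tempering_average p \<alpha> f \<in> borel_measurable S"
    by (rule borel_measurable_sets_eq_borel[OF S tempering_average_measurable])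
  have nn: "0 \<le> tempering_average p \<alpha> f x" for x
    unfolding tempering_average_def by (rule integral_nonneg_AE) (simp add: nonneg)
  have "(\<integral>\<^sup>+x. ennreal (f x) \<partial>tempered_levy p \<alpha> S) = (\<integral>\<^sup>+x. \<integral>\<^sup>+t. ennreal (f (t *\<^sub>R x)) \<partial>tempering p \<alpha> \<partial>S)"
    by (rule nn_integral_tempered_levy[OF S]) measurable
  also have "\<dots> = (\<integral>\<^sup>+x. ennreal (tempering_average p \<alpha> f x) \<partial>S)"
    unfolding tempering_average_def
    by (intro nn_integral_cong nn_integral_eq_integral integrable_ray) (simp add: nonneg)
  finally have eq: "(\<integral>\<^sup>+x. ennreal (f x) \<partial>tempered_levy p \<alpha> S) = (\<integral>\<^sup>+x. ennreal (tempering_average p \<alpha> f x) \<partial>S)" .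
  have f_T: "f \<in> borel_measurable (tempered_levy p \<alpha> S)"
    by measurable
  show "(LINT x|tempered_levy p \<alpha> S. f x) = (LINT x|S. tempering_average p \<alpha> f x)"
    using integral_eq_nn_integral[OF f_T] integral_eq_nn_integral[OF meas] eq nonneg nn by simp
  show "integrable S (tempering_average p \<alpha> f)" if "integrable (tempered_levy p \<alpha> S) f"
    using that eq meas f_T nn nonneg unfolding integrable_iff_bounded by simp
qed

end

section \<open>Domains of attraction\<close>

context regularly_varying_levy_measure
begin

text \<open>Move the tempering from the measures to \<open>f\<close>. The Tonelli theorem does this for
  nonnegative \<open>f\<close>; in general, split \<open>f\<close> into its positive and negative parts.\<close>

lemma tempered_integral_convergence:
  assumes p: "0 < p" and \<beta>: "0 < \<beta>" "\<alpha> < \<beta>" "\<beta> < \<gamma>"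
    and a: "\<And>n. 0 < a n" "filterlim (\<lambda>n. 1 / a n) at_top sequentially"
    and conv: "\<And>r D. 0 < r \<Longrightarrow> continuity_set \<sigma> D \<Longrightarrow>
      (\<lambda>n. real n * measure R (ray_set (r / a n) D))
        \<longlonglongrightarrow> 1 / (\<gamma> * tempering_moment p \<alpha> \<gamma>) * r powr (- \<gamma>) * measure \<sigma> D"
    and T: "levy_measure (tempered_levy p \<alpha> R)"
    and f: "continuous_on UNIV f" and f_le: "\<And>x. \<bar>f x\<bar> \<le> B * min ((norm x)\<^sup>2) 1"
  shows "(\<lambda>n. LINT x|tempered_levy p \<alpha> (scaled (real n) (a n) R). f x) \<longlonglongrightarrow> (LINT x|stable_levy \<gamma> \<sigma>. f x)"
proof -
  define m where "m = tempering_moment p \<alpha> \<gamma>"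
  have m: "0 < m"
    unfolding m_def using p \<beta> by (intro pos_tempering_moment) auto
  define N' where "N' = scaled (1 / m) 1 (stable_levy \<gamma> \<sigma>)"
  have L: "levy_measure (stable_levy \<gamma> \<sigma>)"
    by (rule levy_measure_stable_levy[OF \<sigma> \<gamma>])
  have N': "levy_measure N'"
    unfolding N'_def by (rule levy_measure_scaled[OF L]) simp
  have TN': "tempered_levy p \<alpha> N' = stable_levy \<gamma> \<sigma>"
    unfolding N'_def m_def using p \<beta> by (intro tempered_levy_stable_levy[OF \<sigma>]) auto
  have N'_ray: "measure N' (ray_set r D) = 1 / (\<gamma> * m) * r powr (- \<gamma>) * measure \<sigma> D"
    if "0 < r" "continuity_set \<sigma> D" for r D
    unfolding N'_def using that m \<gamma>
    by (subst measure_scaled_stable_levy_ray_set[OF \<sigma>]) (auto simp: continuity_set_def field_simps)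
  have T_levy: "levy_measure (tempered_levy p \<alpha> (scaled (real n) (a n) R))" for n
    using levy_measure_scaled[OF T, of "a n"] a(1)[of n] tempered_levy_scaled[OF levy_measure_sets[OF R]] by simp
  have nonneg: "(\<lambda>n. LINT x|tempered_levy p \<alpha> (scaled (real n) (a n) R). g x) \<longlonglongrightarrow> (LINT x|stable_levy \<gamma> \<sigma>. g x)"
    if g: "continuous_on UNIV g" and g_le: "\<And>x. \<bar>g x\<bar> \<le> B * min ((norm x)\<^sup>2) 1" and pos: "\<And>x. 0 \<le> g x" for g
  proof -
    interpret g: tempered_test_function p \<alpha> \<beta> g B
      by unfold_locales (use p \<beta> \<gamma> g g_le in auto)
    have int_g: "integrable (tempered_levy p \<alpha> N') g"
      unfolding TN' using g_le by (intro integrable_levy_measure[OF L, where C=B]) auto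
    have "(\<lambda>n. LINT x|scaled (real n) (a n) R. tempering_average p \<alpha> g x) \<longlonglongrightarrow> (LINT x|N'. tempering_average p \<alpha> g x)"
    proof (rule scaled_integral_convergence[OF \<beta>(1,3) a _ _ N'])
      show "0 < 1 / (\<gamma> * m)"
        using m \<gamma> by simp
      show "continuous_on {x. x \<noteq> 0} (tempering_average p \<alpha> g)"
        using g.continuous_on_tempering_average by (rule continuous_on_subset) simp
      show "integrable N' (tempering_average p \<alpha> g)"
        by (rule g.integrable_tempering_average[OF levy_measure_sets[OF N'] pos int_g])
    qed (use conv N'_ray g.tempering_average_measurable g.tempering_average_le in \<open>auto simp: m_def\<close>)
    then show ?thesis
      by (simp add: g.integral_tempered_levy pos levy_measure_sets[OF N'] flip: TN')
  qed
  define f1 f2 where "f1 x = max (f x) 0" and "f2 x = max (- f x) 0" for x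
  have cont: "continuous_on UNIV f1" "continuous_on UNIV f2"
    unfolding f1_def f2_def by (intro continuous_intros f)+
  have le: "\<bar>f1 x\<bar> \<le> B * min ((norm x)\<^sup>2) 1" "\<bar>f2 x\<bar> \<le> B * min ((norm x)\<^sup>2) 1" for x
    using f_le[of x] by (auto simp: f1_def f2_def)
  have split: "(LINT x|M. f x) = (LINT x|M. f1 x) - (LINT x|M. f2 x)" if M: "levy_measure M" for M
  proof -
    have "integrable M f1" "integrable M f2"
      using le cont by (auto intro!: integrable_levy_measure[OF M, where C=B] borel_measurable_continuous_onI)
    then have "(LINT x|M. f1 x - f2 x) = (LINT x|M. f1 x) - (LINT x|M. f2 x)"
      by simp
    moreover have "f1 x - f2 x = f x" for x
      by (simp add: f1_def f2_def)
    ultimately show ?thesis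
      by simp
  qed
  have "(\<lambda>n. (LINT x|tempered_levy p \<alpha> (scaled (real n) (a n) R). f1 x)
      - (LINT x|tempered_levy p \<alpha> (scaled (real n) (a n) R). f2 x))
    \<longlonglongrightarrow> (LINT x|stable_levy \<gamma> \<sigma>. f1 x) - (LINT x|stable_levy \<gamma> \<sigma>. f2 x)"
    by (intro tendsto_diff nonneg cont le) (auto simp: f1_def f2_def)
  then show ?thesis
    by (simp only: split[OF T_levy] split[OF L])
qed

text \<open>The real and imaginary parts of \<open>levy_integrand z\<close> are admissible test functions, so
  the exponents of the normed sums converge once the centring gives all of them the shift of
  the limit.\<close>

theorem in_domain_of_attraction_if_regularly_varying:
  assumes TS: "is_TS p \<alpha> R b \<mu>" and "\<alpha> < \<gamma>"
  obtains \<nu> where "is_stable \<gamma> \<sigma> \<nu>" "in_domain_of_attraction \<mu> \<nu>"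
proof -
  let ?L = "stable_levy \<gamma> \<sigma>"
  have p: "0 < p" and ID: "is_ID (tempered_levy p \<alpha> R) b \<mu>"
    using TS by (auto simp: is_TS_def)
  then have T: "levy_measure (tempered_levy p \<alpha> R)"
    by (simp add: is_ID_iff)
  have L: "levy_measure ?L"
    by (rule levy_measure_stable_levy[OF \<sigma> \<gamma>])
  obtain \<beta> where \<beta>: "max 0 \<alpha> < \<beta>" "\<beta> < \<gamma>"
    using dense[of "max 0 \<alpha>" \<gamma>] \<gamma> \<open>\<alpha> < \<gamma>\<close> by auto
  have "0 < 1 / (\<gamma> * tempering_moment p \<alpha> \<gamma>)"
    using \<gamma> pos_tempering_moment[OF p \<open>\<alpha> < \<gamma>\<close>] by simp
  then obtain a where a: "\<And>n. 0 < a n" "filterlim (\<lambda>n. 1 / a n) at_top sequentially"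
    and conv: "\<And>r D. 0 < r \<Longrightarrow> continuity_set \<sigma> D \<Longrightarrow>
      (\<lambda>n. real n * measure R (ray_set (r / a n) D))
        \<longlonglongrightarrow> 1 / (\<gamma> * tempering_moment p \<alpha> \<gamma>) * r powr (- \<gamma>) * measure \<sigma> D"
    by (rule ex_norming_sequence) blast
  define M where "M n = tempered_levy p \<alpha> (scaled (real n) (a n) R)" for n
  have M_eq: "M n = scaled (real n) (a n) (tempered_levy p \<alpha> R)" for n
    unfolding M_def by (rule tempered_levy_scaled[OF levy_measure_sets[OF R]])
  obtain b0 \<nu> where \<nu>: "is_ID ?L b0 \<nu>"
    by (rule ex_is_ID[OF L])
  have "\<exists>d. \<forall>c. is_ID (M n) (d - c) (normed_sum_law \<mu> (a n) c n)" for n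
    unfolding M_eq by (rule is_ID_normed_sum_law[OF ID a(1)[of n], of n]) blast
  then obtain d where d: "\<And>n c. is_ID (M n) (d n - c) (normed_sum_law \<mu> (a n) c n)"
    by metis
  define \<mu>n where "\<mu>n n = normed_sum_law \<mu> (a n) (d n - b0) n" for n
  have \<mu>n: "is_ID (M n) b0 (\<mu>n n)" for n
    using d[of n "d n - b0"] by (simp add: \<mu>n_def)
  have char: "(\<lambda>n. char_fun (\<mu>n n) z) \<longlonglongrightarrow> char_fun \<nu> z" for z
  proof -
    let ?C = "2 + norm z + (norm z)\<^sup>2"
    have lim: "(\<lambda>n. LINT x|M n. g (levy_integrand z x)) \<longlonglongrightarrow> (LINT x|?L. g (levy_integrand z x))"
      if g: "continuous_on UNIV g" "\<And>w. \<bar>g w\<bar> \<le> cmod w" for g :: "complex \<Rightarrow> real"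
      unfolding M_def
    proof (rule tempered_integral_convergence[OF p _ _ _ a conv T])
      show "continuous_on UNIV (\<lambda>x. g (levy_integrand z x))"
        by (rule continuous_on_compose2[OF g(1) continuous_on_levy_integrand]) auto
      show "\<bar>g (levy_integrand z x)\<bar> \<le> ?C * min ((norm x)\<^sup>2) 1" for x
        using g(2) norm_levy_integrand_le by (rule order_trans)
    qed (use \<beta> in auto)
    have eq: "(LINT x|N. levy_integrand z x)
        = Complex (LINT x|N. Re (levy_integrand z x)) (LINT x|N. Im (levy_integrand z x))"
      if "levy_measure N" for N
      using integrable_levy_integrand[OF that] by (simp add: complex_eq_iff integral_Re integral_Im)
    have M_levy: "levy_measure (M n)" for n
      using \<mu>n[of n] by (simp add: is_ID_iff)
    have "(\<lambda>n. LINT x|M n. levy_integrand z x) \<longlonglongrightarrow> (LINT x|?L. levy_integrand z x)"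
      unfolding eq[OF M_levy] eq[OF L]
      by (intro tendsto_Complex lim abs_Re_le_cmod abs_Im_le_cmod continuous_intros)
    then have "(\<lambda>n. exp (levy_exponent (M n) b0 z)) \<longlonglongrightarrow> exp (levy_exponent ?L b0 z)"
      unfolding levy_exponent_def by (intro tendsto_intros)
    then show ?thesis
      using \<mu>n \<nu> by (simp add: is_ID_iff)
  qed
  have "conv_in_dist \<mu>n \<nu>"
    using \<mu>n \<nu> by (intro conv_in_dist_char_fun char) (auto simp: is_ID_iff)
  then have "in_domain_of_attraction \<mu> \<nu>"
    unfolding in_domain_of_attraction_def \<mu>n_def using a(1) by (intro exI conjI allI)
  moreover have "is_stable \<gamma> \<sigma> \<nu>"
    unfolding is_stable_def using \<gamma> \<sigma> \<nu> by blast
  ultimately show ?thesis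
    by (rule that[rotated])
qed

end

theorem corollary18:
  fixes \<alpha> p \<gamma> :: real
    and R \<sigma> \<mu> :: "'a::euclidean_space measure"
    and b :: 'a
  assumes "\<alpha> < 2" and "0 < p"
    and "is_TS p \<alpha> R b \<mu>"
    and "finite_sphere_measure \<sigma>" and "emeasure \<sigma> (sphere 0 1) \<noteq> 0"
    and "\<gamma> \<in> {max 0 \<alpha><..<2}"
  shows "(\<exists>\<nu>. is_stable \<gamma> \<sigma> \<nu> \<and> in_domain_of_attraction \<mu> \<nu>) \<longleftrightarrow> regularly_varying \<gamma> \<sigma> R"
proof
  have order: "0 < \<gamma>" "\<alpha> < \<gamma>" "\<gamma> < 2"
    using assms(6) by auto
  show "regularly_varying \<gamma> \<sigma> R" if "\<exists>\<nu>. is_stable \<gamma> \<sigma> \<nu> \<and> in_domain_of_attraction \<mu> \<nu>"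
    using that regularly_varying_if_in_domain_of_attraction[OF assms(3,4,5) order(2)] by blast
  show "\<exists>\<nu>. is_stable \<gamma> \<sigma> \<nu> \<and> in_domain_of_attraction \<mu> \<nu>" if "regularly_varying \<gamma> \<sigma> R"
  proof -
    have "rosinski_measure \<alpha> R"
      using assms(3) by (simp add: is_TS_def)
    then interpret regularly_varying_levy_measure R \<sigma> \<gamma>
      using assms(1,4) order that by unfold_locales (auto intro: levy_measure_rosinski_measure)
    show ?thesis
      using in_domain_of_attraction_if_regularly_varying[OF assms(3) order(2)] by blast
  qed
qed

end
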